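(* Let $m\ge 2$ be an integer and let $\overline{\zeta}$ be an $m$th root of unity. Then the category $\mathcal{C}_{m,\overline{\zeta}}$ (defined in the context) is monoidally equivalent to $\mathrm{Vec}_{\mathbb{Z}_m}^{\omega}$ for some 3-cocycle $\omega:\mathbb{Z}_m\times\mathbb{Z}_m\times\mathbb{Z}_m\to\mathbb{C}^\times$.
   Context: $\mathrm{Vec}_G^\omega$, for a finite group $G$ and a 3-cocycle $\omega:G^3\to\mathbb{C}^\times$, is the category of finite-dimensional $G$-graded complex vector spaces, with simple objects $V_g$ ($g\in G$), $V_g\otimes V_h=V_{gh}$, and associator $\omega(g,h,k)\,\mathrm{id}_{V_{ghk}}:(V_g\otimes V_h)\otimes V_k\to V_g\otimes(V_h\otimes V_k)$. Unshaded planar algebras. An unshaded planar algebra is the notion obtained from Jones' planar algebras by dropping the shading: a family of complex vector spaces with a compatible action of unshaded planar tangles (outer box, inner boxes, non-crossing strands, a star at each box; isotopy invariant, compatible with composition of tangles). Boxes may have any number of boundary points, divided into bottom and top points; $\mathcal P_k$ is the space of elements with $k$ strands on top and $k$ on the bottom, star on the left. The planar algebra with given generators and relations is the quotient of the free planar algebra on the generators by the planar ideal generated by the relations. $fg$ is $f$ stacked on top of $g$; $\otimes$ is horizontal juxtaposition; $\overline{T}$ is rotation by $\pi$; $\emptyset$ is the empty diagram; $X\in\mathcal P_1$ is the vertical strand. Number the boundary points of a box clockwise from the star (top from left to right, then bottom from right to left). The click $\mathcal F$ is the one-step rotation, keeping the numbers of top and bottom points, for which the $i$-th boundary point of $T$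 becomes the $(i+1)$-st (cyclically) boundary point of $\mathcal F(T)$. The planar algebra $\mathcal P^{(m,\lambda)}$, for $m\ge2$ and $\lambda$ an $m$th root of unity. Put $n=\lfloor m/2\rfloor$ and $a=m-n$. It is the unshaded planar algebra generated by $P_1\in\mathcal P_1$, $U$ and $U^*$ as follows. $P_1$ is drawn as an upward oriented strand and $Q_1:=\overline{P}_1$ as a downward oriented strand (up to isotopy). $U$ has $a$ bottom strands coloured $P_1$ and $n$ top strands coloured $Q_1$ (all strands oriented into $U$; $U=Q_1^{\otimes n}UP_1^{\otimes a}$); $U^*$ has $n$ bottom strands coloured $Q_1$ and $a$ top strands coloured $P_1$. Relations: (i) closed oriented loops of either orientation equal $1$; (ii) $X=P_1+Q_1$; (iii) $P_1Q_1=0=Q_1P_1$; (iv) the element of $\mathcal P_2$ consisting of an oriented arc joining the two top points and an oriented arc joining the two bottom points, with orientations at the four boundary points equal to those of $P_1\otimes Q_1$ (resp. $Q_1\otimes P_1$), equals $P_1\otimes Q_1$ (resp. $Q_1\otimes P_1$); (v) $UU^*=Q_1^{\otimes n}$, $U^*U=P_1^{\otimes a}$; (vi) $\mathcal F(U)=\lambda U$, $\mathcal F(U^* )=\lambda U^*$. The adjoint $*$ is antilinear, reflects diagrams over a horizontal line, fixes $P_1$ and swaps $U$ and $U^*$. The category $\mathcal C_{m,\lambda}$ is the additive envelope (formal finite direct sums, matrices of morphisms) of the following strict monoidal category: objects are the projections $p=p^2=p^*$ in all $\mathcal P^{(m,\lambda)}_k$, $k\ge0$; $\mathrm{Hom}(p,q)$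 is the space of diagrams $f$ with bottom boundary that of $p$, top boundary that of $q$ and $qfp=f$; composition is vertical stacking; tensor product is horizontal juxtaposition; the unit is $\emptyset$. In the claim $\lambda=\overline{\zeta}$. *)

theory Defs
  imports
    "Jordan_Normal_Form.Matrix"
    "HOL-Library.Poly_Mapping"
    "HOL-Algebra.Elementary_Groups"
begin

section \<open>Linear monoidal categories and monoidal equivalence\<close>

datatype ('o, 'v) arrow = Arrow (src: 'o) (tgt: 'o) (val: 'v)

text \<open>
  Composition is written in the order of functions: \<open>g \<cdot> f\<close> is \<open>f\<close> followed by \<open>g\<close>.
  \<open>\<boxtimes>\<close> is the tensor product of objects and \<open>\<star>\<close> that of arrows.  The fields
  \<open>zeroA\<close>, \<open>addA\<close>, \<open>scaleA\<close> are the complex vector space structure of the Hom spaces.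
\<close>

record ('o, 'v) mcat =
  Obj :: "'o set"
  Arr :: "('o, 'v) arrow set"
  idA :: "'o \<Rightarrow> ('o, 'v) arrow"
  cmpA :: "('o, 'v) arrow \<Rightarrow> ('o, 'v) arrow \<Rightarrow> ('o, 'v) arrow"  (infixr \<open>\<cdot>\<index>\<close> 75)
  zeroA :: "'o \<Rightarrow> 'o \<Rightarrow> ('o, 'v) arrow"
  addA :: "('o, 'v) arrow \<Rightarrow> ('o, 'v) arrow \<Rightarrow> ('o, 'v) arrow"
  scaleA :: "complex \<Rightarrow> ('o, 'v) arrow \<Rightarrow> ('o, 'v) arrow"
  tenO :: "'o \<Rightarrow> 'o \<Rightarrow> 'o"  (infixr \<open>\<boxtimes>\<index>\<close> 80)
  tenA :: "('o, 'v) arrow \<Rightarrow> ('o, 'v) arrow \<Rightarrow> ('o, 'v) arrow"  (infixr \<open>\<star>\<index>\<close> 80)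
  unitO :: "'o"
  assocA :: "'o \<Rightarrow> 'o \<Rightarrow> 'o \<Rightarrow> ('o, 'v) arrow"
  lunitA :: "'o \<Rightarrow> ('o, 'v) arrow"
  runitA :: "'o \<Rightarrow> ('o, 'v) arrow"

definition Hom :: "('o, 'v) mcat \<Rightarrow> 'o \<Rightarrow> 'o \<Rightarrow> ('o, 'v) arrow set" where
  "Hom C X Y = {f \<in> Arr C. src f = X \<and> tgt f = Y}"

definition iso_arrow :: "('o, 'v) mcat \<Rightarrow> ('o, 'v) arrow \<Rightarrow> bool" where
  "iso_arrow C f \<longleftrightarrow> f \<in> Arr C \<and>
     (\<exists>g \<in> Hom C (tgt f) (src f). g \<cdot>\<^bsub>C\<^esub> f = idA C (src f) \<and> f \<cdot>\<^bsub>C\<^esub> g = idA C (tgt f))"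

locale category =
  fixes C :: "('o, 'v) mcat" (structure)
  assumes src_tgt_Obj: "f \<in> Arr C \<Longrightarrow> src f \<in> Obj C \<and> tgt f \<in> Obj C"
    and id_Hom: "X \<in> Obj C \<Longrightarrow> idA C X \<in> Hom C X X"
    and comp_Hom: "f \<in> Hom C X Y \<Longrightarrow> g \<in> Hom C Y Z \<Longrightarrow> g \<cdot> f \<in> Hom C X Z"
    and id_comp: "f \<in> Hom C X Y \<Longrightarrow> idA C Y \<cdot> f = f"
    and comp_id: "f \<in> Hom C X Y \<Longrightarrow> f \<cdot> idA C X = f"
    and comp_assoc: "f \<in> Hom C W X \<Longrightarrow> g \<in> Hom C X Y \<Longrightarrow> h \<in> Hom C Y Z \<Longrightarrow>
      (h \<cdot> g) \<cdot> f = h \<cdot> (g \<cdot> f)"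

locale monoidal_category = category C for C :: "('o, 'v) mcat" (structure) +
  assumes unit_Obj: "unitO C \<in> Obj C"
    and tensor_Obj: "X \<in> Obj C \<Longrightarrow> Y \<in> Obj C \<Longrightarrow> X \<boxtimes> Y \<in> Obj C"
    and tensor_Hom: "f \<in> Hom C X Y \<Longrightarrow> f' \<in> Hom C X' Y' \<Longrightarrow>
      f \<star> f' \<in> Hom C (X \<boxtimes> X') (Y \<boxtimes> Y')"
    and tensor_id: "X \<in> Obj C \<Longrightarrow> Y \<in> Obj C \<Longrightarrow> idA C X \<star> idA C Y = idA C (X \<boxtimes> Y)"
    and tensor_comp: "f \<in> Hom C X Y \<Longrightarrow> g \<in> Hom C Y Z \<Longrightarrow>
      f' \<in> Hom C X' Y' \<Longrightarrow> g' \<in> Hom C Y' Z' \<Longrightarrow>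
      (g \<cdot> f) \<star> (g' \<cdot> f') = (g \<star> g') \<cdot> (f \<star> f')"
    and assoc_Hom: "X \<in> Obj C \<Longrightarrow> Y \<in> Obj C \<Longrightarrow> Z \<in> Obj C \<Longrightarrow>
      assocA C X Y Z \<in> Hom C ((X \<boxtimes> Y) \<boxtimes> Z) (X \<boxtimes> (Y \<boxtimes> Z))"
    and assoc_iso: "X \<in> Obj C \<Longrightarrow> Y \<in> Obj C \<Longrightarrow> Z \<in> Obj C \<Longrightarrow> iso_arrow C (assocA C X Y Z)"
    and assoc_natural: "f \<in> Hom C X X' \<Longrightarrow> g \<in> Hom C Y Y' \<Longrightarrow> h \<in> Hom C Z Z' \<Longrightarrow>
      assocA C X' Y' Z' \<cdot> ((f \<star> g) \<star> h) = (f \<star> (g \<star> h)) \<cdot> assocA C X Y Z"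
    and lunit_Hom: "X \<in> Obj C \<Longrightarrow> lunitA C X \<in> Hom C (unitO C \<boxtimes> X) X"
    and lunit_iso: "X \<in> Obj C \<Longrightarrow> iso_arrow C (lunitA C X)"
    and lunit_natural: "f \<in> Hom C X Y \<Longrightarrow>
      lunitA C Y \<cdot> (idA C (unitO C) \<star> f) = f \<cdot> lunitA C X"
    and runit_Hom: "X \<in> Obj C \<Longrightarrow> runitA C X \<in> Hom C (X \<boxtimes> unitO C) X"
    and runit_iso: "X \<in> Obj C \<Longrightarrow> iso_arrow C (runitA C X)"
    and runit_natural: "f \<in> Hom C X Y \<Longrightarrow>
      runitA C Y \<cdot> (f \<star> idA C (unitO C)) = f \<cdot> runitA C X"
    and pentagon: "W \<in> Obj C \<Longrightarrow> X \<in> Obj C \<Longrightarrow> Y \<in> Obj C \<Longrightarrow> Z \<in> Obj C \<Longrightarrow>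
      assocA C W X (Y \<boxtimes> Z) \<cdot> assocA C (W \<boxtimes> X) Y Z =
      (idA C W \<star> assocA C X Y Z) \<cdot> (assocA C W (X \<boxtimes> Y) Z \<cdot> (assocA C W X Y \<star> idA C Z))"
    and triangle: "X \<in> Obj C \<Longrightarrow> Y \<in> Obj C \<Longrightarrow>
      (idA C X \<star> lunitA C Y) \<cdot> assocA C X (unitO C) Y = runitA C X \<star> idA C Y"

locale linear_functor =
  fixes C :: "('o, 'v) mcat" and D :: "('p, 'w) mcat"
    and FO :: "'o \<Rightarrow> 'p" and FA :: "('o, 'v) arrow \<Rightarrow> ('p, 'w) arrow"
  assumes F_Obj: "X \<in> Obj C \<Longrightarrow> FO X \<in> Obj D"
    and F_Hom: "f \<in> Hom C X Y \<Longrightarrow> FA f \<in> Hom D (FO X) (FO Y)"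
    and F_id: "X \<in> Obj C \<Longrightarrow> FA (idA C X) = idA D (FO X)"
    and F_comp: "f \<in> Hom C X Y \<Longrightarrow> g \<in> Hom C Y Z \<Longrightarrow> FA (g \<cdot>\<^bsub>C\<^esub> f) = FA g \<cdot>\<^bsub>D\<^esub> FA f"
    and F_add: "f \<in> Hom C X Y \<Longrightarrow> g \<in> Hom C X Y \<Longrightarrow> FA (addA C f g) = addA D (FA f) (FA g)"
    and F_scale: "f \<in> Hom C X Y \<Longrightarrow> FA (scaleA C c f) = scaleA D c (FA f)"

definition natural_iso ::
  "('o, 'v) mcat \<Rightarrow> ('p, 'w) mcat \<Rightarrow> ('o \<Rightarrow> 'p) \<Rightarrow> (('o, 'v) arrow \<Rightarrow> ('p, 'w) arrow)
    \<Rightarrow> ('o \<Rightarrow> 'p) \<Rightarrow> (('o, 'v) arrow \<Rightarrow> ('p, 'w) arrow) \<Rightarrow> ('o \<Rightarrow> ('p, 'w) arrow) \<Rightarrow> bool" where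
  "natural_iso C D FO FA GO GA \<eta> \<longleftrightarrow>
     (\<forall>X \<in> Obj C. \<eta> X \<in> Hom D (FO X) (GO X) \<and> iso_arrow D (\<eta> X)) \<and>
     (\<forall>X Y. \<forall>f \<in> Hom C X Y. \<eta> Y \<cdot>\<^bsub>D\<^esub> FA f = GA f \<cdot>\<^bsub>D\<^esub> \<eta> X)"

locale monoidal_functor = linear_functor C D FO FA
  for C :: "('o, 'v) mcat" and D :: "('p, 'w) mcat"
    and FO :: "'o \<Rightarrow> 'p" and FA :: "('o, 'v) arrow \<Rightarrow> ('p, 'w) arrow" +
  fixes J :: "'o \<Rightarrow> 'o \<Rightarrow> ('p, 'w) arrow" and \<phi> :: "('p, 'w) arrow"
  assumes J_Hom: "X \<in> Obj C \<Longrightarrow> Y \<in> Obj C \<Longrightarrow>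
      J X Y \<in> Hom D (FO X \<boxtimes>\<^bsub>D\<^esub> FO Y) (FO (X \<boxtimes>\<^bsub>C\<^esub> Y))"
    and J_iso: "X \<in> Obj C \<Longrightarrow> Y \<in> Obj C \<Longrightarrow> iso_arrow D (J X Y)"
    and J_natural: "f \<in> Hom C X X' \<Longrightarrow> g \<in> Hom C Y Y' \<Longrightarrow>
      J X' Y' \<cdot>\<^bsub>D\<^esub> (FA f \<star>\<^bsub>D\<^esub> FA g) = FA (f \<star>\<^bsub>C\<^esub> g) \<cdot>\<^bsub>D\<^esub> J X Y"
    and phi_Hom: "\<phi> \<in> Hom D (unitO D) (FO (unitO C))"
    and phi_iso: "iso_arrow D \<phi>"
    and hexagon: "X \<in> Obj C \<Longrightarrow> Y \<in> Obj C \<Longrightarrow> Z \<in> Obj C \<Longrightarrow>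
      FA (assocA C X Y Z) \<cdot>\<^bsub>D\<^esub> (J (X \<boxtimes>\<^bsub>C\<^esub> Y) Z \<cdot>\<^bsub>D\<^esub> (J X Y \<star>\<^bsub>D\<^esub> idA D (FO Z))) =
      J X (Y \<boxtimes>\<^bsub>C\<^esub> Z) \<cdot>\<^bsub>D\<^esub> ((idA D (FO X) \<star>\<^bsub>D\<^esub> J Y Z) \<cdot>\<^bsub>D\<^esub> assocA D (FO X) (FO Y) (FO Z))"
    and left_unity: "X \<in> Obj C \<Longrightarrow>
      FA (lunitA C X) \<cdot>\<^bsub>D\<^esub> (J (unitO C) X \<cdot>\<^bsub>D\<^esub> (\<phi> \<star>\<^bsub>D\<^esub> idA D (FO X))) = lunitA D (FO X)"
    and right_unity: "X \<in> Obj C \<Longrightarrow>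
      FA (runitA C X) \<cdot>\<^bsub>D\<^esub> (J X (unitO C) \<cdot>\<^bsub>D\<^esub> (idA D (FO X) \<star>\<^bsub>D\<^esub> \<phi>)) = runitA D (FO X)"

definition equivalence_functor ::
  "('o, 'v) mcat \<Rightarrow> ('p, 'w) mcat \<Rightarrow> ('o \<Rightarrow> 'p) \<Rightarrow> (('o, 'v) arrow \<Rightarrow> ('p, 'w) arrow) \<Rightarrow> bool" where
  "equivalence_functor C D FO FA \<longleftrightarrow>
     linear_functor C D FO FA \<and>
     (\<exists>GO GA \<eta> \<epsilon>. linear_functor D C GO GA \<and>
        natural_iso C C id id (GO \<circ> FO) (GA \<circ> FA) \<eta> \<and>
        natural_iso D D (FO \<circ> GO) (FA \<circ> GA) id id \<epsilon>)"

definition monoidally_equivalent :: "('o, 'v) mcat \<Rightarrow> ('p, 'w) mcat \<Rightarrow> bool" where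
  "monoidally_equivalent C D \<longleftrightarrow>
     monoidal_category C \<and> monoidal_category D \<and>
     (\<exists>FO FA J \<phi>. monoidal_functor C D FO FA J \<phi> \<and> equivalence_functor C D FO FA)"


section \<open>The additive envelope\<close>

text \<open>
  A formal direct sum is the list of its summands.  The \<open>(i, j)\<close> entry of a matrix
  \<open>Xs \<rightarrow> Ys\<close> is an arrow from the \<open>j\<close>-th summand of \<open>Xs\<close> to the \<open>i\<close>-th summand of \<open>Ys\<close>.
  Tensor products of direct sums are ordered lexicographically, so that the list
  \<open>(Xs \<otimes> Ys) \<otimes> Zs\<close> has \<open>(x \<otimes> y) \<otimes> z\<close> in the position in which \<open>Xs \<otimes> (Ys \<otimes> Zs)\<close> has
  \<open>x \<otimes> (y \<otimes> z)\<close>, and the structural isomorphisms are diagonal matrices.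
\<close>

definition hom_sum :: "('o, 'v) mcat \<Rightarrow> 'o \<Rightarrow> 'o \<Rightarrow> ('o, 'v) arrow list \<Rightarrow> ('o, 'v) arrow" where
  "hom_sum C X Y fs = foldr (addA C) fs (zeroA C X Y)"

type_synonym ('o, 'v) matrix_arrow = "('o list, ('o, 'v) arrow mat) arrow"

definition matrix_arrow ::
  "'o list \<Rightarrow> 'o list \<Rightarrow> (nat \<Rightarrow> nat \<Rightarrow> ('o, 'v) arrow) \<Rightarrow> ('o, 'v) matrix_arrow" where
  "matrix_arrow Xs Ys M = Arrow Xs Ys (mat (length Ys) (length Xs) (\<lambda>(i, j). M i j))"

abbreviation entry :: "('o, 'a mat) arrow \<Rightarrow> nat \<Rightarrow> nat \<Rightarrow> 'a" where
  "entry f i j \<equiv> val f $$ (i, j)"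

definition diagonal_arrow ::
  "('o, 'v) mcat \<Rightarrow> 'o list \<Rightarrow> 'o list \<Rightarrow> ('o, 'v) arrow list \<Rightarrow> ('o, 'v) matrix_arrow" where
  "diagonal_arrow C Xs Ys fs =
     matrix_arrow Xs Ys (\<lambda>i j. if i = j then fs ! i else zeroA C (Xs ! j) (Ys ! i))"

definition envelope_tensor :: "('o, 'v) mcat \<Rightarrow> 'o list \<Rightarrow> 'o list \<Rightarrow> 'o list" where
  "envelope_tensor C Xs Ys = [X \<boxtimes>\<^bsub>C\<^esub> Y. X \<leftarrow> Xs, Y \<leftarrow> Ys]"

definition additive_envelope :: "('o, 'v) mcat \<Rightarrow> ('o list, ('o, 'v) arrow mat) mcat" where
  "additive_envelope C = \<lparr>
     Obj = lists (Obj C),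
     Arr = {Arrow Xs Ys M | Xs Ys M. Xs \<in> lists (Obj C) \<and> Ys \<in> lists (Obj C) \<and>
       M \<in> carrier_mat (length Ys) (length Xs) \<and>
       (\<forall>i < length Ys. \<forall>j < length Xs. M $$ (i, j) \<in> Hom C (Xs ! j) (Ys ! i))},
     idA = (\<lambda>Xs. diagonal_arrow C Xs Xs (map (idA C) Xs)),
     cmpA = (\<lambda>g f. matrix_arrow (src f) (tgt g) (\<lambda>i j.
       hom_sum C (src f ! j) (tgt g ! i)
         [entry g i k \<cdot>\<^bsub>C\<^esub> entry f k j. k \<leftarrow> [0..<length (tgt f)]])),
     zeroA = (\<lambda>Xs Ys. matrix_arrow Xs Ys (\<lambda>i j. zeroA C (Xs ! j) (Ys ! i))),
     addA = (\<lambda>f g. matrix_arrow (src f) (tgt f) (\<lambda>i j. addA C (entry f i j) (entry g i j))),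
     scaleA = (\<lambda>c f. matrix_arrow (src f) (tgt f) (\<lambda>i j. scaleA C c (entry f i j))),
     tenO = envelope_tensor C,
     tenA = (\<lambda>f g. matrix_arrow (envelope_tensor C (src f) (src g))
       (envelope_tensor C (tgt f) (tgt g)) (\<lambda>i j.
         entry f (i div length (tgt g)) (j div length (src g)) \<star>\<^bsub>C\<^esub>
         entry g (i mod length (tgt g)) (j mod length (src g)))),
     unitO = [unitO C],
     assocA = (\<lambda>Xs Ys Zs. diagonal_arrow C
       (envelope_tensor C (envelope_tensor C Xs Ys) Zs)
       (envelope_tensor C Xs (envelope_tensor C Ys Zs))
       [assocA C X Y Z. X \<leftarrow> Xs, Y \<leftarrow> Ys, Z \<leftarrow> Zs]),
     lunitA = (\<lambda>Xs. diagonal_arrow C (envelope_tensor C [unitO C] Xs) Xs (map (lunitA C) Xs)),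
     runitA = (\<lambda>Xs. diagonal_arrow C (envelope_tensor C Xs [unitO C]) Xs (map (runitA C) Xs))\<rparr>"


section \<open>Graded vector spaces\<close>

definition three_cocycle :: "('g, 'b) monoid_scheme \<Rightarrow> ('g \<Rightarrow> 'g \<Rightarrow> 'g \<Rightarrow> complex) \<Rightarrow> bool" where
  "three_cocycle G \<omega> \<longleftrightarrow>
     (\<forall>g \<in> carrier G. \<forall>h \<in> carrier G. \<forall>k \<in> carrier G. \<omega> g h k \<noteq> 0) \<and>
     (\<forall>g \<in> carrier G. \<forall>h \<in> carrier G. \<forall>k \<in> carrier G. \<forall>l \<in> carrier G.
        \<omega> h k l * \<omega> g (h \<otimes>\<^bsub>G\<^esub> k) l * \<omega> g h k = \<omega> (g \<otimes>\<^bsub>G\<^esub> h) k l * \<omega> g h (k \<otimes>\<^bsub>G\<^esub> l))"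

text \<open>
  A finite-dimensional graded vector space is given in coordinates, in a homogeneous basis:
  the list \<open>[g\<^sub>1, \<dots>, g\<^sub>n]\<close> of elements of \<open>G\<close> is \<open>\<complex>\<^sup>n\<close> with its \<open>i\<close>-th standard basis
  vector in degree \<open>g\<^sub>i\<close>, that is, \<open>V\<^bsub>g\<^sub>1\<^esub> \<oplus> \<dots> \<oplus> V\<^bsub>g\<^sub>n\<^esub>\<close>.  Arrows are the matrices of
  the degree-preserving linear maps, and \<open>[g]\<close> is \<open>V\<^sub>g\<close>.  The unit constraints are the ones
  which the triangle axiom forces when \<open>\<omega>\<close> is not normalized.
\<close>

definition graded_tensor :: "('g, 'b) monoid_scheme \<Rightarrow> 'g list \<Rightarrow> 'g list \<Rightarrow> 'g list" where
  "graded_tensor G gs hs = [g \<otimes>\<^bsub>G\<^esub> h. g \<leftarrow> gs, h \<leftarrow> hs]"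

definition kronecker :: "complex mat \<Rightarrow> complex mat \<Rightarrow> complex mat" where
  "kronecker A B = mat (dim_row A * dim_row B) (dim_col A * dim_col B) (\<lambda>(i, j).
     A $$ (i div dim_row B, j div dim_col B) * B $$ (i mod dim_row B, j mod dim_col B))"

definition diag_list :: "complex list \<Rightarrow> complex mat" where
  "diag_list cs = mat_diag (length cs) (\<lambda>i. cs ! i)"

definition graded_vec ::
  "('g, 'b) monoid_scheme \<Rightarrow> ('g \<Rightarrow> 'g \<Rightarrow> 'g \<Rightarrow> complex) \<Rightarrow> ('g list, complex mat) mcat" where
  "graded_vec G \<omega> = \<lparr>
     Obj = lists (carrier G),
     Arr = {Arrow gs hs M | gs hs M. gs \<in> lists (carrier G) \<and> hs \<in> lists (carrier G) \<and>
       M \<in> carrier_mat (length hs) (length gs) \<and>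
       (\<forall>i < length hs. \<forall>j < length gs. hs ! i \<noteq> gs ! j \<longrightarrow> M $$ (i, j) = 0)},
     idA = (\<lambda>gs. Arrow gs gs (1\<^sub>m (length gs))),
     cmpA = (\<lambda>g f. Arrow (src f) (tgt g) (val g * val f)),
     zeroA = (\<lambda>gs hs. Arrow gs hs (0\<^sub>m (length hs) (length gs))),
     addA = (\<lambda>f g. Arrow (src f) (tgt f) (val f + val g)),
     scaleA = (\<lambda>c f. Arrow (src f) (tgt f) (c \<cdot>\<^sub>m val f)),
     tenO = graded_tensor G,
     tenA = (\<lambda>f g. Arrow (graded_tensor G (src f) (src g)) (graded_tensor G (tgt f) (tgt g))
       (kronecker (val f) (val g))),
     unitO = [\<one>\<^bsub>G\<^esub>],
     assocA = (\<lambda>gs hs ks. Arrow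
       (graded_tensor G (graded_tensor G gs hs) ks) (graded_tensor G gs (graded_tensor G hs ks))
       (diag_list [\<omega> g h k. g \<leftarrow> gs, h \<leftarrow> hs, k \<leftarrow> ks])),
     lunitA = (\<lambda>gs. Arrow (graded_tensor G [\<one>\<^bsub>G\<^esub>] gs) gs
       (diag_list [inverse (\<omega> \<one>\<^bsub>G\<^esub> \<one>\<^bsub>G\<^esub> g). g \<leftarrow> gs])),
     runitA = (\<lambda>gs. Arrow (graded_tensor G gs [\<one>\<^bsub>G\<^esub>]) gs
       (diag_list [\<omega> g \<one>\<^bsub>G\<^esub> \<one>\<^bsub>G\<^esub>. g \<leftarrow> gs]))\<rparr>"


section \<open>Planar diagrams up to isotopy\<close>

text \<open>
  A labelled unshaded planar tangle can be isotoped so that it is assembled by stacking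
  (\<open>Stack f g\<close> is \<open>f\<close> on top of \<open>g\<close>) and horizontal juxtaposition (\<open>Beside\<close>) from
  vertical strands, local minima (\<open>Cup\<close>, joining two top points), local maxima (\<open>Cap\<close>,
  joining two bottom points) and upright boxes with the star on the left; \<open>Box g b t\<close> is
  labelled \<open>g\<close> and has \<open>b\<close> bottom and \<open>t\<close> top points.  \<open>Strands 0\<close> is the empty picture.
\<close>

datatype 'g picture =
    Strands nat
  | Cup
  | Cap
  | Box 'g nat nat
  | Stack "'g picture" "'g picture"
  | Beside "'g picture" "'g picture"

primrec bottom_pts :: "'g picture \<Rightarrow> nat" where
  "bottom_pts (Strands n) = n"
| "bottom_pts Cup = 0"
| "bottom_pts Cap = 2"
| "bottom_pts (Box g b t) = b"
| "bottom_pts (Stack f g) = bottom_pts g"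
| "bottom_pts (Beside f g) = bottom_pts f + bottom_pts g"

primrec top_pts :: "'g picture \<Rightarrow> nat" where
  "top_pts (Strands n) = n"
| "top_pts Cup = 2"
| "top_pts Cap = 0"
| "top_pts (Box g b t) = t"
| "top_pts (Stack f g) = top_pts f"
| "top_pts (Beside f g) = top_pts f + top_pts g"

primrec well_formed :: "'g picture \<Rightarrow> bool" where
  "well_formed (Strands n) \<longleftrightarrow> True"
| "well_formed Cup \<longleftrightarrow> True"
| "well_formed Cap \<longleftrightarrow> True"
| "well_formed (Box g b t) \<longleftrightarrow> True"
| "well_formed (Stack f g) \<longleftrightarrow> well_formed f \<and> well_formed g \<and> bottom_pts f = top_pts g"
| "well_formed (Beside f g) \<longleftrightarrow> well_formed f \<and> well_formed g"

primrec boxes :: "'g picture \<Rightarrow> ('g \<times> nat \<times> nat) set" where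
  "boxes (Strands n) = {}"
| "boxes Cup = {}"
| "boxes Cap = {}"
| "boxes (Box g b t) = {(g, b, t)}"
| "boxes (Stack f g) = boxes f \<union> boxes g"
| "boxes (Beside f g) = boxes f \<union> boxes g"

text \<open>
  The click bends the leftmost bottom strand up along the left side and the rightmost top
  strand down along the right side, so that the last boundary point (bottom left) becomes
  the first one (top left) and the last top point becomes the first bottom point (bottom
  right).  The unclick is the rotation by one step in the other direction.
\<close>

definition click_pic :: "'g picture \<Rightarrow> 'g picture" where
  "click_pic f =
     Stack (Beside (Strands (top_pts f)) Cap)
       (Stack (Beside (Strands 1) (Beside f (Strands 1)))
         (Beside Cup (Strands (bottom_pts f))))"

definition unclick_pic :: "'g picture \<Rightarrow> 'g picture" where
  "unclick_pic f =
     Stack (Beside Cap (Strands (top_pts f)))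
       (Stack (Beside (Strands 1) (Beside f (Strands 1)))
         (Beside (Strands (bottom_pts f)) Cup))"

text \<open>
  Planar isotopy, generated by its elementary moves: rescaling (associativity and unit rules),
  sliding distant parts past each other vertically, straightening a strand, and turning an
  inner box by \<open>2\<pi>\<close> in either direction.  A box turned by a smaller angle is by definition
  the same box with its strands bent around it.  That these moves generate planar isotopy of
  diagrams is the coherence theorem for pivotal categories (Joyal--Street, Freyd--Yetter), for
  one object which is its own dual.
\<close>

inductive isotopic :: "'g picture \<Rightarrow> 'g picture \<Rightarrow> bool" where
  isotopic_refl: "isotopic f f"
| isotopic_sym: "isotopic f g \<Longrightarrow> isotopic g f"
| isotopic_trans: "isotopic f g \<Longrightarrow> isotopic g h \<Longrightarrow> isotopic f h"
| stack_cong: "isotopic f f' \<Longrightarrow> isotopic g g' \<Longrightarrow> isotopic (Stack f g) (Stack f' g')"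
| beside_cong: "isotopic f f' \<Longrightarrow> isotopic g g' \<Longrightarrow> isotopic (Beside f g) (Beside f' g')"
| stack_assoc: "isotopic (Stack (Stack f g) h) (Stack f (Stack g h))"
| stack_strands_left: "isotopic (Stack (Strands (top_pts f)) f) f"
| stack_strands_right: "isotopic (Stack f (Strands (bottom_pts f))) f"
| beside_assoc: "isotopic (Beside (Beside f g) h) (Beside f (Beside g h))"
| beside_empty_left: "isotopic (Beside (Strands 0) f) f"
| beside_empty_right: "isotopic (Beside f (Strands 0)) f"
| beside_strands: "isotopic (Beside (Strands k) (Strands l)) (Strands (k + l))"
| interchange: "bottom_pts f = top_pts g \<Longrightarrow> bottom_pts f' = top_pts g' \<Longrightarrow>
    isotopic (Beside (Stack f g) (Stack f' g')) (Stack (Beside f f') (Beside g g'))"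
| zigzag_left: "isotopic (Stack (Beside Cap (Strands 1)) (Beside (Strands 1) Cup)) (Strands 1)"
| zigzag_right: "isotopic (Stack (Beside (Strands 1) Cap) (Beside Cup (Strands 1))) (Strands 1)"
| full_turn: "isotopic ((click_pic ^^ (b + t)) (Box g b t)) (Box g b t)"
| full_unturn: "isotopic ((unclick_pic ^^ (b + t)) (Box g b t)) (Box g b t)"

lemma click_pts [simp]:
  "bottom_pts (click_pic f) = bottom_pts f" "top_pts (click_pic f) = top_pts f"
  "bottom_pts (unclick_pic f) = bottom_pts f" "top_pts (unclick_pic f) = top_pts f"
  by (simp_all add: click_pic_def unclick_pic_def)

lemma click_boxes [simp]: "boxes (click_pic f) = boxes f" "boxes (unclick_pic f) = boxes f"
  by (simp_all add: click_pic_def unclick_pic_def)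

lemma click_well_formed [simp]:
  "well_formed (click_pic f) = well_formed f" "well_formed (unclick_pic f) = well_formed f"
  by (simp_all add: click_pic_def unclick_pic_def)

lemma click_funpow [simp]:
  "bottom_pts ((click_pic ^^ n) f) = bottom_pts f" "top_pts ((click_pic ^^ n) f) = top_pts f"
  "bottom_pts ((unclick_pic ^^ n) f) = bottom_pts f" "top_pts ((unclick_pic ^^ n) f) = top_pts f"
  "boxes ((click_pic ^^ n) f) = boxes f" "boxes ((unclick_pic ^^ n) f) = boxes f"
  "well_formed ((click_pic ^^ n) f) = well_formed f"
  "well_formed ((unclick_pic ^^ n) f) = well_formed f"
  by (induction n) simp_all

lemma isotopic_pts:
  assumes "isotopic f g"
  shows "bottom_pts f = bottom_pts g" "top_pts f = top_pts g"
  using assms by (induction rule: isotopic.induct) auto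

lemma isotopic_boxes: "isotopic f g \<Longrightarrow> boxes f = boxes g"
  by (induction rule: isotopic.induct) auto

lemma isotopic_well_formed: "isotopic f g \<Longrightarrow> well_formed f = well_formed g"
  by (induction rule: isotopic.induct) (auto simp: isotopic_pts)

text \<open>Reflection over a horizontal line, with the labels changed by \<open>s\<close>.\<close>

primrec reflect_pic :: "('g \<Rightarrow> 'g) \<Rightarrow> 'g picture \<Rightarrow> 'g picture" where
  "reflect_pic s (Strands n) = Strands n"
| "reflect_pic s Cup = Cap"
| "reflect_pic s Cap = Cup"
| "reflect_pic s (Box g b t) = Box (s g) t b"
| "reflect_pic s (Stack f g) = Stack (reflect_pic s g) (reflect_pic s f)"
| "reflect_pic s (Beside f g) = Beside (reflect_pic s f) (reflect_pic s g)"

lemma reflect_pts [simp]: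
  "bottom_pts (reflect_pic s f) = top_pts f" "top_pts (reflect_pic s f) = bottom_pts f"
  by (induction f) simp_all

lemma click_cong: "isotopic f g \<Longrightarrow> isotopic (click_pic f) (click_pic g)"
  unfolding click_pic_def
  by (simp add: isotopic_pts, intro stack_cong beside_cong isotopic_refl)

lemma unclick_cong: "isotopic f g \<Longrightarrow> isotopic (unclick_pic f) (unclick_pic g)"
  unfolding unclick_pic_def
  by (simp add: isotopic_pts, intro stack_cong beside_cong isotopic_refl)

lemma reflect_click: "isotopic (reflect_pic s (click_pic f)) (unclick_pic (reflect_pic s f))"
  by (simp add: click_pic_def unclick_pic_def isotopic.stack_assoc)

lemma reflect_unclick: "isotopic (reflect_pic s (unclick_pic f)) (click_pic (reflect_pic s f))"
  by (simp add: click_pic_def unclick_pic_def isotopic.stack_assoc)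

lemma reflect_click_funpow:
  "isotopic (reflect_pic s ((click_pic ^^ n) f)) ((unclick_pic ^^ n) (reflect_pic s f))"
  by (induction n)
    (auto intro: isotopic_refl isotopic_trans[OF reflect_click] unclick_cong)

lemma reflect_unclick_funpow:
  "isotopic (reflect_pic s ((unclick_pic ^^ n) f)) ((click_pic ^^ n) (reflect_pic s f))"
  by (induction n)
    (auto intro: isotopic_refl isotopic_trans[OF reflect_unclick] click_cong)

lemma reflect_isotopic: "isotopic f g \<Longrightarrow> isotopic (reflect_pic s f) (reflect_pic s g)"
proof (induction rule: isotopic.induct)
  case (full_turn b t g)
  show ?case
    using isotopic_trans[OF reflect_click_funpow[of s "b + t" "Box g b t"]]
      isotopic.full_unturn[of t b "s g"] by (simp add: add.commute)
next
  case (full_unturn b t g)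
  show ?case
    using isotopic_trans[OF reflect_unclick_funpow[of s "b + t" "Box g b t"]]
      isotopic.full_turn[of t b "s g"] by (simp add: add.commute)
next
  case (stack_strands_left f)
  show ?case
    using isotopic.stack_strands_right[of "reflect_pic s f"] by simp
next
  case (stack_strands_right f)
  show ?case
    using isotopic.stack_strands_left[of "reflect_pic s f"] by simp
next
  case (stack_assoc f g h)
  show ?case
    using isotopic_sym[OF isotopic.stack_assoc] by simp
next
  case zigzag_left
  show ?case using isotopic.zigzag_right by simp
next
  case zigzag_right
  show ?case using isotopic.zigzag_left by simp
qed (auto intro: isotopic.intros)

quotient_type 'g diagram = "'g picture" / isotopic
  by (rule equivpI) (auto simp: reflp_def symp_def transp_def intro: isotopic.intros(1-3))

lift_definition strands :: "nat \<Rightarrow> 'g diagram" is Strands .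
lift_definition cup :: "'g diagram" is Cup .
lift_definition cap :: "'g diagram" is Cap .
lift_definition box :: "'g \<Rightarrow> nat \<Rightarrow> nat \<Rightarrow> 'g diagram" is Box .
lift_definition stack :: "'g diagram \<Rightarrow> 'g diagram \<Rightarrow> 'g diagram" is Stack by (rule stack_cong)
lift_definition beside :: "'g diagram \<Rightarrow> 'g diagram \<Rightarrow> 'g diagram" is Beside by (rule beside_cong)
lift_definition click :: "'g diagram \<Rightarrow> 'g diagram" is click_pic by (rule click_cong)
lift_definition reflect :: "('g \<Rightarrow> 'g) \<Rightarrow> 'g diagram \<Rightarrow> 'g diagram" is reflect_pic
  by (rule reflect_isotopic)

text \<open>The diagrams with \<open>b\<close> bottom and \<open>t\<close> top points whose boxes are taken from \<open>G\<close>.\<close>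

lift_definition is_diagram :: "('g \<times> nat \<times> nat) set \<Rightarrow> nat \<Rightarrow> nat \<Rightarrow> 'g diagram \<Rightarrow> bool" is
  "\<lambda>G b t f. well_formed f \<and> bottom_pts f = b \<and> top_pts f = t \<and> boxes f \<subseteq> G"
  using isotopic_pts isotopic_boxes isotopic_well_formed by metis

primrec beside_power :: "'g diagram \<Rightarrow> nat \<Rightarrow> 'g diagram" where
  "beside_power d 0 = strands 0"
| "beside_power d (Suc n) = beside d (beside_power d n)"


section \<open>Planar algebras by generators and relations\<close>

type_synonym 'g lincomb = "'g diagram \<Rightarrow>\<^sub>0 complex"

definition single_diagram :: "'g diagram \<Rightarrow> 'g lincomb"  (\<open>\<langle>_\<rangle>\<close>) where
  "\<langle>d\<rangle> = Poly_Mapping.single d 1"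

definition scale :: "complex \<Rightarrow> 'g lincomb \<Rightarrow> 'g lincomb" where
  "scale c x = Poly_Mapping.map ((*) c) x"

definition bilinear_extension ::
  "('g diagram \<Rightarrow> 'g diagram \<Rightarrow> 'g diagram) \<Rightarrow> 'g lincomb \<Rightarrow> 'g lincomb \<Rightarrow> 'g lincomb" where
  "bilinear_extension op x y =
     (\<Sum>d \<in> Poly_Mapping.keys x. \<Sum>e \<in> Poly_Mapping.keys y.
        Poly_Mapping.single (op d e) (Poly_Mapping.lookup x d * Poly_Mapping.lookup y e))"

definition stack_lc :: "'g lincomb \<Rightarrow> 'g lincomb \<Rightarrow> 'g lincomb" where
  "stack_lc = bilinear_extension stack"

definition beside_lc :: "'g lincomb \<Rightarrow> 'g lincomb \<Rightarrow> 'g lincomb" where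
  "beside_lc = bilinear_extension beside"

definition adjoint_lc :: "('g \<Rightarrow> 'g) \<Rightarrow> 'g lincomb \<Rightarrow> 'g lincomb" where
  "adjoint_lc s x =
     (\<Sum>d \<in> Poly_Mapping.keys x. Poly_Mapping.single (reflect s d) (cnj (Poly_Mapping.lookup x d)))"

text \<open>
  Generators are labels with their numbers of bottom and top points; \<open>label_star\<close> is the
  effect of the adjoint on the labels.
\<close>

record 'g presentation =
  gens :: "('g \<times> nat \<times> nat) set"
  rels :: "'g lincomb set"
  label_star :: "'g \<Rightarrow> 'g"

definition free_space :: "'g presentation \<Rightarrow> nat \<Rightarrow> nat \<Rightarrow> 'g lincomb set" where
  "free_space A b t = {x. \<forall>d \<in> Poly_Mapping.keys x. is_diagram (gens A) b t d}"

text \<open>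
  The planar ideal of the free planar algebra generated by the relations: every tangle with
  an element of the ideal in one of its boxes is obtained by stacking and juxtaposing that
  element with further diagrams.
\<close>

inductive planar_ideal :: "'g presentation \<Rightarrow> nat \<Rightarrow> nat \<Rightarrow> 'g lincomb \<Rightarrow> bool" for A where
  ideal_rel: "x \<in> rels A \<Longrightarrow> x \<in> free_space A b t \<Longrightarrow> planar_ideal A b t x"
| ideal_zero: "planar_ideal A b t 0"
| ideal_add: "planar_ideal A b t x \<Longrightarrow> planar_ideal A b t y \<Longrightarrow> planar_ideal A b t (x + y)"
| ideal_scale: "planar_ideal A b t x \<Longrightarrow> planar_ideal A b t (scale c x)"
| ideal_stack_left: "planar_ideal A b t x \<Longrightarrow> y \<in> free_space A t u \<Longrightarrow>
    planar_ideal A b u (stack_lc y x)"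
| ideal_stack_right: "planar_ideal A b t x \<Longrightarrow> y \<in> free_space A a b \<Longrightarrow>
    planar_ideal A a t (stack_lc x y)"
| ideal_beside_left: "planar_ideal A b t x \<Longrightarrow> y \<in> free_space A b' t' \<Longrightarrow>
    planar_ideal A (b' + b) (t' + t) (beside_lc y x)"
| ideal_beside_right: "planar_ideal A b t x \<Longrightarrow> y \<in> free_space A b' t' \<Longrightarrow>
    planar_ideal A (b + b') (t + t') (beside_lc x y)"

text \<open>
  The quotient planar algebra.  Its elements are cosets of the planar ideal, and the
  operations on cosets are induced by those on representatives.
\<close>

definition coset :: "'g presentation \<Rightarrow> nat \<Rightarrow> nat \<Rightarrow> 'g lincomb \<Rightarrow> 'g lincomb set" where
  "coset A b t x = {y \<in> free_space A b t. planar_ideal A b t (y - x)}"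

definition pa_space :: "'g presentation \<Rightarrow> nat \<Rightarrow> nat \<Rightarrow> 'g lincomb set set" where
  "pa_space A b t = coset A b t ` free_space A b t"

definition pa_add :: "'g presentation \<Rightarrow> nat \<Rightarrow> nat \<Rightarrow>
    'g lincomb set \<Rightarrow> 'g lincomb set \<Rightarrow> 'g lincomb set" where
  "pa_add A b t S T = (\<Union>x \<in> S. \<Union>y \<in> T. coset A b t (x + y))"

definition pa_scale :: "'g presentation \<Rightarrow> nat \<Rightarrow> nat \<Rightarrow>
    complex \<Rightarrow> 'g lincomb set \<Rightarrow> 'g lincomb set" where
  "pa_scale A b t c S = (\<Union>x \<in> S. coset A b t (scale c x))"

definition pa_stack :: "'g presentation \<Rightarrow> nat \<Rightarrow> nat \<Rightarrow>
    'g lincomb set \<Rightarrow> 'g lincomb set \<Rightarrow> 'g lincomb set" where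
  "pa_stack A b t S T = (\<Union>x \<in> S. \<Union>y \<in> T. coset A b t (stack_lc x y))"

definition pa_beside :: "'g presentation \<Rightarrow> nat \<Rightarrow> nat \<Rightarrow>
    'g lincomb set \<Rightarrow> 'g lincomb set \<Rightarrow> 'g lincomb set" where
  "pa_beside A b t S T = (\<Union>x \<in> S. \<Union>y \<in> T. coset A b t (beside_lc x y))"

definition pa_adjoint :: "'g presentation \<Rightarrow> nat \<Rightarrow> nat \<Rightarrow> 'g lincomb set \<Rightarrow> 'g lincomb set" where
  "pa_adjoint A b t S = (\<Union>x \<in> S. coset A b t (adjoint_lc (label_star A) x))"

text \<open>
  The category of projections.  The object \<open>(k, p)\<close> is the projection \<open>p\<close> in
  \<open>pa_space A k k\<close>.
\<close>

definition is_projection :: "'g presentation \<Rightarrow> nat \<times> 'g lincomb set \<Rightarrow> bool" where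
  "is_projection A = (\<lambda>(k, p).
     p \<in> pa_space A k k \<and> pa_stack A k k p p = p \<and> pa_adjoint A k k p = p)"

definition projection_tensor :: "'g presentation \<Rightarrow>
    nat \<times> 'g lincomb set \<Rightarrow> nat \<times> 'g lincomb set \<Rightarrow> nat \<times> 'g lincomb set" where
  "projection_tensor A = (\<lambda>(k, p) (l, q). (k + l, pa_beside A (k + l) (k + l) p q))"

definition projection_category ::
  "'g presentation \<Rightarrow> (nat \<times> 'g lincomb set, 'g lincomb set) mcat" where
  "projection_category A = \<lparr>
     Obj = {P. is_projection A P},
     Arr = {Arrow (k, p) (l, q) f | k p l q f.
       is_projection A (k, p) \<and> is_projection A (l, q) \<and>
       f \<in> pa_space A k l \<and> pa_stack A k l q (pa_stack A k l f p) = f},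
     idA = (\<lambda>P. Arrow P P (snd P)),
     cmpA = (\<lambda>g f. Arrow (src f) (tgt g)
       (pa_stack A (fst (src f)) (fst (tgt g)) (val g) (val f))),
     zeroA = (\<lambda>P Q. Arrow P Q (coset A (fst P) (fst Q) 0)),
     addA = (\<lambda>f g. Arrow (src f) (tgt f) (pa_add A (fst (src f)) (fst (tgt f)) (val f) (val g))),
     scaleA = (\<lambda>c f. Arrow (src f) (tgt f) (pa_scale A (fst (src f)) (fst (tgt f)) c (val f))),
     tenO = projection_tensor A,
     tenA = (\<lambda>f g. Arrow
       (projection_tensor A (src f) (src g)) (projection_tensor A (tgt f) (tgt g))
       (pa_beside A (fst (src f) + fst (src g)) (fst (tgt f) + fst (tgt g)) (val f) (val g))),
     unitO = (0, coset A 0 0 \<langle>strands 0\<rangle>),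
     assocA = (\<lambda>P Q R. let S = projection_tensor A P (projection_tensor A Q R)
       in Arrow S S (snd S)),
     lunitA = (\<lambda>P. Arrow P P (snd P)),
     runitA = (\<lambda>P. Arrow P P (snd P))\<rparr>"


section \<open>The planar algebra with parameters \<open>m\<close> and \<open>\<lambda>\<close>\<close>

datatype label = LP | LU | LUstar

primrec star_of :: "label \<Rightarrow> label" where
  "star_of LP = LP"
| "star_of LU = LUstar"
| "star_of LUstar = LU"

definition P1 :: "label diagram" where
  "P1 = box LP 1 1"

text \<open>For a box with two boundary points, rotation by \<open>\<pi>\<close> is one click.\<close>

definition Q1 :: "label diagram" where
  "Q1 = click P1"

text \<open>
  An oriented strand is a strand carrying one box \<open>P1\<close>, whose direction is that of the box.
  So the cup whose left leg carries \<open>P1\<close> (or, isotopically, whose right leg carries \<open>Q1\<close>)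
  has the boundary orientations of \<open>P1 \<otimes> Q1\<close>.
\<close>

definition cyclic_presentation :: "nat \<Rightarrow> complex \<Rightarrow> label presentation" where
  "cyclic_presentation m lam =
    (let n = m div 2; a = m - n;
         U = box LU a n; Us = box LUstar n a;
         Pa = beside_power P1 a; Qn = beside_power Q1 n;
         X = strands 1;
         loop = (\<lambda>d. stack cap (stack (beside d X) cup));
         turnback = (\<lambda>d. stack (stack (beside d X) cup) (stack cap (beside d X)))
     in \<lparr>gens = {(LP, 1, 1), (LU, a, n), (LUstar, n, a)},
         rels = {\<langle>U\<rangle> - \<langle>stack Qn (stack U Pa)\<rangle>,
                 \<langle>Us\<rangle> - \<langle>stack Pa (stack Us Qn)\<rangle>,
                 \<langle>loop P1\<rangle> - \<langle>strands 0\<rangle>,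
                 \<langle>loop Q1\<rangle> - \<langle>strands 0\<rangle>,
                 \<langle>X\<rangle> - (\<langle>P1\<rangle> + \<langle>Q1\<rangle>),
                 \<langle>stack P1 Q1\<rangle>,
                 \<langle>stack Q1 P1\<rangle>,
                 \<langle>turnback P1\<rangle> - \<langle>beside P1 Q1\<rangle>,
                 \<langle>turnback Q1\<rangle> - \<langle>beside Q1 P1\<rangle>,
                 \<langle>stack U Us\<rangle> - \<langle>Qn\<rangle>,
                 \<langle>stack Us U\<rangle> - \<langle>Pa\<rangle>,
                 \<langle>click U\<rangle> - scale lam \<langle>U\<rangle>,
                 \<langle>click Us\<rangle> - scale lam \<langle>Us\<rangle>},
         label_star = star_of\<rparr>)"

definition planar_category ::
  "nat \<Rightarrow> complex \<Rightarrow> ((nat \<times> label lincomb set) list,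
     (nat \<times> label lincomb set, label lincomb set) arrow mat) mcat" where
  "planar_category m lam =
     additive_envelope (projection_category (cyclic_presentation m lam))"

end

theory Submission
  imports Defs
begin

text \<open>
  Both categories are categories of graded matrices, and they carry the same cocycle. Give a
  strand directed upwards the degree 1 and a strand directed downwards the degree -1. Since the
  identity of one strand is \<open>P1 + Q1\<close>, an element of the planar algebra with
  \<open>b\<close> bottom and \<open>t\<close> top points is a matrix of blocks, one for each
  pair of words of directions of lengths \<open>t\<close> and \<open>b\<close>. The heart of the
  proof is that a block is zero unless the two words have the same degree modulo
  \<open>m\<close>, and is then one-dimensional. Hence the planar algebra consists of all complex
  matrices, indexed by words, that preserve the degree modulo \<open>m\<close>
  (\<open>rho_inj\<close>, \<open>rho_surj\<close>).

  The blocks are at most one-dimensional because every word can be fused, letter by letter, into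
  a stack of fewer than \<open>m\<close> upward strands: a downward strand is cancelled against
  an upward one by a cap, and \<open>U\<close>, closed off by caps, is an isomorphism from
  \<open>m\<close> upward strands to the empty word. This gives invertible normal forms \<open>e
  r w\<close>, and every generator is shown to carry normal forms to multiples of normal forms
  (\<open>reducible_Mor\<close>). The delicate generator is \<open>U\<close> itself next to
  \<open>r\<close> strands, where the rotation eigenvalue is used to move it past one strand at a
  time (\<open>e_U\<close>).

  The blocks do not collapse because there is a model (\<open>ev\<close>): a state sum over
  directions of the strands, in which \<open>U\<close> contributes the power of
  \<open>lam\<close> given by minus the total degree of all that lies to its left. The dependence
  on the left is what makes \<open>U\<close> an eigenvector of the click, and it is consistent
  because \<open>lam ^ m = 1\<close>. It also twists the juxtaposition of matrices: with
  \<open>h\<close> the degree of the bottom word on the left, the matrix on the right is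
  multiplied by a power of \<open>lam ^ h\<close> (\<open>rho_beside\<close>). After rescaling
  the basis vectors this twisted product is the Kronecker product, but the rescalings of a triple
  product disagree, and the discrepancy is the cocycle \<open>omega g h k = lam powi (- (g * ((h
  + k) div m)))\<close>.

  The remaining passage is formal. In a category whose objects are idempotent graded matrices and
  whose arrows are all matrices that these idempotents absorb, objects are determined by the
  degrees in a splitting of the idempotent. So choosing splittings gives an equivalence with
  graded vector spaces (\<open>is_equivalence\<close>), and it is monoidal as soon as the
  associators are given by the same function of the degrees (\<open>is_monoidal_functor\<close>).
  The additive envelope of such a category is again of this kind (\<open>envelope\<close>), every
  graded idempotent splits (\<open>idempotent_splits\<close>), and the powers of
  \<open>P1\<close> realize all degrees.
\<close>

section \<open>Categories of matrices\<close>

text \<open>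
  The range of summation is explicit because the index types, such as lists, are infinite.
\<close>

definition mm :: "'i set \<Rightarrow> ('a \<Rightarrow> 'i \<Rightarrow> complex) \<Rightarrow> ('i \<Rightarrow> 'b \<Rightarrow> complex) \<Rightarrow> 'a \<Rightarrow> 'b \<Rightarrow> complex" where
  "mm S M N = (\<lambda>x y. \<Sum>z \<in> S. M x z * N z y)"

definition ten :: "('a \<Rightarrow> 'b \<Rightarrow> complex) \<Rightarrow> ('c \<Rightarrow> 'd \<Rightarrow> complex) \<Rightarrow> 'a \<times> 'c \<Rightarrow> 'b \<times> 'd \<Rightarrow> complex" where
  "ten M N = (\<lambda>(x, x') (y, y'). M x y * N x' y')"

lemma ten_pair [simp]: "ten M N (x, x') (y, y') = M x y * N x' y'"
  by (simp add: ten_def)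

lemma mm_assoc: "mm S (mm T M N) K = mm T M (mm S N K)"
proof (intro ext)
  fix x y
  have "(\<Sum>z \<in> S. \<Sum>z' \<in> T. M x z' * N z' z * K z y) = (\<Sum>z' \<in> T. \<Sum>z \<in> S. M x z' * N z' z * K z y)"
    by (rule sum.swap)
  then show "mm S (mm T M N) K x y = mm T M (mm S N K) x y"
    by (simp add: mm_def sum_distrib_left sum_distrib_right mult.assoc)
qed

lemma mm_add_left: "mm S (\<lambda>x y. M x y + M' x y) N = (\<lambda>x y. mm S M N x y + mm S M' N x y)"
  by (simp add: mm_def distrib_right sum.distrib)

lemma mm_add_right: "mm S N (\<lambda>x y. M x y + M' x y) = (\<lambda>x y. mm S N M x y + mm S N M' x y)"
  by (simp add: mm_def distrib_left sum.distrib)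

lemma mm_scale_left: "mm S (\<lambda>x y. c * M x y) N = (\<lambda>x y. c * mm S M N x y)"
  by (simp add: mm_def sum_distrib_left mult.assoc)

lemma mm_scale_right: "mm S N (\<lambda>x y. c * M x y) = (\<lambda>x y. c * mm S N M x y)"
  by (simp add: mm_def sum_distrib_left mult.left_commute)

lemma mm_nz: "mm S M N x y \<noteq> 0 \<Longrightarrow> \<exists>z \<in> S. M x z \<noteq> 0 \<and> N z y \<noteq> 0"
  unfolding mm_def by (erule sum.not_neutral_contains_not_neutral) auto

lemma mm_cong:
  "(\<And>z. z \<in> S \<Longrightarrow> M x z = M' x z) \<Longrightarrow> (\<And>z. z \<in> S \<Longrightarrow> N z y = N' z y) \<Longrightarrow>
    mm S M N x y = mm S M' N' x y"
  by (simp add: mm_def)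

lemma mm_ten: "mm (S \<times> T) (ten M N) (ten M' N') = ten (mm S M M') (mm T N N')"
proof -
  have pairs: "(\<Sum>z \<in> S \<times> T. h z) = (\<Sum>i \<in> S. \<Sum>j \<in> T. h (i, j))" for h :: "_ \<Rightarrow> complex"
    using sum.cartesian_product[of "\<lambda>i j. h (i, j)" T S] by simp
  have "mm (S \<times> T) (ten M N) (ten M' N') (x, x') (y, y') = ten (mm S M M') (mm T N N') (x, x') (y, y')"
    for x x' y y'
    by (simp add: mm_def pairs sum_product mult.assoc mult.left_commute)
  then show ?thesis by (intro ext) (metis surj_pair)
qed

text \<open>The matrix of \<open>N\<close> after a change of basis: \<open>p \<tau> / s \<tau>\<close> is the new basis vector with index \<open>\<tau>\<close>.\<close>

definition cm where
  "cm q s' p s N = (\<lambda>\<tau>' \<tau>. N (q \<tau>') (p \<tau>) * s \<tau> / s' \<tau>')"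

lemma cm_mm:
  assumes "bij_betw p' S J" "\<And>\<tau>. \<tau> \<in> S \<Longrightarrow> s' \<tau> \<noteq> 0"
  shows "cm q r p s (mm J N M) = mm S (cm q r p' s' N) (cm p' s' p s M)"
proof (intro ext)
  fix \<tau>' \<tau>
  have "cm q r p s (mm J N M) \<tau>' \<tau> = (\<Sum>z \<in> S. N (q \<tau>') (p' z) * M (p' z) (p \<tau>)) * s \<tau> / r \<tau>'"
    unfolding cm_def mm_def using sum.reindex_bij_betw[OF assms(1), of "\<lambda>z. N (q \<tau>') z * M z (p \<tau>)"] by simp
  also have "\<dots> = mm S (cm q r p' s' N) (cm p' s' p s M) \<tau>' \<tau>"
    unfolding mm_def cm_def sum_distrib_right sum_divide_distrib
    using assms(2) by (intro sum.cong refl) (simp add: field_simps)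
  finally show "cm q r p s (mm J N M) \<tau>' \<tau> = mm S (cm q r p' s' N) (cm p' s' p s M) \<tau>' \<tau>" .
qed

text \<open>
  Objects have a finite graded index set and, as the matrix of the identity, an idempotent;
  arrows are exactly the degree-preserving matrices that the idempotents of source and target
  absorb. The idempotents are not assumed to be diagonal: for the category of projections they
  are arbitrary projections. All axioms of a linear category then reduce to matrix computations.
\<close>

locale matrix_cat =
  fixes C :: "('o, 'v) mcat" (structure) and I :: "'o \<Rightarrow> 'i set"
    and Phi :: "('o, 'v) arrow \<Rightarrow> 'i \<Rightarrow> 'i \<Rightarrow> complex" and dg :: "'o \<Rightarrow> 'i \<Rightarrow> 'g"
  assumes finite_I: "X \<in> Obj C \<Longrightarrow> finite (I X)"
    and Arr_Obj: "f \<in> Arr C \<Longrightarrow> src f \<in> Obj C \<and> tgt f \<in> Obj C"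
    and id_Hom: "X \<in> Obj C \<Longrightarrow> idA C X \<in> Hom C X X"
    and comp_Hom: "f \<in> Hom C X Y \<Longrightarrow> g \<in> Hom C Y Z \<Longrightarrow> g \<cdot> f \<in> Hom C X Z"
    and add_Hom: "f \<in> Hom C X Y \<Longrightarrow> g \<in> Hom C X Y \<Longrightarrow> addA C f g \<in> Hom C X Y"
    and scale_Hom: "f \<in> Hom C X Y \<Longrightarrow> scaleA C c f \<in> Hom C X Y"
    and Phi_graded: "f \<in> Hom C X Y \<Longrightarrow> Phi f y x \<noteq> 0 \<Longrightarrow> y \<in> I Y \<and> x \<in> I X \<and> dg Y y = dg X x"
    and Phi_comp: "f \<in> Hom C X Y \<Longrightarrow> g \<in> Hom C Y Z \<Longrightarrow> Phi (g \<cdot> f) = mm (I Y) (Phi g) (Phi f)"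
    and Phi_id: "f \<in> Hom C X Y \<Longrightarrow> mm (I Y) (Phi (idA C Y)) (Phi f) = Phi f"
      "f \<in> Hom C X Y \<Longrightarrow> mm (I X) (Phi f) (Phi (idA C X)) = Phi f"
    and Phi_add: "f \<in> Hom C X Y \<Longrightarrow> g \<in> Hom C X Y \<Longrightarrow>
      Phi (addA C f g) = (\<lambda>y x. Phi f y x + Phi g y x)"
    and Phi_scale: "f \<in> Hom C X Y \<Longrightarrow> Phi (scaleA C c f) = (\<lambda>y x. c * Phi f y x)"
    and Phi_inj: "f \<in> Hom C X Y \<Longrightarrow> g \<in> Hom C X Y \<Longrightarrow> Phi f = Phi g \<Longrightarrow> f = g"
    and Phi_surj: "X \<in> Obj C \<Longrightarrow> Y \<in> Obj C \<Longrightarrow>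
      (\<And>y x. M y x \<noteq> 0 \<Longrightarrow> y \<in> I Y \<and> x \<in> I X \<and> dg Y y = dg X x) \<Longrightarrow>
      mm (I Y) (Phi (idA C Y)) M = M \<Longrightarrow> mm (I X) M (Phi (idA C X)) = M \<Longrightarrow>
      \<exists>f \<in> Hom C X Y. Phi f = M"
begin

abbreviation E where "E X \<equiv> Phi (idA C X)"

lemma Hom_Obj: "f \<in> Hom C X Y \<Longrightarrow> X \<in> Obj C" "f \<in> Hom C X Y \<Longrightarrow> Y \<in> Obj C"
  using Arr_Obj by (auto simp: Hom_def)

lemma E_idem: "X \<in> Obj C \<Longrightarrow> mm (I X) (E X) (E X) = E X"
  using Phi_id id_Hom by blast

lemma E_graded: "X \<in> Obj C \<Longrightarrow> E X y x \<noteq> 0 \<Longrightarrow> y \<in> I X \<and> x \<in> I X \<and> dg X y = dg X x"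
  using Phi_graded id_Hom by blast

lemma is_category: "category C"
proof
  fix f X Y assume f: "f \<in> Hom C X Y"
  then have o: "X \<in> Obj C" "Y \<in> Obj C" using Hom_Obj by auto
  show "idA C Y \<cdot> f = f" "f \<cdot> idA C X = f"
    using f o by (auto intro!: Phi_inj[of _ X Y] comp_Hom id_Hom
      simp: Phi_comp[OF f id_Hom] Phi_comp[OF id_Hom f] Phi_id)
next
  fix f W X g Y h Z assume h: "f \<in> Hom C W X" "g \<in> Hom C X Y" "h \<in> Hom C Y Z"
  show "(h \<cdot> g) \<cdot> f = h \<cdot> g \<cdot> f"
    using h comp_Hom[OF h(1,2)] comp_Hom[OF h(2,3)]
    by (intro Phi_inj[of _ W Z]) (auto intro: comp_Hom simp: Phi_comp mm_assoc)
qed (use Arr_Obj id_Hom comp_Hom in auto)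

lemma iso_arrowI:
  assumes "f \<in> Hom C X Y" "g \<in> Hom C Y X"
    "mm (I Y) (Phi g) (Phi f) = E X" "mm (I X) (Phi f) (Phi g) = E Y"
  shows "iso_arrow C f"
proof -
  have o: "X \<in> Obj C" "Y \<in> Obj C" using assms Hom_Obj by auto
  have "g \<cdot> f = idA C X" "f \<cdot> g = idA C Y"
    using assms o by (auto intro!: Phi_inj comp_Hom id_Hom simp: Phi_comp)
  then show ?thesis using assms unfolding iso_arrow_def by (auto simp: Hom_def)
qed

text \<open>
  A basis of an object that is indexed by a set of one's own choice and rescaled. Iterated tensor
  products that differ by bracketing become comparable when they are all indexed by the same
  tuples.
\<close>

definition frame where
  "frame X S p s \<longleftrightarrow> X \<in> Obj C \<and> bij_betw p S (I X) \<and> (\<forall>\<tau> \<in> S. s \<tau> \<noteq> (0 :: complex))"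

abbreviation co where "co q s' p s f \<equiv> cm q s' p s (Phi f)"

lemma co_comp:
  "f \<in> Hom C X Y \<Longrightarrow> g \<in> Hom C Y Z \<Longrightarrow> frame Y S p' s' \<Longrightarrow>
    co q r p s (g \<cdot> f) = mm S (co q r p' s' g) (co p' s' p s f)"
  by (simp add: Phi_comp frame_def cm_mm)

lemma co_eqI:
  assumes f: "f \<in> Hom C X Y" "g \<in> Hom C X Y" and X: "frame X S p s" and Y: "frame Y T q r"
    and eq: "\<And>\<tau> \<tau>'. \<tau> \<in> S \<Longrightarrow> \<tau>' \<in> T \<Longrightarrow> co q r p s f \<tau>' \<tau> = co q r p s g \<tau>' \<tau>"
  shows "f = g"
proof (rule Phi_inj[OF f], intro ext)
  fix y x
  show "Phi f y x = Phi g y x"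
  proof (cases "y \<in> I Y \<and> x \<in> I X")
    case True
    with X Y have "x \<in> p ` S" "y \<in> q ` T" by (simp_all add: frame_def bij_betw_def)
    then obtain \<tau> \<tau>' where "\<tau> \<in> S" "\<tau>' \<in> T" "x = p \<tau>" "y = q \<tau>'" by blast
    then show ?thesis using eq[of \<tau> \<tau>'] X Y by (simp add: cm_def frame_def)
  next
    case False
    then show ?thesis using Phi_graded[OF f(1), of y x] Phi_graded[OF f(2), of y x] by metis
  qed
qed

lemma co_surj:
  assumes X: "frame X S p s" and Y: "frame Y T q r"
    and N: "\<And>\<tau> \<tau>'. \<tau> \<in> S \<Longrightarrow> \<tau>' \<in> T \<Longrightarrow> N \<tau>' \<tau> \<noteq> 0 \<Longrightarrow> dg Y (q \<tau>') = dg X (p \<tau>)"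
    and NY: "\<And>\<tau> \<tau>'. \<tau> \<in> S \<Longrightarrow> \<tau>' \<in> T \<Longrightarrow> mm T (co q r q r (idA C Y)) N \<tau>' \<tau> = N \<tau>' \<tau>"
    and NX: "\<And>\<tau> \<tau>'. \<tau> \<in> S \<Longrightarrow> \<tau>' \<in> T \<Longrightarrow> mm S N (co p s p s (idA C X)) \<tau>' \<tau> = N \<tau>' \<tau>"
  shows "\<exists>f \<in> Hom C X Y. \<forall>\<tau> \<in> S. \<forall>\<tau>' \<in> T. co q r p s f \<tau>' \<tau> = N \<tau>' \<tau>"
proof -
  have o: "X \<in> Obj C" "Y \<in> Obj C" and b: "bij_betw p S (I X)" "bij_betw q T (I Y)"
    and nz: "\<And>\<tau>. \<tau> \<in> S \<Longrightarrow> s \<tau> \<noteq> 0" "\<And>\<tau>. \<tau> \<in> T \<Longrightarrow> r \<tau> \<noteq> 0"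
    using X Y by (auto simp: frame_def)
  define M where "M y x = (if y \<in> I Y \<and> x \<in> I X then
    N (inv_into T q y) (inv_into S p x) * r (inv_into T q y) / s (inv_into S p x) else 0)" for y x
  have pI: "p \<tau> \<in> I X" if "\<tau> \<in> S" for \<tau> using b that by (auto simp: bij_betw_def)
  have qI: "q \<tau> \<in> I Y" if "\<tau> \<in> T" for \<tau> using b that by (auto simp: bij_betw_def)
  have inv: "inv_into S p (p \<tau>) = \<tau>" if "\<tau> \<in> S" for \<tau> using b that by (simp add: bij_betw_def)
  have inv': "inv_into T q (q \<tau>) = \<tau>" if "\<tau> \<in> T" for \<tau> using b that by (simp add: bij_betw_def)
  have M: "cm q r p s M \<tau>' \<tau> = N \<tau>' \<tau>" if "\<tau> \<in> S" "\<tau>' \<in> T" for \<tau> \<tau>'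
    using that nz pI qI by (simp add: cm_def M_def inv inv')
  have ext_eq: "M1 = M2" if "\<And>y x. M1 y x \<noteq> 0 \<Longrightarrow> y \<in> I Y \<and> x \<in> I X"
    "\<And>y x. M2 y x \<noteq> 0 \<Longrightarrow> y \<in> I Y \<and> x \<in> I X"
    "\<And>\<tau> \<tau>'. \<tau> \<in> S \<Longrightarrow> \<tau>' \<in> T \<Longrightarrow> cm q r p s M1 \<tau>' \<tau> = cm q r p s M2 \<tau>' \<tau>" for M1 M2
  proof (intro ext)
    fix y x
    show "M1 y x = M2 y x"
    proof (cases "y \<in> I Y \<and> x \<in> I X")
      case True
      with b have "x \<in> p ` S" "y \<in> q ` T" by (simp_all add: bij_betw_def)
      then obtain \<tau> \<tau>' where "\<tau> \<in> S" "\<tau>' \<in> T" "x = p \<tau>" "y = q \<tau>'" by blast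
      then show ?thesis using that(3)[of \<tau> \<tau>'] nz by (simp add: cm_def)
    next
      case False
      then show ?thesis using that(1,2)[of y x] by metis
    qed
  qed
  have supp: "M y x \<noteq> 0 \<Longrightarrow> y \<in> I Y \<and> x \<in> I X" for y x by (simp add: M_def split: if_splits)
  have "\<exists>f \<in> Hom C X Y. Phi f = M"
  proof (rule Phi_surj[OF o])
    fix y x assume nz': "M y x \<noteq> 0"
    with b supp have "x \<in> p ` S" "y \<in> q ` T" by (auto simp: bij_betw_def)
    then obtain \<tau> \<tau>' where t: "\<tau> \<in> S" "\<tau>' \<in> T" "x = p \<tau>" "y = q \<tau>'" by blast
    then have "N \<tau>' \<tau> \<noteq> 0" using nz' pI qI by (auto simp: M_def inv inv')
    then show "y \<in> I Y \<and> x \<in> I X \<and> dg Y y = dg X x"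
      using t pI qI N by auto
  next
    show "mm (I Y) (E Y) M = M"
    proof (rule ext_eq)
      fix y x assume "mm (I Y) (E Y) M y x \<noteq> 0"
      then show "y \<in> I Y \<and> x \<in> I X" using mm_nz supp E_graded[OF o(2)] by metis
    next
      fix \<tau> \<tau>' assume t: "\<tau> \<in> S" "\<tau>' \<in> T"
      have "cm q r p s (mm (I Y) (E Y) M) \<tau>' \<tau> = mm T (co q r q r (idA C Y)) (cm q r p s M) \<tau>' \<tau>"
        using cm_mm[where q = q and r = r and p = p and s = s, OF b(2) nz(2)] by simp
      also have "\<dots> = mm T (co q r q r (idA C Y)) N \<tau>' \<tau>"
        using t by (intro mm_cong) (auto simp: M)
      finally show "cm q r p s (mm (I Y) (E Y) M) \<tau>' \<tau> = cm q r p s M \<tau>' \<tau>"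
        using t NY M by simp
    qed (rule supp)
  next
    show "mm (I X) M (E X) = M"
    proof (rule ext_eq)
      fix y x assume "mm (I X) M (E X) y x \<noteq> 0"
      then show "y \<in> I Y \<and> x \<in> I X" using mm_nz supp E_graded[OF o(1)] by metis
    next
      fix \<tau> \<tau>' assume t: "\<tau> \<in> S" "\<tau>' \<in> T"
      have "cm q r p s (mm (I X) M (E X)) \<tau>' \<tau> = mm S (cm q r p s M) (co p s p s (idA C X)) \<tau>' \<tau>"
        using cm_mm[where q = q and r = r and p = p and s = s, OF b(1) nz(1)] by simp
      also have "\<dots> = mm S N (co p s p s (idA C X)) \<tau>' \<tau>"
        using t by (intro mm_cong) (auto simp: M)
      finally show "cm q r p s (mm (I X) M (E X)) \<tau>' \<tau> = cm q r p s M \<tau>' \<tau>"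
        using t NX M by simp
    qed (rule supp)
  qed
  then show ?thesis using M by metis
qed

text \<open>
  Structure isomorphisms have the same shape in suitable frames: the common idempotent of
  source and target, rescaled by a function of the degrees.
\<close>

lemma mm_rescaled:
  assumes idem: "\<And>\<tau> \<tau>'. \<tau> \<in> S \<Longrightarrow> \<tau>' \<in> S \<Longrightarrow> mm S e e \<tau>' \<tau> = e \<tau>' \<tau>"
    and k: "\<And>\<tau> \<tau>'. \<tau> \<in> S \<Longrightarrow> \<tau>' \<in> S \<Longrightarrow> e \<tau>' \<tau> \<noteq> 0 \<Longrightarrow> k' \<tau>' = k' \<tau>"
    and M: "\<And>\<tau> \<tau>'. \<tau> \<in> S \<Longrightarrow> \<tau>' \<in> S \<Longrightarrow> M \<tau>' \<tau> = k' \<tau> * e \<tau>' \<tau>"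
    and N: "\<And>\<tau> \<tau>'. \<tau> \<in> S \<Longrightarrow> \<tau>' \<in> S \<Longrightarrow> N \<tau>' \<tau> = k \<tau> * e \<tau>' \<tau>"
    and t: "\<tau> \<in> S" "\<tau>' \<in> S"
  shows "mm S M N \<tau>' \<tau> = k' \<tau> * k \<tau> * e \<tau>' \<tau>"
proof -
  have "mm S M N \<tau>' \<tau> = (\<Sum>z \<in> S. k' \<tau> * k \<tau> * (e \<tau>' z * e z \<tau>))"
    unfolding mm_def
  proof (intro sum.cong refl)
    fix z assume z: "z \<in> S"
    show "M \<tau>' z * N z \<tau> = k' \<tau> * k \<tau> * (e \<tau>' z * e z \<tau>)"
    proof (cases "e z \<tau> = 0")
      case False
      then show ?thesis using k[OF t(1) z False] by (simp add: M[OF z t(2)] N[OF t(1) z])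
    qed (simp add: N[OF t(1) z])
  qed
  then show ?thesis using idem[OF t] by (simp add: mm_def flip: sum_distrib_left)
qed

lemma iso_rescaled:
  assumes f: "f \<in> Hom C X Y" and X: "frame X S p s" and Y: "frame Y S q r"
    and eX: "\<And>\<tau> \<tau>'. \<tau> \<in> S \<Longrightarrow> \<tau>' \<in> S \<Longrightarrow> co p s p s (idA C X) \<tau>' \<tau> = e \<tau>' \<tau>"
    and eY: "\<And>\<tau> \<tau>'. \<tau> \<in> S \<Longrightarrow> \<tau>' \<in> S \<Longrightarrow> co q r q r (idA C Y) \<tau>' \<tau> = e \<tau>' \<tau>"
    and ef: "\<And>\<tau> \<tau>'. \<tau> \<in> S \<Longrightarrow> \<tau>' \<in> S \<Longrightarrow> co q r p s f \<tau>' \<tau> = k \<tau> * e \<tau>' \<tau>"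
    and k: "\<And>\<tau> \<tau>'. \<tau> \<in> S \<Longrightarrow> \<tau>' \<in> S \<Longrightarrow> e \<tau>' \<tau> \<noteq> 0 \<Longrightarrow> k \<tau>' = k \<tau>"
    and nz: "\<And>\<tau>. \<tau> \<in> S \<Longrightarrow> k \<tau> \<noteq> 0"
  shows "iso_arrow C f"
proof -
  have o: "X \<in> Obj C" "Y \<in> Obj C" using X Y by (auto simp: frame_def)
  have idem: "mm S e e \<tau>' \<tau> = e \<tau>' \<tau>" if "\<tau> \<in> S" "\<tau>' \<in> S" for \<tau> \<tau>'
  proof -
    have "mm S e e \<tau>' \<tau> = mm S (co p s p s (idA C X)) (co p s p s (idA C X)) \<tau>' \<tau>"
      using that by (intro mm_cong) (simp_all add: eX)
    also have "\<dots> = co p s p s (idA C X) \<tau>' \<tau>"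
      using cm_mm[of p S "I X" s p s p s "E X" "E X"] X E_idem[OF o(1)] by (simp add: frame_def)
    finally show ?thesis using that by (simp add: eX)
  qed
  have k': "inverse (k \<tau>') = inverse (k \<tau>)" if "\<tau> \<in> S" "\<tau>' \<in> S" "e \<tau>' \<tau> \<noteq> 0" for \<tau> \<tau>'
    using k that by metis
  define N where "N \<tau>' \<tau> = inverse (k \<tau>) * e \<tau>' \<tau>" for \<tau>' \<tau>
  have "\<exists>g \<in> Hom C Y X. \<forall>\<tau> \<in> S. \<forall>\<tau>' \<in> S. co p s q r g \<tau>' \<tau> = N \<tau>' \<tau>"
  proof (rule co_surj[OF Y X])
    fix \<tau> \<tau>' assume t: "\<tau> \<in> S" "\<tau>' \<in> S"
    show "mm S (co p s p s (idA C X)) N \<tau>' \<tau> = N \<tau>' \<tau>"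
      using mm_rescaled[where e = e and k' = "\<lambda>_. 1" and M = "co p s p s (idA C X)" and N = N
        and k = "\<lambda>\<tau>. inverse (k \<tau>)", OF idem _ _ _ t] t
      by (simp add: eX N_def)
    show "mm S N (co q r q r (idA C Y)) \<tau>' \<tau> = N \<tau>' \<tau>"
      using mm_rescaled[where e = e and k' = "\<lambda>\<tau>. inverse (k \<tau>)" and M = N
        and N = "co q r q r (idA C Y)" and k = "\<lambda>_. 1", OF idem k' _ _ t] t
      by (simp add: eY N_def)
    assume "N \<tau>' \<tau> \<noteq> 0"
    then have e: "e \<tau>' \<tau> \<noteq> 0" by (simp add: N_def)
    then have "e \<tau>' \<tau> \<noteq> 0 \<and> k \<tau> * e \<tau> \<tau> = co q r p s f \<tau> \<tau>" using ef t by simp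
    have "dg X (p \<tau>') = dg X (p \<tau>)"
    proof -
      have "E X (p \<tau>') (p \<tau>) \<noteq> 0" using eX[OF t] e unfolding cm_def by (metis div_0 mult_zero_left)
      then show ?thesis using E_graded[OF o(1)] by blast
    qed
    moreover have "dg Y (q \<tau>') = dg X (p \<tau>)"
    proof -
      have "k \<tau> * e \<tau>' \<tau> \<noteq> 0" using e nz[OF t(1)] by simp
      then have "Phi f (q \<tau>') (p \<tau>) \<noteq> 0" using ef[OF t] unfolding cm_def by (metis div_0 mult_zero_left)
      then show ?thesis using Phi_graded[OF f] by blast
    qed
    moreover have "dg Y (q \<tau>') = dg Y (q \<tau>)"
    proof -
      have "E Y (q \<tau>') (q \<tau>) \<noteq> 0" using eY[OF t] e unfolding cm_def by (metis div_0 mult_zero_left)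
      then show ?thesis using E_graded[OF o(2)] by blast
    qed
    ultimately show "dg X (p \<tau>') = dg Y (q \<tau>)" by simp
  qed
  then obtain g where g: "g \<in> Hom C Y X" "\<And>\<tau> \<tau>'. \<tau> \<in> S \<Longrightarrow> \<tau>' \<in> S \<Longrightarrow> co p s q r g \<tau>' \<tau> = N \<tau>' \<tau>"
    by blast
  have "g \<cdot> f = idA C X"
  proof (rule co_eqI[OF comp_Hom[OF f g(1)] id_Hom[OF o(1)] X X])
    fix \<tau> \<tau>' assume t: "\<tau> \<in> S" "\<tau>' \<in> S"
    show "co p s p s (g \<cdot> f) \<tau>' \<tau> = co p s p s (idA C X) \<tau>' \<tau>"
      unfolding co_comp[OF f g(1) Y]
      using mm_rescaled[where e = e and k' = "\<lambda>\<tau>. inverse (k \<tau>)" and M = "co p s q r g"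
        and N = "co q r p s f" and k = k, OF idem k' _ _ t] t nz
      by (simp add: eX ef g N_def)
  qed
  moreover have "f \<cdot> g = idA C Y"
  proof (rule co_eqI[OF comp_Hom[OF g(1) f] id_Hom[OF o(2)] Y Y])
    fix \<tau> \<tau>' assume t: "\<tau> \<in> S" "\<tau>' \<in> S"
    show "co q r q r (f \<cdot> g) \<tau>' \<tau> = co q r q r (idA C Y) \<tau>' \<tau>"
      unfolding co_comp[OF g(1) f X]
      using mm_rescaled[where e = e and k' = k and M = "co q r p s f" and N = "co p s q r g"
        and k = "\<lambda>\<tau>. inverse (k \<tau>)", OF idem k _ _ t] t nz
      by (simp add: eY ef g N_def)
  qed
  ultimately show ?thesis using f g(1) unfolding iso_arrow_def by (auto simp: Hom_def)
qed

end

section \<open>Equivalences from splittings of idempotents\<close>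

text \<open>
  The matrices \<open>a X\<close> and \<open>b X\<close> split the idempotent of \<open>X\<close>
  through the idempotent of \<open>FO X\<close>. They determine the functor: \<open>f\<close> is
  sent to \<open>b Y f a X\<close>.
\<close>

locale split_functor =
  C: matrix_cat C I Phi dg + D: matrix_cat D I' Phi' dg'
  for C :: "('o, 'v) mcat" and I :: "'o \<Rightarrow> 'i set" and Phi and dg :: "'o \<Rightarrow> 'i \<Rightarrow> 'g"
    and D :: "('p, 'w) mcat" and I' :: "'p \<Rightarrow> 'j set" and Phi' and dg' :: "'p \<Rightarrow> 'j \<Rightarrow> 'g" +
  fixes FO :: "'o \<Rightarrow> 'p" and a :: "'o \<Rightarrow> 'i \<Rightarrow> 'j \<Rightarrow> complex" and b :: "'o \<Rightarrow> 'j \<Rightarrow> 'i \<Rightarrow> complex"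
  assumes FO_Obj: "X \<in> Obj C \<Longrightarrow> FO X \<in> Obj D"
    and a_graded: "X \<in> Obj C \<Longrightarrow> a X x y \<noteq> 0 \<Longrightarrow> x \<in> I X \<and> y \<in> I' (FO X) \<and> dg X x = dg' (FO X) y"
    and b_graded: "X \<in> Obj C \<Longrightarrow> b X y x \<noteq> 0 \<Longrightarrow> x \<in> I X \<and> y \<in> I' (FO X) \<and> dg X x = dg' (FO X) y"
    and ab: "X \<in> Obj C \<Longrightarrow> mm (I' (FO X)) (a X) (b X) = Phi (idA C X)"
    and ba: "X \<in> Obj C \<Longrightarrow> mm (I X) (b X) (a X) = Phi' (idA D (FO X))"
    and ea: "X \<in> Obj C \<Longrightarrow> mm (I X) (Phi (idA C X)) (a X) = a X"
    and be: "X \<in> Obj C \<Longrightarrow> mm (I X) (b X) (Phi (idA C X)) = b X"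
begin

lemma ae: "X \<in> Obj C \<Longrightarrow> mm (I' (FO X)) (a X) (Phi' (idA D (FO X))) = a X"
  using mm_assoc[of "I X" "I' (FO X)" "a X" "b X" "a X"] ab ba ea by simp

lemma eb: "X \<in> Obj C \<Longrightarrow> mm (I' (FO X)) (Phi' (idA D (FO X))) (b X) = b X"
  using mm_assoc[of "I' (FO X)" "I X" "b X" "a X" "b X"] ab ba be by simp

lemma contract:
  assumes "X \<in> Obj C"
  shows "mm (I' (FO X)) (a X) (mm (I X) (b X) K) = mm (I X) (Phi (idA C X)) K"
    "mm (I X) (b X) (mm (I' (FO X)) (a X) K') = mm (I' (FO X)) (Phi' (idA D (FO X))) K'"
    "mm (I X) (Phi (idA C X)) (mm (I' (FO X)) (a X) K') = mm (I' (FO X)) (a X) K'"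
    "mm (I' (FO X)) (Phi' (idA D (FO X))) (mm (I X) (b X) K) = mm (I X) (b X) K"
    "mm (I X) (b X) (mm (I X) (Phi (idA C X)) K) = mm (I X) (b X) K"
    "mm (I' (FO X)) (a X) (mm (I' (FO X)) (Phi' (idA D (FO X))) K') = mm (I' (FO X)) (a X) K'"
  using assms by (simp_all add: ab ba ea be ae eb flip: mm_assoc)

lemma Hom_exists:
  assumes f: "f \<in> Hom C X Y"
  shows "\<exists>g \<in> Hom D (FO X) (FO Y). Phi' g = mm (I Y) (b Y) (mm (I X) (Phi f) (a X))"
proof (rule D.Phi_surj)
  have o: "X \<in> Obj C" "Y \<in> Obj C" using f C.Hom_Obj by auto
  then show "FO X \<in> Obj D" "FO Y \<in> Obj D" by (simp_all add: FO_Obj)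
  show "mm (I' (FO Y)) (Phi' (idA D (FO Y))) (mm (I Y) (b Y) (mm (I X) (Phi f) (a X))) =
      mm (I Y) (b Y) (mm (I X) (Phi f) (a X))"
    "mm (I' (FO X)) (mm (I Y) (b Y) (mm (I X) (Phi f) (a X))) (Phi' (idA D (FO X))) =
      mm (I Y) (b Y) (mm (I X) (Phi f) (a X))"
    using o by (simp_all add: contract mm_assoc ae)
  fix y x assume "mm (I Y) (b Y) (mm (I X) (Phi f) (a X)) y x \<noteq> 0"
  then obtain z z' where "b Y y z \<noteq> 0" "Phi f z z' \<noteq> 0" "a X z' x \<noteq> 0" using mm_nz by metis
  then show "y \<in> I' (FO Y) \<and> x \<in> I' (FO X) \<and> dg' (FO Y) y = dg' (FO X) x"
    using a_graded[OF o(1)] b_graded[OF o(2)] C.Phi_graded[OF f] by metis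
qed

definition FA where
  "FA f = (SOME g. g \<in> Hom D (FO (src f)) (FO (tgt f)) \<and>
     Phi' g = mm (I (tgt f)) (b (tgt f)) (mm (I (src f)) (Phi f) (a (src f))))"

lemma FA:
  assumes "f \<in> Hom C X Y"
  shows "FA f \<in> Hom D (FO X) (FO Y)" "Phi' (FA f) = mm (I Y) (b Y) (mm (I X) (Phi f) (a X))"
proof -
  have "src f = X" "tgt f = Y" using assms by (auto simp: Hom_def)
  moreover have "\<exists>g. g \<in> Hom D (FO X) (FO Y) \<and> Phi' g = mm (I Y) (b Y) (mm (I X) (Phi f) (a X))"
    using Hom_exists[OF assms] by blast
  ultimately have "FA f \<in> Hom D (FO X) (FO Y) \<and> Phi' (FA f) = mm (I Y) (b Y) (mm (I X) (Phi f) (a X))"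
    unfolding FA_def using someI_ex by simp
  then show "FA f \<in> Hom D (FO X) (FO Y)" "Phi' (FA f) = mm (I Y) (b Y) (mm (I X) (Phi f) (a X))" by auto
qed

lemma is_linear_functor: "linear_functor C D FO FA"
proof
  fix X assume o: "X \<in> Obj C"
  have "Phi' (FA (idA C X)) = Phi' (idA D (FO X))"
    using o by (simp add: FA[OF C.id_Hom] ea ba)
  then show "FA (idA C X) = idA D (FO X)"
    using o by (intro D.Phi_inj[OF FA(1)[OF C.id_Hom] D.id_Hom] FO_Obj)
next
  fix f X Y g Z assume h: "f \<in> Hom C X Y" "g \<in> Hom C Y Z"
  then have o: "X \<in> Obj C" "Y \<in> Obj C" "Z \<in> Obj C" using C.Hom_Obj by auto
  have "Phi' (FA (g \<cdot>\<^bsub>C\<^esub> f)) = Phi' (FA g \<cdot>\<^bsub>D\<^esub> FA f)"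
    using o by (simp add: FA[OF C.comp_Hom[OF h]] D.Phi_comp[OF FA(1)[OF h(1)] FA(1)[OF h(2)]]
      FA[OF h(1)] FA[OF h(2)] C.Phi_comp[OF h] mm_assoc contract)
      (simp add: C.Phi_id[OF h(1)] flip: mm_assoc)
  then show "FA (g \<cdot>\<^bsub>C\<^esub> f) = FA g \<cdot>\<^bsub>D\<^esub> FA f"
    by (intro D.Phi_inj[OF FA(1)[OF C.comp_Hom[OF h]] D.comp_Hom[OF FA(1)[OF h(1)] FA(1)[OF h(2)]]])
next
  fix f X Y g assume h: "f \<in> Hom C X Y" "g \<in> Hom C X Y"
  have "Phi' (FA (addA C f g)) = Phi' (addA D (FA f) (FA g))"
    by (simp add: FA[OF C.add_Hom[OF h]] D.Phi_add[OF FA(1)[OF h(1)] FA(1)[OF h(2)]]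
      FA[OF h(1)] FA[OF h(2)] C.Phi_add[OF h] mm_add_left mm_add_right)
  then show "FA (addA C f g) = addA D (FA f) (FA g)"
    by (intro D.Phi_inj[OF FA(1)[OF C.add_Hom[OF h]] D.add_Hom[OF FA(1)[OF h(1)] FA(1)[OF h(2)]]])
next
  fix f X Y c assume h: "f \<in> Hom C X Y"
  have "Phi' (FA (scaleA C c f)) = Phi' (scaleA D c (FA f))"
    by (simp add: FA[OF C.scale_Hom[OF h]] D.Phi_scale[OF FA(1)[OF h]]
      FA[OF h] C.Phi_scale[OF h] mm_scale_left mm_scale_right)
  then show "FA (scaleA C c f) = scaleA D c (FA f)"
    by (intro D.Phi_inj[OF FA(1)[OF C.scale_Hom[OF h]] D.scale_Hom[OF FA(1)[OF h]]])
qed (simp_all add: FO_Obj FA(1))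

end

locale split_equivalence =
  F: split_functor C I Phi dg D I' Phi' dg' FO a b + G: split_functor D I' Phi' dg' C I Phi dg GO a' b'
  for C :: "('o, 'v) mcat" and I :: "'o \<Rightarrow> 'i set" and Phi and dg :: "'o \<Rightarrow> 'i \<Rightarrow> 'g"
    and D :: "('p, 'w) mcat" and I' :: "'p \<Rightarrow> 'j set" and Phi' and dg' :: "'p \<Rightarrow> 'j \<Rightarrow> 'g"
    and FO a b GO a' b'
begin

lemma unit_iso:
  assumes o: "X \<in> Obj C"
  shows "\<exists>h. h \<in> Hom C X (GO (FO X)) \<and> iso_arrow C h \<and>
    Phi h = mm (I' (FO X)) (b' (FO X)) (b X)"
proof -
  have o': "FO X \<in> Obj D" "GO (FO X) \<in> Obj C" using o F.FO_Obj G.FO_Obj by auto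
  have "\<exists>h \<in> Hom C X (GO (FO X)). Phi h = mm (I' (FO X)) (b' (FO X)) (b X)"
  proof (rule F.C.Phi_surj[OF o o'(2)])
    fix y x assume "mm (I' (FO X)) (b' (FO X)) (b X) y x \<noteq> 0"
    then obtain z where "b' (FO X) y z \<noteq> 0" "b X z x \<noteq> 0" using mm_nz by metis
    then show "y \<in> I (GO (FO X)) \<and> x \<in> I X \<and> dg (GO (FO X)) y = dg X x"
      using F.b_graded[OF o] G.b_graded[OF o'(1)] by metis
  qed (use o o' in \<open>simp_all add: G.contract mm_assoc F.be\<close>)
  then obtain h where h: "h \<in> Hom C X (GO (FO X))" "Phi h = mm (I' (FO X)) (b' (FO X)) (b X)" by blast
  have "\<exists>k \<in> Hom C (GO (FO X)) X. Phi k = mm (I' (FO X)) (a X) (a' (FO X))"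
  proof (rule F.C.Phi_surj[OF o'(2) o])
    fix y x assume "mm (I' (FO X)) (a X) (a' (FO X)) y x \<noteq> 0"
    then obtain z where "a X y z \<noteq> 0" "a' (FO X) z x \<noteq> 0" using mm_nz by metis
    then show "y \<in> I X \<and> x \<in> I (GO (FO X)) \<and> dg X y = dg (GO (FO X)) x"
      using F.a_graded[OF o] G.a_graded[OF o'(1)] by metis
  qed (use o o' in \<open>simp_all add: F.contract mm_assoc G.ae\<close>)
  then obtain k where k: "k \<in> Hom C (GO (FO X)) X" "Phi k = mm (I' (FO X)) (a X) (a' (FO X))" by blast
  have "iso_arrow C h"
    by (rule F.C.iso_arrowI[OF h(1) k(1)])
      (use o o' in \<open>simp_all add: h k mm_assoc F.contract G.contract F.ab G.ba F.eb G.ea\<close>)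
  then show ?thesis using h by blast
qed

lemma counit_iso:
  assumes o: "Y \<in> Obj D"
  shows "\<exists>h. h \<in> Hom D (FO (GO Y)) Y \<and> iso_arrow D h \<and>
    Phi' h = mm (I (GO Y)) (a' Y) (a (GO Y))"
proof -
  have o': "GO Y \<in> Obj C" "FO (GO Y) \<in> Obj D" using o F.FO_Obj G.FO_Obj by auto
  have "\<exists>h \<in> Hom D (FO (GO Y)) Y. Phi' h = mm (I (GO Y)) (a' Y) (a (GO Y))"
  proof (rule F.D.Phi_surj[OF o'(2) o])
    fix y x assume "mm (I (GO Y)) (a' Y) (a (GO Y)) y x \<noteq> 0"
    then obtain z where "a' Y y z \<noteq> 0" "a (GO Y) z x \<noteq> 0" using mm_nz by metis
    then show "y \<in> I' Y \<and> x \<in> I' (FO (GO Y)) \<and> dg' Y y = dg' (FO (GO Y)) x"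
      using F.a_graded[OF o'(1)] G.a_graded[OF o] by metis
  qed (use o o' in \<open>simp_all add: G.contract mm_assoc F.ae\<close>)
  then obtain h where h: "h \<in> Hom D (FO (GO Y)) Y" "Phi' h = mm (I (GO Y)) (a' Y) (a (GO Y))" by blast
  have "\<exists>k \<in> Hom D Y (FO (GO Y)). Phi' k = mm (I (GO Y)) (b (GO Y)) (b' Y)"
  proof (rule F.D.Phi_surj[OF o o'(2)])
    fix y x assume "mm (I (GO Y)) (b (GO Y)) (b' Y) y x \<noteq> 0"
    then obtain z where "b (GO Y) y z \<noteq> 0" "b' Y z x \<noteq> 0" using mm_nz by metis
    then show "y \<in> I' (FO (GO Y)) \<and> x \<in> I' Y \<and> dg' (FO (GO Y)) y = dg' Y x"
      using F.b_graded[OF o'(1)] G.b_graded[OF o] by metis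
  qed (use o o' in \<open>simp_all add: F.contract mm_assoc G.be\<close>)
  then obtain k where k: "k \<in> Hom D Y (FO (GO Y))" "Phi' k = mm (I (GO Y)) (b (GO Y)) (b' Y)" by blast
  have "iso_arrow D h"
    by (rule F.D.iso_arrowI[OF h(1) k(1)])
      (use o o' in \<open>simp_all add: h k mm_assoc F.contract G.contract F.ba G.ab F.ea G.eb\<close>)
  then show ?thesis using h by blast
qed

text \<open>
  Splittings in the two directions compose to isomorphisms between \<open>X\<close> and its image
  under both functors; they are natural because \<open>a\<close> and \<open>b\<close> cancel up
  to idempotents that arrows absorb.
\<close>

theorem is_equivalence: "equivalence_functor C D FO F.FA"
proof -
  define \<eta> where "\<eta> X = (SOME h. h \<in> Hom C X (GO (FO X)) \<and> iso_arrow C h \<and>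
    Phi h = mm (I' (FO X)) (b' (FO X)) (b X))" for X
  define \<epsilon> where "\<epsilon> Y = (SOME h. h \<in> Hom D (FO (GO Y)) Y \<and> iso_arrow D h \<and>
    Phi' h = mm (I (GO Y)) (a' Y) (a (GO Y)))" for Y
  have \<eta>: "\<eta> X \<in> Hom C X (GO (FO X))" "iso_arrow C (\<eta> X)"
    "Phi (\<eta> X) = mm (I' (FO X)) (b' (FO X)) (b X)" if "X \<in> Obj C" for X
    using someI_ex[OF unit_iso[OF that]] unfolding \<eta>_def by auto
  have \<epsilon>: "\<epsilon> Y \<in> Hom D (FO (GO Y)) Y" "iso_arrow D (\<epsilon> Y)"
    "Phi' (\<epsilon> Y) = mm (I (GO Y)) (a' Y) (a (GO Y))" if "Y \<in> Obj D" for Y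
    using someI_ex[OF counit_iso[OF that]] unfolding \<epsilon>_def by auto
  have "natural_iso C C id id (GO \<circ> FO) (G.FA \<circ> F.FA) \<eta>"
    unfolding natural_iso_def
  proof (intro conjI ballI allI)
    fix X Y f assume f: "f \<in> Hom C X Y"
    then have o: "X \<in> Obj C" "Y \<in> Obj C" "FO X \<in> Obj D" "FO Y \<in> Obj D"
      using F.C.Hom_Obj F.FO_Obj by auto
    note Ff = F.FA[OF f] and GFf = G.FA[OF F.FA(1)[OF f]]
    have "Phi (\<eta> Y \<cdot>\<^bsub>C\<^esub> f) = Phi (G.FA (F.FA f) \<cdot>\<^bsub>C\<^esub> \<eta> X)"
      unfolding F.C.Phi_comp[OF f \<eta>(1)[OF o(2)]] F.C.Phi_comp[OF \<eta>(1)[OF o(1)] GFf(1)]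
        \<eta>(3)[OF o(1)] \<eta>(3)[OF o(2)] GFf(2) Ff(2)
      using o by (simp add: mm_assoc G.contract F.contract F.ab F.eb F.C.Phi_id[OF f])
    then show "\<eta> Y \<cdot>\<^bsub>C\<^esub> id f = (G.FA \<circ> F.FA) f \<cdot>\<^bsub>C\<^esub> \<eta> X"
      using F.C.Phi_inj[OF F.C.comp_Hom[OF f \<eta>(1)[OF o(2)]] F.C.comp_Hom[OF \<eta>(1)[OF o(1)] GFf(1)]] by simp
  qed (simp_all add: \<eta>)
  moreover have "natural_iso D D (FO \<circ> GO) (F.FA \<circ> G.FA) id id \<epsilon>"
    unfolding natural_iso_def
  proof (intro conjI ballI allI)
    fix X Y f assume f: "f \<in> Hom D X Y"
    then have o: "X \<in> Obj D" "Y \<in> Obj D" "GO X \<in> Obj C" "GO Y \<in> Obj C"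
      using F.D.Hom_Obj G.FO_Obj by auto
    note Gf = G.FA[OF f] and FGf = F.FA[OF G.FA(1)[OF f]]
    have "Phi' (\<epsilon> Y \<cdot>\<^bsub>D\<^esub> F.FA (G.FA f)) = Phi' (f \<cdot>\<^bsub>D\<^esub> \<epsilon> X)"
      unfolding F.D.Phi_comp[OF FGf(1) \<epsilon>(1)[OF o(2)]] F.D.Phi_comp[OF \<epsilon>(1)[OF o(1)] f]
        \<epsilon>(3)[OF o(1)] \<epsilon>(3)[OF o(2)] FGf(2) Gf(2)
      using o by (simp add: mm_assoc G.contract F.contract)
        (simp add: F.D.Phi_id[OF f] flip: mm_assoc)
    then show "\<epsilon> Y \<cdot>\<^bsub>D\<^esub> (F.FA \<circ> G.FA) f = id f \<cdot>\<^bsub>D\<^esub> \<epsilon> X"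
      using F.D.Phi_inj[OF F.D.comp_Hom[OF FGf(1) \<epsilon>(1)[OF o(2)]] F.D.comp_Hom[OF \<epsilon>(1)[OF o(1)] f]] by simp
  qed (simp_all add: \<epsilon>)
  ultimately show ?thesis
    unfolding equivalence_functor_def using F.is_linear_functor G.is_linear_functor by blast
qed

end

section \<open>Monoidal categories of matrices\<close>

text \<open>
  The tensor product is the Kronecker product of matrices after the index set of \<open>X
  \<boxtimes> Y\<close> has been identified with pairs by \<open>pr\<close> and the basis vector
  of the pair \<open>(x, y)\<close> has been rescaled by \<open>t X Y x y\<close>. In these bases
  the associator is multiplication by \<open>om\<close> of the three degrees. The scalars
  \<open>t\<close> are what allows a strict category to have a nontrivial \<open>om\<close>: they
  need not be compatible with bracketing.
\<close>

locale matrix_mcat = matrix_cat C I Phi dg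
  for C :: "('o, 'v) mcat" (structure) and I :: "'o \<Rightarrow> 'i set" and Phi and dg :: "'o \<Rightarrow> 'i \<Rightarrow> 'g" +
  fixes G :: "('g, 'b) monoid_scheme" and om :: "'g \<Rightarrow> 'g \<Rightarrow> 'g \<Rightarrow> complex"
    and pr :: "'o \<Rightarrow> 'o \<Rightarrow> 'i \<Rightarrow> 'i \<Rightarrow> 'i" and t :: "'o \<Rightarrow> 'o \<Rightarrow> 'i \<Rightarrow> 'i \<Rightarrow> complex" and u0 :: 'i
  assumes monoid_G: "monoid G" and cocycle: "three_cocycle G om"
    and dg_carrier: "X \<in> Obj C \<Longrightarrow> x \<in> I X \<Longrightarrow> dg X x \<in> carrier G"
    and unit_Obj: "unitO C \<in> Obj C"
    and tensor_Obj: "X \<in> Obj C \<Longrightarrow> Y \<in> Obj C \<Longrightarrow> X \<boxtimes> Y \<in> Obj C"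
    and tensor_Hom: "f \<in> Hom C X Y \<Longrightarrow> f' \<in> Hom C X' Y' \<Longrightarrow>
      f \<star> f' \<in> Hom C (X \<boxtimes> X') (Y \<boxtimes> Y')"
    and tensor_id: "X \<in> Obj C \<Longrightarrow> Y \<in> Obj C \<Longrightarrow> idA C X \<star> idA C Y = idA C (X \<boxtimes> Y)"
    and pr_bij: "X \<in> Obj C \<Longrightarrow> Y \<in> Obj C \<Longrightarrow>
      bij_betw (\<lambda>(x, y). pr X Y x y) (I X \<times> I Y) (I (X \<boxtimes> Y))"
    and t_nz [simp]: "t X Y x y \<noteq> 0"
    and dg_pr: "X \<in> Obj C \<Longrightarrow> Y \<in> Obj C \<Longrightarrow> x \<in> I X \<Longrightarrow> y \<in> I Y \<Longrightarrow>
      dg (X \<boxtimes> Y) (pr X Y x y) = dg X x \<otimes>\<^bsub>G\<^esub> dg Y y"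
    and Phi_tensor: "f \<in> Hom C X Y \<Longrightarrow> f' \<in> Hom C X' Y' \<Longrightarrow>
      x \<in> I X \<Longrightarrow> x' \<in> I X' \<Longrightarrow> y \<in> I Y \<Longrightarrow> y' \<in> I Y' \<Longrightarrow>
      Phi (f \<star> f') (pr Y Y' y y') (pr X X' x x') =
        t Y Y' y y' * (Phi f y x * Phi f' y' x') / t X X' x x'"
    and I_unit: "I (unitO C) = {u0}" and E_unit: "Phi (idA C (unitO C)) u0 u0 = 1"
    and dg_unit: "dg (unitO C) u0 = \<one>\<^bsub>G\<^esub>"
    and assoc_Hom: "X \<in> Obj C \<Longrightarrow> Y \<in> Obj C \<Longrightarrow> Z \<in> Obj C \<Longrightarrow>
      assocA C X Y Z \<in> Hom C ((X \<boxtimes> Y) \<boxtimes> Z) (X \<boxtimes> (Y \<boxtimes> Z))"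
    and Phi_assoc: "X \<in> Obj C \<Longrightarrow> Y \<in> Obj C \<Longrightarrow> Z \<in> Obj C \<Longrightarrow>
      x \<in> I X \<Longrightarrow> y \<in> I Y \<Longrightarrow> z \<in> I Z \<Longrightarrow> x' \<in> I X \<Longrightarrow> y' \<in> I Y \<Longrightarrow> z' \<in> I Z \<Longrightarrow>
      Phi (assocA C X Y Z) (pr X (Y \<boxtimes> Z) x' (pr Y Z y' z')) (pr (X \<boxtimes> Y) Z (pr X Y x y) z) =
        t Y Z y' z' * t X (Y \<boxtimes> Z) x' (pr Y Z y' z') *
        (om (dg X x) (dg Y y) (dg Z z) *
          (Phi (idA C X) x' x * (Phi (idA C Y) y' y * Phi (idA C Z) z' z))) /
        (t X Y x y * t (X \<boxtimes> Y) Z (pr X Y x y) z)"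
    and lunit_Hom: "X \<in> Obj C \<Longrightarrow> lunitA C X \<in> Hom C (unitO C \<boxtimes> X) X"
    and Phi_lunit: "X \<in> Obj C \<Longrightarrow> x \<in> I X \<Longrightarrow> x' \<in> I X \<Longrightarrow>
      Phi (lunitA C X) x' (pr (unitO C) X u0 x) =
        inverse (om \<one>\<^bsub>G\<^esub> \<one>\<^bsub>G\<^esub> (dg X x)) * Phi (idA C X) x' x / t (unitO C) X u0 x"
    and runit_Hom: "X \<in> Obj C \<Longrightarrow> runitA C X \<in> Hom C (X \<boxtimes> unitO C) X"
    and Phi_runit: "X \<in> Obj C \<Longrightarrow> x \<in> I X \<Longrightarrow> x' \<in> I X \<Longrightarrow>
      Phi (runitA C X) x' (pr X (unitO C) x u0) =
        om (dg X x) \<one>\<^bsub>G\<^esub> \<one>\<^bsub>G\<^esub> * Phi (idA C X) x' x / t X (unitO C) x u0"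
begin

lemma om_nz: "g \<in> carrier G \<Longrightarrow> h \<in> carrier G \<Longrightarrow> k \<in> carrier G \<Longrightarrow> om g h k \<noteq> 0"
  using cocycle by (auto simp: three_cocycle_def)

lemma om_cocycle: "g \<in> carrier G \<Longrightarrow> h \<in> carrier G \<Longrightarrow> k \<in> carrier G \<Longrightarrow> l \<in> carrier G \<Longrightarrow>
    om h k l * om g (h \<otimes>\<^bsub>G\<^esub> k) l * om g h k = om (g \<otimes>\<^bsub>G\<^esub> h) k l * om g h (k \<otimes>\<^bsub>G\<^esub> l)"
  using cocycle by (auto simp: three_cocycle_def)

lemma pr_mem [simp]:
  "X \<in> Obj C \<Longrightarrow> Y \<in> Obj C \<Longrightarrow> x \<in> I X \<Longrightarrow> y \<in> I Y \<Longrightarrow> pr X Y x y \<in> I (X \<boxtimes> Y)"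
  using pr_bij[of X Y] by (auto simp: bij_betw_def)

lemma pr_eq_iff [simp]:
  "X \<in> Obj C \<Longrightarrow> Y \<in> Obj C \<Longrightarrow> x \<in> I X \<Longrightarrow> y \<in> I Y \<Longrightarrow> x' \<in> I X \<Longrightarrow> y' \<in> I Y \<Longrightarrow>
    pr X Y x y = pr X Y x' y' \<longleftrightarrow> x = x' \<and> y = y'"
  using pr_bij[of X Y] by (auto simp: bij_betw_def inj_on_def)

lemma pr_ex:
  assumes "X \<in> Obj C" "Y \<in> Obj C" "z \<in> I (X \<boxtimes> Y)"
  shows "\<exists>x \<in> I X. \<exists>y \<in> I Y. z = pr X Y x y"
proof -
  have "z \<in> (\<lambda>(x, y). pr X Y x y) ` (I X \<times> I Y)"
    using pr_bij[OF assms(1,2)] assms(3) by (simp add: bij_betw_def)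
  then show ?thesis by auto
qed

lemma E_tensor [simp]:
  "X \<in> Obj C \<Longrightarrow> Y \<in> Obj C \<Longrightarrow> x \<in> I X \<Longrightarrow> y \<in> I Y \<Longrightarrow> x' \<in> I X \<Longrightarrow> y' \<in> I Y \<Longrightarrow>
    E (X \<boxtimes> Y) (pr X Y x' y') (pr X Y x y) = t X Y x' y' * (E X x' x * E Y y' y) / t X Y x y"
  using Phi_tensor[OF id_Hom id_Hom, of X Y x y x' y'] by (simp add: tensor_id)

lemma u0_mem [simp]: "u0 \<in> I (unitO C)"
  by (simp add: I_unit)

lemma one_mem [simp]: "\<one>\<^bsub>G\<^esub> \<in> carrier G"
  using monoid_G by (rule monoid.one_closed)

lemma mult_mem [simp]: "g \<in> carrier G \<Longrightarrow> h \<in> carrier G \<Longrightarrow> g \<otimes>\<^bsub>G\<^esub> h \<in> carrier G"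
  using monoid_G by (rule monoid.m_closed)

lemma one_mult [simp]:
  "g \<in> carrier G \<Longrightarrow> \<one>\<^bsub>G\<^esub> \<otimes>\<^bsub>G\<^esub> g = g" "g \<in> carrier G \<Longrightarrow> g \<otimes>\<^bsub>G\<^esub> \<one>\<^bsub>G\<^esub> = g"
  using monoid_G by (auto simp: monoid.l_one monoid.r_one)

declare unit_Obj [simp] tensor_Obj [simp] dg_carrier [simp] dg_pr [simp] dg_unit [simp]
  om_nz [simp] E_unit [simp]

subsection \<open>Frames of tensor products\<close>

abbreviation "p2 X Y \<equiv> \<lambda>(x, y). pr X Y x y"
abbreviation "t2 X Y \<equiv> \<lambda>(x, y). t X Y x y"
abbreviation "pL X Y Z \<equiv> \<lambda>(x, y, z). pr (X \<boxtimes> Y) Z (pr X Y x y) z"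
abbreviation "tL X Y Z \<equiv> \<lambda>(x, y, z). t X Y x y * t (X \<boxtimes> Y) Z (pr X Y x y) z"
abbreviation "pR X Y Z \<equiv> \<lambda>(x, y, z). pr X (Y \<boxtimes> Z) x (pr Y Z y z)"
abbreviation "tR X Y Z \<equiv> \<lambda>(x, y, z). t Y Z y z * t X (Y \<boxtimes> Z) x (pr Y Z y z)"

lemma frame_self: "X \<in> Obj C \<Longrightarrow> frame X (I X) (\<lambda>x. x) (\<lambda>x. 1)"
  by (simp add: frame_def bij_betw_def)

lemma frame_tensor:
  "X \<in> Obj C \<Longrightarrow> Y \<in> Obj C \<Longrightarrow> frame (X \<boxtimes> Y) (I X \<times> I Y) (p2 X Y) (t2 X Y)"
  by (auto simp: frame_def pr_bij)

lemma frame_L: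
  assumes o: "X \<in> Obj C" "Y \<in> Obj C" "Z \<in> Obj C"
  shows "frame ((X \<boxtimes> Y) \<boxtimes> Z) (I X \<times> (I Y \<times> I Z)) (pL X Y Z) (tL X Y Z)"
  unfolding frame_def
proof (intro conjI bij_betwI')
  fix w assume "w \<in> I ((X \<boxtimes> Y) \<boxtimes> Z)"
  then obtain v z where v: "v \<in> I (X \<boxtimes> Y)" "z \<in> I Z" "w = pr (X \<boxtimes> Y) Z v z"
    using pr_ex[OF tensor_Obj[OF o(1,2)] o(3)] by blast
  moreover obtain x y where "x \<in> I X" "y \<in> I Y" "v = pr X Y x y"
    using pr_ex[OF o(1,2) v(1)] by blast
  ultimately show "\<exists>\<tau> \<in> I X \<times> (I Y \<times> I Z). w = pL X Y Z \<tau>"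
    by (intro bexI[of _ "(x, y, z)"]) auto
qed (use o in auto)

lemma frame_R:
  assumes o: "X \<in> Obj C" "Y \<in> Obj C" "Z \<in> Obj C"
  shows "frame (X \<boxtimes> (Y \<boxtimes> Z)) (I X \<times> (I Y \<times> I Z)) (pR X Y Z) (tR X Y Z)"
  unfolding frame_def
proof (intro conjI bij_betwI')
  fix w assume "w \<in> I (X \<boxtimes> (Y \<boxtimes> Z))"
  then obtain x v where v: "x \<in> I X" "v \<in> I (Y \<boxtimes> Z)" "w = pr X (Y \<boxtimes> Z) x v"
    using pr_ex[OF o(1) tensor_Obj[OF o(2,3)]] by blast
  moreover obtain y z where "y \<in> I Y" "z \<in> I Z" "v = pr Y Z y z"
    using pr_ex[OF o(2,3) v(2)] by blast
  ultimately show "\<exists>\<tau> \<in> I X \<times> (I Y \<times> I Z). w = pR X Y Z \<tau>"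
    by (intro bexI[of _ "(x, y, z)"]) auto
qed (use o in auto)

lemma frame_lunit: "X \<in> Obj C \<Longrightarrow>
  frame (unitO C \<boxtimes> X) (I X) (\<lambda>x. pr (unitO C) X u0 x) (\<lambda>x. t (unitO C) X u0 x)"
  unfolding frame_def
  by (intro conjI bij_betwI') (use pr_ex[of "unitO C" X] in \<open>auto simp: I_unit\<close>)

lemma frame_runit: "X \<in> Obj C \<Longrightarrow>
  frame (X \<boxtimes> unitO C) (I X) (\<lambda>x. pr X (unitO C) x u0) (\<lambda>x. t X (unitO C) x u0)"
  unfolding frame_def
  by (intro conjI bij_betwI') (use pr_ex[of X "unitO C"] in \<open>auto simp: I_unit\<close>)

lemma co_tensor:
  assumes "f \<in> Hom C X Y" "f' \<in> Hom C X' Y'" "\<tau> \<in> I X \<times> I X'" "\<tau>' \<in> I Y \<times> I Y'"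
  shows "co (p2 Y Y') (t2 Y Y') (p2 X X') (t2 X X') (f \<star> f') \<tau>' \<tau> = ten (Phi f) (Phi f') \<tau>' \<tau>"
  using assms by (auto simp: cm_def Phi_tensor[OF assms(1,2)])

abbreviation "E3 X Y Z \<equiv> ten (E X) (ten (E Y) (E Z))"

lemma co_L:
  assumes "f \<in> Hom C X X'" "g \<in> Hom C Y Y'" "h \<in> Hom C Z Z'"
    "\<tau> \<in> I X \<times> (I Y \<times> I Z)" "\<tau>' \<in> I X' \<times> (I Y' \<times> I Z')"
  shows "co (pL X' Y' Z') (tL X' Y' Z') (pL X Y Z) (tL X Y Z) ((f \<star> g) \<star> h) \<tau>' \<tau> =
    ten (Phi f) (ten (Phi g) (Phi h)) \<tau>' \<tau>"
  using assms Hom_Obj[OF assms(1)] Hom_Obj[OF assms(2)] Hom_Obj[OF assms(3)]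
  by (auto simp: cm_def Phi_tensor[OF assms(1,2)] Phi_tensor[OF tensor_Hom[OF assms(1,2)] assms(3)] field_simps)

lemma co_R:
  assumes "f \<in> Hom C X X'" "g \<in> Hom C Y Y'" "h \<in> Hom C Z Z'"
    "\<tau> \<in> I X \<times> (I Y \<times> I Z)" "\<tau>' \<in> I X' \<times> (I Y' \<times> I Z')"
  shows "co (pR X' Y' Z') (tR X' Y' Z') (pR X Y Z) (tR X Y Z) (f \<star> (g \<star> h)) \<tau>' \<tau> =
    ten (Phi f) (ten (Phi g) (Phi h)) \<tau>' \<tau>"
  using assms Hom_Obj[OF assms(1)] Hom_Obj[OF assms(2)] Hom_Obj[OF assms(3)]
  by (auto simp: cm_def Phi_tensor[OF assms(2,3)] Phi_tensor[OF assms(1) tensor_Hom[OF assms(2,3)]] field_simps)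

abbreviation "om3 X Y Z \<equiv> \<lambda>(x, y, z). om (dg X x) (dg Y y) (dg Z z)"

lemma co_assoc:
  assumes "X \<in> Obj C" "Y \<in> Obj C" "Z \<in> Obj C" "\<tau> \<in> I X \<times> (I Y \<times> I Z)" "\<tau>' \<in> I X \<times> (I Y \<times> I Z)"
  shows "co (pR X Y Z) (tR X Y Z) (pL X Y Z) (tL X Y Z) (assocA C X Y Z) \<tau>' \<tau> =
    om3 X Y Z \<tau> * E3 X Y Z \<tau>' \<tau>"
  using assms by (auto simp: cm_def Phi_assoc[OF assms(1-3)])

lemma om3_graded:
  assumes "X \<in> Obj C" "Y \<in> Obj C" "Z \<in> Obj C" "E3 X Y Z \<tau>' \<tau> \<noteq> 0"
  shows "om3 X Y Z \<tau>' = om3 X Y Z \<tau>"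
proof -
  obtain x y z x' y' z' where \<tau>: "\<tau> = (x, y, z)" "\<tau>' = (x', y', z')" by (cases \<tau>; cases \<tau>') auto
  have "dg X x' = dg X x" "dg Y y' = dg Y y" "dg Z z' = dg Z z"
    using assms(4) E_graded[OF assms(1), of x' x] E_graded[OF assms(2), of y' y] E_graded[OF assms(3), of z' z]
    by (auto simp: \<tau>)
  then show ?thesis by (simp add: \<tau>)
qed

subsection \<open>The axioms\<close>

lemma tensor_comp:
  assumes f: "f \<in> Hom C X Y" and g: "g \<in> Hom C Y Z" and f': "f' \<in> Hom C X' Y'" and g': "g' \<in> Hom C Y' Z'"
  shows "(g \<cdot> f) \<star> (g' \<cdot> f') = (g \<star> g') \<cdot> (f \<star> f')"
proof -
  note o = Hom_Obj[OF f] Hom_Obj[OF g] Hom_Obj[OF f'] Hom_Obj[OF g']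
  note c = comp_Hom[OF f g] comp_Hom[OF f' g']
  show ?thesis
  proof (rule co_eqI[OF tensor_Hom[OF c] comp_Hom[OF tensor_Hom[OF f f'] tensor_Hom[OF g g']]
        frame_tensor[OF o(1,5)] frame_tensor[OF o(4,8)]])
    fix \<tau> \<tau>' assume t: "\<tau> \<in> I X \<times> I X'" "\<tau>' \<in> I Z \<times> I Z'"
    have "co (p2 Z Z') (t2 Z Z') (p2 X X') (t2 X X') ((g \<star> g') \<cdot> (f \<star> f')) \<tau>' \<tau> =
      mm (I Y \<times> I Y') (ten (Phi g) (Phi g')) (ten (Phi f) (Phi f')) \<tau>' \<tau>"
      unfolding co_comp[OF tensor_Hom[OF f f'] tensor_Hom[OF g g'] frame_tensor[OF o(2,6)]]
      using t by (intro mm_cong co_tensor f g f' g')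
    also have "\<dots> = co (p2 Z Z') (t2 Z Z') (p2 X X') (t2 X X') ((g \<cdot> f) \<star> (g' \<cdot> f')) \<tau>' \<tau>"
      unfolding co_tensor[OF c t] by (simp add: mm_ten Phi_comp[OF f g] Phi_comp[OF f' g'])
    finally show "co (p2 Z Z') (t2 Z Z') (p2 X X') (t2 X X') ((g \<cdot> f) \<star> (g' \<cdot> f')) \<tau>' \<tau> =
      co (p2 Z Z') (t2 Z Z') (p2 X X') (t2 X X') ((g \<star> g') \<cdot> (f \<star> f')) \<tau>' \<tau>" by simp
  qed
qed

lemma assoc_iso:
  assumes o: "X \<in> Obj C" "Y \<in> Obj C" "Z \<in> Obj C"
  shows "iso_arrow C (assocA C X Y Z)"
proof (rule iso_rescaled[where e = "E3 X Y Z" and k = "om3 X Y Z",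
      OF assoc_Hom[OF o] frame_L[OF o] frame_R[OF o]])
  fix \<tau> \<tau>' assume t: "\<tau> \<in> I X \<times> (I Y \<times> I Z)" "\<tau>' \<in> I X \<times> (I Y \<times> I Z)"
  show "co (pL X Y Z) (tL X Y Z) (pL X Y Z) (tL X Y Z) (idA C ((X \<boxtimes> Y) \<boxtimes> Z)) \<tau>' \<tau> = E3 X Y Z \<tau>' \<tau>"
    using co_L[OF id_Hom[OF o(1)] id_Hom[OF o(2)] id_Hom[OF o(3)] t] o by (simp add: tensor_id)
  show "co (pR X Y Z) (tR X Y Z) (pR X Y Z) (tR X Y Z) (idA C (X \<boxtimes> Y \<boxtimes> Z)) \<tau>' \<tau> = E3 X Y Z \<tau>' \<tau>"
    using co_R[OF id_Hom[OF o(1)] id_Hom[OF o(2)] id_Hom[OF o(3)] t] o by (simp add: tensor_id)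
  show "co (pR X Y Z) (tR X Y Z) (pL X Y Z) (tL X Y Z) (assocA C X Y Z) \<tau>' \<tau> = om3 X Y Z \<tau> * E3 X Y Z \<tau>' \<tau>"
    by (rule co_assoc[OF o t])
next
  fix \<tau> \<tau>' assume "E3 X Y Z \<tau>' \<tau> \<noteq> 0"
  then show "om3 X Y Z \<tau>' = om3 X Y Z \<tau>" by (rule om3_graded[OF o])
next
  fix \<tau> assume "\<tau> \<in> I X \<times> (I Y \<times> I Z)"
  then show "om3 X Y Z \<tau> \<noteq> 0" using o by auto
qed

lemma assoc_natural:
  assumes f: "f \<in> Hom C X X'" and g: "g \<in> Hom C Y Y'" and h: "h \<in> Hom C Z Z'"
  shows "assocA C X' Y' Z' \<cdot> ((f \<star> g) \<star> h) = (f \<star> (g \<star> h)) \<cdot> assocA C X Y Z"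
proof -
  note o = Hom_Obj(1)[OF f] Hom_Obj(1)[OF g] Hom_Obj(1)[OF h]
  note o' = Hom_Obj(2)[OF f] Hom_Obj(2)[OF g] Hom_Obj(2)[OF h]
  note l = tensor_Hom[OF tensor_Hom[OF f g] h] and r = tensor_Hom[OF f tensor_Hom[OF g h]]
  let ?S = "I X \<times> (I Y \<times> I Z)" and ?S' = "I X' \<times> (I Y' \<times> I Z')"
  let ?N = "ten (Phi f) (ten (Phi g) (Phi h))"
  show ?thesis
  proof (rule co_eqI[OF comp_Hom[OF l assoc_Hom[OF o']] comp_Hom[OF assoc_Hom[OF o] r] frame_L[OF o] frame_R[OF o']])
    fix \<tau> \<tau>' assume t: "\<tau> \<in> ?S" "\<tau>' \<in> ?S'"
    have k: "om3 X' Y' Z' z * ?N z \<tau> = om3 X Y Z \<tau> * ?N z \<tau>" for z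
    proof (cases "?N z \<tau> = 0")
      case False
      obtain x1 y1 z1 x2 y2 z2 where \<tau>: "\<tau> = (x1, y1, z1)" "z = (x2, y2, z2)" by (cases \<tau>; cases z) auto
      have "dg X' x2 = dg X x1" "dg Y' y2 = dg Y y1" "dg Z' z2 = dg Z z1"
        using False Phi_graded[OF f, of x2 x1] Phi_graded[OF g, of y2 y1] Phi_graded[OF h, of z2 z1]
        by (auto simp: \<tau>)
      then show ?thesis by (simp add: \<tau>)
    qed simp
    have "co (pR X' Y' Z') (tR X' Y' Z') (pL X Y Z) (tL X Y Z)
        (assocA C X' Y' Z' \<cdot> ((f \<star> g) \<star> h)) \<tau>' \<tau> =
      mm ?S' (\<lambda>\<tau>' \<tau>. om3 X' Y' Z' \<tau> * E3 X' Y' Z' \<tau>' \<tau>) ?N \<tau>' \<tau>"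
      unfolding co_comp[OF l assoc_Hom[OF o'] frame_L[OF o']]
      using t by (intro mm_cong co_assoc[OF o'] co_L[OF f g h])
    also have "\<dots> = mm ?S' (E3 X' Y' Z') (\<lambda>\<tau>' \<tau>. om3 X' Y' Z' \<tau>' * ?N \<tau>' \<tau>) \<tau>' \<tau>"
      by (simp add: mm_def mult_ac)
    also have "\<dots> = mm ?S' (E3 X' Y' Z') (\<lambda>\<tau>' \<tau>. om3 X Y Z \<tau> * ?N \<tau>' \<tau>) \<tau>' \<tau>"
      by (intro mm_cong refl k)
    also have "\<dots> = om3 X Y Z \<tau> * mm ?S' (E3 X' Y' Z') ?N \<tau>' \<tau>"
      by (simp add: mm_def sum_distrib_left mult_ac)
    also have "mm ?S' (E3 X' Y' Z') ?N = ?N"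
      by (simp add: mm_ten Phi_id[OF f] Phi_id[OF g] Phi_id[OF h])
    also have "?N = mm ?S ?N (E3 X Y Z)"
      by (simp add: mm_ten Phi_id[OF f] Phi_id[OF g] Phi_id[OF h])
    also have "om3 X Y Z \<tau> * mm ?S ?N (E3 X Y Z) \<tau>' \<tau> =
      mm ?S ?N (\<lambda>\<tau>' \<tau>. om3 X Y Z \<tau> * E3 X Y Z \<tau>' \<tau>) \<tau>' \<tau>"
      by (simp add: mm_def sum_distrib_left mult_ac)
    also have "\<dots> = co (pR X' Y' Z') (tR X' Y' Z') (pL X Y Z) (tL X Y Z)
        ((f \<star> (g \<star> h)) \<cdot> assocA C X Y Z) \<tau>' \<tau>"
      unfolding co_comp[OF assoc_Hom[OF o] r frame_R[OF o]]
      using t by (intro mm_cong co_assoc[OF o, symmetric] co_R[OF f g h, symmetric])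
    finally show "co (pR X' Y' Z') (tR X' Y' Z') (pL X Y Z) (tL X Y Z)
        (assocA C X' Y' Z' \<cdot> ((f \<star> g) \<star> h)) \<tau>' \<tau> =
      co (pR X' Y' Z') (tR X' Y' Z') (pL X Y Z) (tL X Y Z)
        ((f \<star> (g \<star> h)) \<cdot> assocA C X Y Z) \<tau>' \<tau>" .
  qed
qed

abbreviation "cl X \<equiv> \<lambda>x. inverse (om \<one>\<^bsub>G\<^esub> \<one>\<^bsub>G\<^esub> (dg X x))"
abbreviation "cr X \<equiv> \<lambda>x. om (dg X x) \<one>\<^bsub>G\<^esub> \<one>\<^bsub>G\<^esub>"
abbreviation "pl X \<equiv> \<lambda>x. pr (unitO C) X u0 x"
abbreviation "tl' X \<equiv> \<lambda>x. t (unitO C) X u0 x"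
abbreviation "pr' X \<equiv> \<lambda>x. pr X (unitO C) x u0"
abbreviation "tr' X \<equiv> \<lambda>x. t X (unitO C) x u0"

lemma co_lunit:
  "X \<in> Obj C \<Longrightarrow> x \<in> I X \<Longrightarrow> x' \<in> I X \<Longrightarrow>
    co (\<lambda>x. x) (\<lambda>x. 1) (pl X) (tl' X) (lunitA C X) x' x = cl X x * E X x' x"
  by (simp add: cm_def Phi_lunit)

lemma co_runit:
  "X \<in> Obj C \<Longrightarrow> x \<in> I X \<Longrightarrow> x' \<in> I X \<Longrightarrow>
    co (\<lambda>x. x) (\<lambda>x. 1) (pr' X) (tr' X) (runitA C X) x' x = cr X x * E X x' x"
  by (simp add: cm_def Phi_runit)

lemma co_self: "co (\<lambda>x. x) (\<lambda>x. 1) (\<lambda>x. x) (\<lambda>x. 1) f = Phi f"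
  by (simp add: cm_def)

lemma co_l:
  "f \<in> Hom C X Y \<Longrightarrow> x \<in> I X \<Longrightarrow> y \<in> I Y \<Longrightarrow>
    co (pl Y) (tl' Y) (pl X) (tl' X) (idA C (unitO C) \<star> f) y x = Phi f y x"
  by (simp add: cm_def Phi_tensor[OF id_Hom])

lemma co_r:
  "f \<in> Hom C X Y \<Longrightarrow> x \<in> I X \<Longrightarrow> y \<in> I Y \<Longrightarrow>
    co (pr' Y) (tr' Y) (pr' X) (tr' X) (f \<star> idA C (unitO C)) y x = Phi f y x"
  by (simp add: cm_def Phi_tensor[OF _ id_Hom])

lemma rescaled_natural:
  assumes f: "f \<in> Hom C X Y" and k: "\<And>x y. Phi f y x \<noteq> 0 \<Longrightarrow> k' y = k x"
  shows "mm (I Y) (\<lambda>y' y. k' y * E Y y' y) (Phi f) y x = mm (I X) (Phi f) (\<lambda>x' x. k x * E X x' x) y x"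
proof -
  have kf: "k' z * Phi f z x = k x * Phi f z x" for z
    using k[of z x] by (cases "Phi f z x = 0") auto
  have "mm (I Y) (\<lambda>y' y. k' y * E Y y' y) (Phi f) y x = (\<Sum>z \<in> I Y. E Y y z * (k' z * Phi f z x))"
    by (simp add: mm_def mult_ac)
  also have "\<dots> = k x * mm (I Y) (E Y) (Phi f) y x"
    unfolding kf by (simp add: mm_def sum_distrib_left mult_ac)
  also have "\<dots> = k x * mm (I X) (Phi f) (E X) y x" by (simp add: Phi_id[OF f])
  also have "\<dots> = mm (I X) (Phi f) (\<lambda>x' x. k x * E X x' x) y x"
    by (simp add: mm_def sum_distrib_left mult_ac)
  finally show ?thesis .
qed

lemma lunit_natural:
  assumes f: "f \<in> Hom C X Y"
  shows "lunitA C Y \<cdot> (idA C (unitO C) \<star> f) = f \<cdot> lunitA C X"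
proof -
  note o = Hom_Obj[OF f]
  note i = tensor_Hom[OF id_Hom[OF unit_Obj] f]
  show ?thesis
  proof (rule co_eqI[OF comp_Hom[OF i lunit_Hom[OF o(2)]] comp_Hom[OF lunit_Hom[OF o(1)] f]
        frame_lunit[OF o(1)] frame_self[OF o(2)]])
    fix x y assume t: "x \<in> I X" "y \<in> I Y"
    have "co (\<lambda>x. x) (\<lambda>x. 1) (pl X) (tl' X) (lunitA C Y \<cdot> (idA C (unitO C) \<star> f)) y x =
      mm (I Y) (\<lambda>y' y. cl Y y * E Y y' y) (Phi f) y x"
      unfolding co_comp[OF i lunit_Hom[OF o(2)] frame_lunit[OF o(2)]]
      using t o by (intro mm_cong co_lunit co_l[OF f])
    also have "\<dots> = mm (I X) (Phi f) (\<lambda>x' x. cl X x * E X x' x) y x"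
      using Phi_graded[OF f] by (intro rescaled_natural[OF f]) metis
    also have "\<dots> = co (\<lambda>x. x) (\<lambda>x. 1) (pl X) (tl' X) (f \<cdot> lunitA C X) y x"
      unfolding co_comp[OF lunit_Hom[OF o(1)] f frame_self[OF o(1)]] co_self
      using t o by (intro mm_cong refl co_lunit[symmetric])
    finally show "co (\<lambda>x. x) (\<lambda>x. 1) (pl X) (tl' X) (lunitA C Y \<cdot> (idA C (unitO C) \<star> f)) y x =
      co (\<lambda>x. x) (\<lambda>x. 1) (pl X) (tl' X) (f \<cdot> lunitA C X) y x" .
  qed
qed

lemma runit_natural:
  assumes f: "f \<in> Hom C X Y"
  shows "runitA C Y \<cdot> (f \<star> idA C (unitO C)) = f \<cdot> runitA C X"
proof -
  note o = Hom_Obj[OF f]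
  note i = tensor_Hom[OF f id_Hom[OF unit_Obj]]
  show ?thesis
  proof (rule co_eqI[OF comp_Hom[OF i runit_Hom[OF o(2)]] comp_Hom[OF runit_Hom[OF o(1)] f]
        frame_runit[OF o(1)] frame_self[OF o(2)]])
    fix x y assume t: "x \<in> I X" "y \<in> I Y"
    have "co (\<lambda>x. x) (\<lambda>x. 1) (pr' X) (tr' X) (runitA C Y \<cdot> (f \<star> idA C (unitO C))) y x =
      mm (I Y) (\<lambda>y' y. cr Y y * E Y y' y) (Phi f) y x"
      unfolding co_comp[OF i runit_Hom[OF o(2)] frame_runit[OF o(2)]]
      using t o by (intro mm_cong co_runit co_r[OF f])
    also have "\<dots> = mm (I X) (Phi f) (\<lambda>x' x. cr X x * E X x' x) y x"
      using Phi_graded[OF f] by (intro rescaled_natural[OF f]) metis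
    also have "\<dots> = co (\<lambda>x. x) (\<lambda>x. 1) (pr' X) (tr' X) (f \<cdot> runitA C X) y x"
      unfolding co_comp[OF runit_Hom[OF o(1)] f frame_self[OF o(1)]] co_self
      using t o by (intro mm_cong refl co_runit[symmetric])
    finally show "co (\<lambda>x. x) (\<lambda>x. 1) (pr' X) (tr' X) (runitA C Y \<cdot> (f \<star> idA C (unitO C))) y x =
      co (\<lambda>x. x) (\<lambda>x. 1) (pr' X) (tr' X) (f \<cdot> runitA C X) y x" .
  qed
qed

lemma unit_isos:
  assumes o: "X \<in> Obj C"
  shows "iso_arrow C (lunitA C X)" "iso_arrow C (runitA C X)"
proof -
  have k: "cl X x' = cl X x" "cr X x' = cr X x" if "E X x' x \<noteq> 0" for x x'
    using E_graded[OF o that] by simp_all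
  show "iso_arrow C (lunitA C X)"
    by (rule iso_rescaled[where e = "E X" and k = "cl X", OF lunit_Hom[OF o] frame_lunit[OF o] frame_self[OF o]])
      (use o co_l[OF id_Hom[OF o]] k in \<open>simp_all add: co_self co_lunit tensor_id\<close>)
  show "iso_arrow C (runitA C X)"
    by (rule iso_rescaled[where e = "E X" and k = "cr X", OF runit_Hom[OF o] frame_runit[OF o] frame_self[OF o]])
      (use o co_r[OF id_Hom[OF o]] k in \<open>simp_all add: co_self co_runit tensor_id\<close>)
qed

text \<open>
  The cocycle identity at the degrees \<open>g\<close>, \<open>1\<close>, \<open>1\<close>,
  \<open>k\<close> says that \<open>om g 1 k = om g 1 1 * om 1 1 k\<close>, which is the triangle
  axiom for the given unit constraints.
\<close>

lemma triangle:
  assumes o: "X \<in> Obj C" "Y \<in> Obj C"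
  shows "(idA C X \<star> lunitA C Y) \<cdot> assocA C X (unitO C) Y = runitA C X \<star> idA C Y"
proof -
  note 1 = tensor_Hom[OF id_Hom[OF o(1)] lunit_Hom[OF o(2)]]
  note 2 = tensor_Hom[OF runit_Hom[OF o(1)] id_Hom[OF o(2)]]
  note a = assoc_Hom[OF o(1) unit_Obj o(2)]
  let ?U = "unitO C" and ?S = "I X \<times> I Y" and ?e = "ten (E X) (E Y)"
  define p q r where "p = (\<lambda>(x, y). pr (X \<boxtimes> ?U) Y (pr X ?U x u0) y)"
    and "q = (\<lambda>(x, y). pr X (?U \<boxtimes> Y) x (pr ?U Y u0 y))" and "r = p2 X Y"
  define sp sq sr where "sp = (\<lambda>(x, y). t X ?U x u0 * t (X \<boxtimes> ?U) Y (pr X ?U x u0) y)"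
    and "sq = (\<lambda>(x, y). t ?U Y u0 y * t X (?U \<boxtimes> Y) x (pr ?U Y u0 y))" and "sr = t2 X Y"
  have fp: "frame ((X \<boxtimes> ?U) \<boxtimes> Y) ?S p sp"
    unfolding frame_def
  proof (intro conjI bij_betwI')
    fix w assume "w \<in> I ((X \<boxtimes> ?U) \<boxtimes> Y)"
    then show "\<exists>\<tau> \<in> ?S. w = p \<tau>"
      using frame_L[OF o(1) unit_Obj o(2)] by (fastforce simp: frame_def bij_betw_def p_def I_unit)
  qed (use o in \<open>auto simp: p_def sp_def\<close>)
  have fq: "frame (X \<boxtimes> (?U \<boxtimes> Y)) ?S q sq"
    unfolding frame_def
  proof (intro conjI bij_betwI')
    fix w assume "w \<in> I (X \<boxtimes> (?U \<boxtimes> Y))"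
    then show "\<exists>\<tau> \<in> ?S. w = q \<tau>"
      using frame_R[OF o(1) unit_Obj o(2)] by (fastforce simp: frame_def bij_betw_def q_def I_unit)
  qed (use o in \<open>auto simp: q_def sq_def\<close>)
  have fr: "frame (X \<boxtimes> Y) ?S r sr"
    unfolding r_def sr_def by (rule frame_tensor[OF o])
  have idem: "mm ?S ?e ?e = ?e" using o by (simp add: mm_ten E_idem)
  define kl ka where "kl = (\<lambda>(x :: 'i, y). cl Y y)" and "ka = (\<lambda>(x, y). om (dg X x) \<one>\<^bsub>G\<^esub> (dg Y y))"
  show ?thesis
  proof (rule co_eqI[OF comp_Hom[OF a 1] 2 fp fr])
    fix \<tau> \<tau>' assume t: "\<tau> \<in> ?S" "\<tau>' \<in> ?S"
    have "mm ?S (co r sr q sq (idA C X \<star> lunitA C Y)) (co q sq p sp (assocA C X ?U Y)) \<tau>' \<tau> =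
      kl \<tau> * ka \<tau> * ?e \<tau>' \<tau>"
    proof (rule mm_rescaled[where e = ?e and k' = kl and k = ka])
      fix \<tau> \<tau>' assume t: "\<tau> \<in> ?S" "\<tau>' \<in> ?S"
      then obtain x y x' y' where xy: "\<tau> = (x, y)" "\<tau>' = (x', y')" "x \<in> I X" "y \<in> I Y" "x' \<in> I X" "y' \<in> I Y"
        by auto
      show "co r sr q sq (idA C X \<star> lunitA C Y) \<tau>' \<tau> = kl \<tau> * ?e \<tau>' \<tau>"
        using o xy Phi_tensor[OF id_Hom[OF o(1)] lunit_Hom[OF o(2)], of x "pr ?U Y u0 y" x' y']
        by (simp add: cm_def r_def sr_def q_def sq_def kl_def Phi_lunit)
      show "co q sq p sp (assocA C X ?U Y) \<tau>' \<tau> = ka \<tau> * ?e \<tau>' \<tau>"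
        using o xy Phi_assoc[OF o(1) unit_Obj o(2), of x u0 y x' u0 y']
        by (simp add: cm_def p_def sp_def q_def sq_def ka_def)
      assume "?e \<tau>' \<tau> \<noteq> 0"
      then show "kl \<tau>' = kl \<tau>" using E_graded[OF o(2), of y' y] by (simp add: xy kl_def)
    qed (use idem t in auto)
    moreover obtain x y x' y' where xy: "\<tau> = (x, y)" "\<tau>' = (x', y')" "x \<in> I X" "y \<in> I Y" "x' \<in> I X" "y' \<in> I Y"
      using t by auto
    moreover have "co r sr p sp (runitA C X \<star> idA C Y) \<tau>' \<tau> = cr X x * ?e \<tau>' \<tau>"
      using o xy Phi_tensor[OF runit_Hom[OF o(1)] id_Hom[OF o(2)], of "pr X ?U x u0" y x' y']
      by (simp add: cm_def r_def sr_def p_def sp_def Phi_runit)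
    moreover have "kl \<tau> * ka \<tau> = cr X x"
      using om_cocycle[of "dg X x" "\<one>\<^bsub>G\<^esub>" "\<one>\<^bsub>G\<^esub>" "dg Y y"] xy o
      by (simp add: kl_def ka_def field_simps)
    ultimately show "co r sr p sp ((idA C X \<star> lunitA C Y) \<cdot> assocA C X ?U Y) \<tau>' \<tau> =
      co r sr p sp (runitA C X \<star> idA C Y) \<tau>' \<tau>"
      unfolding co_comp[OF a 1 fq] by simp
  qed
qed

text \<open>
  In the frames indexed by quadruples, each of the five arrows is the common idempotent
  multiplied by a value of \<open>om\<close> at the degrees, so the pentagon becomes the cocycle
  identity.
\<close>

lemma pentagon:
  assumes o: "W \<in> Obj C" "X \<in> Obj C" "Y \<in> Obj C" "Z \<in> Obj C"
  shows "assocA C W X (Y \<boxtimes> Z) \<cdot> assocA C (W \<boxtimes> X) Y Z =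
    (idA C W \<star> assocA C X Y Z) \<cdot> (assocA C W (X \<boxtimes> Y) Z \<cdot> (assocA C W X Y \<star> idA C Z))"
proof -
  let ?S = "I W \<times> (I X \<times> (I Y \<times> I Z))" and ?e = "ten (E W) (ten (E X) (ten (E Y) (E Z)))"
  define p1 where "p1 = (\<lambda>(w, x, y, z). pr ((W \<boxtimes> X) \<boxtimes> Y) Z (pr (W \<boxtimes> X) Y (pr W X w x) y) z)"
  define s1 where "s1 = (\<lambda>(w, x, y, z). t W X w x * t (W \<boxtimes> X) Y (pr W X w x) y *
    t ((W \<boxtimes> X) \<boxtimes> Y) Z (pr (W \<boxtimes> X) Y (pr W X w x) y) z)"
  define p2' where "p2' = (\<lambda>(w, x, y, z). pr (W \<boxtimes> X) (Y \<boxtimes> Z) (pr W X w x) (pr Y Z y z))"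
  define s2 where "s2 = (\<lambda>(w, x, y, z). t W X w x * t Y Z y z * t (W \<boxtimes> X) (Y \<boxtimes> Z) (pr W X w x) (pr Y Z y z))"
  define p3 where "p3 = (\<lambda>(w, x, y, z). pr W (X \<boxtimes> (Y \<boxtimes> Z)) w (pr X (Y \<boxtimes> Z) x (pr Y Z y z)))"
  define s3 where "s3 = (\<lambda>(w, x, y, z). t Y Z y z * t X (Y \<boxtimes> Z) x (pr Y Z y z) *
    t W (X \<boxtimes> (Y \<boxtimes> Z)) w (pr X (Y \<boxtimes> Z) x (pr Y Z y z)))"
  define p4 where "p4 = (\<lambda>(w, x, y, z). pr (W \<boxtimes> (X \<boxtimes> Y)) Z (pr W (X \<boxtimes> Y) w (pr X Y x y)) z)"
  define s4 where "s4 = (\<lambda>(w, x, y, z). t X Y x y * t W (X \<boxtimes> Y) w (pr X Y x y) *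
    t (W \<boxtimes> (X \<boxtimes> Y)) Z (pr W (X \<boxtimes> Y) w (pr X Y x y)) z)"
  define p5 where "p5 = (\<lambda>(w, x, y, z). pr W ((X \<boxtimes> Y) \<boxtimes> Z) w (pr (X \<boxtimes> Y) Z (pr X Y x y) z))"
  define s5 where "s5 = (\<lambda>(w, x, y, z). t X Y x y * t (X \<boxtimes> Y) Z (pr X Y x y) z *
    t W ((X \<boxtimes> Y) \<boxtimes> Z) w (pr (X \<boxtimes> Y) Z (pr X Y x y) z))"
  note defs = p1_def s1_def p2'_def s2_def p3_def s3_def p4_def s4_def p5_def s5_def
  have f1: "frame (((W \<boxtimes> X) \<boxtimes> Y) \<boxtimes> Z) ?S p1 s1"
    unfolding frame_def
  proof (intro conjI bij_betwI')
    fix v assume mem_v: "v \<in> I (((W \<boxtimes> X) \<boxtimes> Y) \<boxtimes> Z)"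
    obtain v1 z where mem_v1: "v1 \<in> I ((W \<boxtimes> X) \<boxtimes> Y)" and mem_z: "z \<in> I Z" and eq_v: "v = pr ((W \<boxtimes> X) \<boxtimes> Y) Z v1 z"
      using pr_ex[OF tensor_Obj[OF tensor_Obj[OF o(1,2)] o(3)] o(4) mem_v] by blast
    obtain v2 y where mem_v2: "v2 \<in> I (W \<boxtimes> X)" and mem_y: "y \<in> I Y" and eq_v1: "v1 = pr (W \<boxtimes> X) Y v2 y"
      using pr_ex[OF tensor_Obj[OF o(1,2)] o(3) mem_v1] by blast
    obtain w x where mem_w: "w \<in> I W" and mem_x: "x \<in> I X" and eq_v2: "v2 = pr W X w x"
      using pr_ex[OF o(1) o(2) mem_v2] by blast
    show "\<exists>\<tau> \<in> ?S. v = p1 \<tau>"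
      using mem_w mem_x mem_y mem_z unfolding eq_v eq_v1 eq_v2
      by (intro bexI[of _ "(w, x, y, z)"]) (simp_all add: p1_def)
  qed (use o in \<open>auto simp: p1_def s1_def\<close>)
  have f2: "frame ((W \<boxtimes> X) \<boxtimes> (Y \<boxtimes> Z)) ?S p2' s2"
    unfolding frame_def
  proof (intro conjI bij_betwI')
    fix v assume mem_v: "v \<in> I ((W \<boxtimes> X) \<boxtimes> (Y \<boxtimes> Z))"
    obtain v1 v2 where mem_v1: "v1 \<in> I (W \<boxtimes> X)" and mem_v2: "v2 \<in> I (Y \<boxtimes> Z)" and eq_v: "v = pr (W \<boxtimes> X) (Y \<boxtimes> Z) v1 v2"
      using pr_ex[OF tensor_Obj[OF o(1,2)] tensor_Obj[OF o(3,4)] mem_v] by blast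
    obtain w x where mem_w: "w \<in> I W" and mem_x: "x \<in> I X" and eq_v1: "v1 = pr W X w x"
      using pr_ex[OF o(1) o(2) mem_v1] by blast
    obtain y z where mem_y: "y \<in> I Y" and mem_z: "z \<in> I Z" and eq_v2: "v2 = pr Y Z y z"
      using pr_ex[OF o(3) o(4) mem_v2] by blast
    show "\<exists>\<tau> \<in> ?S. v = p2' \<tau>"
      using mem_w mem_x mem_y mem_z unfolding eq_v eq_v1 eq_v2
      by (intro bexI[of _ "(w, x, y, z)"]) (simp_all add: p2'_def)
  qed (use o in \<open>auto simp: p2'_def s2_def\<close>)
  have f3: "frame (W \<boxtimes> (X \<boxtimes> (Y \<boxtimes> Z))) ?S p3 s3"
    unfolding frame_def
  proof (intro conjI bij_betwI')
    fix v assume mem_v: "v \<in> I (W \<boxtimes> (X \<boxtimes> (Y \<boxtimes> Z)))"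
    obtain w v1 where mem_w: "w \<in> I W" and mem_v1: "v1 \<in> I (X \<boxtimes> (Y \<boxtimes> Z))" and eq_v: "v = pr W (X \<boxtimes> (Y \<boxtimes> Z)) w v1"
      using pr_ex[OF o(1) tensor_Obj[OF o(2) tensor_Obj[OF o(3,4)]] mem_v] by blast
    obtain x v2 where mem_x: "x \<in> I X" and mem_v2: "v2 \<in> I (Y \<boxtimes> Z)" and eq_v1: "v1 = pr X (Y \<boxtimes> Z) x v2"
      using pr_ex[OF o(2) tensor_Obj[OF o(3,4)] mem_v1] by blast
    obtain y z where mem_y: "y \<in> I Y" and mem_z: "z \<in> I Z" and eq_v2: "v2 = pr Y Z y z"
      using pr_ex[OF o(3) o(4) mem_v2] by blast
    show "\<exists>\<tau> \<in> ?S. v = p3 \<tau>"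
      using mem_w mem_x mem_y mem_z unfolding eq_v eq_v1 eq_v2
      by (intro bexI[of _ "(w, x, y, z)"]) (simp_all add: p3_def)
  qed (use o in \<open>auto simp: p3_def s3_def\<close>)
  have f4: "frame ((W \<boxtimes> (X \<boxtimes> Y)) \<boxtimes> Z) ?S p4 s4"
    unfolding frame_def
  proof (intro conjI bij_betwI')
    fix v assume mem_v: "v \<in> I ((W \<boxtimes> (X \<boxtimes> Y)) \<boxtimes> Z)"
    obtain v1 z where mem_v1: "v1 \<in> I (W \<boxtimes> (X \<boxtimes> Y))" and mem_z: "z \<in> I Z" and eq_v: "v = pr (W \<boxtimes> (X \<boxtimes> Y)) Z v1 z"
      using pr_ex[OF tensor_Obj[OF o(1) tensor_Obj[OF o(2,3)]] o(4) mem_v] by blast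
    obtain w v2 where mem_w: "w \<in> I W" and mem_v2: "v2 \<in> I (X \<boxtimes> Y)" and eq_v1: "v1 = pr W (X \<boxtimes> Y) w v2"
      using pr_ex[OF o(1) tensor_Obj[OF o(2,3)] mem_v1] by blast
    obtain x y where mem_x: "x \<in> I X" and mem_y: "y \<in> I Y" and eq_v2: "v2 = pr X Y x y"
      using pr_ex[OF o(2) o(3) mem_v2] by blast
    show "\<exists>\<tau> \<in> ?S. v = p4 \<tau>"
      using mem_w mem_x mem_y mem_z unfolding eq_v eq_v1 eq_v2
      by (intro bexI[of _ "(w, x, y, z)"]) (simp_all add: p4_def)
  qed (use o in \<open>auto simp: p4_def s4_def\<close>)
  have f5: "frame (W \<boxtimes> ((X \<boxtimes> Y) \<boxtimes> Z)) ?S p5 s5"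
    unfolding frame_def
  proof (intro conjI bij_betwI')
    fix v assume mem_v: "v \<in> I (W \<boxtimes> ((X \<boxtimes> Y) \<boxtimes> Z))"
    obtain w v1 where mem_w: "w \<in> I W" and mem_v1: "v1 \<in> I ((X \<boxtimes> Y) \<boxtimes> Z)" and eq_v: "v = pr W ((X \<boxtimes> Y) \<boxtimes> Z) w v1"
      using pr_ex[OF o(1) tensor_Obj[OF tensor_Obj[OF o(2,3)] o(4)] mem_v] by blast
    obtain v2 z where mem_v2: "v2 \<in> I (X \<boxtimes> Y)" and mem_z: "z \<in> I Z" and eq_v1: "v1 = pr (X \<boxtimes> Y) Z v2 z"
      using pr_ex[OF tensor_Obj[OF o(2,3)] o(4) mem_v1] by blast
    obtain x y where mem_x: "x \<in> I X" and mem_y: "y \<in> I Y" and eq_v2: "v2 = pr X Y x y"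
      using pr_ex[OF o(2) o(3) mem_v2] by blast
    show "\<exists>\<tau> \<in> ?S. v = p5 \<tau>"
      using mem_w mem_x mem_y mem_z unfolding eq_v eq_v1 eq_v2
      by (intro bexI[of _ "(w, x, y, z)"]) (simp_all add: p5_def)
  qed (use o in \<open>auto simp: p5_def s5_def\<close>)
  define k12 where "k12 = (\<lambda>(w, x, y, z). om (dg W w \<otimes>\<^bsub>G\<^esub> dg X x) (dg Y y) (dg Z z))"
  define k23 where "k23 = (\<lambda>(w, x, y, z). om (dg W w) (dg X x) (dg Y y \<otimes>\<^bsub>G\<^esub> dg Z z))"
  define k14 where "k14 = (\<lambda>(w, x, y, z :: 'i). om (dg W w) (dg X x) (dg Y y))"
  define k45 where "k45 = (\<lambda>(w, x, y, z). om (dg W w) (dg X x \<otimes>\<^bsub>G\<^esub> dg Y y) (dg Z z))"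
  define k53 where "k53 = (\<lambda>(w :: 'i, x, y, z). om (dg X x) (dg Y y) (dg Z z))"
  note kdefs = k12_def k23_def k14_def k45_def k53_def
  have idem: "mm ?S ?e ?e = ?e" using o by (simp add: mm_ten E_idem)
  have kgr: "k12 \<tau>' = k12 \<tau> \<and> k23 \<tau>' = k23 \<tau> \<and> k14 \<tau>' = k14 \<tau> \<and> k45 \<tau>' = k45 \<tau> \<and> k53 \<tau>' = k53 \<tau>"
    if "?e \<tau>' \<tau> \<noteq> 0" for \<tau> \<tau>'
  proof -
    obtain w x y z w' x' y' z' where q: "\<tau> = (w, x, y, z)" "\<tau>' = (w', x', y', z')" by (cases \<tau>; cases \<tau>') auto
    have "dg W w' = dg W w" "dg X x' = dg X x" "dg Y y' = dg Y y" "dg Z z' = dg Z z"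
      using that E_graded[OF o(1), of w' w] E_graded[OF o(2), of x' x] E_graded[OF o(3), of y' y]
        E_graded[OF o(4), of z' z] by (auto simp: q)
    then show ?thesis by (simp add: q kdefs)
  qed
  note H12 = assoc_Hom[OF tensor_Obj[OF o(1,2)] o(3,4)]
  note H23 = assoc_Hom[OF o(1,2) tensor_Obj[OF o(3,4)]]
  note H14 = tensor_Hom[OF assoc_Hom[OF o(1,2,3)] id_Hom[OF o(4)]]
  note H45 = assoc_Hom[OF o(1) tensor_Obj[OF o(2,3)] o(4)]
  note H53 = tensor_Hom[OF id_Hom[OF o(1)] assoc_Hom[OF o(2,3,4)]]
  have c: "co p2' s2 p1 s1 (assocA C (W \<boxtimes> X) Y Z) \<tau>' \<tau> = k12 \<tau> * ?e \<tau>' \<tau>"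
    "co p3 s3 p2' s2 (assocA C W X (Y \<boxtimes> Z)) \<tau>' \<tau> = k23 \<tau> * ?e \<tau>' \<tau>"
    "co p4 s4 p1 s1 (assocA C W X Y \<star> idA C Z) \<tau>' \<tau> = k14 \<tau> * ?e \<tau>' \<tau>"
    "co p5 s5 p4 s4 (assocA C W (X \<boxtimes> Y) Z) \<tau>' \<tau> = k45 \<tau> * ?e \<tau>' \<tau>"
    "co p3 s3 p5 s5 (idA C W \<star> assocA C X Y Z) \<tau>' \<tau> = k53 \<tau> * ?e \<tau>' \<tau>"
    if tt: "\<tau> \<in> ?S" "\<tau>' \<in> ?S" for \<tau> \<tau>'
  proof -
    obtain w x y z w' x' y' z' where q: "\<tau> = (w, x, y, z)" "\<tau>' = (w', x', y', z')"
      and m: "w \<in> I W" "x \<in> I X" "y \<in> I Y" "z \<in> I Z" "w' \<in> I W" "x' \<in> I X" "y' \<in> I Y" "z' \<in> I Z"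
      using tt by auto
    show "co p2' s2 p1 s1 (assocA C (W \<boxtimes> X) Y Z) \<tau>' \<tau> = k12 \<tau> * ?e \<tau>' \<tau>"
      using o m by (simp add: q cm_def defs kdefs Phi_assoc field_simps)
    show "co p3 s3 p2' s2 (assocA C W X (Y \<boxtimes> Z)) \<tau>' \<tau> = k23 \<tau> * ?e \<tau>' \<tau>"
      using o m by (simp add: q cm_def defs kdefs Phi_assoc field_simps)
    show "co p4 s4 p1 s1 (assocA C W X Y \<star> idA C Z) \<tau>' \<tau> = k14 \<tau> * ?e \<tau>' \<tau>"
      using o m by (simp add: q cm_def defs kdefs Phi_tensor[OF assoc_Hom[OF o(1,2,3)] id_Hom[OF o(4)]] Phi_assoc field_simps)
    show "co p5 s5 p4 s4 (assocA C W (X \<boxtimes> Y) Z) \<tau>' \<tau> = k45 \<tau> * ?e \<tau>' \<tau>"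
      using o m by (simp add: q cm_def defs kdefs Phi_assoc field_simps)
    show "co p3 s3 p5 s5 (idA C W \<star> assocA C X Y Z) \<tau>' \<tau> = k53 \<tau> * ?e \<tau>' \<tau>"
      using o m by (simp add: q cm_def defs kdefs Phi_tensor[OF id_Hom[OF o(1)] assoc_Hom[OF o(2,3,4)]] Phi_assoc field_simps)
  qed
  show ?thesis
  proof (rule co_eqI[OF comp_Hom[OF H12 H23] comp_Hom[OF comp_Hom[OF H14 H45] H53] f1 f3])
    fix \<tau> \<tau>' assume t: "\<tau> \<in> ?S" "\<tau>' \<in> ?S"
    have L: "co p3 s3 p1 s1 (assocA C W X (Y \<boxtimes> Z) \<cdot> assocA C (W \<boxtimes> X) Y Z) \<tau>' \<tau> = k23 \<tau> * k12 \<tau> * ?e \<tau>' \<tau>"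
      unfolding co_comp[OF H12 H23 f2]
      by (rule mm_rescaled[where e = ?e and k' = k23 and k = k12]) (use t c kgr idem in \<open>simp_all\<close>)
    have R1: "co p5 s5 p1 s1 (assocA C W (X \<boxtimes> Y) Z \<cdot> (assocA C W X Y \<star> idA C Z)) \<tau>' \<tau> =
      (k45 \<tau> * k14 \<tau>) * ?e \<tau>' \<tau>" if "\<tau> \<in> ?S" "\<tau>' \<in> ?S" for \<tau> \<tau>'
      unfolding co_comp[OF H14 H45 f4]
      by (rule mm_rescaled[where e = ?e and k' = k45 and k = k14]) (use that c kgr idem in \<open>simp_all\<close>)
    have R: "co p3 s3 p1 s1 ((idA C W \<star> assocA C X Y Z) \<cdot>
        (assocA C W (X \<boxtimes> Y) Z \<cdot> (assocA C W X Y \<star> idA C Z))) \<tau>' \<tau> = k53 \<tau> * (k45 \<tau> * k14 \<tau>) * ?e \<tau>' \<tau>"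
      unfolding co_comp[OF comp_Hom[OF H14 H45] H53 f5]
      by (rule mm_rescaled[where e = ?e and k' = k53 and k = "\<lambda>\<tau>. k45 \<tau> * k14 \<tau>"])
        (use t c kgr idem R1 in \<open>simp_all\<close>)
    obtain w x y z where q: "\<tau> = (w, x, y, z)" "w \<in> I W" "x \<in> I X" "y \<in> I Y" "z \<in> I Z" using t by auto
    have "k23 \<tau> * k12 \<tau> = k53 \<tau> * (k45 \<tau> * k14 \<tau>)"
      using om_cocycle[of "dg W w" "dg X x" "dg Y y" "dg Z z"] o q by (simp add: kdefs mult_ac)
    then show "co p3 s3 p1 s1 (assocA C W X (Y \<boxtimes> Z) \<cdot> assocA C (W \<boxtimes> X) Y Z) \<tau>' \<tau> =
      co p3 s3 p1 s1 ((idA C W \<star> assocA C X Y Z) \<cdot>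
        (assocA C W (X \<boxtimes> Y) Z \<cdot> (assocA C W X Y \<star> idA C Z))) \<tau>' \<tau>"
      unfolding L R by simp
  qed
qed

theorem is_monoidal_category: "monoidal_category C"
proof -
  interpret category C by (rule is_category)
  show ?thesis
    by unfold_locales
      (simp_all add: tensor_id tensor_Hom tensor_comp assoc_Hom assoc_iso assoc_natural lunit_Hom unit_isos
        lunit_natural runit_Hom runit_natural pentagon triangle)
qed

end

section \<open>Monoidal equivalences from splittings of idempotents\<close>

context matrix_mcat
begin

lemma mm_tensor:
  assumes o: "X \<in> Obj C" "Y \<in> Obj C"
    and M: "\<And>x y. x \<in> I X \<Longrightarrow> y \<in> I Y \<Longrightarrow> M z (pr X Y x y) = c * (\<alpha> x * \<beta> y) / t X Y x y"
    and N: "\<And>x y. x \<in> I X \<Longrightarrow> y \<in> I Y \<Longrightarrow> N (pr X Y x y) w = t X Y x y * (\<gamma> x * \<delta> y) / d"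
  shows "mm (I (X \<boxtimes> Y)) M N z w = c * ((\<Sum>x \<in> I X. \<alpha> x * \<gamma> x) * (\<Sum>y \<in> I Y. \<beta> y * \<delta> y)) / d"
proof -
  have "mm (I (X \<boxtimes> Y)) M N z w = (\<Sum>(x, y) \<in> I X \<times> I Y. M z (pr X Y x y) * N (pr X Y x y) w)"
    unfolding mm_def
    using sum.reindex_bij_betw[OF pr_bij[OF o], of "\<lambda>v. M z v * N v w"] by (simp add: case_prod_unfold)
  also have "\<dots> = (\<Sum>(x, y) \<in> I X \<times> I Y. c * ((\<alpha> x * \<gamma> x) * (\<beta> y * \<delta> y)) / d)"
    by (intro sum.cong refl) (auto simp: M N)
  also have "\<dots> = c * ((\<Sum>x \<in> I X. \<alpha> x * \<gamma> x) * (\<Sum>y \<in> I Y. \<beta> y * \<delta> y)) / d"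
    unfolding sum_product
    unfolding sum.cartesian_product sum_distrib_left sum_divide_distrib by (simp add: case_prod_unfold)
  finally show ?thesis .
qed

end

lemma matrix_on_images:
  assumes "bij_betw p S J" "bij_betw q T K"
  shows "\<exists>M :: 'a \<Rightarrow> 'b \<Rightarrow> complex. (\<forall>z w. M z w \<noteq> 0 \<longrightarrow> z \<in> J \<and> w \<in> K) \<and>
    (\<forall>\<tau> \<in> S. \<forall>\<tau>' \<in> T. M (p \<tau>) (q \<tau>') = N \<tau> \<tau>')"
proof (intro exI conjI allI ballI impI)
  let ?M = "\<lambda>z w. if z \<in> J \<and> w \<in> K then N (inv_into S p z) (inv_into T q w) else 0"
  fix z w assume "?M z w \<noteq> 0"
  then show "z \<in> J" "w \<in> K" by (auto split: if_splits)
next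
  fix \<tau> \<tau>' assume "\<tau> \<in> S" "\<tau>' \<in> T"
  then show "(if p \<tau> \<in> J \<and> q \<tau>' \<in> K then N (inv_into S p (p \<tau>)) (inv_into T q (q \<tau>')) else 0) = N \<tau> \<tau>'"
    using assms by (auto simp: bij_betw_def)
qed

locale split_monoidal =
  C: matrix_mcat C I Phi dg G om pr t u0 + D: matrix_mcat D I' Phi' dg' G om pr' t' u0' +
  F: split_functor C I Phi dg D I' Phi' dg' FO a b
  for C :: "('o, 'v) mcat" (structure) and I :: "'o \<Rightarrow> 'i set" and Phi and dg :: "'o \<Rightarrow> 'i \<Rightarrow> 'g"
    and G :: "('g, 'b) monoid_scheme" and om pr t u0
    and D :: "('p, 'w) mcat" and I' :: "'p \<Rightarrow> 'j set" and Phi' and dg' :: "'p \<Rightarrow> 'j \<Rightarrow> 'g"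
    and pr' t' u0' and FO a b
begin

lemma FO_Obj [simp]: "X \<in> Obj C \<Longrightarrow> FO X \<in> Obj D"
  by (rule F.FO_Obj)

text \<open>A morphism into an object of the image is determined by its composition with the splitting.\<close>

lemma a_cancel:
  assumes X: "X \<in> Obj C" and h: "h \<in> Hom D Y (FO X)" "h' \<in> Hom D Y (FO X)"
    and eq: "\<And>z w. z \<in> I X \<Longrightarrow> w \<in> I' Y \<Longrightarrow> mm (I' (FO X)) (a X) (Phi' h) z w = mm (I' (FO X)) (a X) (Phi' h') z w"
  shows "h = h'"
proof (rule D.Phi_inj[OF h])
  have zero: "mm (I' (FO X)) (a X) (Phi' k) z w = 0" if "k \<in> Hom D Y (FO X)" "\<not> (z \<in> I X \<and> w \<in> I' Y)" for k z w
  proof (rule ccontr)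
    assume "mm (I' (FO X)) (a X) (Phi' k) z w \<noteq> 0"
    then obtain y where "a X z y \<noteq> 0" "Phi' k y w \<noteq> 0" using mm_nz by metis
    then show False using F.a_graded[OF X] D.Phi_graded[OF that(1)] that(2) by blast
  qed
  have "mm (I' (FO X)) (a X) (Phi' h) z w = mm (I' (FO X)) (a X) (Phi' h') z w" for z w
    using eq[of z w] zero[OF h(1), of z w] zero[OF h(2), of z w] by (cases "z \<in> I X \<and> w \<in> I' Y") auto
  then have "mm (I' (FO X)) (a X) (Phi' h) = mm (I' (FO X)) (a X) (Phi' h')" by (intro ext)
  then have "mm (I X) (b X) (mm (I' (FO X)) (a X) (Phi' h)) = mm (I X) (b X) (mm (I' (FO X)) (a X) (Phi' h'))"
    by simp
  then show "Phi' h = Phi' h'" using X D.Phi_id(1)[OF h(1)] D.Phi_id(1)[OF h(2)] by (simp add: F.contract)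
qed

lemma a_FA:
  assumes "f \<in> Hom C X Y"
  shows "mm (I' (FO Y)) (a Y) (Phi' (F.FA f)) = mm (I X) (Phi f) (a X)"
  using C.Hom_Obj[OF assms] C.Phi_id(1)[OF assms]
  by (simp add: F.FA(2)[OF assms] F.contract mm_assoc)
    (simp flip: mm_assoc)

text \<open>
  The matrices \<open>K\<close> and \<open>K'\<close> below split the idempotent of \<open>X \<boxtimes> Y\<close> through the tensor
  product of the images.
\<close>

lemma tensor_splitting:
  assumes o: "X \<in> Obj C" "Y \<in> Obj C"
  shows "\<exists>K K'.
    (\<forall>z w. K z w \<noteq> 0 \<longrightarrow> z \<in> I (X \<boxtimes> Y) \<and> w \<in> I' (FO X \<boxtimes>\<^bsub>D\<^esub> FO Y) \<and>
      dg (X \<boxtimes> Y) z = dg' (FO X \<boxtimes>\<^bsub>D\<^esub> FO Y) w) \<and>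
    (\<forall>z w. K' z w \<noteq> 0 \<longrightarrow> w \<in> I (X \<boxtimes> Y) \<and> z \<in> I' (FO X \<boxtimes>\<^bsub>D\<^esub> FO Y) \<and>
      dg (X \<boxtimes> Y) w = dg' (FO X \<boxtimes>\<^bsub>D\<^esub> FO Y) z) \<and>
    mm (I' (FO X \<boxtimes>\<^bsub>D\<^esub> FO Y)) K K' = C.E (X \<boxtimes> Y) \<and>
    mm (I (X \<boxtimes> Y)) K' K = D.E (FO X \<boxtimes>\<^bsub>D\<^esub> FO Y) \<and>
    mm (I (X \<boxtimes> Y)) (C.E (X \<boxtimes> Y)) K = K \<and>
    mm (I (X \<boxtimes> Y)) K' (C.E (X \<boxtimes> Y)) = K' \<and>
    (\<forall>x \<in> I X. \<forall>y \<in> I Y. \<forall>x' \<in> I' (FO X). \<forall>y' \<in> I' (FO Y).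
      K (pr X Y x y) (pr' (FO X) (FO Y) x' y') =
        t X Y x y * (a X x x' * a Y y y') / t' (FO X) (FO Y) x' y')"
proof -
  let ?Z = "X \<boxtimes> Y" and ?W = "FO X \<boxtimes>\<^bsub>D\<^esub> FO Y"
  let ?S = "I X \<times> I Y" and ?T = "I' (FO X) \<times> I' (FO Y)"
  have o': "FO X \<in> Obj D" "FO Y \<in> Obj D" using o by simp_all
  have oZ: "?Z \<in> Obj C" "?W \<in> Obj D" using o by simp_all
  note bC = C.pr_bij[OF o] and bD = D.pr_bij[OF o']
  obtain K where K: "\<And>z w. K z w \<noteq> 0 \<Longrightarrow> z \<in> I ?Z \<and> w \<in> I' ?W"
    and K_pr: "\<And>\<tau> \<tau>'. \<tau> \<in> ?S \<Longrightarrow> \<tau>' \<in> ?T \<Longrightarrow> K (C.p2 X Y \<tau>) (D.p2 (FO X) (FO Y) \<tau>') =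
      C.t2 X Y \<tau> * ten (a X) (a Y) \<tau> \<tau>' / D.t2 (FO X) (FO Y) \<tau>'"
    using matrix_on_images[OF bC bD, of "\<lambda>\<tau> \<tau>'. C.t2 X Y \<tau> * ten (a X) (a Y) \<tau> \<tau>' / D.t2 (FO X) (FO Y) \<tau>'"]
    by blast
  obtain K' where K': "\<And>z w. K' z w \<noteq> 0 \<Longrightarrow> z \<in> I' ?W \<and> w \<in> I ?Z"
    and K'_pr: "\<And>\<tau> \<tau>'. \<tau> \<in> ?T \<Longrightarrow> \<tau>' \<in> ?S \<Longrightarrow> K' (D.p2 (FO X) (FO Y) \<tau>) (C.p2 X Y \<tau>') =
      D.t2 (FO X) (FO Y) \<tau> * ten (b X) (b Y) \<tau> \<tau>' / C.t2 X Y \<tau>'"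
    using matrix_on_images[OF bD bC, of "\<lambda>\<tau> \<tau>'. D.t2 (FO X) (FO Y) \<tau> * ten (b X) (b Y) \<tau> \<tau>' / C.t2 X Y \<tau>'"]
    by blast
  have Kv: "K (pr X Y x y) (pr' (FO X) (FO Y) x' y') = t X Y x y * (a X x x' * a Y y y') / t' (FO X) (FO Y) x' y'"
    and K'v: "K' (pr' (FO X) (FO Y) x' y') (pr X Y x y) = t' (FO X) (FO Y) x' y' * (b X x' x * b Y y' y) / t X Y x y"
    if "x \<in> I X" "y \<in> I Y" "x' \<in> I' (FO X)" "y' \<in> I' (FO Y)" for x y x' y'
    using that K_pr[of "(x, y)" "(x', y')"] K'_pr[of "(x', y')" "(x, y)"] by simp_all
  have Kg: "z \<in> I ?Z \<and> w \<in> I' ?W \<and> dg ?Z z = dg' ?W w" if "K z w \<noteq> 0" for z w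
  proof -
    have zw: "z \<in> I ?Z" "w \<in> I' ?W" using K[OF that] by auto
    obtain x y where xy: "x \<in> I X" "y \<in> I Y" "z = pr X Y x y" using C.pr_ex[OF o zw(1)] by blast
    obtain x' y' where xy': "x' \<in> I' (FO X)" "y' \<in> I' (FO Y)" "w = pr' (FO X) (FO Y) x' y'"
      using D.pr_ex[OF o' zw(2)] by blast
    have "a X x x' \<noteq> 0" "a Y y y' \<noteq> 0" using that xy xy' by (auto simp: Kv)
    then have "dg X x = dg' (FO X) x'" "dg Y y = dg' (FO Y) y'"
      using F.a_graded[OF o(1)] F.a_graded[OF o(2)] by blast+
    then show ?thesis using zw xy xy' o by simp
  qed
  have K'g: "w \<in> I ?Z \<and> z \<in> I' ?W \<and> dg ?Z w = dg' ?W z" if "K' z w \<noteq> 0" for z w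
  proof -
    have zw: "w \<in> I ?Z" "z \<in> I' ?W" using K'[OF that] by auto
    obtain x y where xy: "x \<in> I X" "y \<in> I Y" "w = pr X Y x y" using C.pr_ex[OF o zw(1)] by blast
    obtain x' y' where xy': "x' \<in> I' (FO X)" "y' \<in> I' (FO Y)" "z = pr' (FO X) (FO Y) x' y'"
      using D.pr_ex[OF o' zw(2)] by blast
    have "b X x' x \<noteq> 0" "b Y y' y \<noteq> 0" using that xy xy' by (auto simp: K'v)
    then have "dg X x = dg' (FO X) x'" "dg Y y = dg' (FO Y) y'"
      using F.b_graded[OF o(1)] F.b_graded[OF o(2)] by blast+
    then show ?thesis using zw xy xy' o by simp
  qed
  have KK': "mm (I' ?W) K K' = C.E ?Z"
  proof (intro ext)
    fix z z'
    show "mm (I' ?W) K K' z z' = C.E ?Z z z'"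
    proof (cases "z \<in> I ?Z \<and> z' \<in> I ?Z")
      case True
      obtain x y where xy: "x \<in> I X" "y \<in> I Y" "z = pr X Y x y" using C.pr_ex[OF o] True by blast
      obtain x' y' where xy': "x' \<in> I X" "y' \<in> I Y" "z' = pr X Y x' y'" using C.pr_ex[OF o] True by blast
      have "mm (I' ?W) K K' z z' = t X Y x y * ((\<Sum>v \<in> I' (FO X). a X x v * b X v x') *
          (\<Sum>v \<in> I' (FO Y). a Y y v * b Y v y')) / t X Y x' y'"
        unfolding xy(3) xy'(3) by (rule D.mm_tensor[OF o']) (use xy xy' in \<open>auto simp: Kv K'v\<close>)
      also have "\<dots> = t X Y x y * (C.E X x x' * C.E Y y y') / t X Y x' y'"
        by (simp add: F.ab[OF o(1), symmetric] F.ab[OF o(2), symmetric] mm_def)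
      finally show ?thesis using xy xy' o by simp
    next
      case False
      then have "C.E ?Z z z' = 0" using C.E_graded[OF oZ(1)] by blast
      moreover have "mm (I' ?W) K K' z z' = 0"
        using False K K' mm_nz[of "I' ?W" K K' z z'] by blast
      ultimately show ?thesis by simp
    qed
  qed
  have K'K: "mm (I ?Z) K' K = D.E ?W"
  proof (intro ext)
    fix z z'
    show "mm (I ?Z) K' K z z' = D.E ?W z z'"
    proof (cases "z \<in> I' ?W \<and> z' \<in> I' ?W")
      case True
      obtain x y where xy: "x \<in> I' (FO X)" "y \<in> I' (FO Y)" "z = pr' (FO X) (FO Y) x y"
        using D.pr_ex[OF o'] True by blast
      obtain x' y' where xy': "x' \<in> I' (FO X)" "y' \<in> I' (FO Y)" "z' = pr' (FO X) (FO Y) x' y'"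
        using D.pr_ex[OF o'] True by blast
      have "mm (I ?Z) K' K z z' = t' (FO X) (FO Y) x y * ((\<Sum>v \<in> I X. b X x v * a X v x') *
          (\<Sum>v \<in> I Y. b Y y v * a Y v y')) / t' (FO X) (FO Y) x' y'"
        unfolding xy(3) xy'(3) by (rule C.mm_tensor[OF o]) (use xy xy' in \<open>auto simp: Kv K'v\<close>)
      also have "\<dots> = t' (FO X) (FO Y) x y * (D.E (FO X) x x' * D.E (FO Y) y y') / t' (FO X) (FO Y) x' y'"
        by (simp add: F.ba[OF o(1), symmetric] F.ba[OF o(2), symmetric] mm_def)
      finally show ?thesis using xy xy' o' by simp
    next
      case False
      then have "D.E ?W z z' = 0" using D.E_graded[OF oZ(2)] by blast
      moreover have "mm (I ?Z) K' K z z' = 0"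
        using False K K' mm_nz[of "I ?Z" K' K z z'] by blast
      ultimately show ?thesis by simp
    qed
  qed
  have EK: "mm (I ?Z) (C.E ?Z) K = K"
  proof (intro ext)
    fix z w
    show "mm (I ?Z) (C.E ?Z) K z w = K z w"
    proof (cases "z \<in> I ?Z \<and> w \<in> I' ?W")
      case True
      obtain x y where xy: "x \<in> I X" "y \<in> I Y" "z = pr X Y x y" using C.pr_ex[OF o] True by blast
      obtain x' y' where xy': "x' \<in> I' (FO X)" "y' \<in> I' (FO Y)" "w = pr' (FO X) (FO Y) x' y'"
        using D.pr_ex[OF o'] True by blast
      have "mm (I ?Z) (C.E ?Z) K z w = t X Y x y * ((\<Sum>v \<in> I X. C.E X x v * a X v x') *
          (\<Sum>v \<in> I Y. C.E Y y v * a Y v y')) / t' (FO X) (FO Y) x' y'"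
        unfolding xy(3) xy'(3) by (rule C.mm_tensor[OF o]) (use o xy xy' in \<open>auto simp: Kv\<close>)
      also have "\<dots> = t X Y x y * (mm (I X) (C.E X) (a X) x x' * mm (I Y) (C.E Y) (a Y) y y') / t' (FO X) (FO Y) x' y'"
        by (simp add: mm_def)
      finally show ?thesis using xy xy' o by (simp add: F.ea Kv)
    next
      case False
      then have "K z w = 0" using K by blast
      moreover have "mm (I ?Z) (C.E ?Z) K z w = 0"
        using False K C.E_graded[OF oZ(1)] mm_nz[of "I ?Z" "C.E ?Z" K z w] by blast
      ultimately show ?thesis by simp
    qed
  qed
  have K'E: "mm (I ?Z) K' (C.E ?Z) = K'"
  proof (intro ext)
    fix w z
    show "mm (I ?Z) K' (C.E ?Z) w z = K' w z"
    proof (cases "z \<in> I ?Z \<and> w \<in> I' ?W")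
      case True
      obtain x y where xy: "x \<in> I X" "y \<in> I Y" "z = pr X Y x y" using C.pr_ex[OF o] True by blast
      obtain x' y' where xy': "x' \<in> I' (FO X)" "y' \<in> I' (FO Y)" "w = pr' (FO X) (FO Y) x' y'"
        using D.pr_ex[OF o'] True by blast
      have "mm (I ?Z) K' (C.E ?Z) w z = t' (FO X) (FO Y) x' y' * ((\<Sum>v \<in> I X. b X x' v * C.E X v x) *
          (\<Sum>v \<in> I Y. b Y y' v * C.E Y v y)) / t X Y x y"
        unfolding xy(3) xy'(3) by (rule C.mm_tensor[OF o]) (use o xy xy' in \<open>auto simp: K'v\<close>)
      also have "\<dots> = t' (FO X) (FO Y) x' y' * (mm (I X) (b X) (C.E X) x' x * mm (I Y) (b Y) (C.E Y) y' y) / t X Y x y"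
        by (simp add: mm_def)
      finally show ?thesis using xy xy' o by (simp add: F.be K'v)
    next
      case False
      then have "K' w z = 0" using K' by blast
      moreover have "mm (I ?Z) K' (C.E ?Z) w z = 0"
        using False K' C.E_graded[OF oZ(1)] mm_nz[of "I ?Z" K' "C.E ?Z" w z] by blast
      ultimately show ?thesis by simp
    qed
  qed
  have Kg: "\<forall>z w. K z w \<noteq> 0 \<longrightarrow> z \<in> I ?Z \<and> w \<in> I' ?W \<and> dg ?Z z = dg' ?W w" using Kg by blast
  have K'g: "\<forall>z w. K' z w \<noteq> 0 \<longrightarrow> w \<in> I ?Z \<and> z \<in> I' ?W \<and> dg ?Z w = dg' ?W z" using K'g by blast
  have Kv: "\<forall>x \<in> I X. \<forall>y \<in> I Y. \<forall>x' \<in> I' (FO X). \<forall>y' \<in> I' (FO Y).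
      K (pr X Y x y) (pr' (FO X) (FO Y) x' y') = t X Y x y * (a X x x' * a Y y y') / t' (FO X) (FO Y) x' y'"
    by (intro ballI Kv)
  show ?thesis
    by (rule exI[of _ K], rule exI[of _ K'], intro conjI) (fact Kg K'g KK' K'K EK K'E Kv)+
qed

lemma iso_from_splitting:
  assumes o: "Z \<in> Obj C" "Y \<in> Obj D"
    and K: "\<And>z w. K z w \<noteq> 0 \<Longrightarrow> z \<in> I Z \<and> w \<in> I' Y \<and> dg Z z = dg' Y w"
    and K': "\<And>z w. K' z w \<noteq> 0 \<Longrightarrow> w \<in> I Z \<and> z \<in> I' Y \<and> dg Z w = dg' Y z"
    and KK': "mm (I' Y) K K' = C.E Z" and K'K: "mm (I Z) K' K = D.E Y"
    and EK: "mm (I Z) (C.E Z) K = K" and K'E: "mm (I Z) K' (C.E Z) = K'"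
  shows "\<exists>h \<in> Hom D Y (FO Z). iso_arrow D h \<and> mm (I' (FO Z)) (a Z) (Phi' h) = K"
proof -
  have K_E: "mm (I' Y) K (D.E Y) = K"
    using mm_assoc[of "I Z" "I' Y" K K' K] KK' K'K EK by simp
  have E_K': "mm (I' Y) (D.E Y) K' = K'"
    using mm_assoc[of "I' Y" "I Z" K' K K'] KK' K'K K'E by simp
  have "\<exists>h \<in> Hom D Y (FO Z). Phi' h = mm (I Z) (b Z) K"
  proof (rule D.Phi_surj[OF o(2) FO_Obj[OF o(1)]])
    fix y x assume "mm (I Z) (b Z) K y x \<noteq> 0"
    then obtain z where "b Z y z \<noteq> 0" "K z x \<noteq> 0" using mm_nz by metis
    then show "y \<in> I' (FO Z) \<and> x \<in> I' Y \<and> dg' (FO Z) y = dg' Y x"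
      using F.b_graded[OF o(1)] K by metis
  qed (use o in \<open>simp_all add: F.contract mm_assoc K_E\<close>)
  then obtain h where h: "h \<in> Hom D Y (FO Z)" "Phi' h = mm (I Z) (b Z) K" by blast
  have "\<exists>k \<in> Hom D (FO Z) Y. Phi' k = mm (I Z) K' (a Z)"
  proof (rule D.Phi_surj[OF FO_Obj[OF o(1)] o(2)])
    fix y x assume "mm (I Z) K' (a Z) y x \<noteq> 0"
    then obtain z where "K' y z \<noteq> 0" "a Z z x \<noteq> 0" using mm_nz by metis
    then show "y \<in> I' Y \<and> x \<in> I' (FO Z) \<and> dg' Y y = dg' (FO Z) x"
      using F.a_graded[OF o(1)] K' by metis
  qed (use o in \<open>simp_all add: F.ae mm_assoc E_K' flip: mm_assoc[of _ _ "D.E Y"]\<close>)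
  then obtain k where k: "k \<in> Hom D (FO Z) Y" "Phi' k = mm (I Z) K' (a Z)" by blast
  have "mm (I' (FO Z)) (Phi' k) (Phi' h) = mm (I Z) K' (mm (I Z) (C.E Z) K)"
    using o by (simp add: h k mm_assoc F.contract)
  moreover have "mm (I' Y) (Phi' h) (Phi' k) = mm (I Z) (b Z) (mm (I Z) (mm (I' Y) K K') (a Z))"
    by (simp add: h k mm_assoc)
  ultimately have "iso_arrow D h"
    using o by (intro D.iso_arrowI[OF h(1) k(1)]) (simp_all add: EK K'K KK' F.ea F.ba)
  moreover have "mm (I' (FO Z)) (a Z) (Phi' h) = K"
    using o by (simp add: h F.contract EK)
  ultimately show ?thesis using h(1) by blast
qed

text \<open>
  The monoidal constraint compares the chosen splitting of \<open>X \<boxtimes> Y\<close> with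
  the tensor product of the splittings of \<open>X\<close> and \<open>Y\<close>;
  \<open>a_cancel\<close> shows that the condition determines it.
\<close>

definition J where
  "J X Y = (SOME h. h \<in> Hom D (FO X \<boxtimes>\<^bsub>D\<^esub> FO Y) (FO (X \<boxtimes> Y)) \<and> iso_arrow D h \<and>
     (\<forall>x \<in> I X. \<forall>y \<in> I Y. \<forall>x' \<in> I' (FO X). \<forall>y' \<in> I' (FO Y).
       mm (I' (FO (X \<boxtimes> Y))) (a (X \<boxtimes> Y)) (Phi' h) (pr X Y x y) (pr' (FO X) (FO Y) x' y') =
       t X Y x y * (a X x x' * a Y y y') / t' (FO X) (FO Y) x' y'))"

lemma J:
  assumes o: "X \<in> Obj C" "Y \<in> Obj C"
  shows "J X Y \<in> Hom D (FO X \<boxtimes>\<^bsub>D\<^esub> FO Y) (FO (X \<boxtimes> Y))" "iso_arrow D (J X Y)"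
    "x \<in> I X \<Longrightarrow> y \<in> I Y \<Longrightarrow> x' \<in> I' (FO X) \<Longrightarrow> y' \<in> I' (FO Y) \<Longrightarrow>
       mm (I' (FO (X \<boxtimes> Y))) (a (X \<boxtimes> Y)) (Phi' (J X Y)) (pr X Y x y) (pr' (FO X) (FO Y) x' y') =
       t X Y x y * (a X x x' * a Y y y') / t' (FO X) (FO Y) x' y'"
proof -
  obtain K K' where K: "\<forall>z w. K z w \<noteq> 0 \<longrightarrow> z \<in> I (X \<boxtimes> Y) \<and> w \<in> I' (FO X \<boxtimes>\<^bsub>D\<^esub> FO Y) \<and>
      dg (X \<boxtimes> Y) z = dg' (FO X \<boxtimes>\<^bsub>D\<^esub> FO Y) w"
    "\<forall>z w. K' z w \<noteq> 0 \<longrightarrow> w \<in> I (X \<boxtimes> Y) \<and> z \<in> I' (FO X \<boxtimes>\<^bsub>D\<^esub> FO Y) \<and>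
      dg (X \<boxtimes> Y) w = dg' (FO X \<boxtimes>\<^bsub>D\<^esub> FO Y) z"
    "mm (I' (FO X \<boxtimes>\<^bsub>D\<^esub> FO Y)) K K' = C.E (X \<boxtimes> Y)"
    "mm (I (X \<boxtimes> Y)) K' K = D.E (FO X \<boxtimes>\<^bsub>D\<^esub> FO Y)"
    "mm (I (X \<boxtimes> Y)) (C.E (X \<boxtimes> Y)) K = K"
    "mm (I (X \<boxtimes> Y)) K' (C.E (X \<boxtimes> Y)) = K'"
    and Kv: "\<forall>x \<in> I X. \<forall>y \<in> I Y. \<forall>x' \<in> I' (FO X). \<forall>y' \<in> I' (FO Y).
      K (pr X Y x y) (pr' (FO X) (FO Y) x' y') =
        t X Y x y * (a X x x' * a Y y y') / t' (FO X) (FO Y) x' y'"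
    using tensor_splitting[OF o] by (elim exE conjE) (rule that)
  have "\<exists>h \<in> Hom D (FO X \<boxtimes>\<^bsub>D\<^esub> FO Y) (FO (X \<boxtimes> Y)). iso_arrow D h \<and>
      mm (I' (FO (X \<boxtimes> Y))) (a (X \<boxtimes> Y)) (Phi' h) = K"
    by (rule iso_from_splitting[OF _ _ K(1,2)[rule_format] K(3-6)]) (use o in simp_all)
  then have "\<exists>h. h \<in> Hom D (FO X \<boxtimes>\<^bsub>D\<^esub> FO Y) (FO (X \<boxtimes> Y)) \<and> iso_arrow D h \<and>
     (\<forall>x \<in> I X. \<forall>y \<in> I Y. \<forall>x' \<in> I' (FO X). \<forall>y' \<in> I' (FO Y).
       mm (I' (FO (X \<boxtimes> Y))) (a (X \<boxtimes> Y)) (Phi' h) (pr X Y x y) (pr' (FO X) (FO Y) x' y') =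
       t X Y x y * (a X x x' * a Y y y') / t' (FO X) (FO Y) x' y')"
    using Kv by blast
  from someI_ex[OF this]
  show "J X Y \<in> Hom D (FO X \<boxtimes>\<^bsub>D\<^esub> FO Y) (FO (X \<boxtimes> Y))" "iso_arrow D (J X Y)"
    "x \<in> I X \<Longrightarrow> y \<in> I Y \<Longrightarrow> x' \<in> I' (FO X) \<Longrightarrow> y' \<in> I' (FO Y) \<Longrightarrow>
       mm (I' (FO (X \<boxtimes> Y))) (a (X \<boxtimes> Y)) (Phi' (J X Y)) (pr X Y x y) (pr' (FO X) (FO Y) x' y') =
       t X Y x y * (a X x x' * a Y y y') / t' (FO X) (FO Y) x' y'"
    unfolding J_def[symmetric] by blast+
qed

definition phi where
  "phi = (SOME h. h \<in> Hom D (unitO D) (FO (unitO C)) \<and> iso_arrow D h \<and>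
     mm (I' (FO (unitO C))) (a (unitO C)) (Phi' h) u0 u0' = 1)"

lemma phi: "phi \<in> Hom D (unitO D) (FO (unitO C))" "iso_arrow D phi"
  "mm (I' (FO (unitO C))) (a (unitO C)) (Phi' phi) u0 u0' = 1"
proof -
  let ?K = "\<lambda>z w. if z = u0 \<and> w = u0' then 1 else 0 :: complex"
  let ?K' = "\<lambda>z w. if z = u0' \<and> w = u0 then 1 else 0 :: complex"
  have E: "C.E (unitO C) = (\<lambda>z w. if z = u0 \<and> w = u0 then 1 else 0)"
    using C.E_graded[OF C.unit_Obj] by (intro ext) (auto simp: C.I_unit)
  have E': "D.E (unitO D) = (\<lambda>z w. if z = u0' \<and> w = u0' then 1 else 0)"
    using D.E_graded[OF D.unit_Obj] by (intro ext) (auto simp: D.I_unit)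
  have "\<exists>h \<in> Hom D (unitO D) (FO (unitO C)). iso_arrow D h \<and>
    mm (I' (FO (unitO C))) (a (unitO C)) (Phi' h) = ?K"
    by (rule iso_from_splitting[where K' = ?K'])
      (auto simp: E E' C.I_unit D.I_unit mm_def fun_eq_iff split: if_splits)
  then have "\<exists>h. h \<in> Hom D (unitO D) (FO (unitO C)) \<and> iso_arrow D h \<and>
     mm (I' (FO (unitO C))) (a (unitO C)) (Phi' h) u0 u0' = 1" by auto
  from someI_ex[OF this] show "phi \<in> Hom D (unitO D) (FO (unitO C))" "iso_arrow D phi"
    "mm (I' (FO (unitO C))) (a (unitO C)) (Phi' phi) u0 u0' = 1"
    unfolding phi_def[symmetric] by blast+
qed

lemma J_tensor:
  assumes o: "X \<in> Obj C" "Y \<in> Obj C" and f: "f \<in> Hom D X' (FO X)" and g: "g \<in> Hom D Y' (FO Y)"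
    and m: "x \<in> I X" "y \<in> I Y" "x' \<in> I' X'" "y' \<in> I' Y'"
  shows "mm (I' (FO (X \<boxtimes> Y))) (a (X \<boxtimes> Y)) (Phi' (J X Y \<cdot>\<^bsub>D\<^esub> (f \<star>\<^bsub>D\<^esub> g))) (pr X Y x y) (pr' X' Y' x' y') =
    t X Y x y * (mm (I' (FO X)) (a X) (Phi' f) x x' * mm (I' (FO Y)) (a Y) (Phi' g) y y') / t' X' Y' x' y'"
proof -
  have o': "FO X \<in> Obj D" "FO Y \<in> Obj D" using o by simp_all
  let ?aJ = "mm (I' (FO (X \<boxtimes> Y))) (a (X \<boxtimes> Y)) (Phi' (J X Y))"
  have "mm (I' (FO (X \<boxtimes> Y))) (a (X \<boxtimes> Y)) (Phi' (J X Y \<cdot>\<^bsub>D\<^esub> (f \<star>\<^bsub>D\<^esub> g))) =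
    mm (I' (FO X \<boxtimes>\<^bsub>D\<^esub> FO Y)) ?aJ (Phi' (f \<star>\<^bsub>D\<^esub> g))"
    by (simp add: D.Phi_comp[OF D.tensor_Hom[OF f g] J(1)[OF o]] mm_assoc)
  moreover have "mm (I' (FO X \<boxtimes>\<^bsub>D\<^esub> FO Y)) ?aJ (Phi' (f \<star>\<^bsub>D\<^esub> g)) (pr X Y x y) (pr' X' Y' x' y') =
    t X Y x y * ((\<Sum>v \<in> I' (FO X). a X x v * Phi' f v x') * (\<Sum>v \<in> I' (FO Y). a Y y v * Phi' g v y')) / t' X' Y' x' y'"
  proof (rule D.mm_tensor[OF o'])
    fix v w assume vw: "v \<in> I' (FO X)" "w \<in> I' (FO Y)"
    show "?aJ (pr X Y x y) (pr' (FO X) (FO Y) v w) = t X Y x y * (a X x v * a Y y w) / t' (FO X) (FO Y) v w"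
      by (rule J(3)[OF o m(1,2) vw])
    show "Phi' (f \<star>\<^bsub>D\<^esub> g) (pr' (FO X) (FO Y) v w) (pr' X' Y' x' y') =
      t' (FO X) (FO Y) v w * (Phi' f v x' * Phi' g w y') / t' X' Y' x' y'"
      by (rule D.Phi_tensor[OF f g m(3,4) vw])
  qed
  ultimately show ?thesis by (simp only: mm_def[of "I' (FO X)"] mm_def[of "I' (FO Y)"])
qed

lemma J_natural:
  assumes f: "f \<in> Hom C X X'" and g: "g \<in> Hom C Y Y'"
  shows "J X' Y' \<cdot>\<^bsub>D\<^esub> (F.FA f \<star>\<^bsub>D\<^esub> F.FA g) = F.FA (f \<star> g) \<cdot>\<^bsub>D\<^esub> J X Y"
proof -
  note o = C.Hom_Obj(1)[OF f] C.Hom_Obj(1)[OF g] and o' = C.Hom_Obj(2)[OF f] C.Hom_Obj(2)[OF g]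
  note Ff = F.FA(1)[OF f] and Fg = F.FA(1)[OF g] and fg = C.tensor_Hom[OF f g]
  show ?thesis
  proof (rule a_cancel[OF C.tensor_Obj[OF o'] D.comp_Hom[OF D.tensor_Hom[OF Ff Fg] J(1)[OF o']]
        D.comp_Hom[OF J(1)[OF o] F.FA(1)[OF fg]]])
    fix z w assume zw: "z \<in> I (X' \<boxtimes> Y')" "w \<in> I' (FO X \<boxtimes>\<^bsub>D\<^esub> FO Y)"
    obtain x y where xy: "x \<in> I X'" "y \<in> I Y'" "z = pr X' Y' x y" using C.pr_ex[OF o' zw(1)] by blast
    obtain x' y' where xy': "x' \<in> I' (FO X)" "y' \<in> I' (FO Y)" "w = pr' (FO X) (FO Y) x' y'"
      using D.pr_ex[OF FO_Obj[OF o(1)] FO_Obj[OF o(2)] zw(2)] by blast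
    let ?aR = "mm (I' (FO (X' \<boxtimes> Y'))) (a (X' \<boxtimes> Y'))"
    have "?aR (Phi' (F.FA (f \<star> g) \<cdot>\<^bsub>D\<^esub> J X Y)) =
      mm (I (X \<boxtimes> Y)) (Phi (f \<star> g)) (mm (I' (FO (X \<boxtimes> Y))) (a (X \<boxtimes> Y)) (Phi' (J X Y)))"
      unfolding D.Phi_comp[OF J(1)[OF o] F.FA(1)[OF fg]] mm_assoc[symmetric] a_FA[OF fg] ..
    then have "?aR (Phi' (F.FA (f \<star> g) \<cdot>\<^bsub>D\<^esub> J X Y)) z w =
      mm (I (X \<boxtimes> Y)) (Phi (f \<star> g)) (mm (I' (FO (X \<boxtimes> Y))) (a (X \<boxtimes> Y)) (Phi' (J X Y))) z w"
      by (rule arg_cong[where f = "\<lambda>M. M z w"])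
    also have "\<dots> = t X' Y' x y * ((\<Sum>v \<in> I X. Phi f x v * a X v x') * (\<Sum>v \<in> I Y. Phi g y v * a Y v y')) /
        t' (FO X) (FO Y) x' y'"
      unfolding xy(3) xy'(3)
    proof (rule C.mm_tensor[OF o])
      fix v w assume vw: "v \<in> I X" "w \<in> I Y"
      show "Phi (f \<star> g) (pr X' Y' x y) (pr X Y v w) = t X' Y' x y * (Phi f x v * Phi g y w) / t X Y v w"
        by (rule C.Phi_tensor[OF f g vw xy(1,2)])
      show "mm (I' (FO (X \<boxtimes> Y))) (a (X \<boxtimes> Y)) (Phi' (J X Y)) (pr X Y v w) (pr' (FO X) (FO Y) x' y') =
        t X Y v w * (a X v x' * a Y w y') / t' (FO X) (FO Y) x' y'"
        by (rule J(3)[OF o vw xy'(1,2)])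
    qed
    also have "\<dots> = ?aR (Phi' (J X' Y' \<cdot>\<^bsub>D\<^esub> (F.FA f \<star>\<^bsub>D\<^esub> F.FA g))) z w"
      unfolding xy(3) xy'(3) J_tensor[OF o' Ff Fg xy(1,2) xy'(1,2)] a_FA[OF f] a_FA[OF g] by (simp add: mm_def)
    finally show "?aR (Phi' (J X' Y' \<cdot>\<^bsub>D\<^esub> (F.FA f \<star>\<^bsub>D\<^esub> F.FA g))) z w = ?aR (Phi' (F.FA (f \<star> g) \<cdot>\<^bsub>D\<^esub> J X Y)) z w" ..
  qed
qed

lemma aE: "X \<in> Obj C \<Longrightarrow> mm (I' (FO X)) (a X) (D.E (FO X)) = a X"
  by (rule F.ae)

text \<open>
  Splittings preserve degrees, so the value of \<open>om\<close> at the degrees in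
  \<open>C\<close> equals the value at the degrees in \<open>D\<close>; therefore both composites
  have the matrix of the threefold product of \<open>a\<close>, scaled alike.
\<close>

lemma hexagon:
  assumes o: "X \<in> Obj C" "Y \<in> Obj C" "Z \<in> Obj C"
  shows "F.FA (assocA C X Y Z) \<cdot>\<^bsub>D\<^esub> (J (X \<boxtimes> Y) Z \<cdot>\<^bsub>D\<^esub> (J X Y \<star>\<^bsub>D\<^esub> idA D (FO Z))) =
      J X (Y \<boxtimes> Z) \<cdot>\<^bsub>D\<^esub> ((idA D (FO X) \<star>\<^bsub>D\<^esub> J Y Z) \<cdot>\<^bsub>D\<^esub> assocA D (FO X) (FO Y) (FO Z))"
proof -
  have o': "FO X \<in> Obj D" "FO Y \<in> Obj D" "FO Z \<in> Obj D" using o by simp_all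
  note oXY = C.tensor_Obj[OF o(1,2)] and oYZ = C.tensor_Obj[OF o(2,3)]
  let ?R = "X \<boxtimes> (Y \<boxtimes> Z)" and ?L = "(X \<boxtimes> Y) \<boxtimes> Z"
  let ?S = "I X \<times> (I Y \<times> I Z)" and ?S' = "I' (FO X) \<times> (I' (FO Y) \<times> I' (FO Z))"
  note iX = D.id_Hom[OF o'(1)] and iZ = D.id_Hom[OF o'(3)]
  note HL = D.comp_Hom[OF D.tensor_Hom[OF J(1)[OF o(1,2)] iZ] J(1)[OF oXY o(3)]]
  note HR = D.comp_Hom[OF D.tensor_Hom[OF iX J(1)[OF o(2,3)]] J(1)[OF o(1) oYZ]]
  note aC = C.assoc_Hom[OF o] and aD = D.assoc_Hom[OF o']
  note HR' = D.tensor_Hom[OF iX J(1)[OF o(2,3)]]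
  let ?hL = "J (X \<boxtimes> Y) Z \<cdot>\<^bsub>D\<^esub> (J X Y \<star>\<^bsub>D\<^esub> idA D (FO Z))"
  let ?hR = "J X (Y \<boxtimes> Z) \<cdot>\<^bsub>D\<^esub> (idA D (FO X) \<star>\<^bsub>D\<^esub> J Y Z)"
  let ?aaa = "ten (a X) (ten (a Y) (a Z))"
  let ?pL = "C.pL X Y Z" and ?tL = "C.tL X Y Z" and ?pR = "C.pR X Y Z" and ?tR = "C.tR X Y Z"
  let ?pL' = "D.pL (FO X) (FO Y) (FO Z)" and ?tL' = "D.tL (FO X) (FO Y) (FO Z)"
  let ?pR' = "D.pR (FO X) (FO Y) (FO Z)" and ?tR' = "D.tR (FO X) (FO Y) (FO Z)"
  let ?om = "C.om3 X Y Z" and ?om' = "D.om3 (FO X) (FO Y) (FO Z)"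
  have L: "cm ?pL ?tL ?pL' ?tL' (mm (I' (FO ?L)) (a ?L) (Phi' ?hL)) \<tau> \<tau>' = ?aaa \<tau> \<tau>'"
    if tt: "\<tau> \<in> ?S" "\<tau>' \<in> ?S'" for \<tau> \<tau>'
  proof -
    obtain x y z x' y' z' where q: "\<tau> = (x, y, z)" "\<tau>' = (x', y', z')"
      and m: "x \<in> I X" "y \<in> I Y" "z \<in> I Z" "x' \<in> I' (FO X)" "y' \<in> I' (FO Y)" "z' \<in> I' (FO Z)"
      using tt by auto
    have mm': "pr X Y x y \<in> I (X \<boxtimes> Y)" "pr' (FO X) (FO Y) x' y' \<in> I' (FO X \<boxtimes>\<^bsub>D\<^esub> FO Y)"
      using m o by simp_all
    show ?thesis
      using J_tensor[OF oXY o(3) J(1)[OF o(1,2)] iZ mm'(1) m(3) mm'(2) m(6)] J(3)[OF o(1,2) m(1,2,4,5)]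
      by (simp add: q cm_def aE[OF o(3)])
  qed
  have R: "cm ?pR ?tR ?pR' ?tR' (mm (I' (FO ?R)) (a ?R) (Phi' ?hR)) \<tau> \<tau>' = ?aaa \<tau> \<tau>'"
    if tt: "\<tau> \<in> ?S" "\<tau>' \<in> ?S'" for \<tau> \<tau>'
  proof -
    obtain x y z x' y' z' where q: "\<tau> = (x, y, z)" "\<tau>' = (x', y', z')"
      and m: "x \<in> I X" "y \<in> I Y" "z \<in> I Z" "x' \<in> I' (FO X)" "y' \<in> I' (FO Y)" "z' \<in> I' (FO Z)"
      using tt by auto
    have mm': "pr Y Z y z \<in> I (Y \<boxtimes> Z)" "pr' (FO Y) (FO Z) y' z' \<in> I' (FO Y \<boxtimes>\<^bsub>D\<^esub> FO Z)"
      using m o by simp_all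
    show ?thesis
      using J_tensor[OF o(1) oYZ iX J(1)[OF o(2,3)] m(1) mm'(1) m(4) mm'(2)] J(3)[OF o(2,3) m(2,3,5,6)]
      by (simp add: q cm_def aE[OF o(1)])
  qed
  have fL: "bij_betw ?pL ?S (I ?L)" "\<And>\<tau>. \<tau> \<in> ?S \<Longrightarrow> ?tL \<tau> \<noteq> 0" and fR: "bij_betw ?pR ?S (I ?R)"
    using C.frame_L[OF o] C.frame_R[OF o] by (auto simp: C.frame_def)
  have fL': "bij_betw ?pL' ?S' (I' ((FO X \<boxtimes>\<^bsub>D\<^esub> FO Y) \<boxtimes>\<^bsub>D\<^esub> FO Z))" "\<And>\<tau>. \<tau> \<in> ?S' \<Longrightarrow> ?tL' \<tau> \<noteq> 0"
    and fR': "bij_betw ?pR' ?S' (I' (FO X \<boxtimes>\<^bsub>D\<^esub> (FO Y \<boxtimes>\<^bsub>D\<^esub> FO Z)))" "\<And>\<tau>. \<tau> \<in> ?S' \<Longrightarrow> ?tR' \<tau> \<noteq> 0"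
    using D.frame_L[OF o'] D.frame_R[OF o'] by (auto simp: D.frame_def)
  have om_aaa: "?om \<tau> * ?aaa \<tau> \<tau>' = ?om' \<tau>' * ?aaa \<tau> \<tau>'" for \<tau> \<tau>'
  proof -
    obtain x y z x' y' z' where q: "\<tau> = (x, y, z)" "\<tau>' = (x', y', z')" by (cases \<tau>; cases \<tau>') auto
    show ?thesis
      using F.a_graded[OF o(1), of x x'] F.a_graded[OF o(2), of y y'] F.a_graded[OF o(3), of z z']
      by (cases "?aaa \<tau> \<tau>' = 0") (auto simp: q)
  qed
  have Eaaa: "mm ?S (C.E3 X Y Z) ?aaa = ?aaa" and aaaE: "mm ?S' ?aaa (D.E3 (FO X) (FO Y) (FO Z)) = ?aaa"
    using o by (simp_all add: mm_ten F.ea F.ae)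
  have key: "cm ?pR ?tR ?pL' ?tL' (mm (I' (FO ?R)) (a ?R) (Phi' (F.FA (assocA C X Y Z) \<cdot>\<^bsub>D\<^esub> ?hL))) \<tau> \<tau>' =
    cm ?pR ?tR ?pL' ?tL' (mm (I' (FO ?R)) (a ?R) (Phi' (?hR \<cdot>\<^bsub>D\<^esub> assocA D (FO X) (FO Y) (FO Z)))) \<tau> \<tau>'"
    if t: "\<tau> \<in> ?S" "\<tau>' \<in> ?S'" for \<tau> \<tau>'
  proof -
    have "mm (I' (FO ?R)) (a ?R) (Phi' (F.FA (assocA C X Y Z) \<cdot>\<^bsub>D\<^esub> ?hL)) =
      mm (I ?L) (Phi (assocA C X Y Z)) (mm (I' (FO ?L)) (a ?L) (Phi' ?hL))"
      unfolding D.Phi_comp[OF HL F.FA(1)[OF aC]] mm_assoc[symmetric] a_FA[OF aC] ..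
    then have "cm ?pR ?tR ?pL' ?tL' (mm (I' (FO ?R)) (a ?R) (Phi' (F.FA (assocA C X Y Z) \<cdot>\<^bsub>D\<^esub> ?hL))) \<tau> \<tau>' =
      mm ?S (cm ?pR ?tR ?pL ?tL (Phi (assocA C X Y Z)))
        (cm ?pL ?tL ?pL' ?tL' (mm (I' (FO ?L)) (a ?L) (Phi' ?hL))) \<tau> \<tau>'"
      by (simp only: cm_mm[OF fL])
    also have "\<dots> = mm ?S (\<lambda>\<tau>' \<tau>. ?om \<tau> * C.E3 X Y Z \<tau>' \<tau>) ?aaa \<tau> \<tau>'"
      using t by (intro mm_cong C.co_assoc[OF o] L)
    also have "\<dots> = mm ?S (C.E3 X Y Z) (\<lambda>\<tau> \<tau>'. ?om \<tau> * ?aaa \<tau> \<tau>') \<tau> \<tau>'"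
      by (simp add: mm_def mult_ac)
    also have "\<dots> = mm ?S (C.E3 X Y Z) (\<lambda>\<tau> \<tau>'. ?om' \<tau>' * ?aaa \<tau> \<tau>') \<tau> \<tau>'"
      by (intro mm_cong refl om_aaa)
    also have "\<dots> = ?om' \<tau>' * mm ?S (C.E3 X Y Z) ?aaa \<tau> \<tau>'"
      by (simp add: mm_def sum_distrib_left mult_ac)
    also have "\<dots> = ?om' \<tau>' * mm ?S' ?aaa (D.E3 (FO X) (FO Y) (FO Z)) \<tau> \<tau>'"
      unfolding Eaaa aaaE ..
    also have "\<dots> = mm ?S' ?aaa (\<lambda>\<tau>' \<tau>. ?om' \<tau> * D.E3 (FO X) (FO Y) (FO Z) \<tau>' \<tau>) \<tau> \<tau>'"
      by (simp add: mm_def sum_distrib_left mult_ac)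
    also have "\<dots> = mm ?S' (cm ?pR ?tR ?pR' ?tR' (mm (I' (FO ?R)) (a ?R) (Phi' ?hR)))
        (cm ?pR' ?tR' ?pL' ?tL' (Phi' (assocA D (FO X) (FO Y) (FO Z)))) \<tau> \<tau>'"
      using t by (intro mm_cong D.co_assoc[OF o', symmetric] R[symmetric])
    also have "\<dots> = cm ?pR ?tR ?pL' ?tL' (mm (I' (FO X \<boxtimes>\<^bsub>D\<^esub> (FO Y \<boxtimes>\<^bsub>D\<^esub> FO Z)))
        (mm (I' (FO ?R)) (a ?R) (Phi' ?hR)) (Phi' (assocA D (FO X) (FO Y) (FO Z)))) \<tau> \<tau>'"
      by (simp only: cm_mm[OF fR'])
    also have "\<dots> = cm ?pR ?tR ?pL' ?tL' (mm (I' (FO ?R)) (a ?R) (Phi' (?hR \<cdot>\<^bsub>D\<^esub> assocA D (FO X) (FO Y) (FO Z)))) \<tau> \<tau>'"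
      unfolding D.Phi_comp[OF aD HR] mm_assoc ..
    finally show ?thesis .
  qed
  have "F.FA (assocA C X Y Z) \<cdot>\<^bsub>D\<^esub> ?hL = ?hR \<cdot>\<^bsub>D\<^esub> assocA D (FO X) (FO Y) (FO Z)"
  proof (rule a_cancel[OF _ D.comp_Hom[OF HL F.FA(1)[OF aC]] D.comp_Hom[OF aD HR]])
    show "?R \<in> Obj C" using o by simp
    fix z w assume zw: "z \<in> I ?R" "w \<in> I' ((FO X \<boxtimes>\<^bsub>D\<^esub> FO Y) \<boxtimes>\<^bsub>D\<^esub> FO Z)"
    have "z \<in> ?pR ` ?S" "w \<in> ?pL' ` ?S'" using zw fR fL'(1) by (simp_all only: bij_betw_def)
    then obtain \<tau> \<tau>' where q: "\<tau> \<in> ?S" "z = ?pR \<tau>" "\<tau>' \<in> ?S'" "w = ?pL' \<tau>'" by blast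
    have "?tR \<tau> \<noteq> 0" "?tL' \<tau>' \<noteq> 0" using q(1,3) by auto
    then show "mm (I' (FO ?R)) (a ?R) (Phi' (F.FA (assocA C X Y Z) \<cdot>\<^bsub>D\<^esub> ?hL)) z w =
      mm (I' (FO ?R)) (a ?R) (Phi' (?hR \<cdot>\<^bsub>D\<^esub> assocA D (FO X) (FO Y) (FO Z))) z w"
      using key[OF q(1,3)] unfolding cm_def q(2,4) by simp
  qed
  also have "\<dots> = J X (Y \<boxtimes> Z) \<cdot>\<^bsub>D\<^esub> ((idA D (FO X) \<star>\<^bsub>D\<^esub> J Y Z) \<cdot>\<^bsub>D\<^esub> assocA D (FO X) (FO Y) (FO Z))"
    using category.comp_assoc[OF D.is_category aD HR' J(1)[OF o(1) oYZ]] .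
  finally show ?thesis .
qed

lemma left_unity:
  assumes o: "X \<in> Obj C"
  shows "F.FA (lunitA C X) \<cdot>\<^bsub>D\<^esub> (J (unitO C) X \<cdot>\<^bsub>D\<^esub> (phi \<star>\<^bsub>D\<^esub> idA D (FO X))) = lunitA D (FO X)"
proof -
  have o': "FO X \<in> Obj D" using o by simp
  note i = D.id_Hom[OF o'] and l = C.lunit_Hom[OF o] and l' = D.lunit_Hom[OF o']
  note H = D.comp_Hom[OF D.tensor_Hom[OF phi(1) i] J(1)[OF C.unit_Obj o]]
  let ?h = "J (unitO C) X \<cdot>\<^bsub>D\<^esub> (phi \<star>\<^bsub>D\<^esub> idA D (FO X))" and ?U = "unitO C \<boxtimes> X"
  show ?thesis
  proof (rule a_cancel[OF o D.comp_Hom[OF H F.FA(1)[OF l]] l'])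
    fix z w assume zw: "z \<in> I X" "w \<in> I' (unitO D \<boxtimes>\<^bsub>D\<^esub> FO X)"
    then obtain y where y: "y \<in> I' (FO X)" "w = pr' (unitO D) (FO X) u0' y"
      using D.pr_ex[OF D.unit_Obj o'] by (auto simp: D.I_unit)
    have "mm (I' (FO X)) (a X) (Phi' (F.FA (lunitA C X) \<cdot>\<^bsub>D\<^esub> ?h)) =
      mm (I ?U) (Phi (lunitA C X)) (mm (I' (FO ?U)) (a ?U) (Phi' ?h))"
      unfolding D.Phi_comp[OF H F.FA(1)[OF l]] mm_assoc[symmetric] a_FA[OF l] ..
    then have "mm (I' (FO X)) (a X) (Phi' (F.FA (lunitA C X) \<cdot>\<^bsub>D\<^esub> ?h)) z w = mm (I ?U) (Phi (lunitA C X)) (mm (I' (FO ?U)) (a ?U) (Phi' ?h)) z w"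
      by (rule arg_cong[where f = "\<lambda>M. M z w"])
    also have "\<dots> = 1 * ((\<Sum>v \<in> I (unitO C). 1 * 1) * (\<Sum>x \<in> I X. (C.cl X x * C.E X z x) * a X x y)) / t' (unitO D) (FO X) u0' y"
      unfolding y(2)
    proof (rule C.mm_tensor[OF C.unit_Obj o])
      fix x0 x assume x: "x0 \<in> I (unitO C)" "x \<in> I X"
      then have [simp]: "x0 = u0" by (simp add: C.I_unit)
      show "Phi (lunitA C X) z (pr (unitO C) X x0 x) = 1 * (1 * (C.cl X x * C.E X z x)) / t (unitO C) X x0 x"
        using x zw o by (simp add: C.Phi_lunit)
      show "mm (I' (FO ?U)) (a ?U) (Phi' ?h) (pr (unitO C) X x0 x) (pr' (unitO D) (FO X) u0' y) =
        t (unitO C) X x0 x * (1 * a X x y) / t' (unitO D) (FO X) u0' y"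
        using x y J_tensor[OF C.unit_Obj o phi(1) i, of x0 x u0' y] by (simp add: phi(3) aE[OF o])
    qed
    also have "\<dots> = (\<Sum>x \<in> I X. C.E X z x * (C.cl X x * a X x y)) / t' (unitO D) (FO X) u0' y"
      by (simp add: C.I_unit mult_ac)
    also have "\<dots> = (\<Sum>x \<in> I X. C.E X z x * (D.cl (FO X) y * a X x y)) / t' (unitO D) (FO X) u0' y"
    proof -
      have "C.cl X x * a X x y = D.cl (FO X) y * a X x y" for x
        using F.a_graded[OF o, of x y] by (cases "a X x y = 0") auto
      then show ?thesis by (simp only:)
    qed
    also have "\<dots> = D.cl (FO X) y * mm (I X) (C.E X) (a X) z y / t' (unitO D) (FO X) u0' y"
      by (simp add: mm_def sum_distrib_left mult_ac)
    also have "mm (I X) (C.E X) (a X) = mm (I' (FO X)) (a X) (D.E (FO X))"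
      using o by (simp add: F.ea F.ae)
    also have "D.cl (FO X) y * mm (I' (FO X)) (a X) (D.E (FO X)) z y / t' (unitO D) (FO X) u0' y =
      mm (I' (FO X)) (a X) (Phi' (lunitA D (FO X))) z w"
      unfolding mm_def sum_distrib_left sum_divide_distrib y(2)
      using y(1) o' by (intro sum.cong refl) (simp add: D.Phi_lunit mult_ac)
    finally show "mm (I' (FO X)) (a X) (Phi' (F.FA (lunitA C X) \<cdot>\<^bsub>D\<^esub> ?h)) z w =
      mm (I' (FO X)) (a X) (Phi' (lunitA D (FO X))) z w" .
  qed
qed

lemma right_unity:
  assumes o: "X \<in> Obj C"
  shows "F.FA (runitA C X) \<cdot>\<^bsub>D\<^esub> (J X (unitO C) \<cdot>\<^bsub>D\<^esub> (idA D (FO X) \<star>\<^bsub>D\<^esub> phi)) = runitA D (FO X)"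
proof -
  have o': "FO X \<in> Obj D" using o by simp
  note i = D.id_Hom[OF o'] and l = C.runit_Hom[OF o] and l' = D.runit_Hom[OF o']
  note H = D.comp_Hom[OF D.tensor_Hom[OF i phi(1)] J(1)[OF o C.unit_Obj]]
  let ?h = "J X (unitO C) \<cdot>\<^bsub>D\<^esub> (idA D (FO X) \<star>\<^bsub>D\<^esub> phi)" and ?U = "X \<boxtimes> unitO C"
  show ?thesis
  proof (rule a_cancel[OF o D.comp_Hom[OF H F.FA(1)[OF l]] l'])
    fix z w assume zw: "z \<in> I X" "w \<in> I' (FO X \<boxtimes>\<^bsub>D\<^esub> unitO D)"
    then obtain y where y: "y \<in> I' (FO X)" "w = pr' (FO X) (unitO D) y u0'"
      using D.pr_ex[OF o' D.unit_Obj] by (auto simp: D.I_unit)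
    have "mm (I' (FO X)) (a X) (Phi' (F.FA (runitA C X) \<cdot>\<^bsub>D\<^esub> ?h)) =
      mm (I ?U) (Phi (runitA C X)) (mm (I' (FO ?U)) (a ?U) (Phi' ?h))"
      unfolding D.Phi_comp[OF H F.FA(1)[OF l]] mm_assoc[symmetric] a_FA[OF l] ..
    then have "mm (I' (FO X)) (a X) (Phi' (F.FA (runitA C X) \<cdot>\<^bsub>D\<^esub> ?h)) z w = mm (I ?U) (Phi (runitA C X)) (mm (I' (FO ?U)) (a ?U) (Phi' ?h)) z w"
      by (rule arg_cong[where f = "\<lambda>M. M z w"])
    also have "\<dots> = 1 * ((\<Sum>x \<in> I X. (C.cr X x * C.E X z x) * a X x y) * (\<Sum>v \<in> I (unitO C). 1 * 1)) / t' (FO X) (unitO D) y u0'"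
      unfolding y(2)
    proof (rule C.mm_tensor[OF o C.unit_Obj])
      fix x x0 assume x: "x \<in> I X" "x0 \<in> I (unitO C)"
      then have [simp]: "x0 = u0" by (simp add: C.I_unit)
      show "Phi (runitA C X) z (pr X (unitO C) x x0) = 1 * ((C.cr X x * C.E X z x) * 1) / t X (unitO C) x x0"
        using x zw o by (simp add: C.Phi_runit)
      show "mm (I' (FO ?U)) (a ?U) (Phi' ?h) (pr X (unitO C) x x0) (pr' (FO X) (unitO D) y u0') =
        t X (unitO C) x x0 * (a X x y * 1) / t' (FO X) (unitO D) y u0'"
        using x y J_tensor[OF o C.unit_Obj i phi(1), of x x0 y u0'] by (simp add: phi(3) aE[OF o])
    qed
    also have "\<dots> = (\<Sum>x \<in> I X. C.E X z x * (C.cr X x * a X x y)) / t' (FO X) (unitO D) y u0'"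
      by (simp add: C.I_unit mult_ac)
    also have "\<dots> = (\<Sum>x \<in> I X. C.E X z x * (D.cr (FO X) y * a X x y)) / t' (FO X) (unitO D) y u0'"
    proof -
      have "C.cr X x * a X x y = D.cr (FO X) y * a X x y" for x
        using F.a_graded[OF o, of x y] by (cases "a X x y = 0") auto
      then show ?thesis by (simp only:)
    qed
    also have "\<dots> = D.cr (FO X) y * mm (I X) (C.E X) (a X) z y / t' (FO X) (unitO D) y u0'"
      by (simp add: mm_def sum_distrib_left mult_ac)
    also have "mm (I X) (C.E X) (a X) = mm (I' (FO X)) (a X) (D.E (FO X))"
      using o by (simp add: F.ea F.ae)
    also have "D.cr (FO X) y * mm (I' (FO X)) (a X) (D.E (FO X)) z y / t' (FO X) (unitO D) y u0' =
      mm (I' (FO X)) (a X) (Phi' (runitA D (FO X))) z w"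
      unfolding mm_def sum_distrib_left sum_divide_distrib y(2)
      using y(1) o' by (intro sum.cong refl) (simp add: D.Phi_runit mult_ac)
    finally show "mm (I' (FO X)) (a X) (Phi' (F.FA (runitA C X) \<cdot>\<^bsub>D\<^esub> ?h)) z w =
      mm (I' (FO X)) (a X) (Phi' (runitA D (FO X))) z w" .
  qed
qed

theorem is_monoidal_functor: "monoidal_functor C D FO F.FA J phi"
proof -
  interpret linear_functor C D FO F.FA by (rule F.is_linear_functor)
  show ?thesis
    by unfold_locales (simp_all only: J(1,2) J_natural phi(1,2) hexagon left_unity right_unity)
qed

end

section \<open>Lexicographic indices\<close>

lemma nth_concat_uniform:
  assumes "\<And>x. x \<in> set xs \<Longrightarrow> length (g x) = n" "i < length xs" "j < n"
  shows "concat (map g xs) ! (i * n + j) = g (xs ! i) ! j"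
  using assms
proof (induction xs arbitrary: i)
  case (Cons x xs)
  then show ?case by (cases i) (auto simp: nth_append add.assoc)
qed simp

lemma length_concat_uniform:
  "(\<And>x. x \<in> set xs \<Longrightarrow> length (g x) = n) \<Longrightarrow> length (concat (map g xs)) = length xs * n"
  by (induction xs) auto

lemma lex_less: "i < a \<Longrightarrow> j < n \<Longrightarrow> i * n + j < a * (n :: nat)"
proof -
  assume "i < a" "j < n"
  then have "i * n + j < i * n + n" "(i + 1) * n \<le> a * n" by (simp, intro mult_le_mono1, simp)
  then show ?thesis by (simp add: algebra_simps)
qed

lemma lex_split:
  assumes "k < a * (n :: nat)"
  obtains i j where "i < a" "j < n" "k = i * n + j"
proof
  have n: "n > 0" using assms by (cases n) auto
  show "k div n < a" using assms n by (simp add: div_less_iff_less_mult)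
  show "k mod n < n" using n by simp
  show "k = k div n * n + k mod n" by simp
qed

lemma lex_div_mod [simp]: "j < n \<Longrightarrow> (i * n + j) div n = i" "j < n \<Longrightarrow> (i * n + j) mod n = (j :: nat)"
  by simp_all

lemma lex_eq: "j < n \<Longrightarrow> j' < n \<Longrightarrow> i * n + j = i' * n + j' \<longleftrightarrow> i = i' \<and> j = (j' :: nat)"
  using lex_div_mod by metis

lemma nth_pairs:
  "i < length xs \<Longrightarrow> j < length ys \<Longrightarrow> [f x y. x \<leftarrow> xs, y \<leftarrow> ys] ! (i * length ys + j) = f (xs ! i) (ys ! j)"
  by (simp add: nth_concat_uniform[where n = "length ys"])

lemma length_pairs: "length [f x y. x \<leftarrow> xs, y \<leftarrow> ys] = length xs * length ys"
  by (simp add: length_concat_uniform[where n = "length ys"])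

lemma length_triples: "length [f x y z. x \<leftarrow> xs, y \<leftarrow> ys, z \<leftarrow> zs] = length xs * (length ys * length zs)"
  by (rule length_concat_uniform) (rule length_pairs)

lemma nth_triples:
  assumes "i < length xs" "j < length ys" "k < length zs"
  shows "[f x y z. x \<leftarrow> xs, y \<leftarrow> ys, z \<leftarrow> zs] ! (i * (length ys * length zs) + (j * length zs + k)) =
    f (xs ! i) (ys ! j) (zs ! k)"
  using assms nth_concat_uniform[of xs "\<lambda>x. [f x y z. y \<leftarrow> ys, z \<leftarrow> zs]" "length ys * length zs" i "j * length zs + k"]
  by (simp only: length_pairs lex_less nth_pairs)

lemma lex_assoc: "(i * a + j) * b + k = i * (a * b) + (j * b + (k :: nat))"
  by (simp add: algebra_simps)

section \<open>Additive envelopes\<close>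

text \<open>
  Zero arrows fill the off-diagonal entries of matrices over the category.
\<close>

locale zero_matrix_mcat = matrix_mcat +
  assumes zero_Hom: "X \<in> Obj C \<Longrightarrow> Y \<in> Obj C \<Longrightarrow> zeroA C X Y \<in> Hom C X Y"
    and Phi_zero: "X \<in> Obj C \<Longrightarrow> Y \<in> Obj C \<Longrightarrow> Phi (zeroA C X Y) = (\<lambda>y x. 0)"
begin

abbreviation "EC \<equiv> additive_envelope C"

definition eI where "eI Xs = Sigma {..<length Xs} (\<lambda>i. I (Xs ! i))"

definition ePhi where
  "ePhi f = (\<lambda>(i, y) (j, x). if i < dim_row (val f) \<and> j < dim_col (val f) then Phi (entry f i j) y x else 0)"

definition edg where "edg Xs = (\<lambda>(i, x). dg (Xs ! i) x)"

definition epr where "epr Xs Ys = (\<lambda>(i, x) (j, y). (i * length Ys + j, pr (Xs ! i) (Ys ! j) x y))"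

definition et where "et Xs Ys = (\<lambda>(i, x) (j, y). t (Xs ! i) (Ys ! j) x y)"

lemma Obj_env: "Xs \<in> Obj EC \<longleftrightarrow> (\<forall>i < length Xs. Xs ! i \<in> Obj C)"
  by (auto simp: additive_envelope_def in_lists_conv_set all_set_conv_all_nth)

lemma Hom_env: "f \<in> Hom EC Xs Ys \<longleftrightarrow> src f = Xs \<and> tgt f = Ys \<and> Xs \<in> Obj EC \<and> Ys \<in> Obj EC \<and>
    val f \<in> carrier_mat (length Ys) (length Xs) \<and>
    (\<forall>i < length Ys. \<forall>j < length Xs. entry f i j \<in> Hom C (Xs ! j) (Ys ! i))"
  by (cases f) (auto simp: Hom_def additive_envelope_def)

lemma ePhi_Hom:
  "f \<in> Hom EC Xs Ys \<Longrightarrow> ePhi f (i, y) (j, x) = (if i < length Ys \<and> j < length Xs then Phi (entry f i j) y x else 0)"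
  by (auto simp: ePhi_def Hom_env)

lemma matrix_arrow_Hom:
  assumes "Xs \<in> Obj EC" "Ys \<in> Obj EC"
    "\<And>i j. i < length Ys \<Longrightarrow> j < length Xs \<Longrightarrow> M i j \<in> Hom C (Xs ! j) (Ys ! i)"
  shows "matrix_arrow Xs Ys M \<in> Hom EC Xs Ys"
  using assms by (auto simp: Hom_env matrix_arrow_def)

lemma ePhi_matrix_arrow [simp]:
  "ePhi (matrix_arrow Xs Ys M) (i, y) (j, x) = (if i < length Ys \<and> j < length Xs then Phi (M i j) y x else 0)"
  by (auto simp: ePhi_def matrix_arrow_def)

lemma src_matrix_arrow [simp]:
  "src (matrix_arrow Xs Ys M) = Xs" "tgt (matrix_arrow Xs Ys M) = Ys"
  by (simp_all add: matrix_arrow_def)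

lemma diagonal_Hom:
  assumes "Xs \<in> Obj EC" "Ys \<in> Obj EC" "length Xs = length Ys"
    "\<And>i. i < length Ys \<Longrightarrow> fs ! i \<in> Hom C (Xs ! i) (Ys ! i)"
  shows "diagonal_arrow C Xs Ys fs \<in> Hom EC Xs Ys"
  unfolding diagonal_arrow_def
  by (rule matrix_arrow_Hom) (use assms in \<open>auto simp: Obj_env zero_Hom\<close>)

lemma ePhi_diagonal:
  "Xs \<in> Obj EC \<Longrightarrow> Ys \<in> Obj EC \<Longrightarrow> i < length Ys \<Longrightarrow> j < length Xs \<Longrightarrow>
    ePhi (diagonal_arrow C Xs Ys fs) (i, y) (j, x) = (if i = j then Phi (fs ! i) y x else 0)"
  by (auto simp: diagonal_arrow_def Obj_env Phi_zero)

lemma hom_sum: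
  assumes "X \<in> Obj C" "Y \<in> Obj C" "\<And>f. f \<in> set fs \<Longrightarrow> f \<in> Hom C X Y"
  shows "hom_sum C X Y fs \<in> Hom C X Y \<and> Phi (hom_sum C X Y fs) = (\<lambda>y x. \<Sum>f \<leftarrow> fs. Phi f y x)"
  using assms(3)
proof (induction fs)
  case Nil
  then show ?case by (simp add: hom_sum_def zero_Hom Phi_zero assms)
next
  case (Cons f fs)
  then have h: "f \<in> Hom C X Y" "hom_sum C X Y fs \<in> Hom C X Y"
    and p: "Phi (hom_sum C X Y fs) = (\<lambda>y x. \<Sum>f \<leftarrow> fs. Phi f y x)" by auto
  have e: "hom_sum C X Y (f # fs) = addA C f (hom_sum C X Y fs)" by (simp add: hom_sum_def)
  show ?case unfolding e using add_Hom[OF h] Phi_add[OF h] by (simp add: p)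
qed

lemma sum_eI:
  "(\<Sum>v \<in> eI Xs. h v) = (\<Sum>i < length Xs. \<Sum>x \<in> I (Xs ! i). h (i, x))" if "Xs \<in> Obj EC" for h :: "_ \<Rightarrow> complex"
  unfolding eI_def using that finite_I by (subst sum.Sigma) (auto simp: Obj_env)

lemma Hom_envD:
  assumes "f \<in> Hom EC Xs Ys"
  shows "Xs \<in> Obj EC" "Ys \<in> Obj EC" "src f = Xs" "tgt f = Ys"
    "i < length Ys \<Longrightarrow> j < length Xs \<Longrightarrow> entry f i j \<in> Hom C (Xs ! j) (Ys ! i)"
  using assms by (auto simp: Hom_env)

lemma comp_env:
  assumes f: "f \<in> Hom EC Xs Ys" and g: "g \<in> Hom EC Ys Zs"
  shows "g \<cdot>\<^bsub>EC\<^esub> f \<in> Hom EC Xs Zs \<and> ePhi (g \<cdot>\<^bsub>EC\<^esub> f) = mm (eI Ys) (ePhi g) (ePhi f)"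
proof -
  note F = Hom_envD[OF f] and G = Hom_envD[OF g]
  let ?fs = "\<lambda>i j. [entry g i k \<cdot>\<^bsub>C\<^esub> entry f k j. k \<leftarrow> [0..<length Ys]]"
  have e: "g \<cdot>\<^bsub>EC\<^esub> f = matrix_arrow Xs Zs (\<lambda>i j. hom_sum C (Xs ! j) (Zs ! i) (?fs i j))"
    using F(3,4) G(4) by (simp add: additive_envelope_def)
  have s: "hom_sum C (Xs ! j) (Zs ! i) (?fs i j) \<in> Hom C (Xs ! j) (Zs ! i) \<and>
      Phi (hom_sum C (Xs ! j) (Zs ! i) (?fs i j)) = (\<lambda>y x. \<Sum>h \<leftarrow> ?fs i j. Phi h y x)"
    if "i < length Zs" "j < length Xs" for i j
    by (rule hom_sum) (use that F G in \<open>auto simp: Obj_env intro!: comp_Hom\<close>)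
  have "ePhi (g \<cdot>\<^bsub>EC\<^esub> f) (i, z) (j, x) = mm (eI Ys) (ePhi g) (ePhi f) (i, z) (j, x)" for i z j x
  proof (cases "i < length Zs \<and> j < length Xs")
    case True
    have "ePhi (g \<cdot>\<^bsub>EC\<^esub> f) (i, z) (j, x) = (\<Sum>k < length Ys. Phi (entry g i k \<cdot>\<^bsub>C\<^esub> entry f k j) z x)"
      using True s by (simp add: e o_def interv_sum_list_conv_sum_set_nat atLeast0LessThan)
    also have "\<dots> = (\<Sum>k < length Ys. mm (I (Ys ! k)) (Phi (entry g i k)) (Phi (entry f k j)) z x)"
      using True by (intro sum.cong refl) (simp add: Phi_comp[OF F(5) G(5)])
    also have "\<dots> = mm (eI Ys) (ePhi g) (ePhi f) (i, z) (j, x)"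
      using True F by (simp add: mm_def sum_eI ePhi_Hom[OF f] ePhi_Hom[OF g])
    finally show ?thesis .
  next
    case False
    then show ?thesis using F by (auto simp: e mm_def sum_eI ePhi_Hom[OF f] ePhi_Hom[OF g])
  qed
  then have "ePhi (g \<cdot>\<^bsub>EC\<^esub> f) = mm (eI Ys) (ePhi g) (ePhi f)" by (intro ext) (metis surj_pair)
  then show ?thesis unfolding e using s F G by (auto intro!: matrix_arrow_Hom)
qed

lemma id_env:
  assumes "Xs \<in> Obj EC"
  shows "idA EC Xs \<in> Hom EC Xs Xs"
    "i < length Xs \<Longrightarrow> j < length Xs \<Longrightarrow> ePhi (idA EC Xs) (i, y) (j, x) = (if i = j then E (Xs ! i) y x else 0)"
  using assms diagonal_Hom[OF assms assms, of "map (idA C) Xs"] ePhi_diagonal[OF assms assms]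
  by (auto simp: additive_envelope_def Obj_env id_Hom)

lemma mm_id_env:
  assumes o: "Xs \<in> Obj EC" and i: "i < length Xs"
  shows "mm (eI Xs) (ePhi (idA EC Xs)) M (i, y) v = mm (I (Xs ! i)) (E (Xs ! i)) (\<lambda>x. M (i, x)) y v"
    "mm (eI Xs) N (ePhi (idA EC Xs)) u (i, y) = mm (I (Xs ! i)) (\<lambda>u x. N u (i, x)) (E (Xs ! i)) u y"
proof -
  have d: "(\<Sum>k < length Xs. if k = i then h k else 0) = h i" for h :: "nat \<Rightarrow> complex"
    using i by simp
  have "mm (eI Xs) (ePhi (idA EC Xs)) M (i, y) v =
      (\<Sum>k < length Xs. if k = i then \<Sum>x \<in> I (Xs ! k). E (Xs ! i) y x * M (k, x) v else 0)"
    unfolding mm_def sum_eI[OF o] using i o by (intro sum.cong refl) (auto simp: id_env)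
  then show "mm (eI Xs) (ePhi (idA EC Xs)) M (i, y) v = mm (I (Xs ! i)) (E (Xs ! i)) (\<lambda>x. M (i, x)) y v"
    unfolding d by (simp add: mm_def)
  have "mm (eI Xs) N (ePhi (idA EC Xs)) u (i, y) =
      (\<Sum>k < length Xs. if k = i then \<Sum>x \<in> I (Xs ! k). N u (k, x) * E (Xs ! i) x y else 0)"
    unfolding mm_def sum_eI[OF o] using i o by (intro sum.cong refl) (auto simp: id_env)
  then show "mm (eI Xs) N (ePhi (idA EC Xs)) u (i, y) = mm (I (Xs ! i)) (\<lambda>u x. N u (i, x)) (E (Xs ! i)) u y"
    unfolding d by (simp add: mm_def)
qed

lemma matrix_cat_env: "matrix_cat EC eI ePhi edg"
proof (rule matrix_cat.intro)
  fix X assume o: "X \<in> Obj EC"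
  show "finite (eI X)" using o finite_I by (auto simp: eI_def Obj_env)
  show "idA EC X \<in> Hom EC X X" using id_env(1)[OF o] .
next
  fix f assume "f \<in> Arr EC"
  then show "src f \<in> Obj EC \<and> tgt f \<in> Obj EC" by (auto simp: additive_envelope_def)
next
  fix f X Y g Z assume f: "f \<in> Hom EC X Y" and g: "g \<in> Hom EC Y Z"
  show "g \<cdot>\<^bsub>EC\<^esub> f \<in> Hom EC X Z" "ePhi (g \<cdot>\<^bsub>EC\<^esub> f) = mm (eI Y) (ePhi g) (ePhi f)"
    using comp_env[OF f g] by auto
next
  fix f X Y g assume f: "f \<in> Hom EC X Y" and g: "g \<in> Hom EC X Y"
  note F = Hom_envD[OF f] and G = Hom_envD[OF g]
  have e: "addA EC f g = matrix_arrow X Y (\<lambda>i j. addA C (entry f i j) (entry g i j))"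
    using F by (simp add: additive_envelope_def)
  show "addA EC f g \<in> Hom EC X Y" unfolding e using F G by (auto intro!: matrix_arrow_Hom add_Hom)
  have "ePhi (addA EC f g) (i, y) (j, x) = ePhi f (i, y) (j, x) + ePhi g (i, y) (j, x)" for i y j x
    using Phi_add[OF F(5) G(5)] by (auto simp: e ePhi_Hom[OF f] ePhi_Hom[OF g])
  then show "ePhi (addA EC f g) = (\<lambda>y x. ePhi f y x + ePhi g y x)" by (intro ext) (metis surj_pair)
  assume eq: "ePhi f = ePhi g"
  have "val f = val g"
  proof (rule eq_matI)
    fix i j assume "i < dim_row (val g)" "j < dim_col (val g)"
    then have ij: "i < length Y" "j < length X" using g by (auto simp: Hom_env)
    have "Phi (entry f i j) y x = Phi (entry g i j) y x" for y x
      using fun_cong[OF fun_cong[OF eq, of "(i, y)"], of "(j, x)"] ij by (simp add: ePhi_Hom[OF f] ePhi_Hom[OF g])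
    then have "Phi (entry f i j) = Phi (entry g i j)" by (intro ext)
    then show "entry f i j = entry g i j" using F(5)[OF ij] G(5)[OF ij] Phi_inj by blast
  qed (use f g in \<open>auto simp: Hom_env\<close>)
  then show "f = g" using F G by (cases f; cases g) auto
next
  fix f X Y c assume f: "f \<in> Hom EC X Y"
  note F = Hom_envD[OF f]
  have e: "scaleA EC c f = matrix_arrow X Y (\<lambda>i j. scaleA C c (entry f i j))"
    using F by (simp add: additive_envelope_def)
  show "scaleA EC c f \<in> Hom EC X Y" unfolding e using F by (auto intro!: matrix_arrow_Hom scale_Hom)
  have "ePhi (scaleA EC c f) (i, y) (j, x) = c * ePhi f (i, y) (j, x)" for i y j x
    using Phi_scale[OF F(5)] by (auto simp: e ePhi_Hom[OF f])
  then show "ePhi (scaleA EC c f) = (\<lambda>y x. c * ePhi f y x)" by (intro ext) (metis surj_pair)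
next
  fix f X Y assume f: "f \<in> Hom EC X Y"
  note F = Hom_envD[OF f]
  have p: "Phi (entry f i j) y x = 0" if "i < length Y" "j < length X" "y \<notin> I (Y ! i) \<or> x \<notin> I (X ! j)" for i j y x
    using Phi_graded[OF F(5)[OF that(1,2)]] that(3) by blast
  have "mm (eI Y) (ePhi (idA EC Y)) (ePhi f) (i, y) (j, x) = ePhi f (i, y) (j, x)" for i y j x
  proof (cases "i < length Y \<and> j < length X")
    case True
    then have "mm (eI Y) (ePhi (idA EC Y)) (ePhi f) (i, y) (j, x) = mm (I (Y ! i)) (E (Y ! i)) (Phi (entry f i j)) y x"
      using F by (simp add: mm_id_env) (simp add: mm_def ePhi_Hom[OF f])
    then show ?thesis using True Phi_id(1)[OF F(5)] by (simp add: ePhi_Hom[OF f])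
  next
    case False
    then show ?thesis using F by (auto simp: mm_def sum_eI ePhi_Hom[OF f] ePhi_Hom[OF id_env(1)])
  qed
  then show "mm (eI Y) (ePhi (idA EC Y)) (ePhi f) = ePhi f" by (intro ext) (metis surj_pair)
  have "mm (eI X) (ePhi f) (ePhi (idA EC X)) (i, y) (j, x) = ePhi f (i, y) (j, x)" for i y j x
  proof (cases "i < length Y \<and> j < length X")
    case True
    then have "mm (eI X) (ePhi f) (ePhi (idA EC X)) (i, y) (j, x) = mm (I (X ! j)) (Phi (entry f i j)) (E (X ! j)) y x"
      using F by (simp add: mm_id_env) (simp add: mm_def ePhi_Hom[OF f])
    then show ?thesis using True Phi_id(2)[OF F(5)] by (simp add: ePhi_Hom[OF f])
  next
    case False
    then show ?thesis using F by (auto simp: mm_def sum_eI ePhi_Hom[OF f] ePhi_Hom[OF id_env(1)])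
  qed
  then show "mm (eI X) (ePhi f) (ePhi (idA EC X)) = ePhi f" by (intro ext) (metis surj_pair)
  fix v u assume nz: "ePhi f v u \<noteq> 0"
  obtain i y j x where q: "v = (i, y)" "u = (j, x)" by (metis surj_pair)
  have "i < length Y" "j < length X" "Phi (entry f i j) y x \<noteq> 0"
    using nz by (auto simp: q ePhi_Hom[OF f] split: if_splits)
  then show "v \<in> eI Y \<and> u \<in> eI X \<and> edg Y v = edg X u"
    using Phi_graded[OF F(5)] by (auto simp: q eI_def edg_def)
next
  fix X Y M assume o: "X \<in> Obj EC" "Y \<in> Obj EC"
    and M: "\<And>y x. M y x \<noteq> 0 \<Longrightarrow> y \<in> eI Y \<and> x \<in> eI X \<and> edg Y y = edg X x"
    and eM: "mm (eI Y) (ePhi (idA EC Y)) M = M" and Me: "mm (eI X) M (ePhi (idA EC X)) = M"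
  have "\<exists>h \<in> Hom C (X ! j) (Y ! i). Phi h = (\<lambda>y x. M (i, y) (j, x))" if ij: "i < length Y" "j < length X" for i j
  proof (rule Phi_surj)
    show "X ! j \<in> Obj C" "Y ! i \<in> Obj C" using o ij by (auto simp: Obj_env)
    fix y x assume "M (i, y) (j, x) \<noteq> 0"
    then show "y \<in> I (Y ! i) \<and> x \<in> I (X ! j) \<and> dg (Y ! i) y = dg (X ! j) x"
      using M[of "(i, y)" "(j, x)"] by (auto simp: eI_def edg_def)
  next
    show "mm (I (Y ! i)) (E (Y ! i)) (\<lambda>y x. M (i, y) (j, x)) = (\<lambda>y x. M (i, y) (j, x))"
    proof (intro ext)
      fix y x
      show "mm (I (Y ! i)) (E (Y ! i)) (\<lambda>y x. M (i, y) (j, x)) y x = M (i, y) (j, x)"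
        using fun_cong[OF fun_cong[OF eM, of "(i, y)"], of "(j, x)"] o ij by (simp add: mm_id_env) (simp add: mm_def)
    qed
    show "mm (I (X ! j)) (\<lambda>y x. M (i, y) (j, x)) (E (X ! j)) = (\<lambda>y x. M (i, y) (j, x))"
    proof (intro ext)
      fix y x
      show "mm (I (X ! j)) (\<lambda>y x. M (i, y) (j, x)) (E (X ! j)) y x = M (i, y) (j, x)"
        using fun_cong[OF fun_cong[OF Me, of "(i, y)"], of "(j, x)"] o ij by (simp add: mm_id_env) (simp add: mm_def)
    qed
  qed
  then obtain h where h: "\<And>i j. i < length Y \<Longrightarrow> j < length X \<Longrightarrow> h i j \<in> Hom C (X ! j) (Y ! i)"
    "\<And>i j. i < length Y \<Longrightarrow> j < length X \<Longrightarrow> Phi (h i j) = (\<lambda>y x. M (i, y) (j, x))"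
    by metis
  have "ePhi (matrix_arrow X Y h) (i, y) (j, x) = M (i, y) (j, x)" for i y j x
    using h(2)[of i j] M[of "(i, y)" "(j, x)"] by (auto simp: eI_def)
  then have "ePhi (matrix_arrow X Y h) = M" by (intro ext) (metis surj_pair)
  then show "\<exists>f \<in> Hom EC X Y. ePhi f = M" using matrix_arrow_Hom[OF o h(1)] by blast
qed

lemma env_simps:
  "tenO EC = envelope_tensor C" "unitO EC = [unitO C]"
  "assocA EC X Y Z = diagonal_arrow C (envelope_tensor C (envelope_tensor C X Y) Z)
       (envelope_tensor C X (envelope_tensor C Y Z)) [assocA C x y z. x \<leftarrow> X, y \<leftarrow> Y, z \<leftarrow> Z]"
  "lunitA EC X = diagonal_arrow C (envelope_tensor C [unitO C] X) X (map (lunitA C) X)"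
  "runitA EC X = diagonal_arrow C (envelope_tensor C X [unitO C]) X (map (runitA C) X)"
  by (simp_all add: additive_envelope_def)

lemma length_tensor [simp]: "length (envelope_tensor C X Y) = length X * length Y"
  unfolding envelope_tensor_def by (rule length_pairs)

lemma nth_tensor [simp]:
  "i < length X \<Longrightarrow> j < length Y \<Longrightarrow> envelope_tensor C X Y ! (i * length Y + j) = X ! i \<boxtimes>\<^bsub>C\<^esub> Y ! j"
  unfolding envelope_tensor_def by (rule nth_pairs)

lemma tensor_env_Obj:
  assumes "X \<in> Obj EC" "Y \<in> Obj EC"
  shows "envelope_tensor C X Y \<in> Obj EC"
  unfolding Obj_env length_tensor
proof (intro allI impI)
  fix k assume "k < length X * length Y"
  then show "envelope_tensor C X Y ! k \<in> Obj C"
    by (elim lex_split) (use assms in \<open>simp add: Obj_env\<close>)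
qed

lemma nth_tensor3:
  assumes "i < length X" "j < length Y" "k < length Z"
  shows "envelope_tensor C (envelope_tensor C X Y) Z ! (i * (length Y * length Z) + (j * length Z + k)) =
      (X ! i \<boxtimes>\<^bsub>C\<^esub> Y ! j) \<boxtimes>\<^bsub>C\<^esub> Z ! k"
    "envelope_tensor C X (envelope_tensor C Y Z) ! (i * (length Y * length Z) + (j * length Z + k)) =
      X ! i \<boxtimes>\<^bsub>C\<^esub> (Y ! j \<boxtimes>\<^bsub>C\<^esub> Z ! k)"
  using assms nth_tensor[of "i * length Y + j" "envelope_tensor C X Y" k Z]
    nth_tensor[of i X "j * length Z + k" "envelope_tensor C Y Z"]
  by (simp_all add: lex_less lex_assoc)

lemma tenA_env:
  assumes f: "f \<in> Hom EC X Y" and g: "g \<in> Hom EC X' Y'"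
  shows "f \<star>\<^bsub>EC\<^esub> g = matrix_arrow (envelope_tensor C X X') (envelope_tensor C Y Y')
    (\<lambda>i j. entry f (i div length Y') (j div length X') \<star>\<^bsub>C\<^esub> entry g (i mod length Y') (j mod length X'))"
    "f \<star>\<^bsub>EC\<^esub> g \<in> Hom EC (envelope_tensor C X X') (envelope_tensor C Y Y')"
proof -
  note F = Hom_envD[OF f] and G = Hom_envD[OF g]
  show e: "f \<star>\<^bsub>EC\<^esub> g = matrix_arrow (envelope_tensor C X X') (envelope_tensor C Y Y')
    (\<lambda>i j. entry f (i div length Y') (j div length X') \<star>\<^bsub>C\<^esub> entry g (i mod length Y') (j mod length X'))"
    using F G by (simp add: additive_envelope_def)
  show "f \<star>\<^bsub>EC\<^esub> g \<in> Hom EC (envelope_tensor C X X') (envelope_tensor C Y Y')"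
    unfolding e
  proof (rule matrix_arrow_Hom)
    fix i j assume "i < length (envelope_tensor C Y Y')" "j < length (envelope_tensor C X X')"
    then have "i < length Y * length Y'" "j < length X * length X'" by simp_all
    then obtain i1 i2 j1 j2 where "i1 < length Y" "i2 < length Y'" "i = i1 * length Y' + i2"
      "j1 < length X" "j2 < length X'" "j = j1 * length X' + j2" by (elim lex_split) blast
    then show "entry f (i div length Y') (j div length X') \<star>\<^bsub>C\<^esub> entry g (i mod length Y') (j mod length X')
      \<in> Hom C (envelope_tensor C X X' ! j) (envelope_tensor C Y Y' ! i)"
      using tensor_Hom[OF F(5) G(5)] by simp
  qed (use F G in \<open>auto intro: tensor_env_Obj\<close>)
qed

lemma epr_ex:
  assumes o: "X \<in> Obj EC" "Y \<in> Obj EC" and v: "v \<in> eI (envelope_tensor C X Y)"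
  shows "\<exists>i j x y. i < length X \<and> j < length Y \<and> x \<in> I (X ! i) \<and> y \<in> I (Y ! j) \<and>
    v = (i * length Y + j, pr (X ! i) (Y ! j) x y)"
proof -
  obtain k z where k: "v = (k, z)" "k < length X * length Y" "z \<in> I (envelope_tensor C X Y ! k)"
    using v by (auto simp: eI_def)
  from k(2) obtain i j where ij: "i < length X" "j < length Y" "k = i * length Y + j" by (rule lex_split)
  have "z \<in> I (X ! i \<boxtimes>\<^bsub>C\<^esub> Y ! j)" using k(3) ij by simp
  then obtain x y where "x \<in> I (X ! i)" "y \<in> I (Y ! j)" "z = pr (X ! i) (Y ! j) x y"
    using pr_ex[of "X ! i" "Y ! j" z] ij o by (auto simp: Obj_env)
  then show ?thesis using ij k(1) by blast
qed

lemma ePhi_tensor: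
  assumes f: "f \<in> Hom EC X Y" and g: "g \<in> Hom EC X' Y'"
    and m: "v \<in> eI X" "w \<in> eI X'" "v' \<in> eI Y" "w' \<in> eI Y'"
  shows "ePhi (f \<star>\<^bsub>EC\<^esub> g) (epr Y Y' v' w') (epr X X' v w) =
    et Y Y' v' w' * (ePhi f v' v * ePhi g w' w) / et X X' v w"
  using m Phi_tensor[OF Hom_envD(5)[OF f] Hom_envD(5)[OF g]]
  by (auto simp: eI_def epr_def et_def tenA_env(1)[OF f g] ePhi_Hom[OF f] ePhi_Hom[OF g] lex_less)

lemma tensor_id_env:
  assumes o: "X \<in> Obj EC" "Y \<in> Obj EC"
  shows "idA EC X \<star>\<^bsub>EC\<^esub> idA EC Y = idA EC (envelope_tensor C X Y)"
proof -
  note T = tensor_env_Obj[OF o] and i = id_env(1)[OF o(1)] id_env(1)[OF o(2)]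
  note L = tenA_env(2)[OF i] and R = id_env(1)[OF T]
  have "ePhi (idA EC X \<star>\<^bsub>EC\<^esub> idA EC Y) v w = ePhi (idA EC (envelope_tensor C X Y)) v w" for v w
  proof (cases "v \<in> eI (envelope_tensor C X Y) \<and> w \<in> eI (envelope_tensor C X Y)")
    case True
    obtain i j x y where v: "i < length X" "j < length Y" "x \<in> I (X ! i)" "y \<in> I (Y ! j)"
      "v = (i * length Y + j, pr (X ! i) (Y ! j) x y)" using epr_ex[OF o] True by blast
    obtain i' j' x' y' where w: "i' < length X" "j' < length Y" "x' \<in> I (X ! i')" "y' \<in> I (Y ! j')"
      "w = (i' * length Y + j', pr (X ! i') (Y ! j') x' y')" using epr_ex[OF o] True by blast
    have vw: "v = epr X Y (i, x) (j, y)" "w = epr X Y (i', x') (j', y')" using v w by (simp_all add: epr_def)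
    have "ePhi (idA EC X \<star>\<^bsub>EC\<^esub> idA EC Y) v w =
      et X Y (i, x) (j, y) * (ePhi (idA EC X) (i, x) (i', x') * ePhi (idA EC Y) (j, y) (j', y')) / et X Y (i', x') (j', y')"
      unfolding vw by (rule ePhi_tensor[OF i]) (use v w in \<open>auto simp: eI_def\<close>)
    also have "\<dots> = ePhi (idA EC (envelope_tensor C X Y)) v w"
      using v w o by (auto simp: id_env[OF o(1)] id_env[OF o(2)] id_env[OF T] lex_less lex_eq et_def Obj_env)
    finally show ?thesis .
  next
    case False
    then show ?thesis
      using matrix_cat.Phi_graded[OF matrix_cat_env L, of v w] matrix_cat.Phi_graded[OF matrix_cat_env R, of v w]
      by metis
  qed
  then show ?thesis by (intro matrix_cat.Phi_inj[OF matrix_cat_env L R] ext)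
qed

text \<open>
  A formal direct sum has the disjoint union of the index sets of its summands, so the additive
  envelope inherits the structure of a category of matrices with the same \<open>om\<close>.
\<close>

theorem envelope: "matrix_mcat EC eI ePhi edg G om epr et (0, u0)"
proof (intro matrix_mcat.intro matrix_mcat_axioms.intro matrix_cat_env)
  show "monoid G" "three_cocycle G om" by (rule monoid_G, rule cocycle)
  show uO: "unitO EC \<in> Obj EC" by (simp add: env_simps Obj_env)
  fix X assume X: "X \<in> Obj EC"
  then have Xo: "\<And>i. i < length X \<Longrightarrow> X ! i \<in> Obj C" by (simp add: Obj_env)
  show "edg X v \<in> carrier G" if "v \<in> eI X" for v
    using that Xo by (auto simp: edg_def eI_def)
  have [simp]: "length (envelope_tensor C [unitO C] X) = length X" "length (envelope_tensor C X [unitO C]) = length X"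
    by simp_all
  have nu: "envelope_tensor C [unitO C] X ! i = unitO C \<boxtimes>\<^bsub>C\<^esub> X ! i"
    "envelope_tensor C X [unitO C] ! i = X ! i \<boxtimes>\<^bsub>C\<^esub> unitO C" if "i < length X" for i
    using nth_tensor[of 0 "[unitO C]" i X] nth_tensor[of i X 0 "[unitO C]"] that by simp_all
  have oU: "envelope_tensor C [unitO C] X \<in> Obj EC" "envelope_tensor C X [unitO C] \<in> Obj EC"
    using tensor_env_Obj X uO by (simp_all add: env_simps)
  show "lunitA EC X \<in> Hom EC (unitO EC \<boxtimes>\<^bsub>EC\<^esub> X) X"
    unfolding env_simps by (rule diagonal_Hom[OF oU(1) X]) (simp_all add: nu Xo lunit_Hom)
  show "runitA EC X \<in> Hom EC (X \<boxtimes>\<^bsub>EC\<^esub> unitO EC) X"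
    unfolding env_simps by (rule diagonal_Hom[OF oU(2) X]) (simp_all add: nu Xo runit_Hom)
  fix v v' assume v: "v \<in> eI X" "v' \<in> eI X"
  obtain i x i' x' where q: "v = (i, x)" "v' = (i', x')" "i < length X" "x \<in> I (X ! i)" "i' < length X" "x' \<in> I (X ! i')"
    using v by (auto simp: eI_def)
  show "ePhi (lunitA EC X) v' (epr (unitO EC) X (0, u0) v) =
        inverse (om \<one>\<^bsub>G\<^esub> \<one>\<^bsub>G\<^esub> (edg X v)) * ePhi (idA EC X) v' v / et (unitO EC) X (0, u0) v"
    using q Xo ePhi_diagonal[OF oU(1) X, of i' i "map (lunitA C) X"]
    by (auto simp: env_simps epr_def et_def edg_def id_env[OF X] Phi_lunit)
  show "ePhi (runitA EC X) v' (epr X (unitO EC) v (0, u0)) =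
        om (edg X v) \<one>\<^bsub>G\<^esub> \<one>\<^bsub>G\<^esub> * ePhi (idA EC X) v' v / et X (unitO EC) v (0, u0)"
    using q Xo ePhi_diagonal[OF oU(2) X, of i' i "map (runitA C) X"]
    by (auto simp: env_simps epr_def et_def edg_def id_env[OF X] Phi_runit)
next
  fix X Y v w show "et X Y v w \<noteq> 0" by (cases v; cases w) (simp add: et_def)
next
  fix X Y assume o: "X \<in> Obj EC" "Y \<in> Obj EC"
  then have Xo: "\<And>i. i < length X \<Longrightarrow> X ! i \<in> Obj C" and Yo: "\<And>i. i < length Y \<Longrightarrow> Y ! i \<in> Obj C"
    by (simp_all add: Obj_env)
  show XY: "X \<boxtimes>\<^bsub>EC\<^esub> Y \<in> Obj EC" using tensor_env_Obj[OF o] by (simp add: env_simps)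
  show "edg (X \<boxtimes>\<^bsub>EC\<^esub> Y) (epr X Y v w) = edg X v \<otimes>\<^bsub>G\<^esub> edg Y w" if "v \<in> eI X" "w \<in> eI Y" for v w
    using that Xo Yo by (auto simp: eI_def epr_def edg_def env_simps)
  show "bij_betw (\<lambda>(x, y). epr X Y x y) (eI X \<times> eI Y) (eI (X \<boxtimes>\<^bsub>EC\<^esub> Y))"
  proof (rule bij_betwI')
    fix v w assume "v \<in> eI X \<times> eI Y" "w \<in> eI X \<times> eI Y"
    then show "((\<lambda>(x, y). epr X Y x y) v = (\<lambda>(x, y). epr X Y x y) w) = (v = w)"
      using Xo Yo by (auto simp: eI_def epr_def lex_eq)
  next
    fix v assume "v \<in> eI X \<times> eI Y"
    then show "(\<lambda>(x, y). epr X Y x y) v \<in> eI (X \<boxtimes>\<^bsub>EC\<^esub> Y)"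
      using Xo Yo by (auto simp: eI_def epr_def env_simps lex_less)
  next
    fix v assume "v \<in> eI (X \<boxtimes>\<^bsub>EC\<^esub> Y)"
    then obtain i j x y where "i < length X" "j < length Y" "x \<in> I (X ! i)" "y \<in> I (Y ! j)"
      "v = (i * length Y + j, pr (X ! i) (Y ! j) x y)" using epr_ex[OF o] unfolding env_simps by blast
    then show "\<exists>u \<in> eI X \<times> eI Y. v = (\<lambda>(x, y). epr X Y x y) u"
      by (intro bexI[of _ "((i, x), (j, y))"]) (auto simp: eI_def epr_def)
  qed
  show "idA EC X \<star>\<^bsub>EC\<^esub> idA EC Y = idA EC (X \<boxtimes>\<^bsub>EC\<^esub> Y)"
    using tensor_id_env[OF o] by (simp add: env_simps)
next
  fix f X Y g X' Y' assume f: "f \<in> Hom EC X Y" and g: "g \<in> Hom EC X' Y'"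
  show "f \<star>\<^bsub>EC\<^esub> g \<in> Hom EC (X \<boxtimes>\<^bsub>EC\<^esub> X') (Y \<boxtimes>\<^bsub>EC\<^esub> Y')" using tenA_env(2)[OF f g] by (simp add: env_simps)
  show "ePhi (f \<star>\<^bsub>EC\<^esub> g) (epr Y Y' v' w') (epr X X' v w) =
        et Y Y' v' w' * (ePhi f v' v * ePhi g w' w) / et X X' v w"
    if "v \<in> eI X" "w \<in> eI X'" "v' \<in> eI Y" "w' \<in> eI Y'" for v w v' w'
    by (rule ePhi_tensor[OF f g that])
next
  show "eI (unitO EC) = {(0, u0)}" by (auto simp: eI_def env_simps I_unit)
  have u: "unitO EC \<in> Obj EC" by (simp add: env_simps Obj_env)
  show "ePhi (idA EC (unitO EC)) (0, u0) (0, u0) = 1" using id_env(2)[OF u, of 0 0] by (simp add: env_simps)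
  show "edg (unitO EC) (0, u0) = \<one>\<^bsub>G\<^esub>" by (simp add: env_simps edg_def)
next
  fix X Y Z assume o: "X \<in> Obj EC" "Y \<in> Obj EC" "Z \<in> Obj EC"
  then have Xo: "\<And>i. i < length X \<Longrightarrow> X ! i \<in> Obj C" and Yo: "\<And>i. i < length Y \<Longrightarrow> Y ! i \<in> Obj C"
    and Zo: "\<And>i. i < length Z \<Longrightarrow> Z ! i \<in> Obj C" by (simp_all add: Obj_env)
  let ?L = "envelope_tensor C (envelope_tensor C X Y) Z" and ?R = "envelope_tensor C X (envelope_tensor C Y Z)"
  have oL: "?L \<in> Obj EC" and oR: "?R \<in> Obj EC" using o by (simp_all add: tensor_env_Obj)
  let ?n = "length Y * length Z"
  show "assocA EC X Y Z \<in> Hom EC ((X \<boxtimes>\<^bsub>EC\<^esub> Y) \<boxtimes>\<^bsub>EC\<^esub> Z) (X \<boxtimes>\<^bsub>EC\<^esub> (Y \<boxtimes>\<^bsub>EC\<^esub> Z))"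
    unfolding env_simps
  proof (rule diagonal_Hom[OF oL oR])
    fix l assume "l < length ?R"
    then have "l < length X * ?n" by simp
    then obtain i l' where i: "i < length X" "l' < ?n" "l = i * ?n + l'" by (rule lex_split)
    from i(2) obtain j k where jk: "j < length Y" "k < length Z" "l' = j * length Z + k" by (rule lex_split)
    show "[assocA C x y z. x \<leftarrow> X, y \<leftarrow> Y, z \<leftarrow> Z] ! l \<in> Hom C (?L ! l) (?R ! l)"
      unfolding i(3) jk(3) nth_triples[OF i(1) jk(1,2)] nth_tensor3[OF i(1) jk(1,2)]
      using assoc_Hom Xo Yo Zo i jk by blast
  qed simp
  fix v1 v2 v3 w1 w2 w3 assume m: "v1 \<in> eI X" "v2 \<in> eI Y" "v3 \<in> eI Z" "w1 \<in> eI X" "w2 \<in> eI Y" "w3 \<in> eI Z"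
  obtain i x j y k z where v: "v1 = (i, x)" "v2 = (j, y)" "v3 = (k, z)"
    "i < length X" "j < length Y" "k < length Z" "x \<in> I (X ! i)" "y \<in> I (Y ! j)" "z \<in> I (Z ! k)"
    using m by (auto simp: eI_def)
  obtain i' x' j' y' k' z' where w: "w1 = (i', x')" "w2 = (j', y')" "w3 = (k', z')"
    "i' < length X" "j' < length Y" "k' < length Z" "x' \<in> I (X ! i')" "y' \<in> I (Y ! j')" "z' \<in> I (Z ! k')"
    using m by (auto simp: eI_def)
  have lt: "i' * ?n + (j' * length Z + k') < length ?R" "i * ?n + (j * length Z + k) < length ?L"
    using v w by (simp_all add: lex_less mult.assoc)
  have eq: "i' * ?n + (j' * length Z + k') = i * ?n + (j * length Z + k) \<longleftrightarrow> i' = i \<and> j' = j \<and> k' = k"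
    using v w by (simp add: lex_eq lex_less)
  have L: "epr (X \<boxtimes>\<^bsub>EC\<^esub> Y) Z (epr X Y v1 v2) v3 =
      (i * ?n + (j * length Z + k), pr (X ! i \<boxtimes>\<^bsub>C\<^esub> Y ! j) (Z ! k) (pr (X ! i) (Y ! j) x y) z)"
    using v by (simp add: epr_def env_simps lex_assoc)
  have R: "epr X (Y \<boxtimes>\<^bsub>EC\<^esub> Z) w1 (epr Y Z w2 w3) =
      (i' * ?n + (j' * length Z + k'), pr (X ! i') (Y ! j' \<boxtimes>\<^bsub>C\<^esub> Z ! k') x' (pr (Y ! j') (Z ! k') y' z'))"
    using w by (simp add: epr_def env_simps)
  show "ePhi (assocA EC X Y Z) (epr X (Y \<boxtimes>\<^bsub>EC\<^esub> Z) w1 (epr Y Z w2 w3)) (epr (X \<boxtimes>\<^bsub>EC\<^esub> Y) Z (epr X Y v1 v2) v3) =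
        et Y Z w2 w3 * et X (Y \<boxtimes>\<^bsub>EC\<^esub> Z) w1 (epr Y Z w2 w3) *
        (om (edg X v1) (edg Y v2) (edg Z v3) *
          (ePhi (idA EC X) w1 v1 * (ePhi (idA EC Y) w2 v2 * ePhi (idA EC Z) w3 v3))) /
        (et X Y v1 v2 * et (X \<boxtimes>\<^bsub>EC\<^esub> Y) Z (epr X Y v1 v2) v3)"
  proof (cases "i' = i \<and> j' = j \<and> k' = k")
    case True
    have "ePhi (assocA EC X Y Z) (epr X (Y \<boxtimes>\<^bsub>EC\<^esub> Z) w1 (epr Y Z w2 w3)) (epr (X \<boxtimes>\<^bsub>EC\<^esub> Y) Z (epr X Y v1 v2) v3) =
      Phi (assocA C (X ! i) (Y ! j) (Z ! k)) (pr (X ! i) (Y ! j \<boxtimes>\<^bsub>C\<^esub> Z ! k) x' (pr (Y ! j) (Z ! k) y' z'))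
        (pr (X ! i \<boxtimes>\<^bsub>C\<^esub> Y ! j) (Z ! k) (pr (X ! i) (Y ! j) x y) z)"
      unfolding L R unfolding env_simps ePhi_diagonal[OF oL oR lt] eq using True
      by (simp only: nth_triples[OF v(4-6)] simp_thms if_True)
    then show ?thesis
      using v w True Xo Yo Zo
      by (simp add: Phi_assoc et_def epr_def env_simps edg_def id_env[OF o(1)] id_env[OF o(2)] id_env[OF o(3)])
  next
    case False
    then have "ePhi (assocA EC X Y Z) (epr X (Y \<boxtimes>\<^bsub>EC\<^esub> Z) w1 (epr Y Z w2 w3)) (epr (X \<boxtimes>\<^bsub>EC\<^esub> Y) Z (epr X Y v1 v2) v3) = 0"
      unfolding L R unfolding env_simps ePhi_diagonal[OF oL oR lt] eq by (simp only: if_False)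
    moreover have "ePhi (idA EC X) w1 v1 * (ePhi (idA EC Y) w2 v2 * ePhi (idA EC Z) w3 v3) = 0"
      using False v w by (auto simp: id_env[OF o(1)] id_env[OF o(2)] id_env[OF o(3)])
    ultimately show ?thesis by simp
  qed
qed

end

section \<open>Graded vector spaces\<close>

lemma dim_kronecker [simp]:
  "dim_row (kronecker A B) = dim_row A * dim_row B" "dim_col (kronecker A B) = dim_col A * dim_col B"
  by (simp_all add: kronecker_def)

lemma index_kronecker:
  "i < dim_row A \<Longrightarrow> j < dim_row B \<Longrightarrow> k < dim_col A \<Longrightarrow> l < dim_col B \<Longrightarrow>
    kronecker A B $$ (i * dim_row B + j, k * dim_col B + l) = A $$ (i, k) * B $$ (j, l)"
  by (simp add: kronecker_def lex_less)

lemma dim_diag_list [simp]: "dim_row (diag_list cs) = length cs" "dim_col (diag_list cs) = length cs"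
  by (simp_all add: diag_list_def mat_diag_def)

lemma index_diag_list:
  "i < length cs \<Longrightarrow> j < length cs \<Longrightarrow> diag_list cs $$ (i, j) = (if i = j then cs ! i else 0)"
  by (simp add: diag_list_def mat_diag_def)

lemma length_graded_tensor [simp]: "length (graded_tensor G gs hs) = length gs * length hs"
  unfolding graded_tensor_def by (rule length_pairs)

lemma nth_graded_tensor [simp]:
  "i < length gs \<Longrightarrow> j < length hs \<Longrightarrow> graded_tensor G gs hs ! (i * length hs + j) = gs ! i \<otimes>\<^bsub>G\<^esub> hs ! j"
  unfolding graded_tensor_def by (rule nth_pairs)

definition vI :: "'g list \<Rightarrow> nat set" where "vI gs = {..<length gs}"

definition vPhi :: "('g list, complex mat) arrow \<Rightarrow> nat \<Rightarrow> nat \<Rightarrow> complex" where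
  "vPhi f i j = (if i < dim_row (val f) \<and> j < dim_col (val f) then entry f i j else 0)"

definition vpr :: "'g list \<Rightarrow> 'g list \<Rightarrow> nat \<Rightarrow> nat \<Rightarrow> nat" where "vpr gs hs i j = i * length hs + j"

locale graded_vector_spaces =
  fixes G :: "('g, 'b) monoid_scheme" and om :: "'g \<Rightarrow> 'g \<Rightarrow> 'g \<Rightarrow> complex"
  assumes monoid_G: "monoid G" and cocycle: "three_cocycle G om"
begin

abbreviation "V \<equiv> graded_vec G om"

lemma Hom_vec: "f \<in> Hom V X Y \<longleftrightarrow> src f = X \<and> tgt f = Y \<and> X \<in> lists (carrier G) \<and> Y \<in> lists (carrier G) \<and>
    val f \<in> carrier_mat (length Y) (length X) \<and>
    (\<forall>i < length Y. \<forall>j < length X. Y ! i \<noteq> X ! j \<longrightarrow> entry f i j = 0)"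
  by (cases f) (auto simp: Hom_def graded_vec_def)

lemma vec_simps:
  "Obj V = lists (carrier G)" "tenO V = graded_tensor G" "unitO V = [\<one>\<^bsub>G\<^esub>]"
  "idA V X = Arrow X X (1\<^sub>m (length X))" "g \<cdot>\<^bsub>V\<^esub> f = Arrow (src f) (tgt g) (val g * val f)"
  "addA V f g = Arrow (src f) (tgt f) (val f + val g)"
  "scaleA V c f = Arrow (src f) (tgt f) (c \<cdot>\<^sub>m val f)"
  "f \<star>\<^bsub>V\<^esub> g = Arrow (graded_tensor G (src f) (src g)) (graded_tensor G (tgt f) (tgt g)) (kronecker (val f) (val g))"
  "assocA V X Y Z = Arrow
       (graded_tensor G (graded_tensor G X Y) Z) (graded_tensor G X (graded_tensor G Y Z))
       (diag_list [om x y z. x \<leftarrow> X, y \<leftarrow> Y, z \<leftarrow> Z])"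
  "lunitA V X = Arrow (graded_tensor G [\<one>\<^bsub>G\<^esub>] X) X (diag_list [inverse (om \<one>\<^bsub>G\<^esub> \<one>\<^bsub>G\<^esub> g). g \<leftarrow> X])"
  "runitA V X = Arrow (graded_tensor G X [\<one>\<^bsub>G\<^esub>]) X (diag_list [om g \<one>\<^bsub>G\<^esub> \<one>\<^bsub>G\<^esub>. g \<leftarrow> X])"
  by (simp_all add: graded_vec_def)

lemma HomD:
  assumes "f \<in> Hom V X Y"
  shows "src f = X" "tgt f = Y" "X \<in> lists (carrier G)" "Y \<in> lists (carrier G)"
    "dim_row (val f) = length Y" "dim_col (val f) = length X"
    "i < length Y \<Longrightarrow> j < length X \<Longrightarrow> Y ! i \<noteq> X ! j \<Longrightarrow> entry f i j = 0"
    "vPhi f i j = (if i < length Y \<and> j < length X then entry f i j else 0)"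
  using assms by (auto simp: Hom_vec vPhi_def)

lemma id_vec: "X \<in> lists (carrier G) \<Longrightarrow> idA V X \<in> Hom V X X"
  "vPhi (idA V X) i j = (if i = j \<and> i < length X then 1 else 0)"
  by (auto simp: Hom_vec vec_simps vPhi_def)

lemma comp_vec:
  assumes f: "f \<in> Hom V X Y" and g: "g \<in> Hom V Y Z"
  shows "g \<cdot>\<^bsub>V\<^esub> f \<in> Hom V X Z \<and> vPhi (g \<cdot>\<^bsub>V\<^esub> f) = mm (vI Y) (vPhi g) (vPhi f)"
proof -
  note F = HomD[OF f] and H = HomD[OF g]
  have e: "(val g * val f) $$ (i, j) = (\<Sum>k < length Y. entry g i k * entry f k j)"
    if "i < length Z" "j < length X" for i j
    using that F H by (simp add: scalar_prod_def atLeast0LessThan)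
  have "entry g i k * entry f k j = 0" if "i < length Z" "j < length X" "k < length Y" "Z ! i \<noteq> X ! j" for i j k
    using F(7)[of k j] H(7)[of i k] that by (cases "Z ! i = Y ! k") auto
  then have "(\<Sum>k < length Y. entry g i k * entry f k j) = 0"
    if "i < length Z" "j < length X" "Z ! i \<noteq> X ! j" for i j
    using that by (intro sum.neutral) blast
  then have "g \<cdot>\<^bsub>V\<^esub> f \<in> Hom V X Z" using F(1-6) H(1-6) by (auto simp: Hom_vec vec_simps e intro!: carrier_matI simp del: index_mult_mat(1))
  moreover have "vPhi (g \<cdot>\<^bsub>V\<^esub> f) i j = mm (vI Y) (vPhi g) (vPhi f) i j" for i j
    using F H by (auto simp: vPhi_def vec_simps e mm_def vI_def simp del: index_mult_mat(1))
  ultimately show ?thesis by blast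
qed

lemma matrix_cat_vec: "matrix_cat V vI vPhi (!)"
proof (rule matrix_cat.intro)
  fix X assume o: "X \<in> Obj V"
  show "finite (vI X)" by (simp add: vI_def)
  show "idA V X \<in> Hom V X X" using id_vec o by (simp add: vec_simps(1))
next
  fix f assume "f \<in> Arr V"
  then show "src f \<in> Obj V \<and> tgt f \<in> Obj V" by (auto simp: graded_vec_def)
next
  fix f X Y g Z assume f: "f \<in> Hom V X Y" and g: "g \<in> Hom V Y Z"
  show "g \<cdot>\<^bsub>V\<^esub> f \<in> Hom V X Z" "vPhi (g \<cdot>\<^bsub>V\<^esub> f) = mm (vI Y) (vPhi g) (vPhi f)"
    using comp_vec[OF f g] by auto
next
  fix f X Y g assume f: "f \<in> Hom V X Y" and g: "g \<in> Hom V X Y"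
  note F = HomD[OF f] and H = HomD[OF g]
  show "addA V f g \<in> Hom V X Y" using f g by (auto simp: Hom_vec vec_simps)
  show "vPhi (addA V f g) = (\<lambda>y x. vPhi f y x + vPhi g y x)"
    using F H by (intro ext) (auto simp: vPhi_def vec_simps)
  assume eq: "vPhi f = vPhi g"
  have "val f = val g"
  proof (rule eq_matI)
    fix i j assume "i < dim_row (val g)" "j < dim_col (val g)"
    then show "entry f i j = entry g i j"
      using fun_cong[OF fun_cong[OF eq, of i], of j] F H by (simp add: vPhi_def)
  qed (use F H in auto)
  then show "f = g" using F H by (cases f; cases g) auto
next
  fix f X Y c assume f: "f \<in> Hom V X Y"
  show "scaleA V c f \<in> Hom V X Y" using f by (auto simp: Hom_vec vec_simps)
  show "vPhi (scaleA V c f) = (\<lambda>y x. c * vPhi f y x)"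
    using HomD[OF f] by (intro ext) (auto simp: vPhi_def vec_simps)
next
  fix f X Y assume f: "f \<in> Hom V X Y"
  note F = HomD[OF f]
  show "mm (vI Y) (vPhi (idA V Y)) (vPhi f) = vPhi f"
    by (intro ext) (auto simp: mm_def id_vec vI_def F(8) if_distrib[of "\<lambda>x. x * _"] cong: if_cong)
  show "mm (vI X) (vPhi f) (vPhi (idA V X)) = vPhi f"
    by (intro ext) (auto simp: mm_def id_vec vI_def F(8) if_distrib[of "\<lambda>x. _ * x"] cong: if_cong)
  fix i j assume nz: "vPhi f i j \<noteq> 0"
  then show "i \<in> vI Y \<and> j \<in> vI X \<and> Y ! i = X ! j"
    using F(7)[of i j] by (auto simp: F(8) vI_def split: if_splits)
next
  fix X Y and M :: "nat \<Rightarrow> nat \<Rightarrow> complex" assume o: "X \<in> Obj V" "Y \<in> Obj V"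
    and M: "\<And>y x. M y x \<noteq> 0 \<Longrightarrow> y \<in> vI Y \<and> x \<in> vI X \<and> Y ! y = X ! x"
  let ?f = "Arrow X Y (mat (length Y) (length X) (\<lambda>(i, j). M i j))"
  have "M i j = 0" if "Y ! i \<noteq> X ! j" for i j using M[of i j] that by blast
  then have "?f \<in> Hom V X Y" using o by (auto simp: Hom_vec vec_simps(1))
  moreover have "vPhi ?f i j = M i j" for i j using M[of i j] by (auto simp: vPhi_def vI_def)
  ultimately show "\<exists>f \<in> Hom V X Y. vPhi f = M" by (intro bexI[of _ ?f]) auto
qed

lemma graded_tensor_Cons: "graded_tensor G (x # xs) ys = map (\<lambda>y. x \<otimes>\<^bsub>G\<^esub> y) ys @ graded_tensor G xs ys"
  by (simp add: graded_tensor_def)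

lemma graded_tensor_append:
  "graded_tensor G (xs @ xs') ys = graded_tensor G xs ys @ graded_tensor G xs' ys"
  by (simp add: graded_tensor_def)

lemma graded_tensor_mem:
  "X \<in> lists (carrier G) \<Longrightarrow> Y \<in> lists (carrier G) \<Longrightarrow> graded_tensor G X Y \<in> lists (carrier G)"
  using monoid.m_closed[OF monoid_G] by (auto simp: graded_tensor_def in_lists_conv_set)

lemma graded_tensor_map:
  "x \<in> carrier G \<Longrightarrow> ys \<in> lists (carrier G) \<Longrightarrow> zs \<in> lists (carrier G) \<Longrightarrow>
    graded_tensor G (map (\<lambda>y. x \<otimes>\<^bsub>G\<^esub> y) ys) zs = map (\<lambda>y. x \<otimes>\<^bsub>G\<^esub> y) (graded_tensor G ys zs)"
  by (induction ys) (auto simp: graded_tensor_def monoid.m_assoc[OF monoid_G] in_lists_conv_set)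

lemma graded_tensor_assoc:
  assumes "X \<in> lists (carrier G)" "Y \<in> lists (carrier G)" "Z \<in> lists (carrier G)"
  shows "graded_tensor G (graded_tensor G X Y) Z = graded_tensor G X (graded_tensor G Y Z)"
  using assms(1)
proof (induction X)
  case Nil
  then show ?case by (simp add: graded_tensor_def)
next
  case (Cons x X)
  then show ?case using assms by (simp add: graded_tensor_Cons graded_tensor_append graded_tensor_map)
qed

lemma graded_tensor_unit:
  assumes "X \<in> lists (carrier G)"
  shows "graded_tensor G [\<one>\<^bsub>G\<^esub>] X = X" "graded_tensor G X [\<one>\<^bsub>G\<^esub>] = X"
  using assms monoid.l_one[OF monoid_G] monoid.r_one[OF monoid_G]
  by (auto simp: graded_tensor_def in_lists_conv_set intro!: map_idI)

lemma diag_Hom: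
  "X \<in> lists (carrier G) \<Longrightarrow> length cs = length X \<Longrightarrow> Arrow X X (diag_list cs) \<in> Hom V X X"
  by (auto simp: Hom_vec index_diag_list intro!: carrier_matI)

lemma vPhi_diag: "length cs = length X \<Longrightarrow> i < length X \<Longrightarrow> j < length X \<Longrightarrow>
    vPhi (Arrow Y Z (diag_list cs)) i j = (if i = j then cs ! i else 0)"
  by (simp add: vPhi_def index_diag_list)

theorem vec: "matrix_mcat V vI vPhi (!) G om vpr (\<lambda>_ _ _ _. 1) 0"
proof (intro matrix_mcat.intro matrix_mcat_axioms.intro matrix_cat_vec)
  show "monoid G" "three_cocycle G om" by (rule monoid_G, rule cocycle)
  show "unitO V \<in> Obj V" using monoid.one_closed[OF monoid_G] by (simp add: vec_simps(1,3))
  fix X assume X: "X \<in> Obj V"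
  then have X': "X \<in> lists (carrier G)" by (simp add: vec_simps(1))
  show "X ! i \<in> carrier G" if "i \<in> vI X" for i using that X' by (auto simp: vI_def in_lists_conv_set)
  show "lunitA V X \<in> Hom V (unitO V \<boxtimes>\<^bsub>V\<^esub> X) X" "runitA V X \<in> Hom V (X \<boxtimes>\<^bsub>V\<^esub> unitO V) X"
    unfolding vec_simps graded_tensor_unit[OF X'] by (rule diag_Hom[OF X']; simp)+
  fix i j assume ij: "i \<in> vI X" "j \<in> vI X"
  show "vPhi (lunitA V X) j (vpr (unitO V) X 0 i) =
      inverse (om \<one>\<^bsub>G\<^esub> \<one>\<^bsub>G\<^esub> (X ! i)) * vPhi (idA V X) j i / 1"
    "vPhi (runitA V X) j (vpr X (unitO V) i 0) = om (X ! i) \<one>\<^bsub>G\<^esub> \<one>\<^bsub>G\<^esub> * vPhi (idA V X) j i / 1"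
    using ij by (auto simp: vec_simps vPhi_def vpr_def vI_def index_diag_list)
next
  fix X Y assume o: "X \<in> Obj V" "Y \<in> Obj V"
  show "X \<boxtimes>\<^bsub>V\<^esub> Y \<in> Obj V" using o graded_tensor_mem by (simp add: vec_simps(1,2))
  show "(X \<boxtimes>\<^bsub>V\<^esub> Y) ! (vpr X Y i j) = X ! i \<otimes>\<^bsub>G\<^esub> Y ! j" if "i \<in> vI X" "j \<in> vI Y" for i j
    using that by (simp add: vI_def vpr_def vec_simps)
  show "bij_betw (\<lambda>(x, y). vpr X Y x y) (vI X \<times> vI Y) (vI (X \<boxtimes>\<^bsub>V\<^esub> Y))"
  proof (rule bij_betwI')
    fix k assume "k \<in> vI (X \<boxtimes>\<^bsub>V\<^esub> Y)"
    then have "k < length X * length Y" by (simp add: vI_def vec_simps)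
    then obtain i j where "i < length X" "j < length Y" "k = i * length Y + j" by (rule lex_split)
    then show "\<exists>u \<in> vI X \<times> vI Y. k = (\<lambda>(x, y). vpr X Y x y) u"
      by (intro bexI[of _ "(i, j)"]) (auto simp: vI_def vpr_def)
  qed (auto simp: vI_def vpr_def vec_simps lex_less lex_eq)
  show "idA V X \<star>\<^bsub>V\<^esub> idA V Y = idA V (X \<boxtimes>\<^bsub>V\<^esub> Y)"
  proof -
    have "kronecker (1\<^sub>m (length X)) (1\<^sub>m (length Y)) = 1\<^sub>m (length X * length Y)"
    proof (rule eq_matI)
      fix k l assume "k < dim_row (1\<^sub>m (length X * length Y))" "l < dim_col (1\<^sub>m (length X * length Y))"
      then have kl: "k < length X * length Y" "l < length X * length Y" by simp_all
      obtain i j where ij: "i < length X" "j < length Y" "k = i * length Y + j" using kl(1) by (rule lex_split)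
      obtain i' j' where ij': "i' < length X" "j' < length Y" "l = i' * length Y + j'" using kl(2) by (rule lex_split)
      show "kronecker (1\<^sub>m (length X)) (1\<^sub>m (length Y)) $$ (k, l) = 1\<^sub>m (length X * length Y) $$ (k, l)"
        using ij ij' index_kronecker[of i "1\<^sub>m (length X)" j "1\<^sub>m (length Y)" i' j'] by (simp add: lex_less lex_eq)
    qed simp_all
    then show ?thesis by (simp add: vec_simps)
  qed
next
  fix f X Y g X' Y' assume f: "f \<in> Hom V X Y" and g: "g \<in> Hom V X' Y'"
  note F = HomD[OF f] and H = HomD[OF g]
  have k: "kronecker (val f) (val g) $$ (i * length Y' + j, k * length X' + l) = entry f i k * entry g j l"
    if "i < length Y" "j < length Y'" "k < length X" "l < length X'" for i j k l
    using index_kronecker[of i "val f" j "val g" k l] that F H by simp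
  show "vPhi (f \<star>\<^bsub>V\<^esub> g) (vpr Y Y' v' w') (vpr X X' v w) = 1 * (vPhi f v' v * vPhi g w' w) / 1"
    if "v \<in> vI X" "w \<in> vI X'" "v' \<in> vI Y" "w' \<in> vI Y'" for v w v' w'
    using that F H k by (simp add: vPhi_def vpr_def vI_def vec_simps lex_less)
  show "f \<star>\<^bsub>V\<^esub> g \<in> Hom V (X \<boxtimes>\<^bsub>V\<^esub> X') (Y \<boxtimes>\<^bsub>V\<^esub> Y')"
  proof -
    have "kronecker (val f) (val g) $$ (p, q) = 0"
      if pq: "p < length Y * length Y'" "q < length X * length X'"
        and ne: "graded_tensor G Y Y' ! p \<noteq> graded_tensor G X X' ! q" for p q
    proof -
      obtain i j where ij: "i < length Y" "j < length Y'" "p = i * length Y' + j" using pq(1) by (rule lex_split)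
      obtain i' j' where ij': "i' < length X" "j' < length X'" "q = i' * length X' + j'" using pq(2) by (rule lex_split)
      have "Y ! i \<noteq> X ! i' \<or> Y' ! j \<noteq> X' ! j'" using ne ij ij' by auto
      then show ?thesis using k[OF ij(1,2) ij'(1,2)] F(7)[OF ij(1) ij'(1)] H(7)[OF ij(2) ij'(2)]
        unfolding ij(3) ij'(3) by auto
    qed
    then show ?thesis using F H by (auto simp: Hom_vec vec_simps graded_tensor_mem intro!: carrier_matI)
  qed
next
  show "vI (unitO V) = {0}" "vPhi (idA V (unitO V)) 0 0 = 1" "unitO V ! 0 = \<one>\<^bsub>G\<^esub>"
    by (auto simp: vI_def vec_simps vPhi_def)
next
  fix X Y Z assume o: "X \<in> Obj V" "Y \<in> Obj V" "Z \<in> Obj V"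
  then have o': "X \<in> lists (carrier G)" "Y \<in> lists (carrier G)" "Z \<in> lists (carrier G)" by (simp_all add: vec_simps(1))
  show "assocA V X Y Z \<in> Hom V ((X \<boxtimes>\<^bsub>V\<^esub> Y) \<boxtimes>\<^bsub>V\<^esub> Z) (X \<boxtimes>\<^bsub>V\<^esub> (Y \<boxtimes>\<^bsub>V\<^esub> Z))"
    unfolding vec_simps graded_tensor_assoc[OF o']
    by (rule diag_Hom) (use o' in \<open>simp_all only: graded_tensor_mem length_graded_tensor length_triples\<close>)
  fix i j k i' j' k' assume "i \<in> vI X" "j \<in> vI Y" "k \<in> vI Z" "i' \<in> vI X" "j' \<in> vI Y" "k' \<in> vI Z"
  then have m: "i < length X" "j < length Y" "k < length Z" "i' < length X" "j' < length Y" "k' < length Z"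
    by (simp_all add: vI_def)
  let ?n = "length Y * length Z" let ?p = "i * ?n + (j * length Z + k)" and ?q = "i' * ?n + (j' * length Z + k')"
  have p: "vpr (X \<boxtimes>\<^bsub>V\<^esub> Y) Z (vpr X Y i j) k = ?p" and q: "vpr X (Y \<boxtimes>\<^bsub>V\<^esub> Z) i' (vpr Y Z j' k') = ?q"
    by (simp_all add: vpr_def vec_simps lex_assoc)
  have lt: "?p < length (graded_tensor G X (graded_tensor G Y Z))" "?q < length (graded_tensor G X (graded_tensor G Y Z))"
    using m by (simp_all add: lex_less)
  have eq: "?q = ?p \<longleftrightarrow> i' = i \<and> j' = j \<and> k' = k"
    using m by (simp add: lex_eq lex_less)
  have "vPhi (assocA V X Y Z) ?q ?p = (if ?q = ?p then [om x y z. x \<leftarrow> X, y \<leftarrow> Y, z \<leftarrow> Z] ! ?q else 0)"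
    unfolding vec_simps by (rule vPhi_diag[OF _ lt(2,1)]) (simp only: length_triples length_graded_tensor)
  then show "vPhi (assocA V X Y Z) (vpr X (Y \<boxtimes>\<^bsub>V\<^esub> Z) i' (vpr Y Z j' k')) (vpr (X \<boxtimes>\<^bsub>V\<^esub> Y) Z (vpr X Y i j) k) =
        1 * 1 * (om (X ! i) (Y ! j) (Z ! k) *
          (vPhi (idA V X) i' i * (vPhi (idA V Y) j' j * vPhi (idA V Z) k' k))) / (1 * 1)"
    unfolding p q eq using m by (simp only: nth_triples id_vec) auto
qed simp_all

end

section \<open>Splitting idempotents\<close>

definition splits where
  "splits S dg e gs a b \<longleftrightarrow>
    set gs \<subseteq> dg ` S \<and>
    (\<forall>x k. a x k \<noteq> 0 \<longrightarrow> x \<in> S \<and> k < length gs \<and> dg x = gs ! k) \<and>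
    (\<forall>x k. b k x \<noteq> 0 \<longrightarrow> x \<in> S \<and> k < length gs \<and> dg x = gs ! k) \<and>
    mm {..<length gs} a b = e \<and>
    mm S b a = (\<lambda>k l. if k = l \<and> k < length gs then 1 else (0 :: complex)) \<and>
    mm S e a = a \<and> mm S b e = b"

text \<open>
  Rank one pieces are split off one by one. If \<open>e x0 y0\<close> is not zero, the column
  \<open>v = e _ y0\<close> and the row \<open>u = e x0 _ / e x0 y0\<close> satisfy \<open>e v =
  v\<close>, \<open>u e = u\<close> and \<open>u v = 1\<close>. Hence \<open>e - v u\<close> is
  an idempotent, and it has fewer nonzero rows, because its row \<open>x0\<close> vanishes.
\<close>

lemma idempotent_splits:
  fixes e :: "'i \<Rightarrow> 'i \<Rightarrow> complex"
  assumes "finite S" "\<And>x y. e x y \<noteq> 0 \<Longrightarrow> x \<in> S \<and> y \<in> S \<and> dg x = dg y" "mm S e e = e"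
  shows "\<exists>gs a b. splits S dg e gs a b"
  using assms(2,3)
proof (induction "card {x \<in> S. \<exists>y. e x y \<noteq> 0}" arbitrary: e rule: less_induct)
  case less
  note gr = less.prems(1) and idem = less.prems(2)
  show ?case
  proof (cases "\<exists>x y. e x y \<noteq> 0")
    case False
    then have "e = (\<lambda>x y. 0)" by (intro ext) auto
    then have "splits S dg e [] (\<lambda>x k. 0) (\<lambda>k x. 0)"
      by (auto simp: splits_def mm_def)
    then show ?thesis by blast
  next
    case True
    then obtain x0 y0 where nz: "e x0 y0 \<noteq> 0" by blast
    define v where "v x = e x y0" for x
    define u where "u y = e x0 y / e x0 y0" for y
    define e' where "e' x y = e x y - v x * u y" for x y
    have ee: "(\<Sum>z \<in> S. e x z * e z y) = e x y" for x y
      using fun_cong[OF fun_cong[OF idem, of x], of y] by (simp add: mm_def)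
    have ev: "(\<Sum>z \<in> S. e x z * v z) = v x" for x by (simp add: v_def ee)
    have ue: "(\<Sum>z \<in> S. u z * e z y) = u y" for y
      by (simp add: u_def ee flip: sum_divide_distrib)
    have uv: "(\<Sum>z \<in> S. u z * v z) = 1"
      using nz by (simp add: u_def v_def ee flip: sum_divide_distrib)
    have ue': "(\<Sum>z \<in> S. u z * e' z y) = 0" for y
    proof -
      have "(\<Sum>z \<in> S. u z * e' z y) = (\<Sum>z \<in> S. u z * e z y) - (\<Sum>z \<in> S. u z * v z) * u y"
        by (simp add: e'_def right_diff_distrib sum_subtractf sum_distrib_right mult.assoc)
      then show ?thesis by (simp add: ue uv)
    qed
    have e'v: "(\<Sum>z \<in> S. e' x z * v z) = 0" for x
    proof -
      have "(\<Sum>z \<in> S. e' x z * v z) = (\<Sum>z \<in> S. e x z * v z) - v x * (\<Sum>z \<in> S. u z * v z)"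
        by (simp add: e'_def left_diff_distrib sum_subtractf sum_distrib_left mult.assoc)
      then show ?thesis by (simp add: ev uv)
    qed
    have ee': "(\<Sum>z \<in> S. e x z * e' z y) = e' x y" for x y
    proof -
      have "(\<Sum>z \<in> S. e x z * e' z y) = (\<Sum>z \<in> S. e x z * e z y) - (\<Sum>z \<in> S. e x z * v z) * u y"
        by (simp add: e'_def right_diff_distrib sum_subtractf sum_distrib_right mult.assoc)
      then show ?thesis by (simp add: ee ev e'_def)
    qed
    have e'e: "(\<Sum>z \<in> S. e' x z * e z y) = e' x y" for x y
    proof -
      have "(\<Sum>z \<in> S. e' x z * e z y) = (\<Sum>z \<in> S. e x z * e z y) - v x * (\<Sum>z \<in> S. u z * e z y)"
        by (simp add: e'_def left_diff_distrib sum_subtractf sum_distrib_left mult.assoc)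
      then show ?thesis by (simp add: ee ue e'_def)
    qed
    have e'e': "(\<Sum>z \<in> S. e' x z * e' z y) = e' x y" for x y
    proof -
      have "(\<Sum>z \<in> S. e' x z * e' z y) = (\<Sum>z \<in> S. e x z * e' z y) - v x * (\<Sum>z \<in> S. u z * e' z y)"
        by (subst e'_def) (simp add: left_diff_distrib sum_subtractf sum_distrib_left mult.assoc)
      then show ?thesis by (simp add: ee' ue')
    qed
    have vS: "x \<in> S \<and> dg x = dg y0" if "v x \<noteq> 0" for x using gr that by (auto simp: v_def)
    have uS: "y \<in> S \<and> dg y = dg y0" if "u y \<noteq> 0" for y
      using gr[of x0 y] gr[OF nz] that by (auto simp: u_def)
    have gr': "x \<in> S \<and> y \<in> S \<and> dg x = dg y" if "e' x y \<noteq> 0" for x y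
    proof (cases "e x y = 0")
      case True
      then have "v x \<noteq> 0" "u y \<noteq> 0" using that by (auto simp: e'_def)
      then show ?thesis using vS uS by auto
    qed (rule gr)
    have smaller: "card {x \<in> S. \<exists>y. e' x y \<noteq> 0} < card {x \<in> S. \<exists>y. e x y \<noteq> 0}"
    proof (rule psubset_card_mono)
      have "e' x0 y = 0" for y using nz by (simp add: e'_def v_def u_def)
      moreover have "e' x y = 0" if "\<forall>y. e x y = 0" for x y using that by (simp add: e'_def v_def)
      moreover have "x0 \<in> S" using gr[OF nz] by simp
      ultimately show "{x \<in> S. \<exists>y. e' x y \<noteq> 0} \<subset> {x \<in> S. \<exists>y. e x y \<noteq> 0}" using nz by blast
    qed (use assms(1) in simp)
    have "mm S e' e' = e'" by (intro ext) (simp add: mm_def e'e')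
    from less.hyps[OF smaller gr' this] obtain gs a b where sp: "splits S dg e' gs a b" by blast
    then have gs: "set gs \<subseteq> dg ` S"
      and a: "\<And>x k. a x k \<noteq> 0 \<Longrightarrow> x \<in> S \<and> k < length gs \<and> dg x = gs ! k"
      and b: "\<And>x k. b k x \<noteq> 0 \<Longrightarrow> x \<in> S \<and> k < length gs \<and> dg x = gs ! k"
      and ab: "mm {..<length gs} a b = e'"
      and ba: "mm S b a = (\<lambda>k l. if k = l \<and> k < length gs then 1 else 0)"
      and e'a: "mm S e' a = a" and be': "mm S b e' = b"
      unfolding splits_def by blast+
    define a1 where "a1 x k = (case k of 0 \<Rightarrow> v x | Suc k \<Rightarrow> a x k)" for x k
    define b1 where "b1 k x = (case k of 0 \<Rightarrow> u x | Suc k \<Rightarrow> b k x)" for k x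
    have ea: "mm S e a = a"
    proof -
      have "mm S e e' = e'" by (intro ext) (simp add: mm_def ee')
      then show ?thesis using e'a mm_assoc[of S S e e' a] by simp
    qed
    have be: "mm S b e = b"
    proof -
      have "mm S e' e = e'" by (intro ext) (simp add: mm_def e'e)
      then show ?thesis using be' mm_assoc[of S S b e' e] by simp
    qed
    have ua: "(\<Sum>z \<in> S. u z * a z k) = 0" for k
    proof -
      let ?u = "\<lambda>_ :: unit. u"
      have "mm S ?u e' = (\<lambda>_ _. 0)" by (intro ext) (simp add: mm_def ue')
      then have "mm S ?u (mm S e' a) = (\<lambda>_ _. 0)" by (simp flip: mm_assoc) (simp add: mm_def)
      then show ?thesis unfolding e'a using fun_cong[OF fun_cong] by (fastforce simp: mm_def)
    qed
    have bv: "(\<Sum>z \<in> S. b k z * v z) = 0" for k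
    proof -
      let ?v = "\<lambda>x (_ :: unit). v x"
      have "mm S e' ?v = (\<lambda>_ _. 0)" by (intro ext) (simp add: mm_def e'v)
      then have "mm S (mm S b e') ?v = (\<lambda>_ _. 0)" by (simp add: mm_assoc) (simp add: mm_def)
      then show ?thesis unfolding be' using fun_cong[OF fun_cong] by (fastforce simp: mm_def)
    qed
    have "splits S dg e (dg y0 # gs) a1 b1"
      unfolding splits_def
    proof (intro conjI allI impI ext)
      show "set (dg y0 # gs) \<subseteq> dg ` S" using gs gr[OF nz] by auto
    next
      fix x k assume "a1 x k \<noteq> 0"
      then have "x \<in> S \<and> k < length (dg y0 # gs) \<and> dg x = (dg y0 # gs) ! k"
        using vS[of x] a[of x "k - 1"] by (cases k) (auto simp: a1_def)
      then show "x \<in> S" "k < length (dg y0 # gs)" "dg x = (dg y0 # gs) ! k" by auto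
    next
      fix x k assume "b1 k x \<noteq> 0"
      then have "x \<in> S \<and> k < length (dg y0 # gs) \<and> dg x = (dg y0 # gs) ! k"
        using uS[of x] b[of "k - 1" x] by (cases k) (auto simp: b1_def)
      then show "x \<in> S" "k < length (dg y0 # gs)" "dg x = (dg y0 # gs) ! k" by auto
    next
      fix x y
      show "mm {..<length (dg y0 # gs)} a1 b1 x y = e x y"
        using fun_cong[OF fun_cong[OF ab, of x], of y]
        by (simp add: mm_def sum.lessThan_Suc_shift a1_def b1_def e'_def del: sum.lessThan_Suc)
    next
      fix k l
      show "mm S b1 a1 k l = (if k = l \<and> k < length (dg y0 # gs) then 1 else 0)"
        using fun_cong[OF fun_cong[OF ba, of "k - 1"], of "l - 1"]
        by (cases k; cases l) (simp_all add: mm_def a1_def b1_def uv ua bv)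
    next
      fix x k
      show "mm S e a1 x k = a1 x k"
        using fun_cong[OF fun_cong[OF ea, of x], of "k - 1"] by (cases k) (simp_all add: mm_def a1_def ev)
    next
      fix k x
      show "mm S b1 e k x = b1 k x"
        using fun_cong[OF fun_cong[OF be, of "k - 1"], of x] by (cases k) (simp_all add: mm_def b1_def ue)
    qed
    then show ?thesis by blast
  qed
qed

lemma (in matrix_mcat) split_functor_to_vec:
  "\<exists>FO a b. split_functor C I Phi dg (graded_vec G om) vI vPhi (!) FO a b"
proof -
  interpret V: graded_vector_spaces G om by (rule graded_vector_spaces.intro[OF monoid_G cocycle])
  have "\<forall>X \<in> Obj C. \<exists>s. splits (I X) (dg X) (E X) (fst s) (fst (snd s)) (snd (snd s))"
    using idempotent_splits[OF finite_I _ E_idem] E_graded by (metis fst_conv snd_conv)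
  then obtain s where s: "\<And>X. X \<in> Obj C \<Longrightarrow> splits (I X) (dg X) (E X) (fst (s X)) (fst (snd (s X))) (snd (snd (s X)))"
    by metis
  have "split_functor C I Phi dg V.V vI vPhi (!) (fst \<circ> s) (fst \<circ> snd \<circ> s) (snd \<circ> snd \<circ> s)"
  proof (intro split_functor.intro split_functor_axioms.intro matrix_cat_axioms V.matrix_cat_vec)
    fix X assume X: "X \<in> Obj C"
    note sp = s[OF X, unfolded splits_def]
    show "(fst \<circ> s) X \<in> Obj V.V" using sp X by (auto simp: V.vec_simps(1))
    show "mm (vI ((fst \<circ> s) X)) ((fst \<circ> snd \<circ> s) X) ((snd \<circ> snd \<circ> s) X) = E X"
      using sp by (simp add: vI_def)
    show "mm (I X) ((snd \<circ> snd \<circ> s) X) ((fst \<circ> snd \<circ> s) X) = vPhi (idA V.V ((fst \<circ> s) X))"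
      using sp by (auto simp: V.id_vec(2) fun_eq_iff)
    show "mm (I X) (E X) ((fst \<circ> snd \<circ> s) X) = (fst \<circ> snd \<circ> s) X"
      "mm (I X) ((snd \<circ> snd \<circ> s) X) (E X) = (snd \<circ> snd \<circ> s) X" using sp by simp_all
    show "x \<in> I X \<and> y \<in> vI ((fst \<circ> s) X) \<and> dg X x = (fst \<circ> s) X ! y" if "(fst \<circ> snd \<circ> s) X x y \<noteq> 0" for x y
      using sp that by (auto simp: vI_def)
    show "x \<in> I X \<and> y \<in> vI ((fst \<circ> s) X) \<and> dg X x = (fst \<circ> s) X ! y" if "(snd \<circ> snd \<circ> s) X y x \<noteq> 0" for x y
      using sp that by (auto simp: vI_def)
  qed
  then show ?thesis by blast
qed

text \<open>
  The one-dimensional space of degree \<open>g\<close> is sent to an object \<open>P g\<close>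
  whose idempotent is the projection to a single basis vector of degree \<open>g\<close>.
\<close>

lemma (in zero_matrix_mcat) split_functor_from_vec:
  assumes P: "\<And>g. g \<in> carrier G \<Longrightarrow> P g \<in> Obj C" "\<And>g. g \<in> carrier G \<Longrightarrow> p g \<in> I (P g)"
    "\<And>g. g \<in> carrier G \<Longrightarrow> dg (P g) (p g) = g"
    and E: "\<And>g y x. g \<in> carrier G \<Longrightarrow> E (P g) y x = (if y = p g \<and> x = p g then 1 else 0)"
  shows "\<exists>GO a b. split_functor (graded_vec G om) vI vPhi (!) EC eI ePhi edg GO a b"
proof -
  interpret V: graded_vector_spaces G om by (rule graded_vector_spaces.intro[OF monoid_G cocycle])
  define a where "a gs k v = (if k < length gs \<and> v = (k, p (gs ! k)) then 1 else 0 :: complex)" for gs k v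
  define b where "b gs v k = (if k < length gs \<and> v = (k, p (gs ! k)) then 1 else 0 :: complex)" for gs v k
  have "split_functor V.V vI vPhi (!) EC eI ePhi edg (map P) a b"
  proof (intro split_functor.intro split_functor_axioms.intro matrix_cat_env V.matrix_cat_vec)
    fix gs assume "gs \<in> Obj V.V"
    then have gs: "\<And>k. k < length gs \<Longrightarrow> gs ! k \<in> carrier G" by (auto simp: V.vec_simps(1) in_lists_conv_set)
    show o: "map P gs \<in> Obj EC" using gs P by (simp add: Obj_env)
    have mem: "(k, p (gs ! k)) \<in> eI (map P gs)" if "k < length gs" for k using that gs P by (simp add: eI_def)
    have fin: "finite (eI (map P gs))" using matrix_cat.finite_I[OF matrix_cat_env o] .
    show ab: "mm (eI (map P gs)) (a gs) (b gs) = vPhi (idA V.V gs)"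
    proof (intro ext)
      fix k l
      show "mm (eI (map P gs)) (a gs) (b gs) k l = vPhi (idA V.V gs) k l"
      proof (cases "k < length gs")
        case True
        then have "mm (eI (map P gs)) (a gs) (b gs) k l =
            (\<Sum>v \<in> eI (map P gs). if v = (k, p (gs ! k)) then b gs v l else 0)"
          unfolding mm_def by (intro sum.cong refl) (simp add: a_def)
        then show ?thesis using True mem[OF True] fin by (auto simp: b_def V.id_vec(2))
      qed (simp add: mm_def a_def V.id_vec(2))
    qed
    have "mm (vI gs) (b gs) (a gs) (i, y) w = ePhi (idA EC (map P gs)) (i, y) w" for i y w
    proof -
      obtain j x where q: "w = (j, x)" by (metis surj_pair)
      have "mm (vI gs) (b gs) (a gs) (i, y) w =
          (\<Sum>k < length gs. if k = i then if y = p (gs ! i) then a gs i w else 0 else 0)"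
        unfolding mm_def vI_def by (intro sum.cong refl) (auto simp: b_def)
      also have "\<dots> = (if i < length gs \<and> y = p (gs ! i) then a gs i w else 0)" by simp
      also have "\<dots> = ePhi (idA EC (map P gs)) (i, y) w"
        using id_env(2)[OF o, of i j y x] ePhi_Hom[OF id_env(1)[OF o], of i y j x] gs
        by (auto simp: a_def q E)
      finally show ?thesis .
    qed
    then show "mm (vI gs) (b gs) (a gs) = ePhi (idA EC (map P gs))" by (intro ext) (metis surj_pair)
    have "mm (vI gs) (vPhi (idA V.V gs)) (a gs) k v = a gs k v" for k v
    proof -
      have "mm (vI gs) (vPhi (idA V.V gs)) (a gs) k v = (\<Sum>z < length gs. if z = k then a gs k v else 0)"
        unfolding mm_def vI_def by (intro sum.cong refl) (auto simp: V.id_vec(2))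
      then show ?thesis by (simp add: a_def)
    qed
    then show "mm (vI gs) (vPhi (idA V.V gs)) (a gs) = a gs" by (intro ext)
    have "mm (vI gs) (b gs) (vPhi (idA V.V gs)) v k = b gs v k" for k v
    proof -
      have "mm (vI gs) (b gs) (vPhi (idA V.V gs)) v k = (\<Sum>z < length gs. if z = k then b gs v k else 0)"
        unfolding mm_def vI_def by (intro sum.cong refl) (auto simp: V.id_vec(2))
      then show ?thesis by (simp add: b_def)
    qed
    then show "mm (vI gs) (b gs) (vPhi (idA V.V gs)) = b gs" by (intro ext)
    show "k \<in> vI gs \<and> v \<in> eI (map P gs) \<and> gs ! k = edg (map P gs) v" if "a gs k v \<noteq> 0" for k v
      using that gs P mem by (auto simp: a_def vI_def edg_def split: if_splits)
    show "k \<in> vI gs \<and> v \<in> eI (map P gs) \<and> gs ! k = edg (map P gs) v" if "b gs v k \<noteq> 0" for k v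
      using that gs P mem by (auto simp: b_def vI_def edg_def split: if_splits)
  qed
  then show ?thesis by blast
qed

theorem (in zero_matrix_mcat) monoidally_equivalent_vec:
  assumes P: "\<And>g. g \<in> carrier G \<Longrightarrow> P g \<in> Obj C" "\<And>g. g \<in> carrier G \<Longrightarrow> p g \<in> I (P g)"
    "\<And>g. g \<in> carrier G \<Longrightarrow> dg (P g) (p g) = g"
    and E: "\<And>g y x. g \<in> carrier G \<Longrightarrow> E (P g) y x = (if y = p g \<and> x = p g then 1 else 0)"
  shows "monoidally_equivalent EC (graded_vec G om)"
proof -
  interpret V: graded_vector_spaces G om by (rule graded_vector_spaces.intro[OF monoid_G cocycle])
  note Em = envelope and Vm = V.vec
  obtain FO a b where F: "split_functor EC eI ePhi edg V.V vI vPhi (!) FO a b"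
    using matrix_mcat.split_functor_to_vec[OF Em] by blast
  obtain GO a' b' where G: "split_functor V.V vI vPhi (!) EC eI ePhi edg GO a' b'"
    using split_functor_from_vec[OF P E] by blast
  have se: "split_equivalence EC eI ePhi edg V.V vI vPhi (!) FO a b GO a' b'"
    by (intro split_equivalence.intro F G)
  have sm: "split_monoidal EC eI ePhi edg G om epr et (0, u0) V.V vI vPhi (!) vpr (\<lambda>_ _ _ _. 1) 0 FO a b"
    by (intro split_monoidal.intro Em Vm F)
  show ?thesis
    unfolding monoidally_equivalent_def
    using matrix_mcat.is_monoidal_category[OF Em] matrix_mcat.is_monoidal_category[OF Vm]
      split_equivalence.is_equivalence[OF se] split_monoidal.is_monoidal_functor[OF sm] by blast
qed

section \<open>Diagrams and their linear combinations\<close>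

lemma stack_assoc_diagram: "stack (stack f g) h = stack f (stack g h)"
  by transfer (rule isotopic.stack_assoc)

lemma beside_assoc_diagram: "beside (beside f g) h = beside f (beside g h)"
  by transfer (rule isotopic.beside_assoc)

lemma stack_strands_diagram:
  "is_diagram G b t f \<Longrightarrow> stack (strands t) f = f" "is_diagram G b t f \<Longrightarrow> stack f (strands b) = f"
  by (transfer, metis isotopic.stack_strands_left isotopic.stack_strands_right)+

lemma beside_empty_diagram [simp]: "beside (strands 0) f = f" "beside f (strands 0) = f"
  by (transfer, rule isotopic.beside_empty_left) (transfer, rule isotopic.beside_empty_right)

lemma beside_strands_diagram: "beside (strands k) (strands l) = strands (k + l)"
  by transfer (rule isotopic.beside_strands)

lemma interchange_diagram:
  "is_diagram G k t f \<Longrightarrow> is_diagram G b k g \<Longrightarrow> is_diagram G' k' t' f' \<Longrightarrow> is_diagram G' b' k' g' \<Longrightarrow>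
    beside (stack f g) (stack f' g') = stack (beside f f') (beside g g')"
  by transfer (rule isotopic.interchange, simp_all)

lemma zigzag_diagram:
  "stack (beside cap (strands 1)) (beside (strands 1) cup) = strands 1"
  "stack (beside (strands 1) cap) (beside cup (strands 1)) = strands 1"
  by (transfer, rule isotopic.zigzag_left) (transfer, rule isotopic.zigzag_right)

lemma click_diagram:
  "is_diagram G b t f \<Longrightarrow> click f =
     stack (beside (strands t) cap)
       (stack (beside (strands 1) (beside f (strands 1))) (beside cup (strands b)))"
  by transfer (auto simp: click_pic_def intro: isotopic_refl)

lemma full_turn_diagram: "(click ^^ (b + t)) (box g b t) = box g b t"
proof -
  have "(click ^^ n) (abs_diagram p) = abs_diagram ((click_pic ^^ n) p)" for n and p :: "'a picture"
    by (induction n) (simp_all add: click.abs_eq)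
  then show ?thesis
    using isotopic.full_turn[of b t g] by (simp add: box.abs_eq diagram.abs_eq_iff)
qed

lemma is_diagram_intros [simp, intro]:
  "is_diagram G n n (strands n)"
  "is_diagram G 0 2 cup"
  "is_diagram G 2 0 cap"
  "(g, b, t) \<in> G \<Longrightarrow> is_diagram G b t (box g b t)"
  by (transfer, simp)+

lemma is_diagram_stack [intro]:
  "is_diagram G k t f \<Longrightarrow> is_diagram G b k g \<Longrightarrow> is_diagram G b t (stack f g)"
  by (transfer, simp)

lemma is_diagram_beside [intro]:
  "is_diagram G b t f \<Longrightarrow> is_diagram G b' t' g \<Longrightarrow> is_diagram G (b + b') (t + t') (beside f g)"
  by (transfer, simp)

lemma is_diagram_click [intro]: "is_diagram G b t f \<Longrightarrow> is_diagram G b t (click f)"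
  by (transfer, simp)

lemma reflect_pic_boxes:
  "boxes (reflect_pic s f) = (\<lambda>(g, b, t). (s g, t, b)) ` boxes f"
  by (induction f) (simp_all add: image_Un Un_commute)

lemma reflect_pic_well_formed: "well_formed (reflect_pic s f) = well_formed f"
  by (induction f) auto

lemma is_diagram_reflect:
  "is_diagram G b t f \<Longrightarrow> (\<lambda>(g, b, t). (s g, t, b)) ` G \<subseteq> G \<Longrightarrow> is_diagram G t b (reflect s f)"
  by transfer (simp only: reflect_pic_boxes reflect_pic_well_formed reflect_pts,
    blast dest: image_mono)

subsection \<open>The vector space of linear combinations\<close>

lemma lookup_scale [simp]: "Poly_Mapping.lookup (scale c x) d = c * Poly_Mapping.lookup x d"
  by (simp add: scale_def Poly_Mapping.map.rep_eq when_def)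

lemma keys_scale: "Poly_Mapping.keys (scale c x) \<subseteq> Poly_Mapping.keys x"
  by (auto simp: in_keys_iff)

lemma scale_simps [simp]:
  "scale c (x + y) = scale c x + scale c y" "scale c (x - y) = scale c x - scale c y"
  "scale c 0 = 0" "scale 0 x = 0" "scale 1 x = x" "scale c (scale d x) = scale (c * d) x"
  "scale (- 1) x = - x" "scale c (Poly_Mapping.single z e) = Poly_Mapping.single z (c * e)"
  by (rule poly_mapping_eqI;
      simp add: lookup_add lookup_minus algebra_simps lookup_single when_def)+

lemma lincomb_induct [case_names zero single add]:
  assumes "P 0" and "\<And>d c. P (Poly_Mapping.single d c)"
    and "\<And>x y. P x \<Longrightarrow> P y \<Longrightarrow> P (x + y)"
  shows "P (x :: 'g lincomb)"
proof (induction x rule: update_induct)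
  case const
  then show ?case by (metis assms(1) poly_mapping_eqI lookup_zero zero_poly_mapping.abs_eq)
next
  case (update f a b)
  have "Poly_Mapping.update a b f = f + Poly_Mapping.single a b"
    using update(1) by (intro poly_mapping_eqI)
      (auto simp: lookup_update lookup_add lookup_single when_def in_keys_iff)
  then show ?case using assms update by metis
qed

lemma free_space_induct [consumes 1, case_names zero single add]:
  assumes "x \<in> free_space A b t" and "P 0"
    and "\<And>d c. is_diagram (gens A) b t d \<Longrightarrow> P (Poly_Mapping.single d c)"
    and "\<And>x y. x \<in> free_space A b t \<Longrightarrow> y \<in> free_space A b t \<Longrightarrow> P x \<Longrightarrow> P y \<Longrightarrow> P (x + y)"
  shows "P x"
proof -
  have "x \<in> free_space A b t \<longrightarrow> P x"
  proof (induction x rule: update_induct)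
    case const
    then show ?case by (metis assms(2) poly_mapping_eqI lookup_zero zero_poly_mapping.abs_eq)
  next
    case (update f a c)
    have eq: "Poly_Mapping.update a c f = f + Poly_Mapping.single a c"
      using update(1) by (intro poly_mapping_eqI)
        (auto simp: lookup_update lookup_add lookup_single when_def in_keys_iff)
    have keys: "Poly_Mapping.keys (Poly_Mapping.update a c f) = insert a (Poly_Mapping.keys f)"
      using update(2) by (simp add: keys_update)
    show ?case
    proof
      assume "Poly_Mapping.update a c f \<in> free_space A b t"
      then have "is_diagram (gens A) b t a" "f \<in> free_space A b t"
        using keys by (auto simp: free_space_def)
      then show "P (Poly_Mapping.update a c f)"
        unfolding eq using assms(3,4) update(3)
        by (auto simp: free_space_def split: if_splits)
    qed
  qed
  then show ?thesis using assms(1) by blast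
qed

lemma bilinear_extension_superset:
  assumes "finite K" "finite L" "Poly_Mapping.keys x \<subseteq> K" "Poly_Mapping.keys y \<subseteq> L"
  shows "bilinear_extension op x y = (\<Sum>d \<in> K. \<Sum>e \<in> L.
    Poly_Mapping.single (op d e) (Poly_Mapping.lookup x d * Poly_Mapping.lookup y e))"
proof -
  have "bilinear_extension op x y = (\<Sum>d \<in> K. \<Sum>e \<in> Poly_Mapping.keys y.
    Poly_Mapping.single (op d e) (Poly_Mapping.lookup x d * Poly_Mapping.lookup y e))"
    unfolding bilinear_extension_def using assms
    by (intro sum.mono_neutral_left) (auto simp: in_keys_iff)
  also have "\<dots> = (\<Sum>d \<in> K. \<Sum>e \<in> L.
    Poly_Mapping.single (op d e) (Poly_Mapping.lookup x d * Poly_Mapping.lookup y e))"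
    using assms by (intro sum.cong refl sum.mono_neutral_left) (auto simp: in_keys_iff)
  finally show ?thesis .
qed

lemma bilinear_extension_simps:
  "bilinear_extension op 0 z = 0" "bilinear_extension op z 0 = 0"
  "bilinear_extension op (x + y) z = bilinear_extension op x z + bilinear_extension op y z"
  "bilinear_extension op z (x + y) = bilinear_extension op z x + bilinear_extension op z y"
  "bilinear_extension op (scale c x) z = scale c (bilinear_extension op x z)"
  "bilinear_extension op z (scale c x) = scale c (bilinear_extension op z x)"
  "bilinear_extension op (Poly_Mapping.single d a) (Poly_Mapping.single e b) =
     Poly_Mapping.single (op d e) (a * b)"
proof -
  let ?K = "Poly_Mapping.keys x \<union> Poly_Mapping.keys y" and ?L = "Poly_Mapping.keys z"
  have sc: "scale c (sum f K) = (\<Sum>d \<in> K. scale c (f d))"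
    for f :: "'a diagram \<Rightarrow> 'b lincomb" and K
    by (induction K rule: infinite_finite_induct) auto
  have sc': "scale c (sum f K) = (\<Sum>d \<in> K. scale c (f d))"
    for f :: "'c diagram \<Rightarrow> 'b lincomb" and K
    by (induction K rule: infinite_finite_induct) auto
  note S = bilinear_extension_superset[where K = ?K and L = ?L]
  note S' = bilinear_extension_superset[where K = ?L and L = ?K]
  have k: "Poly_Mapping.keys (x + y) \<subseteq> ?K" "Poly_Mapping.keys (scale c x) \<subseteq> ?K"
    using keys_add[of x y] keys_scale[of c x] by auto
  show "bilinear_extension op 0 z = 0" "bilinear_extension op z 0 = 0"
    by (simp_all add: bilinear_extension_def)
  show "bilinear_extension op (x + y) z = bilinear_extension op x z + bilinear_extension op y z"
    using k by (simp add: S lookup_add distrib_right single_add sum.distrib)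
  show "bilinear_extension op z (x + y) = bilinear_extension op z x + bilinear_extension op z y"
    using k by (simp add: S' lookup_add distrib_left single_add sum.distrib)
  show "bilinear_extension op (scale c x) z = scale c (bilinear_extension op x z)"
    using k by (simp add: S sc sc' mult.assoc)
  show "bilinear_extension op z (scale c x) = scale c (bilinear_extension op z x)"
    using k by (simp add: S' sc sc' mult.left_commute)
  show "bilinear_extension op (Poly_Mapping.single d a) (Poly_Mapping.single e b) =
     Poly_Mapping.single (op d e) (a * b)"
    by (simp add: bilinear_extension_superset[where K = "{d}" and L = "{e}"])
qed

lemmas stack_lc_simps [simp] = bilinear_extension_simps[where op = stack, folded stack_lc_def]
lemmas beside_lc_simps [simp] = bilinear_extension_simps[where op = beside, folded beside_lc_def]

lemma single_diagram_simps [simp]: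
  "stack_lc \<langle>d\<rangle> \<langle>e\<rangle> = \<langle>stack d e\<rangle>" "beside_lc \<langle>d\<rangle> \<langle>e\<rangle> = \<langle>beside d e\<rangle>"
  by (simp_all add: single_diagram_def)

lemma lc_minus [simp]:
  "stack_lc (x - y) z = stack_lc x z - stack_lc y z" "stack_lc z (x - y) = stack_lc z x - stack_lc z y"
  "beside_lc (x - y) z = beside_lc x z - beside_lc y z"
  "beside_lc z (x - y) = beside_lc z x - beside_lc z y"
proof -
  have eq: "x - y = x + scale (- 1) y" for x y :: "'g lincomb" by simp
  show
  "stack_lc (x - y) z = stack_lc x z - stack_lc y z" "stack_lc z (x - y) = stack_lc z x - stack_lc z y"
  "beside_lc (x - y) z = beside_lc x z - beside_lc y z"
  "beside_lc z (x - y) = beside_lc z x - beside_lc z y"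
    by (simp_all only: eq stack_lc_simps beside_lc_simps)
qed

lemma stack_lc_assoc: "stack_lc (stack_lc x y) z = stack_lc x (stack_lc y z)"
proof (induction x rule: lincomb_induct)
  case (single d c)
  show ?case
  proof (induction y rule: lincomb_induct)
    case (single d' c')
    show ?case
      by (induction z rule: lincomb_induct) (simp_all add: stack_assoc_diagram mult.assoc)
  qed simp_all
qed simp_all

lemma beside_lc_assoc: "beside_lc (beside_lc x y) z = beside_lc x (beside_lc y z)"
proof (induction x rule: lincomb_induct)
  case (single d c)
  show ?case
  proof (induction y rule: lincomb_induct)
    case (single d' c')
    show ?case
      by (induction z rule: lincomb_induct) (simp_all add: beside_assoc_diagram mult.assoc)
  qed simp_all
qed simp_all

lemma beside_lc_empty: "beside_lc \<langle>strands 0\<rangle> x = x" "beside_lc x \<langle>strands 0\<rangle> = x"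
  by (induction x rule: lincomb_induct) (simp_all add: single_diagram_def)

lemma stack_lc_strands:
  assumes "x \<in> free_space A b t"
  shows "stack_lc \<langle>strands t\<rangle> x = x" "stack_lc x \<langle>strands b\<rangle> = x"
  using assms
  by (induction rule: free_space_induct) (simp_all add: single_diagram_def stack_strands_diagram)

lemma interchange_lc:
  assumes "x \<in> free_space A k t" "y \<in> free_space A b k"
    "x' \<in> free_space A k' t'" "y' \<in> free_space A b' k'"
  shows "beside_lc (stack_lc x y) (stack_lc x' y') = stack_lc (beside_lc x x') (beside_lc y y')"
  using assms
proof (induction x rule: free_space_induct)
  case s1: (single d c)
  show ?case using s1(2,3,4,1)
  proof (induction y rule: free_space_induct)
    case s2: (single d' c')
    show ?case using s2(2,3,4,1)
    proof (induction x' rule: free_space_induct)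
      case s3: (single d2 c2)
      show ?case using s3(2,3,4,1)
        by (induction y' rule: free_space_induct)
          (simp_all add: interchange_diagram mult.assoc mult.left_commute)
    qed simp_all
  qed simp_all
qed simp_all

lemma free_space_zero [simp]: "0 \<in> free_space A b t"
  by (simp add: free_space_def)

lemma free_space_single [simp]:
  "is_diagram (gens A) b t d \<Longrightarrow> Poly_Mapping.single d c \<in> free_space A b t"
  "is_diagram (gens A) b t d \<Longrightarrow> \<langle>d\<rangle> \<in> free_space A b t"
  by (auto simp: free_space_def single_diagram_def)

lemma free_space_add [simp]:
  "x \<in> free_space A b t \<Longrightarrow> y \<in> free_space A b t \<Longrightarrow> x + y \<in> free_space A b t"
  using keys_add[of x y] by (auto simp: free_space_def)

lemma free_space_scale [simp]: "x \<in> free_space A b t \<Longrightarrow> scale c x \<in> free_space A b t"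
  using keys_scale[of c x] by (auto simp: free_space_def)

lemma free_space_minus [simp]:
  "x \<in> free_space A b t \<Longrightarrow> y \<in> free_space A b t \<Longrightarrow> x - y \<in> free_space A b t"
  using free_space_add[OF _ free_space_scale[of y A b t "- 1"]] by simp

lemma free_space_stack [simp]:
  "x \<in> free_space A k t \<Longrightarrow> y \<in> free_space A b k \<Longrightarrow> stack_lc x y \<in> free_space A b t"
proof (induction rule: free_space_induct)
  case s: (single d c)
  show ?case using s(2,1) by (induction rule: free_space_induct) (auto simp: is_diagram_stack)
qed simp_all

lemma free_space_beside [simp]:
  "x \<in> free_space A b t \<Longrightarrow> y \<in> free_space A b' t' \<Longrightarrow>
    beside_lc x y \<in> free_space A (b + b') (t + t')"
proof (induction rule: free_space_induct)
  case s: (single d c)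
  show ?case using s(2,1) by (induction rule: free_space_induct) (auto simp: is_diagram_beside)
qed simp_all

lemma adjoint_lc_superset:
  assumes "finite K" "Poly_Mapping.keys x \<subseteq> K"
  shows "adjoint_lc s x =
    (\<Sum>d \<in> K. Poly_Mapping.single (reflect s d) (cnj (Poly_Mapping.lookup x d)))"
  unfolding adjoint_lc_def using assms
  by (intro sum.mono_neutral_left) (auto simp: in_keys_iff)

lemma adjoint_lc_simps [simp]:
  "adjoint_lc s 0 = 0" "adjoint_lc s (x + y) = adjoint_lc s x + adjoint_lc s y"
  "adjoint_lc s (Poly_Mapping.single d c) = Poly_Mapping.single (reflect s d) (cnj c)"
proof -
  let ?K = "Poly_Mapping.keys x \<union> Poly_Mapping.keys y"
  show "adjoint_lc s 0 = 0" by (simp add: adjoint_lc_def)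
  show "adjoint_lc s (x + y) = adjoint_lc s x + adjoint_lc s y"
    using keys_add[of x y]
    by (simp add: adjoint_lc_superset[where K = ?K] lookup_add single_add sum.distrib)
  show "adjoint_lc s (Poly_Mapping.single d c) = Poly_Mapping.single (reflect s d) (cnj c)"
    by (simp add: adjoint_lc_superset[where K = "{d}"])
qed

lemma free_space_adjoint:
  assumes "(\<lambda>(g, b, t). (s g, t, b)) ` gens A \<subseteq> gens A" "x \<in> free_space A b t"
  shows "adjoint_lc s x \<in> free_space A t b"
  using assms(2)
  by (induction rule: free_space_induct) (simp_all add: is_diagram_reflect assms(1))

lemma reflect_beside: "reflect s (beside d e) = beside (reflect s d) (reflect s e)"
  by transfer (simp add: isotopic_refl)

lemma adjoint_lc_beside:
  "adjoint_lc s (beside_lc x y) = beside_lc (adjoint_lc s x) (adjoint_lc s y)"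
proof (induction x rule: lincomb_induct)
  case (single d c)
  show ?case by (induction y rule: lincomb_induct) (simp_all add: reflect_beside)
qed simp_all

section \<open>The quotient as a strict linear monoidal category\<close>

lemma planar_ideal_free: "planar_ideal A b t x \<Longrightarrow> x \<in> free_space A b t"
  by (induction rule: planar_ideal.induct) auto

lemma planar_ideal_minus:
  "planar_ideal A b t x \<Longrightarrow> planar_ideal A b t y \<Longrightarrow> planar_ideal A b t (x - y)"
  using ideal_add[OF _ ideal_scale[of A b t y "- 1"]] by simp

lemma mem_coset: "y \<in> coset A b t x \<longleftrightarrow> y \<in> free_space A b t \<and> planar_ideal A b t (y - x)"
  by (simp add: coset_def)

lemma coset_self: "x \<in> free_space A b t \<Longrightarrow> x \<in> coset A b t x"
  by (simp add: mem_coset ideal_zero)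

lemma coset_eq_iff:
  assumes "x \<in> free_space A b t" "y \<in> free_space A b t"
  shows "coset A b t x = coset A b t y \<longleftrightarrow> planar_ideal A b t (x - y)"
proof
  assume "coset A b t x = coset A b t y"
  then show "planar_ideal A b t (x - y)" using coset_self[OF assms(1)] mem_coset by metis
next
  assume *: "planar_ideal A b t (x - y)"
  have "planar_ideal A b t (z - y) = planar_ideal A b t (z - x)" for z
    using ideal_add[OF *, of "z - x"] planar_ideal_minus[OF _ *, of "z - y"]
    by (auto simp: algebra_simps)
  then show "coset A b t x = coset A b t y" by (simp add: coset_def)
qed

lemma pa_space_cases:
  assumes "S \<in> pa_space A b t"
  obtains x where "x \<in> free_space A b t" "S = coset A b t x"
  using assms by (auto simp: pa_space_def)

lemma coset_pa_space [simp]: "x \<in> free_space A b t \<Longrightarrow> coset A b t x \<in> pa_space A b t"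
  by (simp add: pa_space_def)

lemma UN_coset_const:
  assumes "x \<in> free_space A b t" "\<And>x'. x' \<in> coset A b t x \<Longrightarrow> F x' = C"
  shows "(\<Union>x' \<in> coset A b t x. F x') = C"
  using assms coset_self[OF assms(1)] by auto

lemma pa_add_coset:
  assumes "x \<in> free_space A b t" "y \<in> free_space A b t"
  shows "pa_add A b t (coset A b t x) (coset A b t y) = coset A b t (x + y)"
  unfolding pa_add_def
proof (intro UN_coset_const assms)
  fix x' y' assume *: "x' \<in> coset A b t x" "y' \<in> coset A b t y"
  then have "planar_ideal A b t ((x' - x) + (y' - y))"
    by (intro ideal_add) (auto simp: mem_coset)
  then show "coset A b t (x' + y') = coset A b t (x + y)"
    using assms * by (subst coset_eq_iff) (auto simp: mem_coset algebra_simps)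
qed

lemma pa_scale_coset:
  assumes "x \<in> free_space A b t"
  shows "pa_scale A b t c (coset A b t x) = coset A b t (scale c x)"
  unfolding pa_scale_def
proof (intro UN_coset_const assms)
  fix x' assume *: "x' \<in> coset A b t x"
  then have "planar_ideal A b t (scale c (x' - x))"
    by (intro ideal_scale) (auto simp: mem_coset)
  then show "coset A b t (scale c x') = coset A b t (scale c x)"
    using assms * by (subst coset_eq_iff) (auto simp: mem_coset)
qed

lemma pa_stack_coset:
  assumes "x \<in> free_space A k t" "y \<in> free_space A b k"
  shows "pa_stack A b t (coset A k t x) (coset A b k y) = coset A b t (stack_lc x y)"
  unfolding pa_stack_def
proof (intro UN_coset_const assms)
  fix x' y' assume *: "x' \<in> coset A k t x" "y' \<in> coset A b k y"
  then have "planar_ideal A b t (stack_lc (x' - x) y' + stack_lc x (y' - y))"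
    using assms by (intro ideal_add ideal_stack_left ideal_stack_right) (auto simp: mem_coset)
  then show "coset A b t (stack_lc x' y') = coset A b t (stack_lc x y)"
    using assms * by (subst coset_eq_iff) (auto simp: mem_coset algebra_simps)
qed

lemma pa_beside_coset:
  assumes "x \<in> free_space A b t" "y \<in> free_space A b' t'"
  shows "pa_beside A (b + b') (t + t') (coset A b t x) (coset A b' t' y) =
    coset A (b + b') (t + t') (beside_lc x y)"
  unfolding pa_beside_def
proof (intro UN_coset_const assms)
  fix x' y' assume *: "x' \<in> coset A b t x" "y' \<in> coset A b' t' y"
  then have "planar_ideal A (b + b') (t + t') (beside_lc (x' - x) y' + beside_lc x (y' - y))"
    using assms by (intro ideal_add ideal_beside_left ideal_beside_right) (auto simp: mem_coset)
  then show "coset A (b + b') (t + t') (beside_lc x' y') = coset A (b + b') (t + t') (beside_lc x y)"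
    using assms * by (subst coset_eq_iff) (auto simp: mem_coset algebra_simps)
qed

locale planar_presentation =
  fixes A :: "'g presentation"
begin

text \<open>
  A coset carries its numbers of boundary points as source and target, so that stacking and
  juxtaposition become the operations of a strict monoidal category without size arguments.
\<close>

definition cl :: "nat \<Rightarrow> nat \<Rightarrow> 'g lincomb \<Rightarrow> (nat, 'g lincomb set) arrow" where
  "cl b t x = Arrow b t (coset A b t x)"

definition Mor :: "(nat, 'g lincomb set) arrow set" where
  "Mor = {f. val f \<in> pa_space A (src f) (tgt f)}"

definition comp (infixr \<open>\<odot>\<close> 75) where
  "f \<odot> g = Arrow (src g) (tgt f) (pa_stack A (src g) (tgt f) (val f) (val g))"

definition tens (infixr \<open>||\<close> 80) where
  "f || g = Arrow (src f + src g) (tgt f + tgt g)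
     (pa_beside A (src f + src g) (tgt f + tgt g) (val f) (val g))"

definition add (infixl \<open>\<dotplus>\<close> 65) where
  "f \<dotplus> g = Arrow (src f) (tgt f) (pa_add A (src f) (tgt f) (val f) (val g))"

definition sc where
  "sc c f = Arrow (src f) (tgt f) (pa_scale A (src f) (tgt f) c (val f))"

abbreviation dg where "dg b t d \<equiv> cl b t \<langle>d\<rangle>"

abbreviation I where "I k \<equiv> dg k k (strands k)"
abbreviation zr where "zr b t \<equiv> cl b t 0"

lemma cl_simps [simp]: "src (cl b t x) = b" "tgt (cl b t x) = t"
  by (simp_all add: cl_def)

lemma cl_Mor [simp]: "x \<in> free_space A b t \<Longrightarrow> cl b t x \<in> Mor"
  by (auto simp: cl_def Mor_def)

lemma Mor_cases:
  assumes "f \<in> Mor"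
  obtains b t x where "f = cl b t x" "x \<in> free_space A b t"
  using assms by (cases f) (auto simp: Mor_def cl_def pa_space_def)

lemma cl_eq_iff:
  "x \<in> free_space A b t \<Longrightarrow> y \<in> free_space A b t \<Longrightarrow> cl b t x = cl b t y \<longleftrightarrow> planar_ideal A b t (x - y)"
  by (simp add: cl_def coset_eq_iff)

lemma cl_comp:
  "x \<in> free_space A k t \<Longrightarrow> y \<in> free_space A b k \<Longrightarrow> cl k t x \<odot> cl b k y = cl b t (stack_lc x y)"
  by (simp add: cl_def comp_def pa_stack_coset)

lemma cl_tens:
  "x \<in> free_space A b t \<Longrightarrow> y \<in> free_space A b' t' \<Longrightarrow>
    cl b t x || cl b' t' y = cl (b + b') (t + t') (beside_lc x y)"
  by (simp add: cl_def tens_def pa_beside_coset)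

lemma cl_add:
  "x \<in> free_space A b t \<Longrightarrow> y \<in> free_space A b t \<Longrightarrow> cl b t x \<dotplus> cl b t y = cl b t (x + y)"
  by (simp add: cl_def add_def pa_add_coset)

lemma cl_sc: "x \<in> free_space A b t \<Longrightarrow> sc c (cl b t x) = cl b t (scale c x)"
  by (simp add: cl_def sc_def pa_scale_coset)

lemma op_src_tgt [simp]:
  "src (f \<odot> g) = src g" "tgt (f \<odot> g) = tgt f"
  "src (f || g) = src f + src g" "tgt (f || g) = tgt f + tgt g"
  "src (f \<dotplus> g) = src f" "tgt (f \<dotplus> g) = tgt f"
  "src (sc c f) = src f" "tgt (sc c f) = tgt f"
  by (simp_all add: comp_def tens_def add_def sc_def)

lemmas cl_ops = cl_comp cl_tens cl_add cl_sc

lemma op_Mor [simp]: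
  "f \<in> Mor \<Longrightarrow> g \<in> Mor \<Longrightarrow> src f = tgt g \<Longrightarrow> f \<odot> g \<in> Mor"
  "f \<in> Mor \<Longrightarrow> g \<in> Mor \<Longrightarrow> f || g \<in> Mor"
  "f \<in> Mor \<Longrightarrow> g \<in> Mor \<Longrightarrow> src f = src g \<Longrightarrow> tgt f = tgt g \<Longrightarrow> f \<dotplus> g \<in> Mor"
  "f \<in> Mor \<Longrightarrow> sc c f \<in> Mor"
  by (auto elim!: Mor_cases simp: cl_ops)

lemma comp_assoc:
  "f \<in> Mor \<Longrightarrow> g \<in> Mor \<Longrightarrow> h \<in> Mor \<Longrightarrow> src f = tgt g \<Longrightarrow> src g = tgt h \<Longrightarrow>
    (f \<odot> g) \<odot> h = f \<odot> (g \<odot> h)"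
  by (auto elim!: Mor_cases simp: cl_ops stack_lc_assoc)

lemma comp_I [simp]:
  "f \<in> Mor \<Longrightarrow> tgt f = k \<Longrightarrow> I k \<odot> f = f"
  "f \<in> Mor \<Longrightarrow> src f = k \<Longrightarrow> f \<odot> I k = f"
  by (auto elim!: Mor_cases simp: cl_ops stack_lc_strands)

lemma tens_assoc:
  "f \<in> Mor \<Longrightarrow> g \<in> Mor \<Longrightarrow> h \<in> Mor \<Longrightarrow> (f || g) || h = f || (g || h)"
  by (auto elim!: Mor_cases simp: cl_ops beside_lc_assoc add.assoc)

lemma tens_I0 [simp]: "f \<in> Mor \<Longrightarrow> I 0 || f = f" "f \<in> Mor \<Longrightarrow> f || I 0 = f"
  by (auto elim!: Mor_cases simp: cl_ops beside_lc_empty)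

lemma interchange:
  "f \<in> Mor \<Longrightarrow> g \<in> Mor \<Longrightarrow> f' \<in> Mor \<Longrightarrow> g' \<in> Mor \<Longrightarrow> src f = tgt g \<Longrightarrow> src f' = tgt g' \<Longrightarrow>
    (f || f') \<odot> (g || g') = (f \<odot> g) || (f' \<odot> g')"
  by (auto elim!: Mor_cases simp: cl_ops interchange_lc)

lemma I_tens [simp]: "I k || I l = I (k + l)"
  by (simp add: cl_tens beside_strands_diagram)

lemma comp_linear:
  "f \<in> Mor \<Longrightarrow> g \<in> Mor \<Longrightarrow> h \<in> Mor \<Longrightarrow> src f = src g \<Longrightarrow> tgt f = tgt g \<Longrightarrow> src f = tgt h \<Longrightarrow>
    (f \<dotplus> g) \<odot> h = f \<odot> h \<dotplus> g \<odot> h"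
  "f \<in> Mor \<Longrightarrow> g \<in> Mor \<Longrightarrow> h \<in> Mor \<Longrightarrow> src f = src g \<Longrightarrow> tgt f = tgt g \<Longrightarrow> tgt f = src h \<Longrightarrow>
    h \<odot> (f \<dotplus> g) = h \<odot> f \<dotplus> h \<odot> g"
  "f \<in> Mor \<Longrightarrow> h \<in> Mor \<Longrightarrow> src f = tgt h \<Longrightarrow> sc c f \<odot> h = sc c (f \<odot> h)"
  "f \<in> Mor \<Longrightarrow> h \<in> Mor \<Longrightarrow> tgt f = src h \<Longrightarrow> h \<odot> sc c f = sc c (h \<odot> f)"
  by (auto elim!: Mor_cases simp: cl_ops)

lemma tens_linear:
  "f \<in> Mor \<Longrightarrow> g \<in> Mor \<Longrightarrow> h \<in> Mor \<Longrightarrow> src f = src g \<Longrightarrow> tgt f = tgt g \<Longrightarrow>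
    (f \<dotplus> g) || h = f || h \<dotplus> g || h"
  "f \<in> Mor \<Longrightarrow> g \<in> Mor \<Longrightarrow> h \<in> Mor \<Longrightarrow> src f = src g \<Longrightarrow> tgt f = tgt g \<Longrightarrow>
    h || (f \<dotplus> g) = h || f \<dotplus> h || g"
  "f \<in> Mor \<Longrightarrow> h \<in> Mor \<Longrightarrow> sc c f || h = sc c (f || h)"
  "f \<in> Mor \<Longrightarrow> h \<in> Mor \<Longrightarrow> h || sc c f = sc c (h || f)"
  by (auto elim!: Mor_cases simp: cl_ops)

lemma zr_ops [simp]:
  "h \<in> Mor \<Longrightarrow> tgt h = k \<Longrightarrow> zr k t \<odot> h = zr (src h) t"
  "h \<in> Mor \<Longrightarrow> src h = k \<Longrightarrow> h \<odot> zr b k = zr b (tgt h)"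
  "h \<in> Mor \<Longrightarrow> zr b t || h = zr (b + src h) (t + tgt h)"
  "h \<in> Mor \<Longrightarrow> h || zr b t = zr (src h + b) (tgt h + t)"
  "h \<in> Mor \<Longrightarrow> src h = b \<Longrightarrow> tgt h = t \<Longrightarrow> h \<dotplus> zr b t = h"
  "h \<in> Mor \<Longrightarrow> src h = b \<Longrightarrow> tgt h = t \<Longrightarrow> zr b t \<dotplus> h = h"
  "sc c (zr b t) = zr b t"
  "h \<in> Mor \<Longrightarrow> sc 0 h = zr (src h) (tgt h)"
  "h \<in> Mor \<Longrightarrow> sc 1 h = h"
  by (auto elim!: Mor_cases simp: cl_ops)

lemma sc_sc [simp]: "f \<in> Mor \<Longrightarrow> sc c (sc d f) = sc (c * d) f"
  by (auto elim!: Mor_cases simp: cl_ops)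

lemma sc_add: "f \<in> Mor \<Longrightarrow> g \<in> Mor \<Longrightarrow> src f = src g \<Longrightarrow> tgt f = tgt g \<Longrightarrow>
  sc c (f \<dotplus> g) = sc c f \<dotplus> sc c g"
  by (auto elim!: Mor_cases simp: cl_ops)

lemma dg_comp: "is_diagram (gens A) k t d \<Longrightarrow> is_diagram (gens A) b k e \<Longrightarrow>
    dg k t d \<odot> dg b k e = dg b t (stack d e)"
  by (simp add: cl_comp)

lemma dg_tens: "is_diagram (gens A) b t d \<Longrightarrow> is_diagram (gens A) b' t' e \<Longrightarrow>
    dg b t d || dg b' t' e = dg (b + b') (t + t') (beside d e)"
  by (simp add: cl_tens)

end

section \<open>The state sum\<close>

definition words :: "nat \<Rightarrow> bool list set" where
  "words k = {w. length w = k}"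

lemma finite_words [simp]: "finite (words k)"
  using finite_lists_length_eq[of "UNIV :: bool set" k] by (simp add: words_def)

lemma mem_words [simp]: "w \<in> words k \<longleftrightarrow> length w = k"
  by (simp add: words_def)

lemma words_0 [simp]: "words 0 = {[]}"
  by (auto simp: words_def)

lemma sum_words_Suc:
  "(\<Sum>u \<in> words (Suc k). F u) = (\<Sum>u \<in> words k. F (True # u) + F (False # u))"
  for F :: "bool list \<Rightarrow> complex"
proof -
  have "words (Suc k) = (Cons True ` words k) \<union> (Cons False ` words k)"
    by (auto simp: words_def length_Suc_conv image_iff)
  moreover have "(Cons True ` words k) \<inter> (Cons False ` words k) = {}" by auto
  ultimately show ?thesis
    by (simp add: sum.union_disjoint sum.reindex sum.distrib)
qed

lemma sum_words_append:
  "(\<Sum>u \<in> words (k + l). F u) = (\<Sum>u \<in> words k. \<Sum>u' \<in> words l. F (u @ u'))"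
  for F :: "bool list \<Rightarrow> complex"
  by (induction k arbitrary: F) (simp_all add: sum_words_Suc sum.distrib)

lemma sum_words_delta [simp]:
  "(\<Sum>u \<in> words k. of_bool (v = u) * F u) = (if length v = k then F v else 0)"
  "(\<Sum>u \<in> words k. F u * of_bool (u = v)) = (if length v = k then F v else 0)"
  for F :: "bool list \<Rightarrow> complex"
proof -
  have "(\<Sum>u \<in> words k. of_bool (v = u) * F u) = (\<Sum>u \<in> words k. if u = v then F u else 0)"
    by (intro sum.cong) auto
  then show "(\<Sum>u \<in> words k. of_bool (v = u) * F u) = (if length v = k then F v else 0)"
    by simp
  have "(\<Sum>u \<in> words k. F u * of_bool (u = v)) = (\<Sum>u \<in> words k. if u = v then F u else 0)"
    by (intro sum.cong) auto
  then show "(\<Sum>u \<in> words k. F u * of_bool (u = v)) = (if length v = k then F v else 0)"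
    by simp
qed

text \<open>
  A word records the directions of strands, \<open>True\<close> for upward; its height is the
  degree of the word.
\<close>

primrec ht :: "bool list \<Rightarrow> int" where
  "ht [] = 0"
| "ht (x # w) = (if x then 1 else - 1) + ht w"

lemma ht_append [simp]: "ht (v @ w) = ht v + ht w"
  by (induction v) auto

lemma ht_replicate [simp]: "ht (replicate k x) = (if x then int k else - int k)"
  by (induction k) auto

locale cyclic =
  fixes m :: nat and lam :: complex
  assumes m_ge_2: "m \<ge> 2" and lam_pow: "lam ^ m = 1"
begin

definition "n = m div 2"
definition "a = m - n"
definition "A = cyclic_presentation m lam"

lemma an: "a + n = m" "n \<ge> 1" "a \<ge> 1" "a < m"
  using m_ge_2 by (auto simp: a_def n_def)

lemma an_div:
  "int m dvd - int n - int a" "int m dvd int a + int n"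
  "(- int n - int a) div int m = - 1" "(int a + int n) div int m = 1"
proof -
  have eq: "- int n - int a = - int m" "int a + int n = int m" using an by auto
  show "int m dvd - int n - int a" "int m dvd int a + int n"
    "(- int n - int a) div int m = - 1" "(int a + int n) div int m = 1"
    unfolding eq using m_ge_2 by (simp_all add: zdiv_zminus1_eq_if)
qed

lemma lam_nz [simp]: "lam \<noteq> 0"
  using lam_pow m_ge_2 by (auto simp: power_0_left)

lemma lam_powi_add: "lam powi (i + j) = lam powi i * lam powi j"
  by (simp add: power_int_add)

lemma lam_powi_m: "lam powi (int m * k) = 1"
  by (simp add: power_int_mult lam_pow)

lemma lam_powi_dvd: "int m dvd i - j \<Longrightarrow> lam powi i = lam powi j"
  using lam_powi_add[of "i - j" j] lam_powi_m by (auto simp: dvd_def)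

lemma cnj_lam_powi: "cnj (lam powi i) = lam powi (- i)" "cnj lam powi i = lam powi (- i)"
proof -
  have "norm lam ^ m = 1" using lam_pow norm_power[of lam m] by simp
  then have "norm lam = 1"
    using m_ge_2 by (metis norm_ge_zero not_numeral_le_zero power_eq_1_iff real_norm_def abs_norm_cancel)
  then have "cnj lam = inverse lam"
    using complex_div_cnj[of 1 lam] by (simp add: divide_inverse)
  then have "cnj lam powi i = lam powi (- i)"
    by (simp add: power_int_minus power_int_inverse)
  moreover have "cnj (lam powi i) = cnj lam powi i" by (simp add: power_int_def)
  ultimately show "cnj (lam powi i) = lam powi (- i)" "cnj lam powi i = lam powi (- i)" by simp_all
qed

text \<open>
  The state sum of a picture, with the words \<open>v\<close> and \<open>w\<close> of directions
  at the top and at the bottom. An unmarked cup or cap admits both directions, as the plain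
  strand is \<open>P1 + Q1\<close>. The argument \<open>s\<close> is the degree of everything to
  the left of the picture; only \<open>U\<close> and its adjoint depend on it. A click moves one
  strand from one side of \<open>U\<close> to the other, hence changes \<open>s\<close> by one,
  and this produces the eigenvalue \<open>lam\<close> of the click.
\<close>

primrec ev :: "label picture \<Rightarrow> int \<Rightarrow> bool list \<Rightarrow> bool list \<Rightarrow> complex" where
  "ev (Strands k) s v w = of_bool (length w = k) * of_bool (v = w)"
| "ev Cup s v w = of_bool (w = [] \<and> (v = [True, False] \<or> v = [False, True]))"
| "ev Cap s v w = of_bool (v = [] \<and> (w = [True, False] \<or> w = [False, True]))"
| "ev (Box g b t) s v w = (case g of
     LP \<Rightarrow> of_bool (b = 1 \<and> t = 1 \<and> v = [True] \<and> w = [True])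
   | LU \<Rightarrow> of_bool (b = a \<and> t = n \<and> v = replicate n False \<and> w = replicate a True) * lam powi (- s)
   | LUstar \<Rightarrow> of_bool (b = n \<and> t = a \<and> v = replicate a True \<and> w = replicate n False) * lam powi s)"
| "ev (Stack f g) s v w = (\<Sum>u \<in> words (top_pts g). ev f s v u * ev g s u w)"
| "ev (Beside f g) s v w = ev f s (take (top_pts f) v) (take (bottom_pts f) w) *
     ev g (s + ht (take (bottom_pts f) w)) (drop (top_pts f) v) (drop (bottom_pts f) w)"

lemma ev_support:
  "well_formed f \<Longrightarrow> ev f s v w \<noteq> 0 \<Longrightarrow> length v = top_pts f \<and> length w = bottom_pts f"
proof (induction f arbitrary: s v w)
  case (Stack f g)
  then have "(\<Sum>u \<in> words (top_pts g). ev f s v u * ev g s u w) \<noteq> 0" by simp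
  then obtain u where "ev f s v u * ev g s u w \<noteq> 0"
    using sum.not_neutral_contains_not_neutral by blast
  then have "ev f s v u \<noteq> 0" "ev g s u w \<noteq> 0" by auto
  then show ?case using Stack.IH(1)[of s v u] Stack.IH(2)[of s u w] Stack.prems(1) by simp
next
  case (Beside f g)
  from Beside.prems have "ev f s (take (top_pts f) v) (take (bottom_pts f) w) \<noteq> 0"
    "ev g (s + ht (take (bottom_pts f) w)) (drop (top_pts f) v) (drop (bottom_pts f) w) \<noteq> 0"
    "well_formed f" "well_formed g" by auto
  then have "length (take (top_pts f) v) = top_pts f \<and> length (take (bottom_pts f) w) = bottom_pts f"
    "length (drop (top_pts f) v) = top_pts g \<and> length (drop (bottom_pts f) w) = bottom_pts g"
    using Beside.IH by blast+
  then show ?case unfolding length_take length_drop by simp linarith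
next
  case (Box g b t)
  then show ?case by (cases g) auto
qed auto

text \<open>
  Cups, caps and \<open>P1\<close> preserve the height, whereas \<open>U\<close> and its adjoint
  change it by \<open>a + n = m\<close>.
\<close>

lemma ev_dvd: "well_formed f \<Longrightarrow> ev f s v w \<noteq> 0 \<Longrightarrow> int m dvd ht v - ht w"
proof (induction f arbitrary: s v w)
  case (Box g b t)
  then show ?case using an_div by (cases g) auto
next
  case (Stack f g)
  then have "(\<Sum>u \<in> words (top_pts g). ev f s v u * ev g s u w) \<noteq> 0" by simp
  then obtain u where "ev f s v u * ev g s u w \<noteq> 0"
    using sum.not_neutral_contains_not_neutral by blast
  then have "ev f s v u \<noteq> 0" "ev g s u w \<noteq> 0" by auto
  then have "int m dvd (ht v - ht u) + (ht u - ht w)"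
    using Stack.IH(1)[of s v u] Stack.IH(2)[of s u w] Stack.prems(1) by (intro dvd_add) auto
  then show ?case by simp
next
  case (Beside f g)
  let ?v = "take (top_pts f) v" and ?v' = "drop (top_pts f) v"
  let ?w = "take (bottom_pts f) w" and ?w' = "drop (bottom_pts f) w"
  from Beside.prems have "ev f s ?v ?w \<noteq> 0" "ev g (s + ht ?w) ?v' ?w' \<noteq> 0"
    "well_formed f" "well_formed g" by auto
  then have "int m dvd (ht ?v - ht ?w) + (ht ?v' - ht ?w')"
    using Beside.IH by (intro dvd_add) blast+
  then show ?case
    using ht_append[of ?v ?v'] ht_append[of ?w ?w'] by (simp add: algebra_simps)
qed auto

text \<open>
  The boundary determines the number of boxes \<open>U\<close> less the number of their adjoints,
  namely \<open>(ht w - ht v) div m\<close>, hence also the effect of a change of the degree on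
  the left. That a strand cannot change this effect by crossing a row of the picture gives the
  interchange law.
\<close>

lemma ev_shift:
  "well_formed f \<Longrightarrow> ev f (s + s') v w = lam powi (s * ((ht v - ht w) div int m)) * ev f s' v w"
proof (induction f arbitrary: s' v w)
  case (Box g b t)
  show ?case using an_div by (cases g) (auto simp: lam_powi_add[symmetric])
next
  case (Stack f g)
  have "ev f (s + s') v u * ev g (s + s') u w =
    lam powi (s * ((ht v - ht w) div int m)) * (ev f s' v u * ev g s' u w)" for u
  proof (cases "ev f s' v u * ev g s' u w = 0")
    case False
    then have "int m dvd ht v - ht u" "int m dvd ht u - ht w"
      using Stack.prems ev_dvd by auto
    then have "(ht v - ht w) div int m = (ht v - ht u) div int m + (ht u - ht w) div int m"
      by (simp flip: div_plus_div_distrib_dvd_left)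
    then show ?thesis using Stack by (simp add: distrib_left lam_powi_add)
  next
    case True
    then show ?thesis using Stack by auto
  qed
  then show ?case by (simp add: sum_distrib_left)
next
  case (Beside f g)
  let ?v = "take (top_pts f) v" and ?v' = "drop (top_pts f) v"
  let ?w = "take (bottom_pts f) w" and ?w' = "drop (bottom_pts f) w"
  have h: "ht v - ht w = (ht ?v - ht ?w) + (ht ?v' - ht ?w')"
    using ht_append[of ?v ?v'] ht_append[of ?w ?w'] by simp
  show ?case
  proof (cases "ev f s' ?v ?w = 0")
    case True
    then show ?thesis using Beside by simp
  next
    case False
    moreover have "well_formed f" using Beside.prems by simp
    ultimately have "int m dvd ht ?v - ht ?w" by (rule ev_dvd[rotated])
    then have *: "(ht v - ht w) div int m = (ht ?v - ht ?w) div int m + (ht ?v' - ht ?w') div int m"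
      unfolding h by (rule div_plus_div_distrib_dvd_left)
    show ?thesis
      using Beside by (simp add: * distrib_left lam_powi_add add.assoc)
  qed
qed auto

lemma ev_mod:
  assumes "well_formed f" "int m dvd s - s'"
  shows "ev f s = ev f s'"
proof (intro ext)
  fix v w
  obtain k where "s - s' = int m * k" using assms(2) by auto
  then have "s = int m * k + s'" by simp
  then show "ev f s v w = ev f s' v w"
    using ev_shift[OF assms(1), of "int m * k" s' v w] lam_powi_m by (simp add: mult.assoc)
qed

lemma ev_stack_assoc:
  "well_formed (Stack f (Stack g h)) \<Longrightarrow>
    ev (Stack (Stack f g) h) s v w = ev (Stack f (Stack g h)) s v w"
  by (auto simp: sum_distrib_left sum_distrib_right mult.assoc intro: sum.swap)

lemma ev_interchange:
  assumes "well_formed (Beside (Stack f g) (Stack f' g'))"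
  shows "ev (Beside (Stack f g) (Stack f' g')) s v w = ev (Stack (Beside f f') (Beside g g')) s v w"
proof -
  let ?v = "take (top_pts f) v" and ?v' = "drop (top_pts f) v"
  let ?w = "take (bottom_pts g) w" and ?w' = "drop (bottom_pts g) w"
  have eq: "ev g s u ?w * ev f' (s + ht u) x y = ev g s u ?w * ev f' (s + ht ?w) x y" for u x y
  proof (cases "ev g s u ?w = 0")
    case False
    moreover have "well_formed g" using assms by simp
    ultimately have "int m dvd ht u - ht ?w" by (rule ev_dvd[rotated])
    then have "ev f' (s + ht u) = ev f' (s + ht ?w)" using assms by (intro ev_mod) auto
    then show ?thesis by simp
  qed simp
  have "ev (Stack (Beside f f') (Beside g g')) s v w =
    (\<Sum>u \<in> words (top_pts g). \<Sum>u' \<in> words (top_pts g').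
      ev f s ?v u * ev f' (s + ht u) ?v' u' * (ev g s u ?w * ev g' (s + ht ?w) u' ?w'))"
    using assms by (simp add: sum_words_append)
  also have "\<dots> = (\<Sum>u \<in> words (top_pts g). \<Sum>u' \<in> words (top_pts g').
      ev f s ?v u * (ev g s u ?w * ev f' (s + ht u) ?v' u') * ev g' (s + ht ?w) u' ?w')"
    by (simp add: mult.assoc mult.left_commute)
  also have "\<dots> = ev (Beside (Stack f g) (Stack f' g')) s v w"
    unfolding eq by (simp add: sum_product mult.assoc mult.left_commute)
  finally show ?thesis by simp
qed

lemma ev_zigzag:
  "ev (Stack (Beside Cap (Strands 1)) (Beside (Strands 1) Cup)) s v w = ev (Strands 1) s v w"
  "ev (Stack (Beside (Strands 1) Cap) (Beside Cup (Strands 1))) s v w = ev (Strands 1) s v w"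
proof -
  have z: "length (x::bool list) = 1 \<longleftrightarrow> x = [True] \<or> x = [False]" for x
    by (cases x) auto
  show "ev (Stack (Beside Cap (Strands 1)) (Beside (Strands 1) Cup)) s v w = ev (Strands 1) s v w"
    by (cases w) (auto simp: numeral_3_eq_3 numeral_2_eq_2 sum_words_Suc z)
  show "ev (Stack (Beside (Strands 1) Cap) (Beside Cup (Strands 1))) s v w = ev (Strands 1) s v w"
    by (cases v) (auto simp: numeral_3_eq_3 numeral_2_eq_2 sum_words_Suc z)
qed

abbreviation sg :: "bool \<Rightarrow> int" where "sg x \<equiv> (if x then 1 else - 1)"

lemma ev_Cup_Strands:
  "ev (Beside Cup (Strands b)) s (p # q # r) w = of_bool (q = (\<not> p)) * (of_bool (length w = b) * of_bool (r = w))"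
  "ev (Beside (Strands b) Cup) s (r @ [p, q]) w = of_bool (q = (\<not> p)) * (of_bool (length w = b) * of_bool (r = w))"
  if "length r = b"
  using that by (auto simp: numeral_2_eq_2)

lemma ev_Cap_Strands:
  "ev (Beside Cap (Strands t)) s v (p # q # r) = of_bool (q = (\<not> p)) * (of_bool (length v = t) * of_bool (v = r))"
  "ev (Beside (Strands t) Cap) s v (r @ [p, q]) = of_bool (q = (\<not> p)) * (of_bool (length v = t) * of_bool (v = r))"
  if "length r = t"
  using that by (auto simp: numeral_2_eq_2)

lemma ev_sandwich:
  assumes "length r = top_pts f" "length r' = bottom_pts f"
  shows "ev (Beside (Strands 1) (Beside f (Strands 1))) s (p # r @ [q]) (p' # r' @ [q']) =
    of_bool (p = p') * ev f (s + sg p') r r' * of_bool (q = q')"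
  using assms by simp

lemma ev_sandwich_words:
  assumes "length r = top_pts f" "Suc (length w) = bottom_pts f"
  shows "ev (Beside (Strands (Suc 0)) (Beside f (Strands (Suc 0)))) s (p # r @ [q]) (p' # x # w @ [y]) =
    of_bool (p = p') * ev f (s + sg p') r (x # w) * of_bool (q = y)"
  "ev (Beside (Strands (Suc 0)) (Beside f (Strands (Suc 0)))) s (p # r @ [q]) (p' # w @ [x, y]) =
    of_bool (p = p') * ev f (s + sg p') r (w @ [x]) * of_bool (q = y)"
  using ev_sandwich[of r f "x # w" s p q p' y] ev_sandwich[of r f "w @ [x]" s p q p' y] assms
  by (simp_all del: ev.simps)

lemma sum_words_snoc:
  "(\<Sum>u \<in> words (Suc k). F u) = (\<Sum>u \<in> words k. F (u @ [True]) + F (u @ [False]))"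
  for F :: "bool list \<Rightarrow> complex"
  using sum_words_append[of F k 1] by (simp add: sum_words_Suc)

text \<open>
  Bending a strand reverses its direction, and the strand that is bent to the left side adds to
  the degree on the left of the picture.
\<close>

lemma ev_click:
  assumes f: "well_formed f" "bottom_pts f = Suc (length w)" "top_pts f = Suc (length v)"
  shows "ev (click_pic f) s (z # v) (w @ [l]) = ev f (s + sg z) (v @ [\<not> l]) ((\<not> z) # w)"
proof -
  let ?b = "bottom_pts f" and ?t = "top_pts f"
  let ?M = "Beside (Strands 1) (Beside f (Strands 1))"
  have lower: "(\<Sum>u \<in> words (Suc (Suc ?b)). ev ?M s x u * ev (Beside Cup (Strands ?b)) s u (w @ [l])) =
    ev ?M s x (True # (False # w) @ [l]) + ev ?M s x (False # (True # w) @ [l])" for x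
    using f by (simp add: sum_words_Suc ev_Cup_Strands sum.distrib flip: mult.assoc
      del: ev.simps)
  have "ev (click_pic f) s (z # v) (w @ [l]) =
    (\<Sum>u \<in> words (Suc (Suc ?t)). ev (Beside (Strands ?t) Cap) s (z # v) u *
      (ev ?M s u (True # (False # w) @ [l]) + ev ?M s u (False # (True # w) @ [l])))"
    unfolding lower[symmetric] by (simp add: click_pic_def del: ev.simps(6))
  also have "\<dots> = (\<Sum>p \<in> UNIV. \<Sum>u \<in> words ?t. \<Sum>q \<in> UNIV.
      ev (Beside (Strands ?t) Cap) s (z # v) (p # u @ [q]) *
      (ev ?M s (p # u @ [q]) (True # (False # w) @ [l]) +
       ev ?M s (p # u @ [q]) (False # (True # w) @ [l])))"
    by (subst sum_words_Suc, subst (1) sum_words_snoc)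
      (simp add: UNIV_bool sum.distrib add.assoc add.commute add.left_commute del: ev.simps)
  also have "\<dots> = (\<Sum>p \<in> UNIV. \<Sum>u \<in> words ?t.
      ev (Beside (Strands ?t) Cap) s (z # v) (p # u @ [l]) * ev f (s + sg p) u ((\<not> p) # w))"
    using f by (intro sum.cong refl) (auto simp: UNIV_bool ev_sandwich_words simp del: ev.simps)
  also have "\<dots> = (\<Sum>p \<in> UNIV. \<Sum>u \<in> words (length v). \<Sum>y \<in> UNIV.
      ev (Beside (Strands ?t) Cap) s (z # v) ((p # u) @ [y, l]) * ev f (s + sg p) (u @ [y]) ((\<not> p) # w))"
    unfolding f(3) by (subst sum_words_snoc) (simp add: UNIV_bool add.commute del: ev.simps)
  also have "\<dots> = (\<Sum>p \<in> UNIV. \<Sum>u \<in> words (length v). of_bool (u = v) * 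
      (of_bool (p = z) * ev f (s + sg p) (u @ [\<not> l]) ((\<not> p) # w)))"
    using f by (intro sum.cong refl, subst ev_Cap_Strands)
      (auto simp: UNIV_bool simp del: ev.simps)
  also have "\<dots> = ev f (s + sg z) (v @ [\<not> l]) ((\<not> z) # w)"
    by (cases z) (auto simp: UNIV_bool eq_commute[of _ v])
  finally show ?thesis .
qed

lemma ev_unclick:
  assumes f: "well_formed f" "bottom_pts f = Suc (length w)" "top_pts f = Suc (length v)"
  shows "ev (unclick_pic f) s (v @ [l]) (z # w) = ev f (s + sg z) ((\<not> z) # v) (w @ [\<not> l])"
proof -
  let ?b = "bottom_pts f" and ?t = "top_pts f"
  let ?M = "Beside (Strands 1) (Beside f (Strands 1))"
  have lower: "(\<Sum>u \<in> words (Suc (Suc ?b)). ev ?M s x u * ev (Beside (Strands ?b) Cup) s u (z # w)) =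
    ev ?M s x (z # (w @ [True]) @ [False]) + ev ?M s x (z # (w @ [False]) @ [True])" for x
  proof -
    have "(\<Sum>u \<in> words (?b + 2). ev ?M s x u * ev (Beside (Strands ?b) Cup) s u (z # w)) =
      (\<Sum>u \<in> words ?b. ev ?M s x (u @ [True, False]) * of_bool (u = z # w) +
        ev ?M s x (u @ [False, True]) * of_bool (u = z # w))"
      unfolding sum_words_append using f
      by (intro sum.cong refl) (simp add: numeral_2_eq_2 sum_words_Suc ev_Cup_Strands del: ev.simps)
    then show ?thesis using f by (simp add: sum.distrib del: ev.simps)
  qed
  have "ev (unclick_pic f) s (v @ [l]) (z # w) =
    (\<Sum>u \<in> words (Suc (Suc ?t)). ev (Beside Cap (Strands ?t)) s (v @ [l]) u *
      (ev ?M s u (z # (w @ [True]) @ [False]) + ev ?M s u (z # (w @ [False]) @ [True])))"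
    unfolding lower[symmetric] by (simp add: unclick_pic_def del: ev.simps(6))
  also have "\<dots> = (\<Sum>p \<in> UNIV. \<Sum>u \<in> words ?t. \<Sum>q \<in> UNIV.
      ev (Beside Cap (Strands ?t)) s (v @ [l]) (p # u @ [q]) *
      (ev ?M s (p # u @ [q]) (z # (w @ [True]) @ [False]) +
       ev ?M s (p # u @ [q]) (z # (w @ [False]) @ [True])))"
    by (subst sum_words_Suc, subst (1) sum_words_snoc)
      (simp add: UNIV_bool sum.distrib add.assoc add.commute add.left_commute del: ev.simps)
  also have "\<dots> = (\<Sum>u \<in> words ?t. \<Sum>q \<in> UNIV.
      ev (Beside Cap (Strands ?t)) s (v @ [l]) (z # u @ [q]) * ev f (s + sg z) u (w @ [\<not> q]))"
    using f by (cases z) (simp_all add: UNIV_bool ev_sandwich_words sum.distrib del: ev.simps)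
  also have "\<dots> = (\<Sum>u \<in> words (length v). \<Sum>y \<in> UNIV. \<Sum>q \<in> UNIV.
      ev (Beside Cap (Strands ?t)) s (v @ [l]) (z # y # u @ [q]) * ev f (s + sg z) (y # u) (w @ [\<not> q]))"
    unfolding f(3) by (subst sum_words_Suc) (simp add: UNIV_bool sum.distrib del: ev.simps)
  also have "\<dots> = (\<Sum>u \<in> words (length v). of_bool (v = u) * ev f (s + sg z) ((\<not> z) # u) (w @ [\<not> l]))"
    using f by (intro sum.cong refl, subst (1) ev_Cap_Strands)
      (auto simp: UNIV_bool ev_Cap_Strands simp del: ev.simps)
  also have "\<dots> = ev f (s + sg z) ((\<not> z) # v) (w @ [\<not> l])"
    by simp
  finally show ?thesis .
qed

subsection \<open>Invariance under isotopy\<close>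

text \<open>
  Pictures like \<open>U\<close> and its adjoint, whose boundary strands are all directed into
  the picture or all directed out of it; the function \<open>c\<close> is their value in
  dependence on the degree on the left.
\<close>

definition uniform where
  "uniform b t x c f \<longleftrightarrow> well_formed f \<and> bottom_pts f = b \<and> top_pts f = t \<and>
     (\<forall>s v w. ev f s v w = of_bool (v = replicate t (\<not> x) \<and> w = replicate b x) * c s)"

lemma uniform_click:
  assumes f: "uniform (Suc b) (Suc t) x c f"
  shows "uniform (Suc b) (Suc t) x (\<lambda>s. c (s - sg x)) (click_pic f)"
    "uniform (Suc b) (Suc t) x (\<lambda>s. c (s + sg x)) (unclick_pic f)"
proof -
  have wf: "well_formed f" "bottom_pts f = Suc b" "top_pts f = Suc t"
    and e: "ev f s v w = of_bool (v = replicate (Suc t) (\<not> x) \<and> w = replicate (Suc b) x) * c s"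
    for s v w using f by (auto simp: uniform_def simp del: replicate_Suc)
  have snoc: "u @ [l] = y # replicate k y \<longleftrightarrow> u = replicate k y \<and> l = y" for k u and y l :: bool
    unfolding replicate_append_same[symmetric] by (simp only: append1_eq_conv)
  have outside: "ev g s v w = 0" if "well_formed g" "bottom_pts g = Suc b" "top_pts g = Suc t"
    "\<not> (length v = Suc t \<and> length w = Suc b)" for g s v w
    using ev_support[of g s v w] that by auto
  show "uniform (Suc b) (Suc t) x (\<lambda>s. c (s - sg x)) (click_pic f)"
    unfolding uniform_def
  proof (intro conjI allI)
    fix s v w
    show "ev (click_pic f) s v w =
      of_bool (v = replicate (Suc t) (\<not> x) \<and> w = replicate (Suc b) x) * c (s - sg x)"
    proof (cases "length v = Suc t \<and> length w = Suc b")
      case True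
      then obtain z v' where v: "v = z # v'" "length v' = t" by (auto simp: length_Suc_conv)
      from True have "w \<noteq> []" by auto
      then obtain w' l where w: "w = w' @ [l]" by (metis append_butlast_last_id)
      then have lw: "length w' = b" using True by simp
      have "(v' @ [\<not> l] = replicate (Suc t) (\<not> x) \<and> (\<not> z) # w' = replicate (Suc b) x) \<longleftrightarrow>
        (v = replicate (Suc t) (\<not> x) \<and> w = replicate (Suc b) x)"
        unfolding v w by (auto simp: snoc)
      moreover have "s + sg z = s - sg x" if "(\<not> z) # w' = replicate (Suc b) x"
        using that by auto
      ultimately show ?thesis
        using ev_click[of f w' v' s z l] wf v lw unfolding w v(1) by (auto simp: e simp del: replicate_Suc)
    next
      case False
      then show ?thesis using outside[of "click_pic f" v w s] wf by auto
    qed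
  qed (use wf in auto)
  show "uniform (Suc b) (Suc t) x (\<lambda>s. c (s + sg x)) (unclick_pic f)"
    unfolding uniform_def
  proof (intro conjI allI)
    fix s v w
    show "ev (unclick_pic f) s v w =
      of_bool (v = replicate (Suc t) (\<not> x) \<and> w = replicate (Suc b) x) * c (s + sg x)"
    proof (cases "length v = Suc t \<and> length w = Suc b")
      case True
      then obtain z w' where w: "w = z # w'" "length w' = b" by (auto simp: length_Suc_conv)
      from True have "v \<noteq> []" by auto
      then obtain v' l where v: "v = v' @ [l]" by (metis append_butlast_last_id)
      then have lv: "length v' = t" using True by simp
      have "((\<not> z) # v' = replicate (Suc t) (\<not> x) \<and> w' @ [\<not> l] = replicate (Suc b) x) \<longleftrightarrow>
        (v = replicate (Suc t) (\<not> x) \<and> w = replicate (Suc b) x)"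
        unfolding v w by (auto simp: snoc)
      moreover have "s + sg z = s + sg x" if "(\<not> z) # v' = replicate (Suc t) (\<not> x)"
        using that by auto
      ultimately show ?thesis
        using ev_unclick[of f w' v' s l z] wf w lv unfolding v w(1) by (auto simp: e simp del: replicate_Suc)
    next
      case False
      then show ?thesis using outside[of "unclick_pic f" v w s] wf by auto
    qed
  qed (use wf in auto)
qed

lemma uniform_click_funpow:
  assumes "uniform (Suc b) (Suc t) x c f"
  shows "uniform (Suc b) (Suc t) x (\<lambda>s. c (s - int k * sg x)) ((click_pic ^^ k) f)"
    "uniform (Suc b) (Suc t) x (\<lambda>s. c (s + int k * sg x)) ((unclick_pic ^^ k) f)"
proof (induction k)
  case (Suc k)
  show "uniform (Suc b) (Suc t) x (\<lambda>s. c (s - int (Suc k) * sg x)) ((click_pic ^^ Suc k) f)"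
    using uniform_click(1)[OF Suc(1)] by (auto simp: algebra_simps)
  show "uniform (Suc b) (Suc t) x (\<lambda>s. c (s + int (Suc k) * sg x)) ((unclick_pic ^^ Suc k) f)"
    using uniform_click(2)[OF Suc(2)] by (auto simp: algebra_simps)
qed (use assms in auto)

lemma uniform_full_turn:
  assumes f: "uniform b t x c f" and bt: "b \<ge> 1" "t \<ge> 1" "b + t = m"
    and c: "\<And>s s'. int m dvd s - s' \<Longrightarrow> c s = c s'"
  shows "ev ((click_pic ^^ (b + t)) f) = ev f" "ev ((unclick_pic ^^ (b + t)) f) = ev f"
proof -
  obtain b' t' where b': "b = Suc b'" "t = Suc t'" using bt(1,2) by (metis not0_implies_Suc not_one_le_zero)
  have "c (s - int m * sg x) = c s" "c (s + int m * sg x) = c s" for s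
    by (auto intro!: c)
  then show "ev ((click_pic ^^ (b + t)) f) = ev f" "ev ((unclick_pic ^^ (b + t)) f) = ev f"
    using f uniform_click_funpow[of b' t' x c f "b + t"] bt(3)
    unfolding b'[symmetric] by (auto simp: uniform_def fun_eq_iff)
qed

lemma ev_click_zero:
  assumes "\<And>s v w. ev f s v w = 0"
  shows "ev ((click_pic ^^ k) f) s v w = 0 \<and> ev ((unclick_pic ^^ k) f) s v w = 0"
proof (induction k arbitrary: s v w)
  case (Suc k)
  show ?case
    unfolding funpow.simps o_def click_pic_def[of "(click_pic ^^ k) f"]
      unclick_pic_def[of "(unclick_pic ^^ k) f"] by (simp add: Suc)
qed (use assms in auto)

lemma ev_full_turn_P1:
  defines "f \<equiv> Box LP 1 1"
  shows "ev (click_pic (click_pic f)) = ev f" "ev (unclick_pic (unclick_pic f)) = ev f"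
proof -
  have wf: "well_formed f" "bottom_pts f = 1" "top_pts f = 1" by (simp_all add: f_def)
  have f: "ev f s [x] [y] = of_bool (x \<and> y)" for s x y by (simp add: f_def)
  have outside: "ev g s v w = 0" if "well_formed g" "bottom_pts g = 1" "top_pts g = 1"
    "\<not> (length v = 1 \<and> length w = 1)" for g s v w
    using ev_support[of g s v w] that by auto
  have "ev (click_pic (click_pic f)) s v w = ev f s v w" for s v w
  proof (cases "length v = 1 \<and> length w = 1")
    case True
    then obtain z l where vw: "v = [z]" "w = [l]" by (auto simp: length_Suc_conv)
    have "ev (click_pic (click_pic f)) s ([z]) ([] @ [l]) = ev (click_pic f) (s + sg z) ([] @ [\<not> l]) ((\<not> z) # [])"
      by (rule ev_click) (simp_all add: wf)
    also have "\<dots> = ev (click_pic f) (s + sg z) ([\<not> l]) ([] @ [\<not> z])" by simp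
    also have "\<dots> = ev f (s + sg z + sg (\<not> l)) ([] @ [\<not> \<not> z]) ((\<not> \<not> l) # [])"
      by (rule ev_click) (simp_all add: wf)
    finally show ?thesis unfolding vw by (simp add: f)
  qed (simp add: outside wf)
  then show "ev (click_pic (click_pic f)) = ev f" by (intro ext)
  have "ev (unclick_pic (unclick_pic f)) s v w = ev f s v w" for s v w
  proof (cases "length v = 1 \<and> length w = 1")
    case True
    then obtain z l where vw: "v = [l]" "w = [z]" by (auto simp: length_Suc_conv)
    have "ev (unclick_pic (unclick_pic f)) s ([] @ [l]) ([z]) =
        ev (unclick_pic f) (s + sg z) ((\<not> z) # []) ([] @ [\<not> l])"
      by (rule ev_unclick) (simp_all add: wf)
    also have "\<dots> = ev (unclick_pic f) (s + sg z) ([] @ [\<not> z]) ([\<not> l])" by simp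
    also have "\<dots> = ev f (s + sg z + sg (\<not> l)) ((\<not> \<not> l) # []) ([] @ [\<not> \<not> z])"
      by (rule ev_unclick) (simp_all add: wf)
    finally show ?thesis unfolding vw by (simp add: f)
  qed (simp add: outside wf)
  then show "ev (unclick_pic (unclick_pic f)) = ev f" by (intro ext)
qed

lemma ev_full_turn:
  "ev ((click_pic ^^ (b + t)) (Box g b t)) = ev (Box g b t)"
  "ev ((unclick_pic ^^ (b + t)) (Box g b t)) = ev (Box g b t)"
proof -
  let ?P = "\<lambda>g b t. ev ((click_pic ^^ (b + t)) (Box g b t)) = ev (Box g b t) \<and>
    ev ((unclick_pic ^^ (b + t)) (Box g b t)) = ev (Box g b t)"
  have P: "?P LP 1 1"
    using ev_full_turn_P1 by simp
  have u: "uniform a n True (\<lambda>s. lam powi (- s)) (Box LU a n)"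
    "uniform n a False (\<lambda>s. lam powi s) (Box LUstar n a)" by (auto simp: uniform_def)
  have c: "lam powi (- s) = lam powi (- s')" "lam powi s = lam powi s'" if "int m dvd s - s'" for s s'
  proof -
    have "int m dvd - s - - s'" using that by (simp add: dvd_diff_commute)
    then show "lam powi (- s) = lam powi (- s')" by (rule lam_powi_dvd)
  qed (rule lam_powi_dvd[OF that])
  have na: "n + a = m" using an(1) by simp
  have U: "?P LU a n" using uniform_full_turn[OF u(1) an(3,2,1) c(1)] by blast
  have V: "?P LUstar n a" using uniform_full_turn[OF u(2) an(2,3) na c(2)] by blast
  have "?P g b t"
  proof (cases "(g, b, t) \<in> {(LP, 1, 1), (LU, a, n), (LUstar, n, a)}")
    case True
    then show ?thesis using P U V by (elim insertE emptyE) (simp_all only: prod.inject)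
  next
    case False
    then have no: "ev (Box g b t) s v w = 0" for s v w by (cases g) auto
    show ?thesis
      by (intro conjI ext)
        (simp_all only: no ev_click_zero[OF no, THEN conjunct1] ev_click_zero[OF no, THEN conjunct2])
  qed
  then show "ev ((click_pic ^^ (b + t)) (Box g b t)) = ev (Box g b t)"
    "ev ((unclick_pic ^^ (b + t)) (Box g b t)) = ev (Box g b t)" by blast+
qed

text \<open>
  Apart from the formal rules, the interchange law and the zigzags there is the full turn of a
  box. It moves all \<open>m\<close> strands of \<open>U\<close> past the box, which costs the
  factor \<open>lam ^ m = 1\<close>.
\<close>

lemma isotopic_ev: "isotopic f g \<Longrightarrow> well_formed f \<Longrightarrow> ev f = ev g"
proof (induction rule: isotopic.induct)
  case (isotopic_sym f g)
  then show ?case using isotopic_well_formed[OF isotopic_sym(1)] by simp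
next
  case (isotopic_trans f g h)
  then show ?case using isotopic_well_formed[OF isotopic_trans(1)] by simp
next
  case (stack_cong f f' g g')
  then show ?case using isotopic_pts(2)[of g g'] by (auto simp: fun_eq_iff)
next
  case (beside_cong f f' g g')
  then show ?case using isotopic_pts[of f f'] by (auto simp: fun_eq_iff)
next
  case (stack_assoc f g h)
  then show ?case by (intro ext ev_stack_assoc) auto
next
  case (stack_strands_left f)
  show ?case
  proof (intro ext)
    fix s v w
    have "ev (Stack (Strands (top_pts f)) f) s v w =
      (\<Sum>u \<in> words (top_pts f). of_bool (v = u) * (of_bool (length u = top_pts f) * ev f s u w))"
      by (simp add: mult_ac)
    then show "ev (Stack (Strands (top_pts f)) f) s v w = ev f s v w"
      using ev_support[of f s v w] stack_strands_left by auto
  qed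
next
  case (stack_strands_right f)
  show ?case
  proof (intro ext)
    fix s v w
    have "ev (Stack f (Strands (bottom_pts f))) s v w =
      (\<Sum>u \<in> words (bottom_pts f). ev f s v u * of_bool (u = w)) * of_bool (length w = bottom_pts f)"
      by (simp add: sum_distrib_right mult_ac)
    then show "ev (Stack f (Strands (bottom_pts f))) s v w = ev f s v w"
      using ev_support[of f s v w] stack_strands_right by auto
  qed
next
  case (beside_assoc f g h)
  show ?case
  proof (intro ext)
    fix s and v w :: "bool list"
    let ?b = "bottom_pts f" and ?b' = "bottom_pts g" and ?t = "top_pts f" and ?t' = "top_pts g"
    have "ht (take (?b + ?b') w) = ht (take ?b w) + ht (take ?b' (drop ?b w))"
      by (simp add: take_add)
    moreover have "take ?t (take (?t + ?t') v) = take ?t v" "take ?b (take (?b + ?b') w) = take ?b w"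
      "drop ?t (take (?t + ?t') v) = take ?t' (drop ?t v)"
      "drop ?b (take (?b + ?b') w) = take ?b' (drop ?b w)"
      "drop (?t + ?t') v = drop ?t' (drop ?t v)" "drop (?b + ?b') w = drop ?b' (drop ?b w)"
      by (simp_all add: drop_take add.commute)
    ultimately show "ev (Beside (Beside f g) h) s v w = ev (Beside f (Beside g h)) s v w"
      by (simp only: ev.simps top_pts.simps bottom_pts.simps mult.assoc add.assoc)
  qed
next
  case (beside_empty_left f)
  then show ?case by (auto simp: fun_eq_iff)
next
  case (beside_empty_right f)
  show ?case
  proof (intro ext)
    fix s v w
    show "ev (Beside f (Strands 0)) s v w = ev f s v w"
    proof (cases "length v \<le> top_pts f \<and> length w \<le> bottom_pts f")
      case False
      then have "\<not> (length v = top_pts f \<and> length w = bottom_pts f)" by auto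
      moreover have "well_formed f" using beside_empty_right by simp
      ultimately have "ev f s v w = 0" using ev_support by blast
      then show ?thesis using False by auto
    qed simp
  qed
next
  case (beside_strands k l)
  show ?case
  proof (intro ext)
    fix s and v w :: "bool list"
    have "v = w" if "take k v = take k w" "drop k v = drop k w"
      using that append_take_drop_id by metis
    then show "ev (Beside (Strands k) (Strands l)) s v w = ev (Strands (k + l)) s v w"
      by auto
  qed
next
  case (interchange f g f' g')
  then show ?case by (intro ext ev_interchange) auto
next
  case zigzag_left
  show ?case by (intro ext ev_zigzag)
next
  case zigzag_right
  show ?case by (intro ext ev_zigzag)
next
  case (full_turn b t g)
  show ?case by (rule ev_full_turn)
next
  case (full_unturn b t g)
  show ?case by (rule ev_full_turn)
qed simp

lemma ev_reflect:
  "well_formed f \<Longrightarrow> ev (reflect_pic star_of f) s v w = cnj (ev f s w v)"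
proof (induction f arbitrary: s v w)
  case (Box g b t)
  then show ?case by (cases g) (auto simp: cnj_lam_powi conj_commute)
next
  case (Stack f g)
  then show ?case by (simp add: mult.commute)
next
  case (Beside f g)
  let ?v = "take (bottom_pts f) v" and ?w = "take (top_pts f) w"
  show ?case
  proof (cases "ev f s ?w ?v = 0")
    case False
    moreover have "well_formed f" using Beside.prems by simp
    ultimately have "int m dvd ht ?w - ht ?v" by (rule ev_dvd[rotated])
    then have "ev g (s + ht ?w) = ev g (s + ht ?v)"
      using Beside.prems by (intro ev_mod) auto
    then show ?thesis using Beside by simp
  qed (use Beside in simp)
qed auto

lift_definition evd :: "label diagram \<Rightarrow> int \<Rightarrow> bool list \<Rightarrow> bool list \<Rightarrow> complex"
  is "\<lambda>f. if well_formed f then ev f else (\<lambda>_ _ _. 0)"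
  by (simp add: isotopic_ev isotopic_well_formed)

lemma evd_support:
  "is_diagram G b t d \<Longrightarrow> evd d s v w \<noteq> 0 \<Longrightarrow> length v = t \<and> length w = b"
  by transfer (use ev_support in auto)

lemma evd_dvd: "evd d s v w \<noteq> 0 \<Longrightarrow> int m dvd ht v - ht w"
  by transfer (metis ev_dvd)

lemma evd_shift: "evd d s v w = lam powi (s * ((ht v - ht w) div int m)) * evd d 0 v w"
proof -
  have "ev f s v w = lam powi (s * ((ht v - ht w) div int m)) * ev f 0 v w" if "well_formed f" for f
    using ev_shift[OF that, of s 0 v w] by simp
  then show ?thesis by transfer simp
qed

lemma evd_strands [simp]: "evd (strands k) s v w = of_bool (length w = k) * of_bool (v = w)"
  by transfer simp

lemma evd_cup [simp]: "evd cup s v w = of_bool (w = [] \<and> (v = [True, False] \<or> v = [False, True]))"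
  by transfer simp

lemma evd_cap [simp]: "evd cap s v w = of_bool (v = [] \<and> (w = [True, False] \<or> w = [False, True]))"
  by transfer simp

lemma evd_box:
  "evd (box LP 1 1) s v w = of_bool (v = [True] \<and> w = [True])"
  "evd (box LU a n) s v w = of_bool (v = replicate n False \<and> w = replicate a True) * lam powi (- s)"
  "evd (box LUstar n a) s v w = of_bool (v = replicate a True \<and> w = replicate n False) * lam powi s"
  by (transfer, simp)+

lemma evd_stack:
  "is_diagram G k t f \<Longrightarrow> is_diagram G' b k g \<Longrightarrow>
    evd (stack f g) s v w = (\<Sum>u \<in> words k. evd f s v u * evd g s u w)"
  by transfer auto

lemma evd_beside:
  "is_diagram G b t f \<Longrightarrow> is_diagram G' b' t' g \<Longrightarrow>
    evd (beside f g) s v w = evd f s (take t v) (take b w) * evd g (s + ht (take b w)) (drop t v) (drop b w)"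
  by transfer auto

lemma evd_click:
  "is_diagram G (Suc (length w)) (Suc (length v)) f \<Longrightarrow>
    evd (click f) s (z # v) (w @ [l]) = evd f (s + sg z) (v @ [\<not> l]) ((\<not> z) # w)"
  by transfer (simp add: ev_click)

lemma evd_reflect: "evd (reflect star_of d) s v w = cnj (evd d s w v)"
  by transfer (simp add: ev_reflect reflect_pic_well_formed)

subsection \<open>Linear combinations\<close>

definition evl :: "label lincomb \<Rightarrow> int \<Rightarrow> bool list \<Rightarrow> bool list \<Rightarrow> complex" where
  "evl x s v w = (\<Sum>d \<in> Poly_Mapping.keys x. Poly_Mapping.lookup x d * evd d s v w)"

lemma evl_superset:
  "finite K \<Longrightarrow> Poly_Mapping.keys x \<subseteq> K \<Longrightarrow>
    evl x s v w = (\<Sum>d \<in> K. Poly_Mapping.lookup x d * evd d s v w)"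
  unfolding evl_def by (intro sum.mono_neutral_left) (auto simp: in_keys_iff)

lemma evl_add [simp]: "evl (x + y) s v w = evl x s v w + evl y s v w"
  using keys_add[of x y]
  by (simp add: evl_superset[where K = "Poly_Mapping.keys x \<union> Poly_Mapping.keys y"]
      lookup_add distrib_right sum.distrib)

lemma evl_scale [simp]: "evl (scale c x) s v w = c * evl x s v w"
  using keys_scale[of c x]
  by (simp add: evl_superset[where K = "Poly_Mapping.keys x"] sum_distrib_left mult.assoc)

lemma evl_zero [simp]: "evl 0 s v w = 0"
  by (simp add: evl_def)

lemma evl_single [simp]: "evl (Poly_Mapping.single d c) s v w = c * evd d s v w"
  by (simp add: evl_superset[where K = "{d}"])

lemma evl_single_diagram [simp]: "evl \<langle>d\<rangle> s v w = evd d s v w"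
  by (simp add: single_diagram_def)

lemma evl_minus [simp]: "evl (x - y) s v w = evl x s v w - evl y s v w"
  using evl_add[of x "scale (- 1) y" s v w] evl_scale[of "- 1" y s v w] by simp

lemma evl_support:
  assumes "x \<in> free_space B b t" "evl x s v w \<noteq> 0"
  shows "length v = t \<and> length w = b \<and> int m dvd ht v - ht w"
proof -
  obtain d where "d \<in> Poly_Mapping.keys x" "Poly_Mapping.lookup x d * evd d s v w \<noteq> 0"
    using assms(2) unfolding evl_def using sum.not_neutral_contains_not_neutral by blast
  then show ?thesis
    using assms(1) evd_support[of "gens B" b t d s v w] evd_dvd[of d s v w] by (auto simp: free_space_def)
qed

lemma evl_shift: "evl x s v w = lam powi (s * ((ht v - ht w) div int m)) * evl x 0 v w"
proof (induction x rule: lincomb_induct)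
  case (single d c)
  then show ?case using evd_shift[of d s v w] by simp
qed (simp_all add: distrib_left)

lemma evl_stack:
  assumes "x \<in> free_space B k t" "y \<in> free_space B b k"
  shows "evl (stack_lc x y) s v w = (\<Sum>u \<in> words k. evl x s v u * evl y s u w)"
  using assms
proof (induction x rule: free_space_induct)
  case (single d c)
  show ?case using single(2,1)
    by (induction y rule: free_space_induct)
      (auto simp: evd_stack sum_distrib_left distrib_left sum.distrib intro!: sum.cong)
qed (auto simp: distrib_right sum.distrib)

lemma evl_beside:
  assumes "x \<in> free_space B b t" "y \<in> free_space B b' t'"
  shows "evl (beside_lc x y) s v w =
    evl x s (take t v) (take b w) * evl y (s + ht (take b w)) (drop t v) (drop b w)"
  using assms
proof (induction x rule: free_space_induct)
  case (single d c)
  show ?case using single(2,1)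
    by (induction y rule: free_space_induct) (auto simp: evd_beside distrib_left)
qed (auto simp: distrib_right)

lemma evl_adjoint: "evl (adjoint_lc star_of x) s v w = cnj (evl x s w v)"
  by (induction x rule: lincomb_induct) (auto simp: evd_reflect)

subsection \<open>The relations hold in the state sum\<close>

abbreviation "U \<equiv> box LU a n"
abbreviation "V \<equiv> box LUstar n a"

lemma gens_A: "gens A = {(LP, 1, 1), (LU, a, n), (LUstar, n, a)}"
  by (simp add: A_def cyclic_presentation_def Let_def a_def n_def)

lemma star_A: "label_star A = star_of"
  by (simp add: A_def cyclic_presentation_def Let_def)

lemma rels_A: "rels A =
  {\<langle>U\<rangle> - \<langle>stack (beside_power Q1 n) (stack U (beside_power P1 a))\<rangle>,
   \<langle>V\<rangle> - \<langle>stack (beside_power P1 a) (stack V (beside_power Q1 n))\<rangle>,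
   \<langle>stack cap (stack (beside P1 (strands 1)) cup)\<rangle> - \<langle>strands 0\<rangle>,
   \<langle>stack cap (stack (beside Q1 (strands 1)) cup)\<rangle> - \<langle>strands 0\<rangle>,
   \<langle>strands 1\<rangle> - (\<langle>P1\<rangle> + \<langle>Q1\<rangle>), \<langle>stack P1 Q1\<rangle>, \<langle>stack Q1 P1\<rangle>,
   \<langle>stack (stack (beside P1 (strands 1)) cup) (stack cap (beside P1 (strands 1)))\<rangle> - \<langle>beside P1 Q1\<rangle>,
   \<langle>stack (stack (beside Q1 (strands 1)) cup) (stack cap (beside Q1 (strands 1)))\<rangle> - \<langle>beside Q1 P1\<rangle>,
   \<langle>stack U V\<rangle> - \<langle>beside_power Q1 n\<rangle>, \<langle>stack V U\<rangle> - \<langle>beside_power P1 a\<rangle>,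
   \<langle>click U\<rangle> - scale lam \<langle>U\<rangle>, \<langle>click V\<rangle> - scale lam \<langle>V\<rangle>}"
  by (simp add: A_def cyclic_presentation_def Let_def a_def n_def)

lemma is_diagram_P1_Q1 [simp]:
  "is_diagram (gens A) 1 1 P1" "is_diagram (gens A) (Suc 0) (Suc 0) P1"
  "is_diagram (gens A) 1 1 Q1" "is_diagram (gens A) (Suc 0) (Suc 0) Q1"
  unfolding P1_def Q1_def using is_diagram_click[of "gens A" 1 1 "box LP 1 1"] by (simp_all add: gens_A)

lemma is_diagram_U_V [simp]: "is_diagram (gens A) a n U" "is_diagram (gens A) n a V"
  by (simp_all add: gens_A)

lemma is_diagram_power [simp]:
  "is_diagram G 1 1 d \<Longrightarrow> is_diagram G k k (beside_power d k)"
proof (induction k)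
  case (Suc k)
  then show ?case using is_diagram_beside[of G 1 1 d k k] by simp
qed simp

definition unit_matrix where
  "unit_matrix d w v c \<longleftrightarrow> is_diagram (gens A) (length w) (length v) d \<and>
     (\<forall>s v' w'. evd d s v' w' = of_bool (v' = v \<and> w' = w) * c s)"

lemma unit_matrix_P1_Q1:
  "unit_matrix P1 [True] [True] (\<lambda>s. 1)" "unit_matrix Q1 [False] [False] (\<lambda>s. 1)"
proof -
  show P: "unit_matrix P1 [True] [True] (\<lambda>s. 1)"
    using evd_box(1) is_diagram_P1_Q1(2) by (simp add: unit_matrix_def P1_def)
  have "evd Q1 s v w = of_bool (v = [False] \<and> w = [False])" for s v w
  proof (cases "length v = 1 \<and> length w = 1")
    case True
    then obtain z l where "v = [z]" "w = [l]" by (auto simp: length_Suc_conv)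
    then show ?thesis
      using P evd_click[of "gens A" "[]" "[]" P1 s z l] by (auto simp: unit_matrix_def Q1_def)
  next
    case False
    then show ?thesis using evd_support[of "gens A" 1 1 Q1 s v w] by auto
  qed
  then show "unit_matrix Q1 [False] [False] (\<lambda>s. 1)" by (simp add: unit_matrix_def)
qed

lemma unit_matrix_stack:
  assumes "unit_matrix f w' v c" "unit_matrix g w w' c'"
  shows "unit_matrix (stack f g) w v (\<lambda>s. c s * c' s)"
proof -
  have f: "is_diagram (gens A) (length w') (length v) f"
      "evd f s x y = of_bool (x = v \<and> y = w') * c s"
    and g: "is_diagram (gens A) (length w) (length w') g"
      "evd g s x y = of_bool (x = w' \<and> y = w) * c' s" for s x y
    using assms by (simp_all add: unit_matrix_def)
  have "evd (stack f g) s x y = of_bool (x = v \<and> y = w) * (c s * c' s)" for s x y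
  proof -
    have "evd (stack f g) s x y = (\<Sum>u \<in> words (length w').
        (of_bool (x = v) * c s * of_bool (y = w) * c' s) * of_bool (u = w'))"
      unfolding evd_stack[OF f(1) g(1)] f(2) g(2) by (intro sum.cong) auto
    also have "\<dots> = of_bool (x = v) * c s * of_bool (y = w) * c' s"
      by (subst sum_words_delta(2)) simp
    finally show ?thesis by auto
  qed
  then show ?thesis using is_diagram_stack[OF f(1) g(1)] by (simp add: unit_matrix_def)
qed

lemma unit_matrix_beside:
  assumes f: "unit_matrix f w v c" and g: "unit_matrix g w' v' c'"
  shows "unit_matrix (beside f g) (w @ w') (v @ v') (\<lambda>s. c s * c' (s + ht w))"
proof -
  have "u = x @ y \<longleftrightarrow> take (length x) u = x \<and> drop (length x) u = y" for u x y :: "bool list"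
    by (metis append_eq_conv_conj)
  then show ?thesis
    using f g by (auto simp: unit_matrix_def is_diagram_beside evd_beside)
qed

lemma unit_matrix_power:
  assumes "unit_matrix d [x] [x] (\<lambda>s. 1)"
  shows "unit_matrix (beside_power d k) (replicate k x) (replicate k x) (\<lambda>s. 1)"
proof (induction k)
  case 0
  then show ?case by (auto simp: unit_matrix_def)
next
  case (Suc k)
  then show ?case using unit_matrix_beside[OF assms Suc] by simp
qed

lemma unit_matrix_U_V:
  "unit_matrix U (replicate a True) (replicate n False) (\<lambda>s. lam powi (- s))"
  "unit_matrix V (replicate n False) (replicate a True) (\<lambda>s. lam powi s)"
  by (auto simp: unit_matrix_def evd_box)

lemma unit_matrix_cup_cap:
  assumes "unit_matrix d [x] [x] (\<lambda>s. 1)"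
  shows "unit_matrix (stack (beside d (strands 1)) cup) [] [x, \<not> x] (\<lambda>s. 1)"
    "unit_matrix (stack cap (beside d (strands 1))) [x, \<not> x] [] (\<lambda>s. 1)"
    "unit_matrix (stack cap (stack (beside d (strands 1)) cup)) [] [] (\<lambda>s. 1)"
proof -
  have d: "is_diagram (gens A) (Suc 0) (Suc 0) d" "evd d s v w = of_bool (v = [x] \<and> w = [x])" for s v w
    using assms by (auto simp: unit_matrix_def)
  have dX: "is_diagram (gens A) 2 2 (beside d (strands 1))"
    using is_diagram_beside[OF d(1) is_diagram_intros(1)[of _ 1]] by (simp add: numeral_2_eq_2)
  have dXe: "evd (beside d (strands 1)) s v w = of_bool (\<exists>y. v = [x, y] \<and> w = [x, y])" for s v w
    unfolding evd_beside[OF d(1) is_diagram_intros(1)] d(2)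
    by (cases v; cases "tl v"; cases w; cases "tl w") (auto simp: length_Suc_conv)
  have c: "is_diagram (gens A) 0 2 (stack (beside d (strands 1)) cup)"
    "is_diagram (gens A) 2 0 (stack cap (beside d (strands 1)))"
    "is_diagram (gens A) 0 0 (stack cap (stack (beside d (strands 1)) cup))"
    using dX by (auto intro!: is_diagram_stack)
  have e: "evd (stack (beside d (strands 1)) cup) s v w = of_bool (v = [x, \<not> x] \<and> w = [])"
    "evd (stack cap (beside d (strands 1))) s v w = of_bool (v = [] \<and> w = [x, \<not> x])" for s v w
    unfolding evd_stack[OF dX is_diagram_intros(2)] evd_stack[OF is_diagram_intros(3) dX] dXe
    by (auto simp: numeral_2_eq_2 sum_words_Suc)
  have e': "evd (stack cap (stack (beside d (strands 1)) cup)) s v w = of_bool (v = [] \<and> w = [])" for s v w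
    unfolding evd_stack[OF is_diagram_intros(3) c(1)] e by (auto simp: numeral_2_eq_2 sum_words_Suc)
  show "unit_matrix (stack (beside d (strands 1)) cup) [] [x, \<not> x] (\<lambda>s. 1)"
    "unit_matrix (stack cap (beside d (strands 1))) [x, \<not> x] [] (\<lambda>s. 1)"
    "unit_matrix (stack cap (stack (beside d (strands 1)) cup)) [] [] (\<lambda>s. 1)"
    unfolding unit_matrix_def e e' using c by (simp_all add: numeral_2_eq_2)
qed

lemma unit_matrix_click:
  assumes f: "unit_matrix f (replicate (Suc b) x) (replicate (Suc t) (\<not> x)) c"
  shows "unit_matrix (click f) (replicate (Suc b) x) (replicate (Suc t) (\<not> x)) (\<lambda>s. c (s - sg x))"
  unfolding unit_matrix_def
proof (intro conjI allI)
  have d: "is_diagram (gens A) (Suc b) (Suc t) f" using f by (simp add: unit_matrix_def)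
  show dc: "is_diagram (gens A) (length (replicate (Suc b) x)) (length (replicate (Suc t) (\<not> x))) (click f)"
    using d by (simp add: is_diagram_click)
  have snoc: "u @ [l] = y # replicate k y \<longleftrightarrow> u = replicate k y \<and> l = y" for k u and y l :: bool
    unfolding replicate_append_same[symmetric] by (simp only: append1_eq_conv)
  fix s v w
  show "evd (click f) s v w =
    of_bool (v = replicate (Suc t) (\<not> x) \<and> w = replicate (Suc b) x) * c (s - sg x)"
  proof (cases "length v = Suc t \<and> length w = Suc b")
    case True
    then obtain z v' where v: "v = z # v'" "length v' = t" by (auto simp: length_Suc_conv)
    from True have "w \<noteq> []" by auto
    then obtain w' l where w: "w = w' @ [l]" by (metis append_butlast_last_id)
    then have lw: "length w' = b" using True by simp
    have "(v' @ [\<not> l] = replicate (Suc t) (\<not> x) \<and> (\<not> z) # w' = replicate (Suc b) x) \<longleftrightarrow>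
      (v = replicate (Suc t) (\<not> x) \<and> w = replicate (Suc b) x)"
      unfolding v w by (auto simp: snoc)
    moreover have "s + sg z = s - sg x" if "(\<not> z) # w' = replicate (Suc b) x"
      using that by auto
    ultimately show ?thesis
      using evd_click[of "gens A" w' v' f s z l] d f v lw unfolding w v(1)
      by (auto simp: unit_matrix_def simp del: replicate_Suc)
  next
    case False
    then show ?thesis using evd_support[OF dc, of s v w] by auto
  qed
qed

lemma unit_matrix_click_U_V:
  "unit_matrix (click U) (replicate a True) (replicate n False) (\<lambda>s. lam * lam powi (- s))"
  "unit_matrix (click V) (replicate n False) (replicate a True) (\<lambda>s. lam * lam powi s)"
proof -
  obtain a' n' where a: "a = Suc a'" "n = Suc n'" using an(2,3) by (metis not0_implies_Suc not_one_le_zero)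
  have "lam powi (- (s - 1)) = lam * lam powi (- s)" "lam powi (s + 1) = lam * lam powi s" for s
    using lam_powi_add[of 1 "- s"] lam_powi_add[of 1 s] by (simp_all add: add.commute)
  then show "unit_matrix (click U) (replicate a True) (replicate n False) (\<lambda>s. lam * lam powi (- s))"
    "unit_matrix (click V) (replicate n False) (replicate a True) (\<lambda>s. lam * lam powi s)"
    using unit_matrix_click[of U a' True n' "\<lambda>s. lam powi (- s)"] unit_matrix_U_V
      unit_matrix_click[of V n' False a' "\<lambda>s. lam powi s"]
    unfolding a[symmetric] by simp_all
qed

lemma evl_rels:
  assumes "x \<in> rels A"
  shows "evl x s v w = 0"
proof -
  have e: "evd d s v w = of_bool (v = v' \<and> w = w') * c s" if "unit_matrix d w' v' c" for d v' w' c
    using that by (simp add: unit_matrix_def)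
  note P = unit_matrix_P1_Q1(1) and Q = unit_matrix_P1_Q1(2)
  note Pa = unit_matrix_power[OF P, of a] and Qn = unit_matrix_power[OF Q, of n]
  note UV = unit_matrix_U_V
  have nil: "evd (stack P1 Q1) s v w = 0" "evd (stack Q1 P1) s v w = 0"
    using P Q by (simp_all add: evd_stack[of "gens A" 1 1 _ "gens A" 1] unit_matrix_def sum_words_Suc)
  have X: "evd (strands 1) s v w = evd P1 s v w + evd Q1 s v w"
    using e[OF P] e[OF Q] by (cases w) (auto simp: length_Suc_conv)
  have "lam powi (- s) * lam powi s = 1" "lam powi s * lam powi (- s) = 1"
    by (simp_all flip: lam_powi_add)
  note facts = this nil X e[OF P] e[OF Q] e[OF UV(1)] e[OF UV(2)]
    e[OF unit_matrix_stack[OF Qn unit_matrix_stack[OF UV(1) Pa]]]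
    e[OF unit_matrix_stack[OF Pa unit_matrix_stack[OF UV(2) Qn]]]
    e[OF unit_matrix_cup_cap(3)[OF P]] e[OF unit_matrix_cup_cap(3)[OF Q]]
    e[OF unit_matrix_stack[OF unit_matrix_cup_cap(1,2)[OF P]]]
    e[OF unit_matrix_stack[OF unit_matrix_cup_cap(1,2)[OF Q]]]
    e[OF unit_matrix_beside[OF P Q]] e[OF unit_matrix_beside[OF Q P]]
    e[OF unit_matrix_stack[OF UV]] e[OF unit_matrix_stack[OF UV(2,1)]]
    e[OF Pa] e[OF Qn] e[OF unit_matrix_click_U_V(1)] e[OF unit_matrix_click_U_V(2)]
  show ?thesis
    using assms unfolding rels_A
    by (elim insertE emptyE; hypsubst) (simp_all add: facts conj_commute del: One_nat_def,
      auto simp: length_Suc_conv)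
qed

text \<open>
  The relations hold for every degree on the left, which makes them hold inside any larger
  diagram.
\<close>

theorem planar_ideal_evl: "planar_ideal A b t x \<Longrightarrow> evl x s v w = 0"
proof (induction arbitrary: s v w rule: planar_ideal.induct)
  case (ideal_stack_left b t x y u)
  then show ?case using planar_ideal_free by (subst evl_stack) auto
next
  case (ideal_stack_right b t x y a)
  then show ?case using planar_ideal_free by (subst evl_stack) auto
next
  case (ideal_beside_left b t x y b' t')
  then show ?case using planar_ideal_free by (subst evl_beside) auto
next
  case (ideal_beside_right b t x y b' t')
  then show ?case using planar_ideal_free by (subst evl_beside) auto
qed (auto simp: evl_rels)

end

text \<open>The number of points of a single strand stays \<open>1\<close>, as in \<open>box LP 1 1\<close>.\<close>

declare One_nat_def [simp del] One_nat_def [symmetric, simp]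

lemma plus_one_nat [simp]: "(1::nat) + k = Suc k" "k + 1 = Suc k"
  by simp_all

lemma replicate_one [simp]: "replicate 1 x = [x]"
  by (simp only: One_nat_def replicate.simps)

context cyclic
begin

sublocale planar_presentation A .

notation comp (infixr \<open>\<odot>\<close> 75)
notation tens (infixr \<open>||\<close> 80)
notation add (infixl \<open>\<dotplus>\<close> 65)

section \<open>Reduction of diagrams to a normal form\<close>

definition L :: "bool \<Rightarrow> (nat, label lincomb set) arrow" where
  "L x = dg 1 1 (if x then P1 else Q1)"

primrec W :: "bool list \<Rightarrow> (nat, label lincomb set) arrow" where
  "W [] = I 0"
| "W (x # w) = L x || W w"

definition "Cup' = dg 0 2 cup"
definition "Cap' = dg 2 0 cap"
definition "u = dg a n U"
definition "v = dg n a V"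

lemma is_diagram_L: "is_diagram (gens A) 1 1 (if x then P1 else Q1)"
  by simp

lemma gen_simps [simp]:
  "L x \<in> Mor" "src (L x) = 1" "tgt (L x) = 1"
  "Cup' \<in> Mor" "src Cup' = 0" "tgt Cup' = 2"
  "Cap' \<in> Mor" "src Cap' = 2" "tgt Cap' = 0"
  "u \<in> Mor" "src u = a" "tgt u = n"
  "v \<in> Mor" "src v = n" "tgt v = a"
  unfolding L_def Cup'_def Cap'_def u_def v_def using is_diagram_L[of x] by simp_all

lemma W_simps [simp]: "W w \<in> Mor" "src (W w) = length w" "tgt (W w) = length w"
  by (induction w) simp_all

lemma W_append: "W (w @ w') = W w || W w'"
  by (induction w) (simp_all add: tens_assoc)

abbreviation Pw where "Pw r \<equiv> W (replicate r True)"
abbreviation Qw where "Qw r \<equiv> W (replicate r False)"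

lemma interchange2:
  "f \<in> Mor \<Longrightarrow> g \<in> Mor \<Longrightarrow> f' \<in> Mor \<Longrightarrow> g' \<in> Mor \<Longrightarrow> x \<in> Mor \<Longrightarrow> src f = tgt g \<Longrightarrow> src f' = tgt g' \<Longrightarrow>
    src g + src g' = tgt x \<Longrightarrow>
    (f || f') \<odot> ((g || g') \<odot> x) = ((f \<odot> g) || (f' \<odot> g')) \<odot> x"
  by (simp add: interchange flip: comp_assoc)

lemma dg_rel:
  assumes "\<langle>d\<rangle> - \<langle>e\<rangle> \<in> rels A" "is_diagram (gens A) b t d" "is_diagram (gens A) b t e"
  shows "dg b t d = dg b t e"
  using assms by (simp add: cl_eq_iff ideal_rel)

subsection \<open>The relations\<close>

lemma dg_power:
  "dg k k (beside_power P1 k) = Pw k" "dg k k (beside_power Q1 k) = Qw k"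
proof (induction k)
  case (Suc k)
  have "dg (1 + k) (1 + k) (beside d (beside_power d k)) = dg 1 1 d || dg k k (beside_power d k)"
    if "is_diagram (gens A) 1 1 d" for d
    using that by (subst dg_tens) auto
  from this[of P1] this[of Q1] Suc
  show "dg (Suc k) (Suc k) (beside_power P1 (Suc k)) = Pw (Suc k)"
    "dg (Suc k) (Suc k) (beside_power Q1 (Suc k)) = Qw (Suc k)"
    by (simp_all add: L_def)
qed simp_all

lemma L_rels:
  "I 1 = L True \<dotplus> L False"
  "x \<noteq> y \<Longrightarrow> L x \<odot> L y = zr 1 1"
proof -
  have "planar_ideal A 1 1 (\<langle>strands 1\<rangle> - (\<langle>P1\<rangle> + \<langle>Q1\<rangle>))"
    by (rule ideal_rel) (simp_all add: rels_A)
  then show "I 1 = L True \<dotplus> L False"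
    by (simp add: L_def cl_add cl_eq_iff)
  have "planar_ideal A 1 1 \<langle>stack P1 Q1\<rangle>" "planar_ideal A 1 1 \<langle>stack Q1 P1\<rangle>"
    using is_diagram_stack[of "gens A" 1 1 _ 1] by (auto intro!: ideal_rel simp: rels_A)
  then show "x \<noteq> y \<Longrightarrow> L x \<odot> L y = zr 1 1"
    using is_diagram_stack[of "gens A" 1 1 _ 1]
    by (cases x; cases y) (simp_all add: L_def dg_comp cl_eq_iff)
qed

lemma L_idem [simp]: "L x \<odot> L x = L x"
proof -
  have "L x = L x \<odot> (L True \<dotplus> L False)"
    unfolding L_rels(1)[symmetric] by simp
  also have "\<dots> = L x \<odot> L x"
    by (cases x) (simp_all add: comp_linear L_rels(2))
  finally show ?thesis by simp
qed

lemma loop: "Cap' \<odot> ((L x || I 1) \<odot> Cup') = I 0"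
proof -
  have d: "is_diagram (gens A) 2 2 (beside (if x then P1 else Q1) (strands 1))"
    using is_diagram_beside[OF is_diagram_L is_diagram_intros(1)[of _ 1]] by simp
  have "Cap' \<odot> ((L x || I 1) \<odot> Cup') = dg 0 0 (stack cap (stack (beside (if x then P1 else Q1) (strands 1)) cup))"
    using d is_diagram_stack[OF d is_diagram_intros(2)]
    by (simp add: L_def Cap'_def Cup'_def dg_tens[OF is_diagram_L is_diagram_intros(1)] dg_comp del: if_split)
  also have "\<dots> = dg 0 0 (strands 0)"
    using is_diagram_stack[OF is_diagram_intros(3) is_diagram_stack[OF d is_diagram_intros(2)]]
    by (intro dg_rel) (cases x; simp add: rels_A)+
  finally show ?thesis .
qed

lemma turnback: "((L x || I 1) \<odot> Cup') \<odot> (Cap' \<odot> (L x || I 1)) = L x || L (\<not> x)"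
proof -
  let ?d = "if x then P1 else Q1" and ?d' = "if \<not> x then P1 else Q1"
  have d: "is_diagram (gens A) 2 2 (beside ?d (strands 1))" "is_diagram (gens A) 2 2 (beside ?d ?d')"
    using is_diagram_beside[OF is_diagram_L is_diagram_intros(1)[of _ 1]]
      is_diagram_beside[OF is_diagram_L is_diagram_L] by (simp_all del: if_split)
  have s: "is_diagram (gens A) 0 2 (stack (beside ?d (strands 1)) cup)"
     "is_diagram (gens A) 2 0 (stack cap (beside ?d (strands 1)))"
    using d(1) by (auto intro!: is_diagram_stack simp del: if_split)
  have "((L x || I 1) \<odot> Cup') \<odot> (Cap' \<odot> (L x || I 1)) =
    dg 2 2 (stack (stack (beside ?d (strands 1)) cup) (stack cap (beside ?d (strands 1))))"
    using d s
    by (simp add: L_def Cap'_def Cup'_def dg_tens[OF is_diagram_L is_diagram_intros(1)] dg_comp del: if_split)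
  also have "\<dots> = dg 2 2 (beside ?d ?d')"
    using d(2) is_diagram_stack[OF s] by (intro dg_rel) (cases x; simp add: rels_A)+
  also have "\<dots> = L x || L (\<not> x)"
    unfolding L_def dg_tens[OF is_diagram_L is_diagram_L] by simp
  finally show ?thesis .
qed

lemma zigzag:
  "(Cap' || I 1) \<odot> (I 1 || Cup') = I 1"
  "(I 1 || Cap') \<odot> (Cup' || I 1) = I 1"
proof -
  note b = is_diagram_beside[OF is_diagram_intros(3) is_diagram_intros(1)[of "gens A" 1]]
    is_diagram_beside[OF is_diagram_intros(1)[of "gens A" 1] is_diagram_intros(2)]
    is_diagram_beside[OF is_diagram_intros(1)[of "gens A" 1] is_diagram_intros(3)]
    is_diagram_beside[OF is_diagram_intros(2) is_diagram_intros(1)[of "gens A" 1]]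
  have 3: "(2::nat) + 1 = 3" "(1::nat) + 2 = 3" by simp_all
  show "(Cap' || I 1) \<odot> (I 1 || Cup') = I 1" "(I 1 || Cap') \<odot> (Cup' || I 1) = I 1"
    using b by (simp_all add: Cap'_def Cup'_def dg_tens dg_comp zigzag_diagram 3 del: plus_1_eq_Suc)
qed

lemma dg_click:
  assumes "is_diagram (gens A) b t d"
  shows "dg b t (click d) = (I t || Cap') \<odot> ((I 1 || (dg b t d || I 1)) \<odot> (Cup' || I b))"
proof -
  have 2: "1 + (b + 1) = 2 + b" "1 + (t + 1) = t + 2" by simp_all
  note d1 = is_diagram_beside[OF is_diagram_intros(1)[of "gens A" t] is_diagram_intros(3)]
  note d2 = is_diagram_beside[OF is_diagram_intros(2) is_diagram_intros(1)[of "gens A" b]]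
  note d3 = is_diagram_beside[OF assms is_diagram_intros(1)[of "gens A" 1]]
  note d4 = is_diagram_beside[OF is_diagram_intros(1)[of "gens A" 1] d3, unfolded 2]
  have "(I t || Cap') \<odot> ((I 1 || (dg b t d || I 1)) \<odot> (Cup' || I b)) =
    dg (t + 2) (t + 0) (beside (strands t) cap) \<odot>
     (dg (2 + b) (t + 2) (beside (strands 1) (beside d (strands 1))) \<odot>
      dg (0 + b) (2 + b) (beside cup (strands b)))"
    unfolding Cap'_def Cup'_def dg_tens[OF is_diagram_intros(1) is_diagram_intros(3)]
      dg_tens[OF is_diagram_intros(2) is_diagram_intros(1)] dg_tens[OF assms is_diagram_intros(1)]
      dg_tens[OF is_diagram_intros(1) d3] 2 by (rule refl)
  also have "\<dots> = dg (0 + b) (t + 0) (click d)"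
    unfolding click_diagram[OF assms] dg_comp[OF d4 d2] dg_comp[OF d1 is_diagram_stack[OF d4 d2]]
    by (rule refl)
  finally show ?thesis by simp
qed

lemma L_click: "(I 1 || Cap') \<odot> ((I 1 || (L x || I 1)) \<odot> (Cup' || I 1)) = L (\<not> x)"
proof -
  have "(1::nat) + 1 = Suc (Suc 0)" by (simp only: One_nat_def add_Suc add_0)
  then have "click Q1 = P1"
    using full_turn_diagram[of 1 1 LP] by (simp only: Q1_def P1_def funpow.simps o_apply id_apply)
  then have "click (if x then P1 else Q1) = (if \<not> x then P1 else Q1)" by (simp add: Q1_def)
  then show ?thesis
    using dg_click[OF is_diagram_L, of x] by (simp add: L_def del: if_split)
qed

lemma u_click: "(I n || Cap') \<odot> ((I 1 || (u || I 1)) \<odot> (Cup' || I a)) = sc lam u"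
proof -
  have "planar_ideal A a n (\<langle>click U\<rangle> - scale lam \<langle>U\<rangle>)"
    by (rule ideal_rel) (simp_all add: rels_A is_diagram_click)
  then have "dg a n (click U) = sc lam u"
    by (simp add: u_def cl_sc cl_eq_iff is_diagram_click)
  then show ?thesis using dg_click[OF is_diagram_U_V(1)] by (simp add: u_def)
qed

lemma u_v_rels:
  "Qw n \<odot> (u \<odot> Pw a) = u" "u \<odot> v = Qw n" "v \<odot> u = Pw a" "Pw a \<odot> (v \<odot> Qw n) = v"
proof -
  have d: "is_diagram (gens A) k k (beside_power P1 k)" "is_diagram (gens A) k k (beside_power Q1 k)" for k
    by simp_all
  note s = is_diagram_stack[OF is_diagram_U_V(1) d(1)] is_diagram_stack[OF is_diagram_U_V(2) d(2)]
  show "Qw n \<odot> (u \<odot> Pw a) = u"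
    unfolding dg_power[symmetric] u_def using d s is_diagram_stack[OF d(2) s(1)]
    by (simp add: dg_comp, intro dg_rel[symmetric]) (simp_all add: rels_A)
  show "Pw a \<odot> (v \<odot> Qw n) = v"
    unfolding dg_power[symmetric] v_def using d s is_diagram_stack[OF d(1) s(2)]
    by (simp add: dg_comp, intro dg_rel[symmetric]) (simp_all add: rels_A)
  show "u \<odot> v = Qw n" "v \<odot> u = Pw a"
    unfolding dg_power[symmetric] u_def v_def
    using d is_diagram_stack[OF is_diagram_U_V] is_diagram_stack[OF is_diagram_U_V(2,1)]
    by (simp_all add: dg_comp, (intro dg_rel; simp add: rels_A)+)
qed

lemma W_idem [simp]: "W w \<odot> W w = W w"
  by (induction w) (simp_all add: interchange)

lemma W_orth: "length w = length w' \<Longrightarrow> w \<noteq> w' \<Longrightarrow> W w \<odot> W w' = zr (length w) (length w)"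
proof (induction w w' rule: list_induct2)
  case (Cons x w y w')
  then show ?case by (cases "x = y") (simp_all add: interchange L_rels(2))
qed simp

lemma u_absorb [simp]: "Qw n \<odot> u = u" "u \<odot> Pw a = u" "Pw a \<odot> v = v" "v \<odot> Qw n = v"
proof -
  have "Qw n \<odot> (Qw n \<odot> (u \<odot> Pw a)) = Qw n \<odot> (u \<odot> Pw a)"
    "(Qw n \<odot> (u \<odot> Pw a)) \<odot> Pw a = Qw n \<odot> (u \<odot> Pw a)"
    "Pw a \<odot> (Pw a \<odot> (v \<odot> Qw n)) = Pw a \<odot> (v \<odot> Qw n)"
    "(Pw a \<odot> (v \<odot> Qw n)) \<odot> Qw n = Pw a \<odot> (v \<odot> Qw n)"
    by (simp_all add: comp_assoc) (simp_all flip: comp_assoc)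
  then show "Qw n \<odot> u = u" "u \<odot> Pw a = u" "Pw a \<odot> v = v" "v \<odot> Qw n = v"
    by (simp_all only: u_v_rels)
qed

subsection \<open>Oriented cups and caps\<close>

lemma whisker:
  "f \<in> Mor \<Longrightarrow> g \<in> Mor \<Longrightarrow> src f = tgt g \<Longrightarrow> I k || (f \<odot> g) = (I k || f) \<odot> (I k || g)"
  "f \<in> Mor \<Longrightarrow> g \<in> Mor \<Longrightarrow> src f = tgt g \<Longrightarrow> (f \<odot> g) || I k = (f || I k) \<odot> (g || I k)"
  by (simp_all add: interchange)

lemma exchange_to_empty:
  "f \<in> Mor \<Longrightarrow> g \<in> Mor \<Longrightarrow> tgt f = 0 \<Longrightarrow> tgt g = 0 \<Longrightarrow>
    f \<odot> (I (src f) || g) = g \<odot> (f || I (src g))"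
  using interchange[of f "I (src f)" "I 0" g] interchange[of "I 0" f g "I (src g)"] by simp

lemma exchange_from_empty:
  "f \<in> Mor \<Longrightarrow> g \<in> Mor \<Longrightarrow> src f = 0 \<Longrightarrow> src g = 0 \<Longrightarrow>
    (I (tgt f) || g) \<odot> f = (f || I (tgt g)) \<odot> g"
  using interchange[of "I (tgt f)" f g "I 0"] interchange[of f "I 0" "I (tgt g)" g] by simp

lemma slide_Cap: "Cap' \<odot> (L x || I 1) = Cap' \<odot> (I 1 || L (\<not> x))"
proof -
  have "I 1 || L (\<not> x) = (I 2 || Cap') \<odot> ((I 2 || (L x || I 1)) \<odot> ((I 1 || Cup') || I 1))"
    unfolding L_click[symmetric] by (simp add: whisker(1) flip: tens_assoc)
  then have "Cap' \<odot> (I 1 || L (\<not> x)) =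
    (Cap' \<odot> (I 2 || (Cap' \<odot> (L x || I 1)))) \<odot> ((I 1 || Cup') || I 1)"
    by (simp add: whisker(1) comp_assoc)
  also have "Cap' \<odot> (I 2 || (Cap' \<odot> (L x || I 1))) = (Cap' \<odot> (L x || I 1)) \<odot> (Cap' || I 2)"
    using exchange_to_empty[of Cap' "Cap' \<odot> (L x || I 1)"] by simp
  also have "((Cap' \<odot> (L x || I 1)) \<odot> (Cap' || I 2)) \<odot> ((I 1 || Cup') || I 1) =
    (Cap' \<odot> (L x || I 1)) \<odot> (((Cap' || I 1) || I 1) \<odot> ((I 1 || Cup') || I 1))"
    by (simp add: comp_assoc tens_assoc[of Cap'])
  also have "((Cap' || I 1) || I 1) \<odot> ((I 1 || Cup') || I 1) = I 2"
    by (simp add: interchange zigzag)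
  finally show ?thesis by simp
qed

lemma slide_Cup: "(L x || I 1) \<odot> Cup' = (I 1 || L (\<not> x)) \<odot> Cup'"
proof -
  have "L x || I 1 = ((I 1 || Cap') || I 1) \<odot> (((I 1 || L (\<not> x)) || I 2) \<odot> (Cup' || I 2))"
    using L_click[of "\<not> x", symmetric] by (simp add: whisker(2)) (simp add: tens_assoc)
  then have "(L x || I 1) \<odot> Cup' =
     ((I 1 || Cap') || I 1) \<odot> (((I 1 || L (\<not> x)) || I 2) \<odot> ((Cup' || I 2) \<odot> Cup'))"
    by (simp add: comp_assoc)
  also have "(Cup' || I 2) \<odot> Cup' = (I 2 || Cup') \<odot> Cup'"
    using exchange_from_empty[of Cup' Cup'] by simp
  also have "((I 1 || L (\<not> x)) || I 2) \<odot> ((I 2 || Cup') \<odot> Cup') =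
    (I 2 || Cup') \<odot> ((I 1 || L (\<not> x)) \<odot> Cup')"
    using interchange[of "I 1 || L (\<not> x)" "I 2" "I 2" Cup']
      interchange[of "I 2" "I 1 || L (\<not> x)" Cup' "I 0"]
    by (simp flip: comp_assoc)
  also have "((I 1 || Cap') || I 1) \<odot> ((I 2 || Cup') \<odot> ((I 1 || L (\<not> x)) \<odot> Cup')) =
    ((I 1 || (Cap' || I 1)) \<odot> (I 1 || (I 1 || Cup'))) \<odot> ((I 1 || L (\<not> x)) \<odot> Cup')"
    by (simp add: comp_assoc) (simp add: tens_assoc flip: tens_assoc[of "I 1" "I 1" Cup'])
  also have "(I 1 || (Cap' || I 1)) \<odot> (I 1 || (I 1 || Cup')) = I 2"
    by (simp add: interchange zigzag)
  finally show ?thesis by simp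
qed

definition cu where "cu x = (L x || I 1) \<odot> Cup'"
definition ca where "ca x = Cap' \<odot> (L x || I 1)"

lemma cu_ca_simps [simp]:
  "cu x \<in> Mor" "src (cu x) = 0" "tgt (cu x) = 2"
  "ca x \<in> Mor" "src (ca x) = 2" "tgt (ca x) = 0"
  by (simp_all add: cu_def ca_def)

lemma oriented_Cup: "(L x || L y) \<odot> Cup' = (if y = (\<not> x) then cu x else zr 0 2)"
proof -
  have "(L x || L y) \<odot> Cup' = (I 1 || L y) \<odot> cu x"
    unfolding cu_def by (simp add: interchange flip: comp_assoc)
  also have "\<dots> = (I 1 || (L y \<odot> L (\<not> x))) \<odot> Cup'"
    unfolding cu_def slide_Cup by (simp add: interchange flip: comp_assoc)
  finally have *: "(L x || L y) \<odot> Cup' = (I 1 || (L y \<odot> L (\<not> x))) \<odot> Cup'" .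
  show ?thesis
  proof (cases "y = (\<not> x)")
    case True
    then show ?thesis using * by (simp add: cu_def slide_Cup)
  next
    case False
    then show ?thesis unfolding * by (simp add: L_rels(2))
  qed
qed

lemma oriented_Cap: "Cap' \<odot> (L x || L y) = (if y = (\<not> x) then ca x else zr 2 0)"
proof -
  have "Cap' \<odot> (L x || L y) = ca x \<odot> (I 1 || L y)"
    unfolding ca_def by (simp add: interchange comp_assoc)
  also have "\<dots> = Cap' \<odot> (I 1 || (L (\<not> x) \<odot> L y))"
    unfolding ca_def slide_Cap by (simp add: interchange comp_assoc)
  finally have *: "Cap' \<odot> (L x || L y) = Cap' \<odot> (I 1 || (L (\<not> x) \<odot> L y))" .
  show ?thesis
  proof (cases "y = (\<not> x)")
    case True
    then show ?thesis using * by (simp add: ca_def slide_Cap)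
  next
    case False
    then have "L (\<not> x) \<odot> L y = zr 1 1" by (intro L_rels(2)) auto
    then show ?thesis using False unfolding * by simp
  qed
qed

lemma cu_ca_absorb [simp]: "(L x || L (\<not> x)) \<odot> cu x = cu x" "ca x \<odot> (L x || L (\<not> x)) = ca x"
proof -
  have c: "cu x = (L x || L (\<not> x)) \<odot> Cup'" "ca x = Cap' \<odot> (L x || L (\<not> x))"
    by (simp_all add: oriented_Cup oriented_Cap)
  show "(L x || L (\<not> x)) \<odot> cu x = cu x" unfolding c by (simp add: interchange flip: comp_assoc)
  show "ca x \<odot> (L x || L (\<not> x)) = ca x" unfolding c by (simp add: interchange comp_assoc)
qed

lemma ca_cu: "ca x \<odot> cu x = I 0"
proof -
  have "ca x \<odot> cu x = Cap' \<odot> (((L x || I 1) \<odot> (L x || I 1)) \<odot> Cup')"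
    unfolding cu_def ca_def by (simp add: comp_assoc)
  then show ?thesis by (simp add: interchange loop)
qed

lemma cu_ca: "cu x \<odot> ca x = L x || L (\<not> x)"
  using turnback by (simp add: cu_def ca_def)

lemma Cup_sum: "Cup' = cu True \<dotplus> cu False" and Cap_sum: "Cap' = ca True \<dotplus> ca False"
proof -
  have "I 2 = (L True \<dotplus> L False) || I 1" unfolding L_rels(1)[symmetric] by simp
  then have *: "I 2 = L True || I 1 \<dotplus> L False || I 1" by (simp add: tens_linear)
  have "Cup' = I 2 \<odot> Cup'" "Cap' = Cap' \<odot> I 2" by simp_all
  then show "Cup' = cu True \<dotplus> cu False" "Cap' = ca True \<dotplus> ca False"
    unfolding * cu_def ca_def by (simp_all add: comp_linear)
qed

lemma tens_split:
  assumes "f \<in> Mor" "g \<in> Mor"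
  shows "(f || I (tgt g)) \<odot> (I (src f) || g) = f || g" "(I (tgt f) || g) \<odot> (f || I (src g)) = f || g"
  using assms by (simp_all add: interchange)

lemma comp_empty:
  "g \<in> Mor \<Longrightarrow> g' \<in> Mor \<Longrightarrow> f \<in> Mor \<Longrightarrow> tgt f = 0 \<Longrightarrow> src g = tgt g' \<Longrightarrow>
    g \<odot> (g' || f) = (g \<odot> g') || f"
  using interchange[of g g' "I 0" f] by simp

lemma oriented_zigzag:
  "(ca x || L x) \<odot> (L x || cu (\<not> x)) = L x"
  "(L x || ca (\<not> x)) \<odot> (cu x || L x) = L x"
proof -
  define S where "S = L x || (I 1 || L x)"
  have S [simp]: "S \<in> Mor" "src S = 3" "tgt S = 3" "S \<odot> S = S"
    by (simp_all add: S_def interchange)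
  have S1: "S = (I 2 || L x) \<odot> (L x || I 2)" and S2: "S = (L x || I 2) \<odot> (I 2 || L x)"
    using tens_split[of "L x" "I 1 || L x"] tens_split[of "L x || I 1" "L x"]
    by (simp_all add: S_def tens_assoc)
  have "ca x || L x = (Cap' || I 1) \<odot> S"
    using interchange[of Cap' "L x || I 1" "I 1" "L x"] by (simp add: ca_def S_def tens_assoc)
  moreover have "L x || cu (\<not> x) = S \<odot> (I 1 || Cup')"
    unfolding cu_def slide_Cup S_def by (simp add: interchange)
  ultimately have "(ca x || L x) \<odot> (L x || cu (\<not> x)) = (Cap' || I 1) \<odot> (S \<odot> (S \<odot> (I 1 || Cup')))"
    by (simp add: comp_assoc)
  also have "\<dots> = (Cap' || I 1) \<odot> (S \<odot> (I 1 || Cup'))"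
    by (simp flip: comp_assoc)
  also have "\<dots> = ((Cap' || I 1) \<odot> (I 2 || L x)) \<odot> ((L x || I 2) \<odot> (I 1 || Cup'))"
    unfolding S1 by (simp add: comp_assoc)
  also have "(Cap' || I 1) \<odot> (I 2 || L x) = L x \<odot> (Cap' || I 1)"
    using tens_split[of Cap' "L x"] by simp
  also have "(L x || I 2) \<odot> (I 1 || Cup') = (I 1 || Cup') \<odot> L x"
    using tens_split[of "L x" Cup'] by simp
  also have "(L x \<odot> (Cap' || I 1)) \<odot> ((I 1 || Cup') \<odot> L x) = L x \<odot> (((Cap' || I 1) \<odot> (I 1 || Cup')) \<odot> L x)"
    by (simp add: comp_assoc)
  finally show "(ca x || L x) \<odot> (L x || cu (\<not> x)) = L x"
    by (simp add: zigzag)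
  have "L x || ca (\<not> x) = (I 1 || Cap') \<odot> S"
    unfolding ca_def slide_Cap S_def by (simp add: interchange)
  moreover have "cu x || L x = S \<odot> (Cup' || I 1)"
    using interchange[of "L x || I 1" Cup' "L x" "I 1"] by (simp add: cu_def S_def tens_assoc)
  ultimately have "(L x || ca (\<not> x)) \<odot> (cu x || L x) = (I 1 || Cap') \<odot> (S \<odot> (S \<odot> (Cup' || I 1)))"
    by (simp add: comp_assoc)
  also have "\<dots> = (I 1 || Cap') \<odot> (S \<odot> (Cup' || I 1))"
    by (simp flip: comp_assoc)
  also have "\<dots> = ((I 1 || Cap') \<odot> (L x || I 2)) \<odot> ((I 2 || L x) \<odot> (Cup' || I 1))"
    unfolding S2 by (simp add: comp_assoc)
  also have "(I 1 || Cap') \<odot> (L x || I 2) = L x \<odot> (I 1 || Cap')"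
    using tens_split[of "L x" Cap'] by simp
  also have "(I 2 || L x) \<odot> (Cup' || I 1) = (Cup' || I 1) \<odot> L x"
    using tens_split[of Cup' "L x"] by simp
  also have "(L x \<odot> (I 1 || Cap')) \<odot> ((Cup' || I 1) \<odot> L x) = L x \<odot> (((I 1 || Cap') \<odot> (Cup' || I 1)) \<odot> L x)"
    by (simp add: comp_assoc)
  finally show "(L x || ca (\<not> x)) \<odot> (cu x || L x) = L x"
    by (simp add: zigzag)
qed

subsection \<open>The invertible step morphisms\<close>

lemma replicate_W_snoc: "W (replicate (Suc k) x) = W (replicate k x) || L x"
proof -
  have "W (replicate (Suc k) x) = W (replicate k x @ [x])" by (simp add: replicate_append_same)
  then show ?thesis unfolding W_append by simp
qed

text \<open>
  Nested caps, closing \<open>k\<close> downward strands against \<open>k\<close> upward strands.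
\<close>

primrec capn where
  "capn 0 = I 0"
| "capn (Suc k) = capn k \<odot> (Qw k || (ca False || Pw k))"

primrec cupn where
  "cupn 0 = I 0"
| "cupn (Suc k) = (Qw k || (cu False || Pw k)) \<odot> cupn k"

lemma capn_cupn_simps [simp]:
  "capn k \<in> Mor" "src (capn k) = k + k" "tgt (capn k) = 0"
  "cupn k \<in> Mor" "src (cupn k) = 0" "tgt (cupn k) = k + k"
  by (induction k) simp_all

lemma QP_Suc: "Qw (Suc k) || Pw (Suc k) = Qw k || ((L False || L True) || Pw k)"
  unfolding replicate_W_snoc[of k False] by (simp add: tens_assoc)

lemma capn_absorb: "capn k \<odot> (Qw k || Pw k) = capn k"
  and cupn_absorb: "(Qw k || Pw k) \<odot> cupn k = cupn k"
proof -
  have "capn k \<odot> (Qw k || Pw k) = capn k \<and> (Qw k || Pw k) \<odot> cupn k = cupn k"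
  proof (cases k)
    case (Suc j)
    show ?thesis
      unfolding Suc QP_Suc capn.simps cupn.simps
      using cu_ca_absorb[of False]
      by (simp add: comp_assoc interchange interchange2)
  qed simp
  then show "capn k \<odot> (Qw k || Pw k) = capn k" "(Qw k || Pw k) \<odot> cupn k = cupn k" by blast+
qed

lemma capn_cupn: "capn k \<odot> cupn k = I 0" "cupn k \<odot> capn k = Qw k || Pw k"
proof (induction k)
  case (Suc k)
  have 0: "Qw k || Pw k = Qw k || (I 0 || Pw k)" by simp
  have "capn (Suc k) \<odot> cupn (Suc k) = capn k \<odot> ((Qw k || ((ca False \<odot> cu False) || Pw k)) \<odot> cupn k)"
    by (simp add: comp_assoc interchange interchange2)
  then show "capn (Suc k) \<odot> cupn (Suc k) = I 0"
    by (simp add: ca_cu cupn_absorb Suc)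
  have "cupn (Suc k) \<odot> capn (Suc k) =
    (Qw k || (cu False || Pw k)) \<odot> ((cupn k \<odot> capn k) \<odot> (Qw k || (ca False || Pw k)))"
    by (simp add: comp_assoc)
  also have "\<dots> = Qw k || ((cu False \<odot> ca False) || Pw k)"
    unfolding Suc 0 by (simp only: comp_assoc interchange interchange2 W_simps cu_ca_simps op_Mor op_src_tgt
      cl_simps W_idem comp_I cl_Mor free_space_single is_diagram_intros length_replicate)
  finally show "cupn (Suc k) \<odot> capn (Suc k) = Qw (Suc k) || Pw (Suc k)"
    unfolding QP_Suc cu_ca by simp
qed simp_all

definition "wrap = capn n \<odot> (u || Pw n)"
definition "wrap' = (v || Pw n) \<odot> cupn n"

lemma wrap_simps [simp]:
  "wrap \<in> Mor" "src wrap = m" "tgt wrap = 0"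
  "wrap' \<in> Mor" "src wrap' = 0" "tgt wrap' = m"
  using an(1) by (simp_all add: wrap_def wrap'_def)

lemma wrap_inverse: "wrap \<odot> wrap' = I 0" "wrap' \<odot> wrap = Pw m"
proof -
  have "wrap \<odot> wrap' = capn n \<odot> (((u \<odot> v) || Pw n) \<odot> cupn n)"
    unfolding wrap_def wrap'_def by (simp add: comp_assoc interchange interchange2)
  then show "wrap \<odot> wrap' = I 0" by (simp add: u_v_rels cupn_absorb capn_cupn)
  have "wrap' \<odot> wrap = (v || Pw n) \<odot> ((cupn n \<odot> capn n) \<odot> (u || Pw n))"
    unfolding wrap_def wrap'_def by (simp add: comp_assoc)
  also have "\<dots> = (v \<odot> u) || Pw n"
    unfolding capn_cupn by (simp add: interchange)
  also have "\<dots> = Pw (a + n)"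
    unfolding u_v_rels replicate_add W_append by simp
  finally show "wrap' \<odot> wrap = Pw m" unfolding an(1) .
qed

definition nx where "nx r = (if Suc r < m then Suc r else 0)"
definition pr where "pr r = (if r = 0 then m - 1 else r - 1)"

lemma nx_pr [simp]:
  "nx r < m" "r < m \<Longrightarrow> pr r < m" "r < m \<Longrightarrow> nx (pr r) = r" "r < m \<Longrightarrow> pr (nx r) = r"
  using m_ge_2 by (auto simp: nx_def pr_def)

text \<open>
  A stack of \<open>r < m\<close> upward strands, together with one more upward strand, is the
  next stack; the stack of \<open>m\<close> strands is replaced by the empty one through
  \<open>wrap\<close>. The inverse of \<open>al r\<close> is \<open>be r\<close>.
\<close>

definition al where "al r = (if Suc r < m then Pw (Suc r) else wrap)"
definition be where "be r = (if Suc r < m then Pw (Suc r) else wrap')"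

lemma al_be_simps [simp]:
  assumes "r < m"
  shows "al r \<in> Mor" "src (al r) = Suc r" "tgt (al r) = nx r"
    "be r \<in> Mor" "src (be r) = nx r" "tgt (be r) = Suc r"
    "al r \<odot> be r = Pw (nx r)" "be r \<odot> al r = L True || Pw r"
    "Pw (nx r) \<odot> al r = al r" "al r \<odot> (L True || Pw r) = al r"
    "(L True || Pw r) \<odot> be r = be r" "be r \<odot> Pw (nx r) = be r"
proof -
  have *: "al r \<in> Mor \<and> src (al r) = Suc r \<and> tgt (al r) = nx r \<and>
    be r \<in> Mor \<and> src (be r) = nx r \<and> tgt (be r) = Suc r \<and>
    al r \<odot> be r = Pw (nx r) \<and> be r \<odot> al r = Pw (Suc r)"
  proof (cases "Suc r < m")
    case True
    then have e: "al r = Pw (Suc r)" "be r = Pw (Suc r)" "nx r = Suc r"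
      by (simp_all add: al_def be_def nx_def)
    show ?thesis unfolding e using W_simps[of "replicate (Suc r) True"] W_idem[of "replicate (Suc r) True"]
      by (simp del: W.simps replicate_Suc W_simps W_idem)
  next
    case False
    then have r: "Suc r = m" using assms by simp
    have e: "al r = wrap" "be r = wrap'" "nx r = 0"
      using False by (simp_all add: al_def be_def nx_def)
    show ?thesis unfolding e r by (simp add: wrap_inverse)
  qed
  then show s: "al r \<in> Mor" "src (al r) = Suc r" "tgt (al r) = nx r"
    "be r \<in> Mor" "src (be r) = nx r" "tgt (be r) = Suc r"
    "al r \<odot> be r = Pw (nx r)" "be r \<odot> al r = L True || Pw r" by simp_all
  have i: "Pw (nx r) \<odot> al r = al r \<odot> (be r \<odot> al r)" "be r \<odot> Pw (nx r) = (be r \<odot> al r) \<odot> be r"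
    unfolding s(7)[symmetric]
    by (rule comp_assoc; simp only: s) (rule comp_assoc[symmetric]; simp only: s)
  have w: "al r \<odot> (L True || Pw r) = al r" "(L True || Pw r) \<odot> be r = be r"
  proof -
    have P: "L True || Pw r = Pw (Suc r)" by simp
    have "al r \<odot> Pw (Suc r) = al r \<and> Pw (Suc r) \<odot> be r = be r"
    proof (cases "Suc r < m")
      case True
      then have e: "al r = Pw (Suc r)" "be r = Pw (Suc r)" by (simp_all add: al_def be_def)
      show ?thesis unfolding e W_idem by simp
    next
      case False
      then have r: "Suc r = m" and e: "al r = wrap" "be r = wrap'"
        using assms by (simp_all add: al_def be_def)
      have "wrap \<odot> (wrap' \<odot> wrap) = (wrap \<odot> wrap') \<odot> wrap"
        "(wrap' \<odot> wrap) \<odot> wrap' = wrap' \<odot> (wrap \<odot> wrap')" by (simp_all add: comp_assoc)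
      then show ?thesis unfolding e r wrap_inverse by simp
    qed
    then show "al r \<odot> (L True || Pw r) = al r" "(L True || Pw r) \<odot> be r = be r" unfolding P by auto
  qed
  then show "al r \<odot> (L True || Pw r) = al r" "(L True || Pw r) \<odot> be r = be r" by auto
  show "Pw (nx r) \<odot> al r = al r" "be r \<odot> Pw (nx r) = be r"
    unfolding i s(8) w by (simp_all add: w)
qed

definition step where "step r x = (if x then nx r else pr r)"

lemma step_less [simp]: "r < m \<Longrightarrow> step r x < m"
  by (simp add: step_def)

lemma step_back [simp]: "r < m \<Longrightarrow> step (step r x) (\<not> x) = r"
  by (simp add: step_def)

text \<open>
  Fusing a strand of direction \<open>x\<close> into a stack of \<open>r\<close> upward strands.
  A downward strand is cancelled against the last strand of the stack; the empty stack is first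
  expanded to \<open>m\<close> strands by \<open>be\<close>. The inverse of \<open>sgm r
  x\<close> is \<open>tau r x\<close>.
\<close>

definition sgm where
  "sgm r x = (if x then al r else (Pw (pr r) || ca True) \<odot> (be (pr r) || L False))"
definition tau where
  "tau r x = (if x then be r else (al (pr r) || L False) \<odot> (Pw (pr r) || cu True))"

lemma Pw_snoc: "L True || Pw k = Pw k || L True"
  using replicate_W_snoc[of k True] by simp

lemma sgm_tau_simps [simp]:
  assumes "r < m"
  shows "sgm r x \<in> Mor" "src (sgm r x) = Suc r" "tgt (sgm r x) = step r x"
    "tau r x \<in> Mor" "src (tau r x) = step r x" "tgt (tau r x) = Suc r"
    "sgm r x \<odot> tau r x = Pw (step r x)" "tau r x \<odot> sgm r x = Pw r || L x"
    "Pw (step r x) \<odot> sgm r x = sgm r x" "sgm r x \<odot> (Pw r || L x) = sgm r x"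
proof -
  let ?p = "pr r"
  have p [simp]: "?p < m" "nx ?p = r" using assms by simp_all
  show "sgm r x \<in> Mor" "src (sgm r x) = Suc r" "tgt (sgm r x) = step r x"
    "tau r x \<in> Mor" "src (tau r x) = step r x" "tgt (tau r x) = Suc r"
    using assms by (simp_all add: sgm_def tau_def step_def)
  have "((Pw ?p || ca True) \<odot> (be ?p || L False)) \<odot> ((al ?p || L False) \<odot> (Pw ?p || cu True)) =
    (Pw ?p || ca True) \<odot> (((be ?p \<odot> al ?p) || L False) \<odot> (Pw ?p || cu True))"
    by (simp add: comp_assoc interchange2 del: al_be_simps(7-12))
  also have "\<dots> = Pw ?p || (ca True \<odot> ((L True || L False) \<odot> cu True))"
    by (simp add: Pw_snoc tens_assoc interchange)
  also have "\<dots> = Pw ?p" using cu_ca_absorb[of True] by (simp add: ca_cu)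
  finally show "sgm r x \<odot> tau r x = Pw (step r x)"
    using assms by (simp add: sgm_def tau_def step_def)
  have "((al ?p || L False) \<odot> (Pw ?p || cu True)) \<odot> ((Pw ?p || ca True) \<odot> (be ?p || L False)) =
    (al ?p || L False) \<odot> ((Pw ?p || (cu True \<odot> ca True)) \<odot> (be ?p || L False))"
    by (simp add: comp_assoc interchange2)
  also have "Pw ?p || (cu True \<odot> ca True) = (L True || Pw ?p) || L False"
    by (simp add: cu_ca Pw_snoc tens_assoc)
  also have "(al ?p || L False) \<odot> (((L True || Pw ?p) || L False) \<odot> (be ?p || L False)) = Pw r || L False"
    by (simp add: interchange)
  finally show "tau r x \<odot> sgm r x = Pw r || L x"
    using assms by (simp add: sgm_def tau_def Pw_snoc)
  show "Pw (step r x) \<odot> sgm r x = sgm r x"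
    using assms by (simp add: sgm_def step_def comp_empty flip: comp_assoc)
  show "sgm r x \<odot> (Pw r || L x) = sgm r x"
    using assms al_be_simps(12)[OF p(1)] by (simp add: sgm_def comp_assoc interchange flip: Pw_snoc)
qed

subsection \<open>Normal forms\<close>

text \<open>
  The normal form: the letters of \<open>w\<close> are fused into a stack of \<open>r\<close>
  upward strands, from left to right. By \<open>e_inverse\<close> it is invertible on the summand
  that \<open>w\<close> describes.
\<close>

fun e :: "nat \<Rightarrow> bool list \<Rightarrow> (nat, label lincomb set) arrow" where
  "e r [] = Pw r"
| "e r (x # w) = e (step r x) w \<odot> (sgm r x || W w)"

definition fin where "fin r w = foldl step r w"

lemma fin_simps [simp]:
  "fin r [] = r" "fin r (x # w) = fin (step r x) w" "fin r (w @ w') = fin (fin r w) w'"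
  by (simp_all add: fin_def)

lemma fin_less [simp]: "r < m \<Longrightarrow> fin r w < m"
  by (induction w arbitrary: r) simp_all

lemma e_simps [simp]:
  assumes "r < m"
  shows "e r w \<in> Mor" "src (e r w) = r + length w" "tgt (e r w) = fin r w"
proof -
  have "e r w \<in> Mor \<and> src (e r w) = r + length w \<and> tgt (e r w) = fin r w"
    using assms
  proof (induction w arbitrary: r)
    case (Cons x w)
    then show ?case using Cons.IH[of "step r x"] by simp
  qed simp
  then show "e r w \<in> Mor" "src (e r w) = r + length w" "tgt (e r w) = fin r w" by auto
qed

lemma e_absorb [simp]:
  assumes "r < m"
  shows "e r w \<odot> (Pw r || W w) = e r w" "Pw (fin r w) \<odot> e r w = e r w"
proof -
  have "e r w \<odot> (Pw r || W w) = e r w \<and> Pw (fin r w) \<odot> e r w = e r w"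
    using assms
  proof (induction w arbitrary: r)
    case (Cons x w)
    have "e r (x # w) \<odot> (Pw r || W (x # w)) =
      e (step r x) w \<odot> ((sgm r x || W w) \<odot> ((Pw r || L x) || W w))"
      using Cons.prems by (simp add: comp_assoc tens_assoc)
    also have "\<dots> = e r (x # w)"
      using Cons.prems by (simp add: interchange)
    finally show ?case
      using Cons.prems Cons.IH[of "step r x"] by (simp flip: comp_assoc)
  qed simp
  then show "e r w \<odot> (Pw r || W w) = e r w" "Pw (fin r w) \<odot> e r w = e r w" by auto
qed

lemma e_append: "r < m \<Longrightarrow> e r (w @ w') = e (fin r w) w' \<odot> (e r w || W w')"
proof (induction w arbitrary: r)
  case (Cons x w)
  have "e r ((x # w) @ w') =
      e (fin r (x # w)) w' \<odot> ((e (step r x) w || W w') \<odot> ((sgm r x || W w) || W w'))"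
    using Cons by (simp add: comp_assoc W_append tens_assoc)
  then show ?case using Cons.prems by (simp add: interchange)
qed simp

lemma e_inverse:
  "r < m \<Longrightarrow> \<exists>y \<in> Mor. src y = fin r w \<and> tgt y = r + length w \<and>
    y \<odot> e r w = Pw r || W w \<and> e r w \<odot> y = Pw (fin r w)"
proof (induction w arbitrary: r)
  case Nil
  then show ?case by (intro bexI[of _ "Pw r"]) simp_all
next
  case (Cons x w)
  let ?s = "step r x"
  obtain y where y: "y \<in> Mor" "src y = fin ?s w" "tgt y = ?s + length w"
    "y \<odot> e ?s w = Pw ?s || W w" "e ?s w \<odot> y = Pw (fin ?s w)"
    using Cons.IH[of ?s] Cons.prems by auto
  let ?y = "(tau r x || W w) \<odot> y"
  have "?y \<odot> e r (x # w) = (tau r x || W w) \<odot> ((y \<odot> e ?s w) \<odot> (sgm r x || W w))"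
    using y(1-3) Cons.prems by (simp add: comp_assoc)
  also have "\<dots> = (Pw r || L x) || W w"
    unfolding y(4) using Cons.prems by (simp add: interchange)
  also have "\<dots> = Pw r || W (x # w)"
    by (simp add: tens_assoc)
  finally have 1: "?y \<odot> e r (x # w) = Pw r || W (x # w)" .
  have "e r (x # w) \<odot> ?y = e ?s w \<odot> ((Pw ?s || W w) \<odot> y)"
    using y(1-3) Cons.prems by (simp add: comp_assoc interchange2)
  also have "\<dots> = Pw (fin r (x # w))"
    using y(1-3,5) Cons.prems by (simp flip: comp_assoc)
  finally show ?case
    using 1 y(1-3) Cons.prems by (intro bexI[of _ ?y]) simp_all
qed

lemma e_turn: 
  assumes r: "r < m"
  shows "e r [x, \<not> x] = Pw r || ca x" "fin r [x, \<not> x] = r"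
proof -
  show "fin r [x, \<not> x] = r" using r by simp
  have e: "e r [x, \<not> x] = sgm (step r x) (\<not> x) \<odot> (sgm r x || L (\<not> x))"
  proof -
    have "e r [x, \<not> x] = (Pw r \<odot> sgm (step r x) (\<not> x)) \<odot> (sgm r x || L (\<not> x))"
      using r by (simp add: comp_assoc)
    also have "Pw r \<odot> sgm (step r x) (\<not> x) = sgm (step r x) (\<not> x)"
      using r sgm_tau_simps(9)[of "step r x" "\<not> x"] by simp
    finally show ?thesis .
  qed
  show "e r [x, \<not> x] = Pw r || ca x"
  proof (cases x)
    case True
    have "e r [True, False] = (Pw r || ca True) \<odot> ((be r \<odot> al r) || L False)"
      using e r True by (simp add: step_def sgm_def comp_assoc interchange)
    also have "\<dots> = Pw r || (ca True \<odot> (L True || L False))"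
      using r by (simp add: Pw_snoc tens_assoc interchange)
    finally show ?thesis using True cu_ca_absorb(2)[of True] by simp
  next
    case False
    let ?p = "pr r"
    have p: "?p < m" "nx ?p = r" using r by auto
    have "e r [False, True] = al ?p \<odot> (((Pw ?p || ca True) \<odot> (be ?p || L False)) || L True)"
      using e r False by (simp add: step_def sgm_def)
    also have "\<dots> = al ?p \<odot> (((Pw ?p || ca True) || L True) \<odot> ((be ?p || L False) || L True))"
      using p by (simp add: interchange)
    also have "(Pw ?p || ca True) || L True = Pw ?p || ((ca True || L True) \<odot> (L True || (L False || L True)))"
      using cu_ca_absorb(2)[of True] interchange[of "ca True" "L True || L False" "L True" "L True"]
      by (simp add: tens_assoc)
    also have "L True || (L False || L True) = L True || (cu False \<odot> ca False)"
      using cu_ca[of False] by simp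
    also have "L True || (cu False \<odot> ca False) = (L True || cu False) \<odot> (L True || ca False)"
      by (simp add: interchange)
    also have "(ca True || L True) \<odot> ((L True || cu False) \<odot> (L True || ca False)) = L True || ca False"
      using oriented_zigzag(1)[of True] by (subst comp_assoc[symmetric]) (simp_all add: comp_empty)
    also have "Pw ?p || (L True || ca False) = (L True || Pw ?p) || ca False"
      by (simp add: Pw_snoc tens_assoc)
    also have "((L True || Pw ?p) || ca False) \<odot> ((be ?p || L False) || L True) =
      be ?p || ca False"
      using p cu_ca_absorb(2)[of False] by (simp add: tens_assoc[of "be ?p"] interchange)
    also have "al ?p \<odot> (be ?p || ca False) = (al ?p \<odot> be ?p) || ca False"
      using p interchange[of "al ?p" "be ?p" "I 0" "ca False"] by simp
    finally show ?thesis using False p by simp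
  qed
qed

subsection \<open>Every morphism is a combination of normal forms\<close>

inductive_set Spn :: "nat \<Rightarrow> nat \<Rightarrow> nat \<Rightarrow> (nat, label lincomb set) arrow set" for r b r' where
  Spn_zero: "zr (r + b) r' \<in> Spn r b r'"
| Spn_base: "length w = b \<Longrightarrow> fin r w = r' \<Longrightarrow> sc c (e r w) \<in> Spn r b r'"
| Spn_add: "x \<in> Spn r b r' \<Longrightarrow> y \<in> Spn r b r' \<Longrightarrow> x \<dotplus> y \<in> Spn r b r'"

lemma Spn_e: "r < m \<Longrightarrow> length w = b \<Longrightarrow> fin r w = r' \<Longrightarrow> e r w \<in> Spn r b r'"
  using Spn_base[of w b r r' 1] by simp

lemma Spn_Mor:
  "x \<in> Spn r b r' \<Longrightarrow> r < m \<Longrightarrow> x \<in> Mor \<and> src x = r + b \<and> tgt x = r'"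
  by (induction rule: Spn.induct) auto

lemma Spn_sc: "x \<in> Spn r b r' \<Longrightarrow> r < m \<Longrightarrow> sc c x \<in> Spn r b r'"
proof (induction rule: Spn.induct)
  case (Spn_add x y)
  then show ?case using Spn_Mor[of x] Spn_Mor[of y] by (auto simp: sc_add intro: Spn.Spn_add)
qed (auto intro: Spn.intros)

text \<open>A linear map that sends normal forms into a span sends the whole span into it.\<close>

lemma Spn_linear:
  assumes x: "x \<in> Spn r b r'" and r: "r < m" "q < m"
    and T0: "T (zr (r + b) r') = zr (q + c) q'"
    and T_add: "\<And>x y. x \<in> Mor \<Longrightarrow> y \<in> Mor \<Longrightarrow> src x = r + b \<Longrightarrow> src y = r + b \<Longrightarrow>
      tgt x = r' \<Longrightarrow> tgt y = r' \<Longrightarrow> T (x \<dotplus> y) = T x \<dotplus> T y"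
    and T_sc: "\<And>k x. x \<in> Mor \<Longrightarrow> src x = r + b \<Longrightarrow> tgt x = r' \<Longrightarrow> T (sc k x) = sc k (T x)"
    and T_e: "\<And>w. length w = b \<Longrightarrow> fin r w = r' \<Longrightarrow> T (e r w) \<in> Spn q c q'"
  shows "T x \<in> Spn q c q'"
  using x
proof (induction rule: Spn.induct)
  case Spn_zero
  then show ?case unfolding T0 by (rule Spn.Spn_zero)
next
  case (Spn_base w k)
  then show ?case using r T_e[of w] by (simp add: T_sc Spn_sc)
next
  case (Spn_add x y)
  then show ?case using r Spn_Mor[of x] Spn_Mor[of y] by (simp add: T_add Spn.Spn_add)
qed

text \<open>
  Fusing the top strands of \<open>f\<close> next to any stack yields a combination of normal
  forms of its bottom strands. The stack on the left is arbitrary in order that the property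
  passes to juxtapositions, so that only the generators have to be examined.
\<close>

definition reducible where
  "reducible f \<longleftrightarrow> f \<in> Mor \<and> (\<forall>r < m. \<forall>w. length w = tgt f \<longrightarrow>
     e r w \<odot> (Pw r || f) \<in> Spn r (src f) (fin r w))"

lemma reducibleD:
  "reducible f \<Longrightarrow> r < m \<Longrightarrow> length w = tgt f \<Longrightarrow>
    e r w \<odot> (Pw r || f) \<in> Spn r (src f) (fin r w)"
  by (simp add: reducible_def)

lemma reducible_comp:
  assumes f: "reducible f" and g: "reducible g" and fg: "src f = tgt g"
  shows "reducible (f \<odot> g)"
  unfolding reducible_def
proof (intro conjI allI impI)
  have M: "f \<in> Mor" "g \<in> Mor" using f g by (auto simp: reducible_def)
  then show "f \<odot> g \<in> Mor" using fg by simp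
  fix r and w :: "bool list" assume r: "r < m" and w: "length w = tgt (f \<odot> g)"
  have "e r w \<odot> (Pw r || f) \<in> Spn r (src f) (fin r w)"
    using f r w by (auto simp: reducible_def)
  then have "(e r w \<odot> (Pw r || f)) \<odot> (Pw r || g) \<in> Spn r (src g) (fin r w)"
  proof (rule Spn_linear[where T = "\<lambda>x. x \<odot> (Pw r || g)", OF _ r r])
    fix u assume u: "length u = src f" "fin r u = fin r w"
    have "e r u \<odot> (Pw r || g) \<in> Spn r (src g) (fin r u)"
      using u(1) fg by (intro reducibleD[OF g r]) simp
    then show "e r u \<odot> (Pw r || g) \<in> Spn r (src g) (fin r w)"
      by (simp only: u(2))
  qed (use M fg in \<open>simp_all add: comp_linear\<close>)
  also have "(e r w \<odot> (Pw r || f)) \<odot> (Pw r || g) = e r w \<odot> (Pw r || (f \<odot> g))"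
    using M fg r w by (simp add: comp_assoc interchange)
  finally show "e r w \<odot> (Pw r || (f \<odot> g)) \<in> Spn r (src (f \<odot> g)) (fin r w)" by simp
qed

lemma reducible_tens:
  assumes f: "reducible f" and g: "reducible g"
  shows "reducible (f || g)"
  unfolding reducible_def
proof (intro conjI allI impI)
  have M: "f \<in> Mor" "g \<in> Mor" using f g by (auto simp: reducible_def)
  then show "f || g \<in> Mor" by simp
  fix r and w :: "bool list" assume r: "r < m" and w: "length w = tgt (f || g)"
  define w1 w2 where "w1 = take (tgt f) w" and "w2 = drop (tgt f) w"
  have ws: "w = w1 @ w2" "length w1 = tgt f" "length w2 = tgt g"
    using w by (simp_all add: w1_def w2_def)
  define q where "q = fin r w1"
  have q: "q < m" using r by (simp add: q_def)
  have "e r w \<odot> (Pw r || (f || g)) = e q w2 \<odot> ((e r w1 || W w2) \<odot> ((Pw r || f) || g))"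
    using M r ws by (simp add: e_append q_def comp_assoc tens_assoc)
  also have "\<dots> = e q w2 \<odot> ((e r w1 \<odot> (Pw r || f)) || (W w2 \<odot> g))"
    using M r ws by (simp add: interchange)
  also have "\<dots> \<in> Spn r (src f + src g) (fin r w)"
  proof (rule Spn_linear[where T = "\<lambda>x. e q w2 \<odot> (x || (W w2 \<odot> g))", OF _ r r])
    show "e r w1 \<odot> (Pw r || f) \<in> Spn r (src f) q"
      using f r ws by (simp add: reducible_def q_def)
    fix u assume u: "length u = src f" "fin r u = q"
    have "e q w2 \<odot> (e r u || (W w2 \<odot> g)) = (e q w2 \<odot> (Pw q || W w2)) \<odot> (e r u || g)"
      using M r q ws u e_absorb(2)[OF r, of u] by (simp add: comp_assoc interchange del: e_absorb)
    also have "\<dots> = e q w2 \<odot> ((Pw q \<odot> e r u) || (g \<odot> I (src g)))"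
      using M r q ws u e_absorb(2)[OF r, of u] by simp
    also have "\<dots> = (e q w2 \<odot> (Pw q || g)) \<odot> (e r u || I (src g))"
      using M r q ws u by (simp add: comp_assoc interchange)
    also have "\<dots> \<in> Spn r (src f + src g) (fin r w)"
    proof (rule Spn_linear[where T = "\<lambda>x. x \<odot> (e r u || I (src g))", OF _ q r])
      show "e q w2 \<odot> (Pw q || g) \<in> Spn q (src g) (fin r w)"
        using g q ws by (simp add: reducible_def q_def)
      fix u' assume u': "length u' = src g" "fin q u' = fin r w"
      have "e q u' \<odot> (e r u || I (src g)) = (e q u' \<odot> (Pw q || W u')) \<odot> (e r u || I (src g))"
        using q by simp
      also have "\<dots> = e q u' \<odot> ((Pw q \<odot> e r u) || W u')"
        using r q u u' by (simp add: comp_assoc interchange del: e_absorb)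
      also have "\<dots> = e r (u @ u')"
        using r u e_absorb(2)[OF r, of u] by (simp add: e_append)
      finally show "e q u' \<odot> (e r u || I (src g)) \<in> Spn r (src f + src g) (fin r w)"
        using r u u' by (simp add: Spn_e)
    qed (use M r q u in \<open>simp_all add: comp_linear add.assoc\<close>)
    finally show "e q w2 \<odot> (e r u || (W w2 \<odot> g)) \<in> Spn r (src f + src g) (fin r w)" .
  qed (use M r q ws in \<open>simp_all add: comp_linear tens_linear q_def add.assoc\<close>)
  finally show "e r w \<odot> (Pw r || (f || g)) \<in> Spn r (src (f || g)) (fin r w)" by simp
qed

lemma reducible_add:
  "reducible f \<Longrightarrow> reducible g \<Longrightarrow> src f = src g \<Longrightarrow> tgt f = tgt g \<Longrightarrow> reducible (f \<dotplus> g)"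
  by (auto simp: reducible_def tens_linear comp_linear intro!: Spn.Spn_add)

lemma reducible_sc: "reducible f \<Longrightarrow> reducible (sc c f)"
  by (auto simp: reducible_def tens_linear comp_linear intro!: Spn_sc)

lemma reducible_zr: "reducible (zr b t)"
  by (auto simp: reducible_def intro!: Spn.Spn_zero)

lemma reducible_I: "reducible (I k)"
  unfolding reducible_def
proof (intro conjI allI impI)
  fix r and w :: "bool list" assume r: "r < m" and w: "length w = tgt (I k)"
  have "e r w \<odot> (Pw r || I k) = (e r w \<odot> (Pw r || W w)) \<odot> (Pw r || I k)"
    using r by simp
  also have "\<dots> = e r w" using r w by (simp add: comp_assoc interchange del: e_absorb) simp
  finally show "e r w \<odot> (Pw r || I k) \<in> Spn r (src (I k)) (fin r w)"
    using r w by (simp add: Spn_e)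
qed simp

lemma e_word:
  assumes "r < m" "f \<in> Mor" "tgt f = length w"
  shows "e r w \<odot> (Pw r || f) = e r w \<odot> (Pw r || (W w \<odot> f))"
proof -
  have "e r w \<odot> (Pw r || f) = (e r w \<odot> (Pw r || W w)) \<odot> (Pw r || f)"
    using assms by simp
  then show ?thesis using assms by (simp add: comp_assoc interchange del: e_absorb)
qed

text \<open>A morphism with coloured top ends has to be examined on its own colours only.\<close>

lemma reducible_coloured:
  assumes f: "f \<in> Mor" "W w0 \<odot> f = f" "tgt f = length w0"
    and w0: "\<And>r. r < m \<Longrightarrow> e r w0 \<odot> (Pw r || f) \<in> Spn r (src f) (fin r w0)"
  shows "reducible f"
  unfolding reducible_def
proof (intro conjI allI impI)
  fix r and w :: "bool list" assume r: "r < m" and w: "length w = tgt f"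
  show "e r w \<odot> (Pw r || f) \<in> Spn r (src f) (fin r w)"
  proof (cases "w = w0")
    case True
    then show ?thesis using w0 r by simp
  next
    case False
    have "W w \<odot> f = W w \<odot> (W w0 \<odot> f)" using f by simp
    also have "\<dots> = (W w \<odot> W w0) \<odot> f" using f w by (simp add: comp_assoc del: f(2))
    also have "\<dots> = zr (src f) (tgt f)" using f w False by (simp add: W_orth)
    finally have "e r w \<odot> (Pw r || f) = zr (r + src f) (fin r w)"
      using e_word[OF r f(1), of w] w r by simp
    then show ?thesis using Spn.Spn_zero by simp
  qed
qed (rule f)

lemma reducible_L: "reducible (L x)"
proof (rule reducible_coloured[where ?w0.0 = "[x]"])
  fix r assume r: "r < m"
  have "e r [x] \<odot> (Pw r || L x) = e r [x]" using e_absorb(1)[OF r, of "[x]"] by simp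
  then show "e r [x] \<odot> (Pw r || L x) \<in> Spn r (src (L x)) (fin r [x])"
    using r by (simp add: Spn_e del: e.simps)
qed simp_all

lemma reducible_cu: "reducible (cu x)"
proof (rule reducible_coloured[where ?w0.0 = "[x, \<not> x]"])
  fix r assume r: "r < m"
  have "e r [x, \<not> x] \<odot> (Pw r || cu x) = e r []"
    unfolding e_turn[OF r] by (simp add: interchange ca_cu)
  then show "e r [x, \<not> x] \<odot> (Pw r || cu x) \<in> Spn r (src (cu x)) (fin r [x, \<not> x])"
    using r Spn_e[of r "[]" 0 r] by (simp del: e.simps)
qed simp_all

lemma reducible_ca: "reducible (ca x)"
proof (rule reducible_coloured[where ?w0.0 = "[]"])
  fix r assume r: "r < m"
  have "e r [] \<odot> (Pw r || ca x) = e r [x, \<not> x]"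
    unfolding e_turn[OF r] by (simp add: comp_empty)
  then show "e r [] \<odot> (Pw r || ca x) \<in> Spn r (src (ca x)) (fin r [])"
    using r Spn_e[of r "[x, \<not> x]" 2 r] by (simp del: e.simps)
qed simp_all

lemma reducible_Cup: "reducible Cup'" and reducible_Cap: "reducible Cap'"
  unfolding Cup_sum Cap_sum by (simp_all add: reducible_add reducible_cu reducible_ca)

end

context cyclic
begin

notation comp (infixr \<open>\<odot>\<close> 75)
notation tens (infixr \<open>||\<close> 80)
notation add (infixl \<open>\<dotplus>\<close> 65)

subsection \<open>Reduction of the trivalent generators\<close>

text \<open>
  The extra strand can be closed to a loop, which has the value 1.
\<close>

lemma cancel_one:
  assumes "f \<in> Mor" "g \<in> Mor" "src f = src g" "tgt f = tgt g" "f || L True = g || L True"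
  shows "f = g"
proof -
  have close: "(I (tgt h) || Cap') \<odot> (((h || L True) || I 1) \<odot> (I (src h) || Cup')) = h" if "h \<in> Mor" for h
  proof -
    have "(I (tgt h) || Cap') \<odot> (((h || L True) || I 1) \<odot> (I (src h) || Cup')) =
        h || (Cap' \<odot> ((L True || I 1) \<odot> Cup'))"
      using that by (simp add: tens_assoc interchange)
    then show ?thesis using that by (simp add: loop)
  qed
  have "f = (I (tgt f) || Cap') \<odot> (((f || L True) || I 1) \<odot> (I (src f) || Cup'))"
    by (rule close[OF assms(1), symmetric])
  also have "\<dots> = (I (tgt g) || Cap') \<odot> (((g || L True) || I 1) \<odot> (I (src g) || Cup'))"
    by (simp only: assms(3-5))
  also have "\<dots> = g" by (rule close[OF assms(2)])
  finally show ?thesis .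
qed

lemma cancel_Pw:
  "f \<in> Mor \<Longrightarrow> g \<in> Mor \<Longrightarrow> src f = src g \<Longrightarrow> tgt f = tgt g \<Longrightarrow> f || Pw k = g || Pw k \<Longrightarrow> f = g"
proof (induction k)
  case (Suc k)
  have "(f || Pw k) || L True = (g || Pw k) || L True"
    using Suc.prems unfolding replicate_W_snoc by (simp add: tens_assoc)
  then show ?case using Suc by (intro Suc.IH cancel_one[of "f || Pw k" "g || Pw k"]) simp_all
qed simp

lemma e_Trues_aux:
  "r + k < m \<Longrightarrow> e r (replicate k True) = Pw (r + k) \<and> fin r (replicate k True) = r + k"
proof (induction k arbitrary: r)
  case (Suc k)
  have s: "step r True = Suc r" "sgm r True = Pw (Suc r)"
    using Suc.prems by (simp_all add: step_def nx_def sgm_def al_def)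
  have IH: "e (Suc r) (replicate k True) = Pw (Suc r + k)" "fin (Suc r) (replicate k True) = Suc r + k"
    using Suc.IH[of "Suc r"] Suc.prems by (simp_all del: replicate_Suc)
  have "e r (replicate (Suc k) True) = e (Suc r) (replicate k True) \<odot> (Pw (Suc r) || Pw k)"
    unfolding replicate_Suc[of k] e.simps s ..
  also have "\<dots> = Pw (Suc r + k) \<odot> Pw (Suc r + k)"
    unfolding IH by (simp only: replicate_add W_append)
  finally show ?case using IH(2) by (simp only: W_idem add_Suc add_Suc_right s fin_simps replicate_Suc[of k])
qed simp

lemma e_Trues:
  assumes "r + k < m"
  shows "e r (replicate k True) = Pw (r + k)" "fin r (replicate k True) = r + k"
  using e_Trues_aux[OF assms] by auto

lemma e_Trues_wrap:
  assumes "r + k = m" "k \<ge> 1"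
  shows "e r (replicate k True) = wrap" "fin r (replicate k True) = 0"
proof -
  obtain j where k: "k = Suc j" using assms(2) by (cases k) auto
  have j: "r + j < m" "Suc (r + j) = m" using assms(1) k by simp_all
  have w: "replicate k True = replicate j True @ [True]" unfolding k by (simp add: replicate_append_same)
  have s: "step (r + j) True = 0" "sgm (r + j) True = wrap"
    using j by (simp_all add: step_def nx_def sgm_def al_def)
  have P: "Pw (r + j) || L True = Pw m"
    using replicate_W_snoc[of "r + j" True, unfolded j(2)] by (rule sym)
  have "e r (replicate k True) = e (r + j) [True] \<odot> Pw m"
    unfolding w using j(1) e_append[of r "replicate j True" "[True]"] P by (simp add: e_Trues)
  also have "e (r + j) [True] = wrap"
    using s j by simp
  also have "wrap \<odot> Pw m = wrap \<odot> (wrap' \<odot> wrap)" by (simp add: wrap_inverse)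
  also have "\<dots> = (wrap \<odot> wrap') \<odot> wrap" by (simp add: comp_assoc)
  finally show "e r (replicate k True) = wrap" by (simp add: wrap_inverse)
  show "fin r (replicate k True) = 0"
    unfolding w using j(1) s by (simp add: e_Trues(2))
qed

lemma fin_falses: "k < m \<Longrightarrow> fin 0 (replicate (Suc k) False) = m - Suc k"
proof (induction k)
  case 0
  then show ?case by (simp add: step_def pr_def)
next
  case (Suc k)
  have "replicate (Suc (Suc k)) False = replicate (Suc k) False @ [False]"
    by (simp add: replicate_append_same)
  then show ?case using Suc by (simp add: step_def pr_def del: replicate_Suc)
qed

lemma e_turn_insert:
  assumes "r < m"
  shows "e r (w @ [x, \<not> x]) = e r w \<odot> (Pw r || (W w || ca x))"
proof -
  have "e r (w @ [x, \<not> x]) = (Pw (fin r w) || ca x) \<odot> (e r w || (L x || L (\<not> x)))"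
    using assms e_turn[of "fin r w" x] by (simp add: e_append del: e.simps)
  also have "\<dots> = e r w || ca x"
    using assms by (simp add: interchange)
  also have "\<dots> = e r w \<odot> ((Pw r || W w) || ca x)"
    using assms by (simp add: comp_empty)
  finally show ?thesis by (simp add: tens_assoc)
qed

lemma e_nested: "k \<le> n \<Longrightarrow> e 0 (replicate k False @ replicate k True) = capn k"
proof (induction k)
  case (Suc k)
  have m: "0 < m" using m_ge_2 by simp
  have w: "replicate (Suc k) False @ replicate (Suc k) True =
    (replicate k False @ [False, \<not> False]) @ replicate k True"
    by (simp add: replicate_app_Cons_same)
  let ?q = "fin 0 (replicate k False)"
  have q: "?q < m" using m by simp
  moreover have "fin ?q [False, \<not> False] = ?q" by (rule e_turn(2)[OF q])
  ultimately have q: "?q < m" "fin ?q [False, \<not> False] = ?q" by blast+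
  have "e 0 (replicate (Suc k) False @ replicate (Suc k) True) =
    e ?q (replicate k True) \<odot> ((e 0 (replicate k False) \<odot> (Qw k || ca False)) || Pw k)"
    unfolding w using m q e_turn_insert[OF m, of "replicate k False" False]
    by (subst e_append[OF m]) (simp del: e.simps)
  also have "\<dots> = e ?q (replicate k True) \<odot> ((e 0 (replicate k False) || Pw k) \<odot> ((Qw k || ca False) || Pw k))"
    using m q by (simp add: interchange)
  also have "\<dots> = e 0 (replicate k False @ replicate k True) \<odot> (Qw k || (ca False || Pw k))"
    using m q by (simp add: e_append comp_assoc tens_assoc)
  finally show ?case using Suc by simp
qed simp

lemma e_U_base: "e 0 (replicate n False) \<odot> u = Pw a"
proof -
  have m: "0 < m" "n < m" "n \<le> m" using m_ge_2 an by simp_all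
  obtain k where k: "n = Suc k" using an(2) by (cases n) auto
  have fin: "fin 0 (replicate n False) = a"
    using fin_falses[of k] m an(1) unfolding k by simp
  let ?f = "e 0 (replicate n False) \<odot> u"
  have f: "?f \<in> Mor" "src ?f = a" "tgt ?f = a" "Pw a \<odot> ?f = ?f"
    using m fin e_absorb(2)[OF m(1), of "replicate n False"] by (simp_all flip: comp_assoc)
  have "wrap = e a (replicate n True) \<odot> ((e 0 (replicate n False) || Pw n) \<odot> (u || Pw n))"
    unfolding wrap_def e_nested[OF order_refl, symmetric]
    using m fin an(4) by (simp add: e_append comp_assoc)
  also have "\<dots> = wrap \<odot> (?f || Pw n)"
    unfolding e_Trues_wrap[OF an(1,2)] using m fin by (simp add: interchange)
  finally have wr: "wrap = wrap \<odot> (?f || Pw n)" .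
  have "Pw (a + n) = Pw a || Pw n" by (simp only: replicate_add W_append)
  then have P: "Pw m = Pw a || Pw n" by (simp only: an(1))
  have "Pw a || Pw n = wrap' \<odot> (wrap \<odot> (?f || Pw n))"
    unfolding wr[symmetric] wrap_inverse(2) P ..
  also have "\<dots> = (wrap' \<odot> wrap) \<odot> (?f || Pw n)"
    by (rule comp_assoc[symmetric]) (use f an(1) in \<open>simp_all only: wrap_simps op_Mor op_src_tgt W_simps length_replicate\<close>)
  also have "\<dots> = (Pw a \<odot> ?f) || (Pw n \<odot> Pw n)"
    unfolding wrap_inverse(2) P by (rule interchange) (use f in \<open>simp_all only: W_simps length_replicate\<close>)
  also have "\<dots> = ?f || Pw n"
    unfolding f(4) W_idem ..
  finally have "?f || Pw n = Pw a || Pw n" by (rule sym)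
  then show ?thesis
    by (rule cancel_Pw[rotated 4]) (use f in \<open>simp_all only: W_simps length_replicate\<close>)
qed

text \<open>
  The click relation with one leg of \<open>U\<close> bent back: moving an upward strand from the
  left of \<open>U\<close> to its right costs the factor \<open>lam\<close>.
\<close>

lemma u_rotation:
  assumes k: "n = Suc k"
  shows "sc lam ((ca True || Qw k) \<odot> (L True || u)) = (Qw k || ca False) \<odot> (u || L True)"
proof -
  have n: "Qw n = L False || Qw k" "Qw n = Qw k || L False"
    unfolding k by (simp, rule replicate_W_snoc)
  obtain j where j: "a = Suc j" using an(3) by (cases a) auto
  have bare: "(Cap' || I k) \<odot> (I 1 || sc lam u) = (I k || Cap') \<odot> (u || I 1)"
  proof -
    have In: "I n = I 1 || I k" using k by simp
    have "(Cap' || I k) \<odot> (I 1 || sc lam u) = (Cap' || I k) \<odot>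
      ((I 1 || (I n || Cap')) \<odot> ((I 1 || (I 1 || (u || I 1))) \<odot> (I 1 || (Cup' || I a))))"
      unfolding u_click[symmetric] by (simp add: interchange k)
    also have "\<dots> = ((Cap' || I k) \<odot> (I (2 + k) || Cap')) \<odot>
      ((I 2 || (u || I 1)) \<odot> ((I 1 || Cup') || I a))"
      by (simp add: comp_assoc k flip: tens_assoc) 
    also have "(Cap' || I k) \<odot> (I (2 + k) || Cap') = (I k || Cap') \<odot> (Cap' || I (k + 2))"
      using tens_split[of "Cap' || I k" Cap'] tens_split[of Cap' "I k || Cap'"] by (simp add: tens_assoc)
    also have "((I k || Cap') \<odot> (Cap' || I (k + 2))) \<odot> ((I 2 || (u || I 1)) \<odot> ((I 1 || Cup') || I a)) =
      (I k || Cap') \<odot> (((Cap' || I (k + 2)) \<odot> (I 2 || (u || I 1))) \<odot> ((I 1 || Cup') || I a))"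
      by (simp add: comp_assoc k)
    also have "(Cap' || I (k + 2)) \<odot> (I 2 || (u || I 1)) = (u || I 1) \<odot> (Cap' || I (a + 1))"
      using tens_split[of Cap' "u || I 1"] by (simp add: k)
    also have "((u || I 1) \<odot> (Cap' || I (a + 1))) \<odot> ((I 1 || Cup') || I a) =
      (u || I 1) \<odot> (((Cap' || I 1) \<odot> (I 1 || Cup')) || I a)"
    proof -
      have "Cap' || I (a + 1) = (Cap' || I 1) || I a" by (simp add: tens_assoc)
      then show ?thesis by (simp add: comp_assoc interchange)
    qed
    finally show ?thesis by (simp add: zigzag)
  qed
  have uQ: "u = (L False || Qw k) \<odot> u" "u = (Qw k || L False) \<odot> u"
    unfolding n[symmetric] by simp_all
  have uP: "u = u \<odot> (L True || I j)"
  proof -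
    have P: "u \<odot> (L True || Pw j) = u" using u_absorb(2) j by simp
    have "u \<odot> (L True || I j) = (u \<odot> (L True || Pw j)) \<odot> (L True || I j)" unfolding P ..
    also have "\<dots> = u \<odot> ((L True || Pw j) \<odot> (L True || I j))" using j by (simp add: comp_assoc)
    also have "\<dots> = u" using P by (simp add: interchange)
    finally show ?thesis ..
  qed
  have caQ: "ca True || Qw k = (Cap' || I k) \<odot> (L True || (I 1 || Qw k))"
    using interchange[of Cap' "L True || I 1" "I k" "Qw k"] by (simp add: ca_def tens_assoc)
  have "(ca True || Qw k) \<odot> (L True || u) = (Cap' || I k) \<odot> ((L True || (I 1 || Qw k)) \<odot> (L True || u))"
    unfolding caQ by (rule comp_assoc) (simp_all add: k)
  also have "(L True || (I 1 || Qw k)) \<odot> (L True || u) = L True || u"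
  proof -
    have "(I 1 || Qw k) \<odot> ((L False || Qw k) \<odot> u) = (L False || Qw k) \<odot> u"
      using k by (simp add: interchange2)
    then show ?thesis using k by (simp add: interchange flip: uQ(1))
  qed
  also have "(Cap' || I k) \<odot> (L True || u) = (Cap' || I k) \<odot> ((I 1 || u) \<odot> (L True || I a))"
    by (simp add: interchange)
  finally have X: "(ca True || Qw k) \<odot> (L True || u) = (Cap' || I k) \<odot> ((I 1 || u) \<odot> (L True || I a))" .
  have "((Cap' || I k) \<odot> (I 1 || sc lam u)) \<odot> (L True || I a) =
      sc lam ((Cap' || I k) \<odot> ((I 1 || u) \<odot> (L True || I a)))"
    using k by (simp add: comp_linear tens_linear comp_assoc)
  then have "sc lam ((ca True || Qw k) \<odot> (L True || u)) = ((Cap' || I k) \<odot> (I 1 || sc lam u)) \<odot> (L True || I a)"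
    unfolding X by (rule sym)
  also have "\<dots> = (I k || Cap') \<odot> ((u || I 1) \<odot> (L True || I a))"
    unfolding bare using k by (simp add: comp_assoc)
  also have "(u || I 1) \<odot> (L True || I a) = u || I 1"
  proof -
    have "L True || I a = (L True || I j) || I 1" by (simp add: tens_assoc j)
    then show ?thesis using j by (simp add: interchange flip: uP)
  qed
  also have "u || I 1 = (Qw k || (L False || I 1)) \<odot> (u || I 1)"
  proof -
    have "(Qw k || (L False || I 1)) \<odot> (u || I 1) = ((Qw k || L False) \<odot> u) || I 1"
      using k by (simp add: interchange flip: tens_assoc)
    then show ?thesis by (simp flip: uQ(2))
  qed
  also have "(I k || Cap') \<odot> ((Qw k || (L False || I 1)) \<odot> (u || I 1)) = (Qw k || ca False) \<odot> (u || I 1)"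
    using k by (simp add: interchange2 ca_def)
  also have "\<dots> = (Qw k || (ca False \<odot> (L False || L True))) \<odot> (u || I 1)"
    using cu_ca_absorb(2)[of False] by simp
  also have "\<dots> = (Qw k || ca False) \<odot> (((Qw k || L False) \<odot> u) || L True)"
  proof -
    have "(Qw k || (ca False \<odot> (L False || L True))) = (Qw k || ca False) \<odot> ((Qw k || L False) || L True)"
      by (simp add: interchange tens_assoc)
    then show ?thesis using k by (simp add: comp_assoc interchange)
  qed
  finally show ?thesis unfolding uQ(2)[symmetric] .
qed

text \<open>
  By induction on the stack to the left of \<open>U\<close>. Without a stack, fusing the
  \<open>n\<close> downward strands undoes \<open>U\<close> by the definition of
  \<open>wrap\<close>. A strand of the stack is moved to the right side of \<open>U\<close> by
  the rotation relation and contributes a power of \<open>lam\<close> to \<open>c\<close>.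
\<close>

lemma e_U: "r < m \<Longrightarrow> \<exists>c. c \<noteq> 0 \<and>
  e r (replicate n False) \<odot> (Pw r || u) = sc c (e r (replicate a True)) \<and>
  fin r (replicate n False) = fin r (replicate a True)"
proof (induction r)
  case 0
  obtain k where k: "n = Suc k" using an(2) by (cases n) auto
  have "fin 0 (replicate n False) = a"
    using fin_falses[of k] an(1) unfolding k by simp
  then show ?case using e_U_base e_Trues[of 0 a] an(4) by (intro exI[of _ 1]) simp
next
  case (Suc r)
  then obtain c where c: "c \<noteq> 0" "e r (replicate n False) \<odot> (Pw r || u) = sc c (e r (replicate a True))"
    "fin r (replicate n False) = fin r (replicate a True)" by auto
  obtain k where k: "n = Suc k" using an(2) by (cases n) auto
  have r: "r < m" "Suc r < m" "r + 1 < m" using Suc.prems by simp_all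
  have step: "step (Suc r) False = r" "step r True = Suc r"
    using r by (simp_all add: step_def pr_def nx_def)
  have sgm: "sgm (Suc r) False = Pw r || ca True"
    using r cu_ca_absorb(2)[of True] by (simp add: sgm_def pr_def be_def Pw_snoc tens_assoc interchange)
  let ?q = "fin r (replicate n False)"
  have "e (Suc r) (replicate n False) \<odot> (Pw (Suc r) || u) =
    e r (replicate k False) \<odot> (((Pw r || ca True) || Qw k) \<odot> ((Pw r || L True) || u))"
    using r by (simp add: k step sgm comp_assoc flip: Pw_snoc)
  also have "\<dots> = e r (replicate k False) \<odot> (Pw r || ((ca True || Qw k) \<odot> (L True || u)))"
    by (simp add: tens_assoc interchange k)
  finally have "sc lam (e (Suc r) (replicate n False) \<odot> (Pw (Suc r) || u)) =
    e r (replicate k False) \<odot> (Pw r || sc lam ((ca True || Qw k) \<odot> (L True || u)))"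
    using r by (simp add: comp_linear tens_linear k)
  also have "\<dots> = e r (replicate k False) \<odot> ((Pw r || (Qw k || ca False)) \<odot> (Pw r || (u || L True)))"
    unfolding u_rotation[OF k] by (simp add: interchange k)
  also have "\<dots> = e r (replicate k False @ [False, \<not> False]) \<odot> (Pw r || (u || L True))"
    unfolding e_turn_insert[OF r(1)] using r by (simp add: comp_assoc k)
  also have "replicate k False @ [False, \<not> False] = replicate n False @ [True]"
    by (simp add: k replicate_app_Cons_same)
  also have "e r (replicate n False @ [True]) \<odot> (Pw r || (u || L True)) =
    e ?q [True] \<odot> ((e r (replicate n False) \<odot> (Pw r || u)) || L True)"
    using r by (simp add: e_append comp_assoc interchange del: e.simps flip: tens_assoc)
  also have "\<dots> = sc c (e ?q [True] \<odot> (e r (replicate a True) || L True))"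
    unfolding c(2) using r c(3) by (simp add: comp_linear tens_linear del: e.simps)
  also have "e ?q [True] \<odot> (e r (replicate a True) || L True) = e r (replicate a True @ [True])"
    using r c(3) by (simp add: e_append del: e.simps)
  also have "\<dots> = e (Suc r) (replicate a True) \<odot> (Pw (Suc r) || Pw a)"
    using r by (simp add: replicate_append_same step sgm_def al_def)
  finally have "sc lam (e (Suc r) (replicate n False) \<odot> (Pw (Suc r) || u)) = sc c (e (Suc r) (replicate a True))"
    using r e_absorb(1)[OF r(2), of "replicate a True"] by (simp del: replicate_Suc)
  then have "sc (inverse lam) (sc lam (e (Suc r) (replicate n False) \<odot> (Pw (Suc r) || u))) =
    sc (inverse lam) (sc c (e (Suc r) (replicate a True)))" by simp
  then have "e (Suc r) (replicate n False) \<odot> (Pw (Suc r) || u) = sc (inverse lam * c) (e (Suc r) (replicate a True))"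
    using r by (simp del: replicate_Suc)
  moreover have "fin (Suc r) (replicate n False) = fin (Suc r) (replicate a True)"
  proof -
    have "fin (Suc r) (replicate a True) = fin r (replicate a True @ [True])"
      by (simp add: replicate_append_same step del: fin_simps(3))
    also have "\<dots> = step (fin r (replicate n False)) True" using c(3) by simp
    also have "\<dots> = fin r (replicate k False @ [False, \<not> False])"
      by (simp add: k replicate_app_Cons_same del: fin_simps(3)) simp
    also have "\<dots> = fin r (replicate k False)"
      using r step_back[of "fin r (replicate k False)" False] by simp
    finally show ?thesis by (simp add: k step)
  qed
  ultimately show ?case using c(1) by (intro exI[of _ "inverse lam * c"]) simp
qed

lemma reducible_u: "reducible u"
proof (rule reducible_coloured[where ?w0.0 = "replicate n False"])
  fix r assume r: "r < m"
  show "e r (replicate n False) \<odot> (Pw r || u) \<in> Spn r (src u) (fin r (replicate n False))"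
    using e_U[OF r] r by (auto intro!: Spn.Spn_base)
qed simp_all

lemma reducible_v: "reducible v"
proof (rule reducible_coloured[where ?w0.0 = "replicate a True"])
  fix r assume r: "r < m"
  obtain c where c: "c \<noteq> 0" "e r (replicate n False) \<odot> (Pw r || u) = sc c (e r (replicate a True))"
    "fin r (replicate n False) = fin r (replicate a True)" using e_U[OF r] by auto
  have "sc c (e r (replicate a True) \<odot> (Pw r || v)) = (e r (replicate n False) \<odot> (Pw r || u)) \<odot> (Pw r || v)"
    unfolding c(2) using r by (simp add: comp_linear)
  also have "\<dots> = e r (replicate n False)"
    using r e_absorb(1)[OF r, of "replicate n False"] by (simp add: comp_assoc interchange u_v_rels)
  finally have "sc c (e r (replicate a True) \<odot> (Pw r || v)) = e r (replicate n False)" .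
  then have "sc (inverse c) (sc c (e r (replicate a True) \<odot> (Pw r || v))) = sc (inverse c) (e r (replicate n False))"
    by simp
  then have "e r (replicate a True) \<odot> (Pw r || v) = sc (inverse c) (e r (replicate n False))"
    using r c(1) by simp
  then show "e r (replicate a True) \<odot> (Pw r || v) \<in> Spn r (src v) (fin r (replicate a True))"
    using c(3) by (auto intro!: Spn.Spn_base)
qed simp_all

lemma reducible_picture:
  "well_formed f \<Longrightarrow> boxes f \<subseteq> gens A \<Longrightarrow> reducible (dg (bottom_pts f) (top_pts f) (abs_diagram f))"
proof (induction f)
  case (Strands k)
  then show ?case using reducible_I[of k] by (simp add: strands.abs_eq)
next
  case Cup
  then show ?case using reducible_Cup by (simp add: Cup'_def cup.abs_eq)
next
  case Cap
  then show ?case using reducible_Cap by (simp add: Cap'_def cap.abs_eq)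
next
  case (Box g b t)
  then consider "g = LP" "b = 1" "t = 1" | "g = LU" "b = a" "t = n" | "g = LUstar" "b = n" "t = a"
    by (auto simp: gens_A)
  then show ?case
    using reducible_L[of True] reducible_u reducible_v
    by cases (simp_all add: L_def P1_def u_def v_def flip: box.abs_eq)
next
  case (Stack f g)
  have d: "is_diagram (gens A) (bottom_pts f) (top_pts f) (abs_diagram f)"
    "is_diagram (gens A) (bottom_pts g) (bottom_pts f) (abs_diagram g)"
    using Stack.prems by (simp_all add: is_diagram.abs_eq)
  have "reducible (dg (bottom_pts f) (top_pts f) (abs_diagram f) \<odot> dg (bottom_pts g) (top_pts g) (abs_diagram g))"
    using Stack by (intro reducible_comp) simp_all
  then show ?case
    using dg_comp[OF d] Stack.prems by (simp add: stack.abs_eq)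
next
  case (Beside f g)
  have d: "is_diagram (gens A) (bottom_pts f) (top_pts f) (abs_diagram f)"
    "is_diagram (gens A) (bottom_pts g) (top_pts g) (abs_diagram g)"
    using Beside.prems by (simp_all add: is_diagram.abs_eq)
  have "reducible (dg (bottom_pts f) (top_pts f) (abs_diagram f) || dg (bottom_pts g) (top_pts g) (abs_diagram g))"
    using Beside by (intro reducible_tens) simp_all
  then show ?case
    using dg_tens[OF d] by (simp add: beside.abs_eq)
qed

lemma reducible_diagram: "is_diagram (gens A) b t d \<Longrightarrow> reducible (dg b t d)"
proof -
  obtain f where f: "d = abs_diagram f" by (metis Quotient_abs_rep Quotient_diagram)
  assume "is_diagram (gens A) b t d"
  then show ?thesis using reducible_picture[of f] unfolding f by (auto simp: is_diagram.abs_eq)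
qed

theorem reducible_Mor: "f \<in> Mor \<Longrightarrow> reducible f"
proof (erule Mor_cases)
  fix b t x assume f: "f = cl b t x" and "x \<in> free_space A b t"
  have "reducible (cl b t x)" using \<open>x \<in> free_space A b t\<close>
  proof (induction rule: free_space_induct)
    case (single d c)
    have "cl b t (Poly_Mapping.single d c) = sc c (dg b t d)"
      using single by (simp add: cl_sc) (simp add: single_diagram_def)
    then show ?case using single by (simp add: reducible_sc reducible_diagram)
  next
    case (add x y)
    then show ?case using reducible_add[of "cl b t x" "cl b t y"] by (simp add: cl_add)
  qed (rule reducible_zr)
  then show "reducible f" using f by simp
qed

end

context cyclic
begin

notation comp (infixr \<open>\<odot>\<close> 75)
notation tens (infixr \<open>||\<close> 80)
notation add (infixl \<open>\<dotplus>\<close> 65)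

section \<open>The planar algebra as an algebra of graded matrices\<close>

text \<open>
  The state sum is constant on cosets of the planar ideal, so the representative does not matter.
\<close>

definition some_evl where "some_evl S = evl (SOME x. x \<in> S)"
definition hev where "hev f = some_evl (val f)"

lemma evl_ideal_eq:
  "planar_ideal A b t (y - x) \<Longrightarrow> evl y = evl x"
  by (intro ext) (use planar_ideal_evl[of b t "y - x"] in simp)

lemma some_evl_coset:
  assumes "x \<in> free_space A b t"
  shows "some_evl (coset A b t x) = evl x"
proof -
  have "(SOME y. y \<in> coset A b t x) \<in> coset A b t x"
    by (rule someI) (rule coset_self[OF assms])
  then show ?thesis unfolding some_evl_def mem_coset by (blast intro: evl_ideal_eq)
qed

lemma hev_cl: "x \<in> free_space A b t \<Longrightarrow> hev (cl b t x) = evl x"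
  by (simp add: hev_def cl_def some_evl_coset)

lemma hev_ops:
  "f \<in> Mor \<Longrightarrow> g \<in> Mor \<Longrightarrow> src f = tgt g \<Longrightarrow>
    hev (f \<odot> g) s x y = (\<Sum>z \<in> words (src f). hev f s x z * hev g s z y)"
  "f \<in> Mor \<Longrightarrow> g \<in> Mor \<Longrightarrow> hev (f || g) s x y =
    hev f s (take (tgt f) x) (take (src f) y) *
    hev g (s + ht (take (src f) y)) (drop (tgt f) x) (drop (src f) y)"
  "f \<in> Mor \<Longrightarrow> hev (sc c f) s x y = c * hev f s x y"
  by (auto elim!: Mor_cases simp: cl_ops hev_cl evl_stack evl_beside)

lemma hev_zr [simp]: "hev (zr b t) s x y = 0"
  by (simp add: hev_cl)

lemma hev_L: "hev (L z) s x y = of_bool (x = [z] \<and> y = [z])"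
  using unit_matrix_P1_Q1 hev_cl[OF free_space_single(2)[OF is_diagram_L, of z]]
  by (cases z) (simp_all add: L_def unit_matrix_def)

lemma hev_W: "hev (W w) s x y = of_bool (x = w \<and> y = w)"
proof (induction w arbitrary: s x y)
  case Nil
  then show ?case by (auto simp: hev_cl)
next
  case (Cons z w)
  have "u = z # w \<longleftrightarrow> take 1 u = [z] \<and> drop 1 u = w" for u
    by (cases u) (simp_all add: One_nat_def del: One_nat_def[symmetric])
  then show ?case by (simp add: hev_ops hev_L Cons)
qed

subsection \<open>Faithfulness\<close>

lemma sc_add_scalar: "f \<in> Mor \<Longrightarrow> sc c f \<dotplus> sc d f = sc (c + d) f"
proof (erule Mor_cases)
  fix b t x assume "f = cl b t x" "x \<in> free_space A b t"
  moreover have "scale (c + d) x = scale c x + scale d x"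
    by (rule poly_mapping_eqI) (simp add: lookup_add distrib_right)
  ultimately show ?thesis by (simp add: cl_ops)
qed

lemma Spn_project:
  assumes "X \<in> Spn r b r'" and r: "r < m" and w: "length w = b"
  shows "X \<odot> (Pw r || W w) = zr (r + b) r' \<or>
    (fin r w = r' \<and> (\<exists>c. X \<odot> (Pw r || W w) = sc c (e r w)))"
  using assms(1)
proof (induction rule: Spn.induct)
  case Spn_zero
  then show ?case using w by simp
next
  case (Spn_base w' c)
  show ?case
  proof (cases "w' = w")
    case True
    then show ?thesis using Spn_base r by (auto simp: comp_linear)
  next
    case False
    have "e r w' \<odot> (Pw r || W w) = (e r w' \<odot> (Pw r || W w')) \<odot> (Pw r || W w)"
      using r by simp
    also have "\<dots> = zr (r + b) r'"
      using r w False Spn_base by (simp add: comp_assoc interchange W_orth del: e_absorb)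
    finally show ?thesis using r w Spn_base by (simp add: comp_linear)
  qed
next
  case (Spn_add x y)
  have M: "x \<in> Mor" "y \<in> Mor" "src x = r + b" "src y = r + b" "tgt x = r'" "tgt y = r'"
    using Spn_Mor[OF Spn_add.hyps(1) r] Spn_Mor[OF Spn_add.hyps(2) r] by auto
  have d: "(x \<dotplus> y) \<odot> (Pw r || W w) = x \<odot> (Pw r || W w) \<dotplus> y \<odot> (Pw r || W w)"
    using M w by (simp add: comp_linear)
  show ?case
    using Spn_add.IH unfolding d using r w by (auto simp: sc_add_scalar)
qed

text \<open>
  The identity of \<open>k\<close> strands is the sum of the projections \<open>W w\<close>.
\<close>

lemma I_decomposition:
  assumes "\<And>w. length w = k \<Longrightarrow> Q (W w)"
    and "\<And>f g. f \<in> Mor \<Longrightarrow> g \<in> Mor \<Longrightarrow> src f = k \<Longrightarrow> tgt f = k \<Longrightarrow> src g = k \<Longrightarrow> tgt g = k \<Longrightarrow>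
      Q f \<Longrightarrow> Q g \<Longrightarrow> Q (f \<dotplus> g)"
  shows "Q (I k)"
  using assms
proof (induction k arbitrary: Q)
  case 0
  then show ?case using 0(1)[of "[]"] by simp
next
  case (Suc k)
  have Q: "Q (L x || I k)" for x
  proof (rule Suc.IH[of "\<lambda>f. Q (L x || f)"])
    fix w :: "bool list" assume "length w = k"
    then show "Q (L x || W w)" using Suc.prems(1)[of "x # w"] by simp
  next
    fix f g assume "f \<in> Mor" "g \<in> Mor" "src f = k" "tgt f = k" "src g = k" "tgt g = k"
      "Q (L x || f)" "Q (L x || g)"
    then show "Q (L x || (f \<dotplus> g))" using Suc.prems(2)[of "L x || f" "L x || g"] by (simp add: tens_linear)
  qed
  have "I (Suc k) = I 1 || I k" by simp
  also have "\<dots> = L True || I k \<dotplus> L False || I k"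
    unfolding L_rels(1) by (simp add: tens_linear)
  finally show ?case using Suc.prems(2)[OF _ _ _ _ _ _ Q[of True] Q[of False]] by simp
qed

text \<open>
  Normal forms are invertible, and the state sum of the identity of a word is not zero.
\<close>

lemma hev_e_nz:
  assumes "r < m"
  shows "\<exists>x. hev (e r w) s x (replicate r True @ w) \<noteq> 0"
proof -
  obtain y where y: "y \<in> Mor" "src y = fin r w" "tgt y = r + length w" "y \<odot> e r w = Pw r || W w"
    using e_inverse[OF assms, of w] by auto
  let ?w = "replicate r True @ w"
  have 1: "hev (y \<odot> e r w) s ?w ?w = 1"
    unfolding y(4) W_append[symmetric] by (simp add: hev_W)
  have "hev (y \<odot> e r w) s ?w ?w = (\<Sum>z \<in> words (src y). hev y s ?w z * hev (e r w) s z ?w)"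
    using y assms by (intro hev_ops(1)) simp_all
  then have "(\<Sum>z \<in> words (src y). hev y s ?w z * hev (e r w) s z ?w) \<noteq> 0"
    unfolding 1 by (metis zero_neq_one)
  then obtain z where "hev y s ?w z * hev (e r w) s z ?w \<noteq> 0"
    using sum.not_neutral_contains_not_neutral by blast
  then show ?thesis by auto
qed

text \<open>
  A block of \<open>f\<close> between two words becomes, after fusing its top, a multiple of one
  normal form. The state sum of the normal form is not zero, so the multiple is zero if the state
  sum of \<open>f\<close> vanishes; fusing is invertible, so the block itself is zero.
\<close>

lemma Mor_zero:
  assumes f: "f \<in> Mor" and z: "\<And>s x y. hev f s x y = 0"
  shows "f = zr (src f) (tgt f)"
proof -
  have m: "0 < m" using m_ge_2 by simp
  have vanish: "W w' \<odot> f = zr (src f) (tgt f)" if w': "length w' = tgt f" for w'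
  proof -
    let ?z = "e 0 w' \<odot> f"
    have z_Mor: "?z \<in> Mor" "src ?z = src f" "tgt ?z = fin 0 w'" using f m w' by simp_all
    have Sp: "?z \<in> Spn 0 (src f) (fin 0 w')"
      using reducibleD[OF reducible_Mor[OF f] m w'] f by simp
    have hz: "hev (?z \<odot> W w) s x y = 0" if "length w = src f" for w s x y
      using f m w' that z by (simp add: hev_ops)
    have zw: "?z \<odot> W w = zr (src f) (fin 0 w')" if w: "length w = src f" for w
    proof (rule disjE[OF Spn_project[OF Sp m w]])
      assume "?z \<odot> (Pw 0 || W w) = zr (0 + src f) (fin 0 w')"
      then show ?thesis by simp
    next
      assume "fin 0 w = fin 0 w' \<and> (\<exists>c. ?z \<odot> (Pw 0 || W w) = sc c (e 0 w))"
      then obtain c where c: "?z \<odot> W w = sc c (e 0 w)" "fin 0 w = fin 0 w'" by auto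
      obtain x where x: "hev (e 0 w) 0 x w \<noteq> 0" using hev_e_nz[OF m, of w 0] by auto
      have "c * hev (e 0 w) 0 x w = 0"
        using hz[OF w, of 0 x w] unfolding c(1) using m by (simp add: hev_ops)
      then have "c = 0" using x by simp
      then show ?thesis unfolding c(1) using m w c(2) by simp
    qed
    have "?z \<odot> I (src f) = zr (src f) (fin 0 w')"
      by (rule I_decomposition[where Q = "\<lambda>h. ?z \<odot> h = zr (src f) (fin 0 w')"])
        (use zw z_Mor in \<open>simp_all add: comp_linear del: op_src_tgt(1,2)\<close>)
    then have ze: "?z = zr (src f) (fin 0 w')" using z_Mor by simp
    obtain y where y: "y \<in> Mor" "src y = fin 0 w'" "tgt y = length w'" "y \<odot> e 0 w' = W w'"
      using e_inverse[OF m, of w'] by auto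
    have "W w' \<odot> f = y \<odot> ?z"
      unfolding y(4)[symmetric] using y(1-3) f m w' by (simp add: comp_assoc)
    then show ?thesis unfolding ze using y w' by simp
  qed
  have "I (tgt f) \<odot> f = zr (src f) (tgt f)"
    by (rule I_decomposition[where Q = "\<lambda>h. h \<odot> f = zr (src f) (tgt f)"])
      (use vanish f in \<open>simp_all add: comp_linear\<close>)
  then show ?thesis using f by simp
qed

theorem planar_ideal_iff:
  assumes "x \<in> free_space A b t"
  shows "planar_ideal A b t x \<longleftrightarrow> evl x 0 = (\<lambda>v w. 0)"
proof
  assume "evl x 0 = (\<lambda>v w. 0)"
  then have "evl x s v w = 0" for s v w using evl_shift[of x s v w] by simp
  then have "cl b t x = zr b t"
    using Mor_zero[of "cl b t x"] assms by (simp add: hev_cl)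
  then show "planar_ideal A b t x" using assms by (simp add: cl_eq_iff)
qed (auto simp: planar_ideal_evl fun_eq_iff)

subsection \<open>Fullness\<close>

lemma fin_ht: "r < m \<Longrightarrow> int (fin r w) = (int r + ht w) mod int m"
proof (induction w arbitrary: r)
  case (Cons x w)
  have s: "int (step r x) = (int r + (if x then 1 else - 1)) mod int m"
  proof (cases x)
    case True
    have "(int r + 1) mod int m = 0" if "\<not> Suc r < m"
    proof -
      have eq: "int r + 1 = int m" using Cons.prems that by linarith
      show ?thesis by (simp only: eq mod_self)
    qed
    then show ?thesis using True Cons.prems by (cases "Suc r < m") (auto simp: step_def nx_def)
  next
    case False
    have "(int r - 1) mod int m = int (pr r)"
    proof (cases "r = 0")
      case True
      have "(- 1) mod int m = int m - 1" using m_ge_2 by (intro zmod_minus1) simp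
      then show ?thesis using True m_ge_2 by (simp add: pr_def)
    next
      case r: False
      then have "(int r - 1) mod int m = int r - 1" using Cons.prems by (intro mod_pos_pos_trivial) auto
      then show ?thesis using r by (simp add: pr_def)
    qed
    then show ?thesis using False by (simp add: step_def)
  qed
  show ?case using Cons by (simp add: s mod_add_left_eq add.assoc)
qed simp

text \<open>
  Words of equal degree modulo \<open>m\<close> are fused into the same stack. Composing one
  normal form with the inverse of the other gives a morphism whose only block is between the two
  words, and it is not zero.
\<close>

lemma matrix_unit_exists:
  assumes w: "length w' = t" "length w = b" "int m dvd ht w' - ht w"
  shows "\<exists>x \<in> free_space A b t. \<forall>v' v. evl x 0 v' v = of_bool (v' = w' \<and> v = w)"
proof -
  have m: "0 < m" using m_ge_2 by simp
  have "ht w' mod int m = ht w mod int m" using w(3) by (simp add: mod_eq_dvd_iff)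
  then have "int (fin 0 w') = int (fin 0 w)" using fin_ht[OF m] by simp
  then have fin: "fin 0 w' = fin 0 w" by (simp only: of_nat_eq_iff)
  obtain y where y: "y \<in> Mor" "src y = fin 0 w" "tgt y = t" "e 0 w' \<odot> y = Pw (fin 0 w)"
    using e_inverse[OF m, of w'] w fin by auto
  define E where "E = W w' \<odot> (y \<odot> e 0 w)"
  have E: "E \<in> Mor" "src E = b" "tgt E = t" using y m w by (simp_all add: E_def)
  have eE: "e 0 w' \<odot> E = e 0 w"
  proof -
    have "e 0 w' \<odot> E = (e 0 w' \<odot> (Pw 0 || W w')) \<odot> (y \<odot> e 0 w)"
      using y m w by (simp add: E_def comp_assoc del: e_absorb)
    also have "\<dots> = (e 0 w' \<odot> y) \<odot> e 0 w"
      unfolding e_absorb(1)[OF m] by (rule comp_assoc[symmetric]) (use y m w in simp_all)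
    finally show ?thesis unfolding y(4) using m by simp
  qed
  have "E = W w' \<odot> (E \<odot> W w)"
  proof -
    have "e 0 w \<odot> W w = e 0 w" using e_absorb(1)[OF m, of w] by simp
    then have "E \<odot> W w = E" using y m w by (simp add: E_def comp_assoc)
    moreover have "W w' \<odot> E = E" using y m w by (simp add: E_def flip: comp_assoc)
    ultimately show ?thesis by simp
  qed
  then have hE: "hev E 0 v' v = of_bool (v' = w') * of_bool (v = w) * hev E 0 w' w" for v' v
  proof -
    assume eq: "E = W w' \<odot> (E \<odot> W w)"
    have 1: "hev (E \<odot> W w) 0 z v = hev E 0 z w * of_bool (v = w)" for z
    proof -
      have "hev (E \<odot> W w) 0 z v = (\<Sum>z' \<in> words b. hev E 0 z z' * of_bool (z' = w \<and> v = w))"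
        using E w by (simp add: hev_ops hev_W)
      also have "\<dots> = (\<Sum>z' \<in> words b. (hev E 0 z z' * of_bool (v = w)) * of_bool (z' = w))"
        by (intro sum.cong) auto
      finally show ?thesis using w by (simp del: sum_mult_of_bool_eq)
    qed
    have "hev E 0 v' v = hev (W w' \<odot> (E \<odot> W w)) 0 v' v" by (simp flip: eq)
    also have "\<dots> = (\<Sum>z \<in> words t. of_bool (v' = w' \<and> z = w') * hev (E \<odot> W w) 0 z v)"
      using E w by (simp add: hev_ops(1) hev_W del: sum_of_bool_mult_eq)
    also have "\<dots> = (\<Sum>z \<in> words t. (of_bool (v' = w') * (hev E 0 z w * of_bool (v = w))) * of_bool (z = w'))"
      by (intro sum.cong) (auto simp: 1)
    finally show ?thesis using w by (simp del: sum_mult_of_bool_eq)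
  qed
  have nz: "hev E 0 w' w \<noteq> 0"
  proof
    assume "hev E 0 w' w = 0"
    then have "hev E 0 v' v = 0" for v' v using hE[of v' v] by simp
    then have "hev (e 0 w' \<odot> E) 0 x w = 0" for x
      using E m w by (subst hev_ops(1)) simp_all
    then show False using hev_e_nz[OF m, of w 0] unfolding eE by auto
  qed
  let ?c = "inverse (hev E 0 w' w)"
  obtain x where x: "x \<in> free_space A b t" "E = cl b t x"
    using Mor_cases[OF E(1)] E(2,3) by (metis cl_simps)
  have "evl x 0 = hev E 0" using hev_cl[OF x(1)] x(2) by simp
  then have "evl (scale ?c x) 0 v' v = ?c * (of_bool (v' = w') * of_bool (v = w) * hev E 0 w' w)" for v' v
    unfolding evl_scale using hE[of v' v] by simp
  then have "evl (scale ?c x) 0 v' v = of_bool (v' = w' \<and> v = w)" for v' v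
    using nz by (simp del: evl_scale)
  then show ?thesis using x(1) by (intro bexI[of _ "scale ?c x"]) simp_all
qed

theorem evl_surj:
  assumes "\<And>v w. M v w \<noteq> 0 \<Longrightarrow> length v = t \<and> length w = b \<and> int m dvd ht v - ht w"
  shows "\<exists>x \<in> free_space A b t. evl x 0 = M"
proof -
  have "\<exists>x \<in> free_space A b t. \<forall>v w. evl x 0 v w = (if (v, w) \<in> F then M v w else 0)"
    if "finite F" for F
    using that
  proof (induction F)
    case empty
    then show ?case by (intro bexI[of _ 0]) simp_all
  next
    case (insert p F)
    obtain v0 w0 where p: "p = (v0, w0)" by (cases p)
    obtain x where x: "x \<in> free_space A b t" "\<And>v w. evl x 0 v w = (if (v, w) \<in> F then M v w else 0)"
      using insert by auto
    show ?case
    proof (cases "M v0 w0 = 0")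
      case True
      then show ?thesis using x p by (intro bexI[of _ x]) auto
    next
      case False
      then obtain y where y: "y \<in> free_space A b t" "\<And>v w. evl y 0 v w = of_bool (v = v0 \<and> w = w0)"
        using matrix_unit_exists[of v0 t w0 b] assms[OF False] by auto
      show ?thesis using x y p insert(2) by (intro bexI[of _ "x + scale (M v0 w0) y"]) auto
    qed
  qed
  from this[of "words t \<times> words b"] obtain x where
    x: "x \<in> free_space A b t" "\<And>v w. evl x 0 v w = (if (v, w) \<in> words t \<times> words b then M v w else 0)"
    by auto
  have "evl x 0 = M" using x(2) assms by (intro ext) auto
  then show ?thesis using x(1) by blast
qed

subsection \<open>The operations on cosets\<close>

definition rho :: "label lincomb set \<Rightarrow> bool list \<Rightarrow> bool list \<Rightarrow> complex" where
  "rho S = some_evl S 0"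

lemma rho_coset: "x \<in> free_space A b t \<Longrightarrow> rho (coset A b t x) = evl x 0"
  by (simp add: rho_def some_evl_coset)

lemma rho_inj:
  assumes "S \<in> pa_space A b t" "T \<in> pa_space A b t" "rho S = rho T"
  shows "S = T"
proof -
  obtain x y where x: "x \<in> free_space A b t" "S = coset A b t x"
    and y: "y \<in> free_space A b t" "T = coset A b t y"
    using assms(1,2) by (auto elim!: pa_space_cases)
  have "evl (x - y) 0 = (\<lambda>v w. 0)" using assms(3) x y by (simp add: rho_coset fun_eq_iff)
  then show ?thesis using x y planar_ideal_iff[of "x - y" b t] by (simp add: coset_eq_iff)
qed

lemma rho_surj:
  assumes "\<And>v w. M v w \<noteq> 0 \<Longrightarrow> length v = t \<and> length w = b \<and> int m dvd ht v - ht w"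
  shows "\<exists>S \<in> pa_space A b t. rho S = M"
proof -
  obtain x where "x \<in> free_space A b t" "evl x 0 = M" using evl_surj[of M t b] assms by blast
  then show ?thesis by (intro bexI[of _ "coset A b t x"]) (simp_all add: rho_coset)
qed

lemma rho_support:
  "S \<in> pa_space A b t \<Longrightarrow> rho S p q \<noteq> 0 \<Longrightarrow> length p = t \<and> length q = b \<and> int m dvd ht p - ht q"
  by (auto elim!: pa_space_cases simp: rho_coset evl_support)

lemma pa_closed [simp]:
  "S \<in> pa_space A k t \<Longrightarrow> T \<in> pa_space A b k \<Longrightarrow> pa_stack A b t S T \<in> pa_space A b t"
  "S \<in> pa_space A b t \<Longrightarrow> T \<in> pa_space A b t \<Longrightarrow> pa_add A b t S T \<in> pa_space A b t"
  "S \<in> pa_space A b t \<Longrightarrow> pa_scale A b t c S \<in> pa_space A b t"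
  "S \<in> pa_space A b t \<Longrightarrow> T \<in> pa_space A b' t' \<Longrightarrow>
    pa_beside A (b + b') (t + t') S T \<in> pa_space A (b + b') (t + t')"
  by (auto elim!: pa_space_cases simp: pa_stack_coset pa_add_coset pa_scale_coset pa_beside_coset)

lemma rho_stack:
  "S \<in> pa_space A k t \<Longrightarrow> T \<in> pa_space A b k \<Longrightarrow>
    rho (pa_stack A b t S T) p q = (\<Sum>z \<in> words k. rho S p z * rho T z q)"
  by (auto elim!: pa_space_cases simp: pa_stack_coset rho_coset evl_stack)

lemma rho_add:
  "S \<in> pa_space A b t \<Longrightarrow> T \<in> pa_space A b t \<Longrightarrow> rho (pa_add A b t S T) p q = rho S p q + rho T p q"
  by (auto elim!: pa_space_cases simp: pa_add_coset rho_coset)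

lemma rho_scale: "S \<in> pa_space A b t \<Longrightarrow> rho (pa_scale A b t c S) p q = c * rho S p q"
  by (auto elim!: pa_space_cases simp: pa_scale_coset rho_coset)

lemma rho_zero [simp]: "rho (coset A b t 0) p q = 0"
  by (simp add: rho_coset)

lemma rho_beside:
  assumes "S \<in> pa_space A b t" "T \<in> pa_space A b' t'" "length p = t" "length q = b"
  shows "rho (pa_beside A (b + b') (t + t') S T) (p @ p') (q @ q') =
    lam powi (ht q * ((ht p' - ht q') div int m)) * rho S p q * rho T p' q'"
  using assms
proof (elim pa_space_cases)
  fix x y assume "x \<in> free_space A b t" "S = coset A b t x" "y \<in> free_space A b' t'" "T = coset A b' t' y"
  then show ?thesis
    using assms(3,4) evl_shift[of y "ht q" p' q'] by (simp add: pa_beside_coset rho_coset evl_beside)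
qed

lemma pa_adjoint_coset:
  assumes x: "x \<in> free_space A b t"
  shows "pa_adjoint A t b (coset A b t x) = coset A t b (adjoint_lc star_of x)"
    "adjoint_lc star_of x \<in> free_space A t b"
proof -
  have G: "(\<lambda>(g, b, t). (star_of g, t, b)) ` gens A \<subseteq> gens A" by (auto simp: gens_A)
  note f = free_space_adjoint[OF G]
  show "adjoint_lc star_of x \<in> free_space A t b" by (rule f[OF x])
  show "pa_adjoint A t b (coset A b t x) = coset A t b (adjoint_lc star_of x)"
    unfolding pa_adjoint_def star_A
  proof (intro UN_coset_const x)
    fix x' assume x': "x' \<in> coset A b t x"
    then have "evl x' = evl x" by (auto simp: mem_coset intro: evl_ideal_eq)
    then have "evl (adjoint_lc star_of x' - adjoint_lc star_of x) 0 = (\<lambda>p q. 0)"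
      by (simp add: evl_adjoint fun_eq_iff)
    then show "coset A t b (adjoint_lc star_of x') = coset A t b (adjoint_lc star_of x)"
      using x x' f[of x b t] f[of x' b t]
        planar_ideal_iff[of "adjoint_lc star_of x' - adjoint_lc star_of x" t b]
      by (auto simp: coset_eq_iff mem_coset)
  qed
qed

text \<open>
  The value \<open>lam powi s\<close> of the adjoint of \<open>U\<close> is the conjugate of the
  value of \<open>U\<close>, because \<open>lam\<close> has modulus 1.
\<close>

lemma rho_adjoint:
  "S \<in> pa_space A b t \<Longrightarrow> pa_adjoint A t b S \<in> pa_space A t b"
  "S \<in> pa_space A b t \<Longrightarrow> rho (pa_adjoint A t b S) p q = cnj (rho S q p)"
  by (auto elim!: pa_space_cases simp: pa_adjoint_coset rho_coset evl_adjoint)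

end

section \<open>The category of projections\<close>

context cyclic
begin

lemma pa_stack_assoc:
  "S \<in> pa_space A l t \<Longrightarrow> T \<in> pa_space A k l \<Longrightarrow> R \<in> pa_space A b k \<Longrightarrow>
    pa_stack A b t (pa_stack A k t S T) R = pa_stack A b t S (pa_stack A b l T R)"
  by (auto elim!: pa_space_cases simp: pa_stack_coset stack_lc_assoc)

lemma pa_interchange:
  "S \<in> pa_space A k t \<Longrightarrow> T \<in> pa_space A b k \<Longrightarrow> S' \<in> pa_space A k' t' \<Longrightarrow> T' \<in> pa_space A b' k' \<Longrightarrow>
    pa_stack A (b + b') (t + t') (pa_beside A (k + k') (t + t') S S') (pa_beside A (b + b') (k + k') T T') =
    pa_beside A (b + b') (t + t') (pa_stack A b t S T) (pa_stack A b' t' S' T')"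
  by (auto elim!: pa_space_cases simp: pa_stack_coset pa_beside_coset interchange_lc)

lemma pa_beside_assoc:
  "S \<in> pa_space A b t \<Longrightarrow> T \<in> pa_space A b' t' \<Longrightarrow> R \<in> pa_space A b'' t'' \<Longrightarrow>
    pa_beside A (b + (b' + b'')) (t + (t' + t'')) S (pa_beside A (b' + b'') (t' + t'') T R) =
    pa_beside A (b + b' + b'') (t + t' + t'') (pa_beside A (b + b') (t + t') S T) R"
proof (elim pa_space_cases)
  fix x y z assume h: "x \<in> free_space A b t" "S = coset A b t x" "y \<in> free_space A b' t'" "T = coset A b' t' y"
    "z \<in> free_space A b'' t''" "R = coset A b'' t'' z"
  have "pa_beside A (b + (b' + b'')) (t + (t' + t'')) S (pa_beside A (b' + b'') (t' + t'') T R) =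
    coset A (b + (b' + b'')) (t + (t' + t'')) (beside_lc x (beside_lc y z))"
    using h by (simp only: pa_beside_coset free_space_beside)
  moreover have "pa_beside A (b + b' + b'') (t + t' + t'') (pa_beside A (b + b') (t + t') S T) R =
    coset A (b + b' + b'') (t + t' + t'') (beside_lc (beside_lc x y) z)"
    using h by (simp only: pa_beside_coset free_space_beside)
  ultimately show ?thesis by (simp add: beside_lc_assoc add.assoc)
qed

lemma pa_beside_unit:
  assumes "S \<in> pa_space A b t"
  shows "pa_beside A b t (coset A 0 0 \<langle>strands 0\<rangle>) S = S" "pa_beside A b t S (coset A 0 0 \<langle>strands 0\<rangle>) = S"
proof -
  obtain x where x: "x \<in> free_space A b t" "S = coset A b t x" using assms by (rule pa_space_cases)
  have s: "\<langle>strands 0\<rangle> \<in> free_space A 0 0" by auto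
  show "pa_beside A b t (coset A 0 0 \<langle>strands 0\<rangle>) S = S"
    using pa_beside_coset[OF s x(1)] x by (simp add: beside_lc_empty)
  show "pa_beside A b t S (coset A 0 0 \<langle>strands 0\<rangle>) = S"
    using pa_beside_coset[OF x(1) s] x by (simp add: beside_lc_empty)
qed

lemma pa_adjoint_beside:
  "S \<in> pa_space A b t \<Longrightarrow> T \<in> pa_space A b' t' \<Longrightarrow>
    pa_adjoint A (t + t') (b + b') (pa_beside A (b + b') (t + t') S T) =
    pa_beside A (t + t') (b + b') (pa_adjoint A t b S) (pa_adjoint A t' b' T)"
  by (auto elim!: pa_space_cases simp: pa_adjoint_coset pa_beside_coset adjoint_lc_beside)

abbreviation "B \<equiv> projection_category A"

lemma proj_simps:
  "P \<in> Obj B \<longleftrightarrow> is_projection A P" "idA B P = Arrow P P (snd P)"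
  "g \<cdot>\<^bsub>B\<^esub> f = Arrow (src f) (tgt g) (pa_stack A (fst (src f)) (fst (tgt g)) (val g) (val f))"
  "zeroA B P Q = Arrow P Q (coset A (fst P) (fst Q) 0)"
  "addA B f g = Arrow (src f) (tgt f) (pa_add A (fst (src f)) (fst (tgt f)) (val f) (val g))"
  "scaleA B c f = Arrow (src f) (tgt f) (pa_scale A (fst (src f)) (fst (tgt f)) c (val f))"
  "P \<boxtimes>\<^bsub>B\<^esub> Q = (fst P + fst Q, pa_beside A (fst P + fst Q) (fst P + fst Q) (snd P) (snd Q))"
  "f \<star>\<^bsub>B\<^esub> g = Arrow (src f \<boxtimes>\<^bsub>B\<^esub> src g) (tgt f \<boxtimes>\<^bsub>B\<^esub> tgt g)
     (pa_beside A (fst (src f) + fst (src g)) (fst (tgt f) + fst (tgt g)) (val f) (val g))"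
  "unitO B = (0, coset A 0 0 \<langle>strands 0\<rangle>)"
  "assocA B P Q R = Arrow (P \<boxtimes>\<^bsub>B\<^esub> (Q \<boxtimes>\<^bsub>B\<^esub> R)) (P \<boxtimes>\<^bsub>B\<^esub> (Q \<boxtimes>\<^bsub>B\<^esub> R)) (snd (P \<boxtimes>\<^bsub>B\<^esub> (Q \<boxtimes>\<^bsub>B\<^esub> R)))"
  "lunitA B P = Arrow P P (snd P)" "runitA B P = Arrow P P (snd P)"
  by (simp_all add: projection_category_def projection_tensor_def Let_def case_prod_unfold)

lemma projD:
  assumes "P \<in> Obj B"
  shows "snd P \<in> pa_space A (fst P) (fst P)" "pa_stack A (fst P) (fst P) (snd P) (snd P) = snd P"
    "pa_adjoint A (fst P) (fst P) (snd P) = snd P"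
  using assms by (auto simp: proj_simps is_projection_def case_prod_unfold)

lemma projI:
  "S \<in> pa_space A k k \<Longrightarrow> pa_stack A k k S S = S \<Longrightarrow> pa_adjoint A k k S = S \<Longrightarrow> (k, S) \<in> Obj B"
  by (auto simp: proj_simps is_projection_def)

text \<open>
  Both sides of the product \<open>q f p = f\<close> can be absorbed separately because
  \<open>p\<close> and \<open>q\<close> are idempotent.
\<close>

lemma Hom_proj:
  "f \<in> Hom B P Q \<longleftrightarrow> src f = P \<and> tgt f = Q \<and> P \<in> Obj B \<and> Q \<in> Obj B \<and> val f \<in> pa_space A (fst P) (fst Q) \<and>
    pa_stack A (fst P) (fst Q) (snd Q) (val f) = val f \<and> pa_stack A (fst P) (fst Q) (val f) (snd P) = val f"
proof (cases f)
  case (Arrow P' Q' h)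
  let ?s = "pa_stack A (fst P) (fst Q)"
  have mem: "f \<in> Hom B P Q \<longleftrightarrow> P' = P \<and> Q' = Q \<and> P \<in> Obj B \<and> Q \<in> Obj B \<and> h \<in> pa_space A (fst P) (fst Q) \<and>
    ?s (snd Q) (?s h (snd P)) = h"
    unfolding Arrow by (cases P; cases Q) (auto simp: Hom_def projection_category_def)
  have "?s (snd Q) (?s h (snd P)) = h \<longleftrightarrow> ?s (snd Q) h = h \<and> ?s h (snd P) = h"
    if o: "P \<in> Obj B" "Q \<in> Obj B" "h \<in> pa_space A (fst P) (fst Q)"
  proof
    note p = projD[OF o(1)] and q = projD[OF o(2)]
    assume eq: "?s (snd Q) (?s h (snd P)) = h"
    have hp: "?s h (snd P) \<in> pa_space A (fst P) (fst Q)" and qh: "?s (snd Q) h \<in> pa_space A (fst P) (fst Q)"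
      using p q o(3) by simp_all
    have "?s (snd Q) (?s (snd Q) (?s h (snd P))) = ?s (snd Q) (?s h (snd P))"
      using pa_stack_assoc[OF q(1) q(1) hp] q(2) by simp
    moreover have "?s (?s (snd Q) (?s h (snd P))) (snd P) = ?s (snd Q) (?s h (snd P))"
      using pa_stack_assoc[OF q(1) hp p(1)] pa_stack_assoc[OF o(3) p(1) p(1)] p(2) by simp
    ultimately show "?s (snd Q) h = h \<and> ?s h (snd P) = h" unfolding eq by simp
  qed simp
  then show ?thesis unfolding mem using Arrow by auto
qed

definition pI :: "nat \<times> label lincomb set \<Rightarrow> bool list set" where "pI P = words (fst P)"

definition pdg :: "nat \<times> label lincomb set \<Rightarrow> bool list \<Rightarrow> int" where "pdg P w = ht w mod int m"

definition pPhi :: "(nat \<times> label lincomb set, label lincomb set) arrow \<Rightarrow> bool list \<Rightarrow> bool list \<Rightarrow> complex" where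
  "pPhi f = rho (val f)"

text \<open>
  These scalars turn the twisted juxtaposition of \<open>rho_beside\<close> into the Kronecker
  product: the exponent \<open>(ht y' - ht x') div m\<close> is a difference of a term in
  \<open>y'\<close> and one in \<open>x'\<close> for words of equal degree.
\<close>

definition pt :: "nat \<times> label lincomb set \<Rightarrow> nat \<times> label lincomb set \<Rightarrow> bool list \<Rightarrow> bool list \<Rightarrow> complex" where
  "pt P Q w w' = lam powi (ht w * (ht w' div int m))"

lemma rho_mm: "S \<in> pa_space A k t \<Longrightarrow> T \<in> pa_space A b k \<Longrightarrow> rho (pa_stack A b t S T) = mm (words k) (rho S) (rho T)"
  by (intro ext) (simp add: rho_stack mm_def)

lemma Hom_projD:
  assumes "f \<in> Hom B P Q"
  shows "src f = P" "tgt f = Q" "P \<in> Obj B" "Q \<in> Obj B" "val f \<in> pa_space A (fst P) (fst Q)"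
    "pa_stack A (fst P) (fst Q) (snd Q) (val f) = val f" "pa_stack A (fst P) (fst Q) (val f) (snd P) = val f"
  using assms by (simp_all add: Hom_proj)

lemma id_proj: "P \<in> Obj B \<Longrightarrow> Arrow P P (snd P) \<in> Hom B P P"
  using projD by (simp add: Hom_proj)

lemma matrix_cat_proj: "matrix_cat B pI pPhi pdg"
proof (rule matrix_cat.intro)
  fix P assume o: "P \<in> Obj B"
  show "finite (pI P)" by (simp add: pI_def)
  show "idA B P \<in> Hom B P P" using id_proj[OF o] by (simp add: proj_simps)
next
  fix f assume "f \<in> Arr B"
  then show "src f \<in> Obj B \<and> tgt f \<in> Obj B" by (auto simp: projection_category_def)
next
  fix f P Q g R assume f: "f \<in> Hom B P Q" and g: "g \<in> Hom B Q R"
  note F = Hom_projD[OF f] and H = Hom_projD[OF g]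
  show "g \<cdot>\<^bsub>B\<^esub> f \<in> Hom B P R"
    using F H pa_stack_assoc[OF projD(1)[OF H(4)] H(5) F(5)] pa_stack_assoc[OF H(5) F(5) projD(1)[OF F(3)]]
    by (simp add: Hom_proj proj_simps)
  show "pPhi (g \<cdot>\<^bsub>B\<^esub> f) = mm (pI Q) (pPhi g) (pPhi f)"
    using F H by (simp add: pPhi_def pI_def proj_simps rho_mm)
next
  fix f P Q g assume f: "f \<in> Hom B P Q" and g: "g \<in> Hom B P Q"
  note F = Hom_projD[OF f] and H = Hom_projD[OF g]
  note p = projD(1)[OF F(3)] and q = projD(1)[OF F(4)]
  let ?s = "pa_add A (fst P) (fst Q) (val f) (val g)"
  have s: "?s \<in> pa_space A (fst P) (fst Q)" "rho ?s = (\<lambda>y x. rho (val f) y x + rho (val g) y x)"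
    using F H by (auto simp: rho_add intro!: ext)
  have "pa_stack A (fst P) (fst Q) (snd Q) ?s = ?s"
    using arg_cong[OF F(6), of rho] arg_cong[OF H(6), of rho] q F(5) H(5)
    by (intro rho_inj[OF pa_closed(1)[OF q s(1)] s(1)]) (simp add: rho_mm[OF q s(1)] rho_mm s(2) mm_add_right)
  moreover have "pa_stack A (fst P) (fst Q) ?s (snd P) = ?s"
    using arg_cong[OF F(7), of rho] arg_cong[OF H(7), of rho] p F(5) H(5)
    by (intro rho_inj[OF pa_closed(1)[OF s(1) p] s(1)]) (simp add: rho_mm[OF s(1) p] rho_mm s(2) mm_add_left)
  ultimately show "addA B f g \<in> Hom B P Q" using F H s by (simp add: Hom_proj) (simp add: proj_simps)
  show "pPhi (addA B f g) = (\<lambda>y x. pPhi f y x + pPhi g y x)"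
    using F s by (simp add: pPhi_def proj_simps)
  assume "pPhi f = pPhi g"
  then have "val f = val g" using rho_inj[OF F(5) H(5)] by (simp add: pPhi_def)
  then show "f = g" using F H by (cases f; cases g) auto
next
  fix f P Q c assume f: "f \<in> Hom B P Q"
  note F = Hom_projD[OF f]
  note p = projD(1)[OF F(3)] and q = projD(1)[OF F(4)]
  let ?s = "pa_scale A (fst P) (fst Q) c (val f)"
  have s: "?s \<in> pa_space A (fst P) (fst Q)" "rho ?s = (\<lambda>y x. c * rho (val f) y x)"
    using F by (auto simp: rho_scale intro!: ext)
  have "pa_stack A (fst P) (fst Q) (snd Q) ?s = ?s"
    using arg_cong[OF F(6), of rho] q F(5)
    by (intro rho_inj[OF pa_closed(1)[OF q s(1)] s(1)]) (simp add: rho_mm[OF q s(1)] rho_mm s(2) mm_scale_right)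
  moreover have "pa_stack A (fst P) (fst Q) ?s (snd P) = ?s"
    using arg_cong[OF F(7), of rho] p F(5)
    by (intro rho_inj[OF pa_closed(1)[OF s(1) p] s(1)]) (simp add: rho_mm[OF s(1) p] rho_mm s(2) mm_scale_left)
  ultimately show "scaleA B c f \<in> Hom B P Q" using F s by (simp add: Hom_proj) (simp add: proj_simps)
  show "pPhi (scaleA B c f) = (\<lambda>y x. c * pPhi f y x)"
    using F s by (simp add: pPhi_def proj_simps)
next
  fix f P Q assume f: "f \<in> Hom B P Q"
  note F = Hom_projD[OF f]
  note p = projD(1)[OF F(3)] and q = projD(1)[OF F(4)]
  show "mm (pI Q) (pPhi (idA B Q)) (pPhi f) = pPhi f" "mm (pI P) (pPhi f) (pPhi (idA B P)) = pPhi f"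
    using arg_cong[OF F(6), of rho] arg_cong[OF F(7), of rho] p q F(5)
    by (simp_all add: pI_def pPhi_def proj_simps rho_mm)
  fix v w assume "pPhi f v w \<noteq> 0"
  then show "v \<in> pI Q \<and> w \<in> pI P \<and> pdg Q v = pdg P w"
    using rho_support[OF F(5)] by (auto simp: pI_def pPhi_def pdg_def mod_eq_dvd_iff)
next
  fix P Q M assume o: "P \<in> Obj B" "Q \<in> Obj B"
    and M: "\<And>y x. M y x \<noteq> 0 \<Longrightarrow> y \<in> pI Q \<and> x \<in> pI P \<and> pdg Q y = pdg P x"
    and QM: "mm (pI Q) (pPhi (idA B Q)) M = M" and MP: "mm (pI P) M (pPhi (idA B P)) = M"
  note p = projD(1)[OF o(1)] and q = projD(1)[OF o(2)]
  obtain S where S: "S \<in> pa_space A (fst P) (fst Q)" "rho S = M"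
    using rho_surj[of M "fst Q" "fst P"] M by (auto simp: pI_def pdg_def mod_eq_dvd_iff)
  have "pa_stack A (fst P) (fst Q) (snd Q) S = S"
    using QM S(2) by (intro rho_inj[OF pa_closed(1)[OF q S(1)] S(1)])
      (simp add: rho_mm[OF q S(1)] pI_def pPhi_def proj_simps)
  moreover have "pa_stack A (fst P) (fst Q) S (snd P) = S"
    using MP S(2) by (intro rho_inj[OF pa_closed(1)[OF S(1) p] S(1)])
      (simp add: rho_mm[OF S(1) p] pI_def pPhi_def proj_simps)
  ultimately have "Arrow P Q S \<in> Hom B P Q" using o S by (simp add: Hom_proj)
  then show "\<exists>f \<in> Hom B P Q. pPhi f = M" using S by (auto simp: pPhi_def intro!: bexI[of _ "Arrow P Q S"])
qed

definition omega :: "int \<Rightarrow> int \<Rightarrow> int \<Rightarrow> complex" where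
  "omega g h k = lam powi (- (g * ((h + k) div int m)))"

text \<open>Both sides of the cocycle identity for the carry of addition modulo \<open>m\<close> count the carry of \<open>h + k + l\<close>.\<close>

lemma carry:
  "(h + k) div int m + ((h + k) mod int m + l) div int m = (h + k + l) div int m"
  "(k + l) div int m + (h + (k + l) mod int m) div int m = (h + k + l) div int m"
proof -
  have m: "int m \<noteq> 0" using m_ge_2 by simp
  have "h + k + l = ((h + k) mod int m + l) + (h + k) div int m * int m" by simp
  then show "(h + k) div int m + ((h + k) mod int m + l) div int m = (h + k + l) div int m"
    using m by (metis add.commute div_mult_self1)
  have "h + k + l = (h + (k + l) mod int m) + (k + l) div int m * int m" by simp
  then show "(k + l) div int m + (h + (k + l) mod int m) div int m = (h + k + l) div int m"
    using m by (metis add.commute div_mult_self1)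
qed

lemma lam_powi_mod: "lam powi (i mod int m * j) = lam powi (i * j)" "lam powi (- (i mod int m * j)) = lam powi (- (i * j))"
proof -
  have "i mod int m * j - i * j = - (int m * (i div int m * j))"
    by (simp add: minus_div_mult_eq_mod[symmetric] algebra_simps)
  then have d: "int m dvd i mod int m * j - i * j" by simp
  then have "int m dvd - (i mod int m * j) - - (i * j)" by (simp add: dvd_diff_commute)
  with d show "lam powi (i mod int m * j) = lam powi (i * j)" "lam powi (- (i mod int m * j)) = lam powi (- (i * j))"
    using lam_powi_dvd by blast+
qed

text \<open>
  \<open>omega\<close> is the cup product of the character given by \<open>g \<mapsto> lam powi
  (- g)\<close> with the carry cocycle of addition modulo \<open>m\<close>.
\<close>

lemma omega_cocycle: "three_cocycle (integer_mod_group m) omega"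
  unfolding three_cocycle_def
proof (intro conjI ballI)
  fix g h k l
  have "omega h k l * omega g ((h + k) mod int m) l * omega g h k =
      lam powi (- (h * ((k + l) div int m)) + - (g * (((h + k) mod int m + l) div int m)) + - (g * ((h + k) div int m)))"
    by (simp only: omega_def lam_powi_add)
  also have "- (h * ((k + l) div int m)) + - (g * (((h + k) mod int m + l) div int m)) + - (g * ((h + k) div int m)) =
      - ((g + h) * ((k + l) div int m)) + - (g * ((h + (k + l) mod int m) div int m))"
  proof -
    have "g * ((h + k) div int m + ((h + k) mod int m + l) div int m) =
        g * ((k + l) div int m + (h + (k + l) mod int m) div int m)"
      by (simp only: carry)
    then show ?thesis unfolding distrib_left distrib_right by linarith
  qed
  also have "lam powi \<dots> = omega ((g + h) mod int m) k l * omega g h ((k + l) mod int m)"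
    by (simp only: omega_def lam_powi_add lam_powi_mod)
  finally show "omega h k l * omega g (h \<otimes>\<^bsub>integer_mod_group m\<^esub> k) l * omega g h k =
      omega (g \<otimes>\<^bsub>integer_mod_group m\<^esub> h) k l * omega g h (k \<otimes>\<^bsub>integer_mod_group m\<^esub> l)" by simp
qed (simp add: omega_def)

lemma tensor_proj_Obj:
  assumes "P \<in> Obj B" "Q \<in> Obj B"
  shows "P \<boxtimes>\<^bsub>B\<^esub> Q \<in> Obj B"
  using projD[OF assms(1)] projD[OF assms(2)]
  by (auto simp: proj_simps(7) pa_interchange pa_adjoint_beside intro!: projI)

lemma tensor_proj_assoc:
  "P \<in> Obj B \<Longrightarrow> Q \<in> Obj B \<Longrightarrow> R \<in> Obj B \<Longrightarrow> P \<boxtimes>\<^bsub>B\<^esub> (Q \<boxtimes>\<^bsub>B\<^esub> R) = (P \<boxtimes>\<^bsub>B\<^esub> Q) \<boxtimes>\<^bsub>B\<^esub> R"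
  using pa_beside_assoc[OF projD(1) projD(1) projD(1), of P Q R] by (simp add: proj_simps(7) add.assoc)

lemma reflect_strands: "reflect s (strands k) = strands k"
  by transfer (simp add: isotopic_refl)

lemma unit_proj: "unitO B \<in> Obj B" "rho (snd (unitO B)) [] [] = 1"
proof -
  have s: "\<langle>strands 0\<rangle> \<in> free_space A 0 0" by auto
  have "adjoint_lc star_of \<langle>strands 0\<rangle> = \<langle>strands 0\<rangle>"
    by (simp add: single_diagram_def reflect_strands)
  then show "unitO B \<in> Obj B" unfolding proj_simps(9)
    by (intro projI coset_pa_space s) (simp_all only: pa_stack_coset[OF s s] stack_lc_strands(1)[OF s] pa_adjoint_coset(1)[OF s])
  show "rho (snd (unitO B)) [] [] = 1"
    using rho_coset[OF s] by (simp add: proj_simps(9))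
qed

lemma tensor_unit_proj: "P \<in> Obj B \<Longrightarrow> unitO B \<boxtimes>\<^bsub>B\<^esub> P = P" "P \<in> Obj B \<Longrightarrow> P \<boxtimes>\<^bsub>B\<^esub> unitO B = P"
  using pa_beside_unit[OF projD(1)] by (simp_all add: proj_simps(7,9))

lemma pt_factor:
  assumes "int m dvd ht y - ht x" "int m dvd ht y' - ht x'"
  shows "lam powi (ht x * ((ht y' - ht x') div int m)) = lam powi (ht y * (ht y' div int m)) / lam powi (ht x * (ht x' div int m))"
proof -
  obtain j where j: "ht y' = ht x' + j * int m" using assms(2) by (metis dvdE diff_add_cancel add.commute mult.commute)
  obtain i where i: "ht y = ht x + i * int m" using assms(1) by (metis dvdE diff_add_cancel add.commute mult.commute)
  have m: "int m \<noteq> 0" using m_ge_2 by simp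
  have "int m dvd ht x * j + ht x * (ht x' div int m) - ht y * (ht x' div int m + j)"
    by (simp add: i algebra_simps)
  then have "lam powi (ht x * j + ht x * (ht x' div int m)) = lam powi (ht y * (ht x' div int m + j))"
    by (rule lam_powi_dvd)
  then show ?thesis using m by (simp add: j lam_powi_add field_simps)
qed

lemma tenA_proj:
  assumes f: "f \<in> Hom B P Q" and g: "g \<in> Hom B P' Q'"
  shows "f \<star>\<^bsub>B\<^esub> g \<in> Hom B (P \<boxtimes>\<^bsub>B\<^esub> P') (Q \<boxtimes>\<^bsub>B\<^esub> Q')"
    "length x = fst P \<Longrightarrow> length x' = fst P' \<Longrightarrow> length y = fst Q \<Longrightarrow> length y' = fst Q' \<Longrightarrow>
      pPhi (f \<star>\<^bsub>B\<^esub> g) (y @ y') (x @ x') = pt Q Q' y y' * (pPhi f y x * pPhi g y' x') / pt P P' x x'"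
proof -
  note F = Hom_projD[OF f] and H = Hom_projD[OF g]
  note d = projD(1)[OF F(3)] projD(1)[OF F(4)] projD(1)[OF H(3)] projD(1)[OF H(4)]
  show "f \<star>\<^bsub>B\<^esub> g \<in> Hom B (P \<boxtimes>\<^bsub>B\<^esub> P') (Q \<boxtimes>\<^bsub>B\<^esub> Q')"
    unfolding Hom_proj using F H tensor_proj_Obj[OF F(3) H(3)] tensor_proj_Obj[OF F(4) H(4)]
      pa_interchange[OF d(2) F(5) d(4) H(5)] pa_interchange[OF F(5) d(1) H(5) d(3)]
    by (simp add: proj_simps(7,8))
  assume l: "length x = fst P" "length x' = fst P'" "length y = fst Q" "length y' = fst Q'"
  have "pPhi (f \<star>\<^bsub>B\<^esub> g) (y @ y') (x @ x') =
      lam powi (ht x * ((ht y' - ht x') div int m)) * rho (val f) y x * rho (val g) y' x'"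
    using rho_beside[OF F(5) H(5) l(3,1)] F H by (simp add: pPhi_def proj_simps(8))
  also have "\<dots> = pt Q Q' y y' * (pPhi f y x * pPhi g y' x') / pt P P' x x'"
  proof (cases "rho (val f) y x = 0 \<or> rho (val g) y' x' = 0")
    case False
    then have "int m dvd ht y - ht x" "int m dvd ht y' - ht x'"
      using rho_support[OF F(5)] rho_support[OF H(5)] by blast+
    then show ?thesis using pt_factor[of y x y' x'] by (simp add: pt_def pPhi_def)
  qed (auto simp: pPhi_def)
  finally show "pPhi (f \<star>\<^bsub>B\<^esub> g) (y @ y') (x @ x') = pt Q Q' y y' * (pPhi f y x * pPhi g y' x') / pt P P' x x'" .
qed

theorem projection_matrix_mcat:
  "zero_matrix_mcat B pI pPhi pdg (integer_mod_group m) omega (\<lambda>_ _. (@)) pt []"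
proof (intro zero_matrix_mcat.intro zero_matrix_mcat_axioms.intro matrix_mcat.intro matrix_mcat_axioms.intro
    matrix_cat_proj)
  have m: "m \<noteq> 0" using m_ge_2 by simp
  show "monoid (integer_mod_group m)" using group.is_monoid[OF group_integer_mod_group] .
  show "three_cocycle (integer_mod_group m) omega" by (rule omega_cocycle)
  show "unitO B \<in> Obj B" by (rule unit_proj)
  show "pI (unitO B) = {[]}" by (simp add: pI_def proj_simps(9))
  show "pPhi (idA B (unitO B)) [] [] = 1" using unit_proj(2) by (simp add: pPhi_def proj_simps(2))
  show "pdg (unitO B) [] = \<one>\<^bsub>integer_mod_group m\<^esub>" by (simp add: pdg_def)
  show "pt P Q w w' \<noteq> 0" for P Q w w' by (simp add: pt_def)
  fix P assume P: "P \<in> Obj B"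
  show "pdg P x \<in> carrier (integer_mod_group m)" for x
    using m by (simp add: pdg_def carrier_integer_mod_group)
  show "lunitA B P \<in> Hom B (unitO B \<boxtimes>\<^bsub>B\<^esub> P) P" "runitA B P \<in> Hom B (P \<boxtimes>\<^bsub>B\<^esub> unitO B) P"
    using id_proj[OF P] by (simp_all add: tensor_unit_proj[OF P] proj_simps(11,12))
  fix x x'
  show "pPhi (lunitA B P) x' ([] @ x) =
      inverse (omega \<one>\<^bsub>integer_mod_group m\<^esub> \<one>\<^bsub>integer_mod_group m\<^esub> (pdg P x)) * pPhi (idA B P) x' x / pt (unitO B) P [] x"
    "pPhi (runitA B P) x' (x @ []) =
      omega (pdg P x) \<one>\<^bsub>integer_mod_group m\<^esub> \<one>\<^bsub>integer_mod_group m\<^esub> * pPhi (idA B P) x' x / pt P (unitO B) x []"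
    by (simp_all add: proj_simps(2,11,12) omega_def pt_def)
next
  fix P Q assume o: "P \<in> Obj B" "Q \<in> Obj B"
  show "P \<boxtimes>\<^bsub>B\<^esub> Q \<in> Obj B" by (rule tensor_proj_Obj[OF o])
  show "idA B P \<star>\<^bsub>B\<^esub> idA B Q = idA B (P \<boxtimes>\<^bsub>B\<^esub> Q)" by (simp add: proj_simps(2,7,8))
  show "pdg (P \<boxtimes>\<^bsub>B\<^esub> Q) (x @ y) = pdg P x \<otimes>\<^bsub>integer_mod_group m\<^esub> pdg Q y" for x y
    by (simp add: pdg_def mod_add_eq)
  show "bij_betw (\<lambda>(x, y). x @ y) (pI P \<times> pI Q) (pI (P \<boxtimes>\<^bsub>B\<^esub> Q))"
  proof (rule bij_betwI')
    fix w assume "w \<in> pI (P \<boxtimes>\<^bsub>B\<^esub> Q)"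
    then show "\<exists>x \<in> pI P \<times> pI Q. w = (\<lambda>(x, y). x @ y) x"
      by (intro bexI[of _ "(take (fst P) w, drop (fst P) w)"]) (auto simp: pI_def proj_simps(7))
  qed (auto simp: pI_def proj_simps(7))
  have z: "coset A k l 0 \<in> pa_space A k l" for k l by simp
  note p = projD(1)[OF o(1)] and q = projD(1)[OF o(2)]
  have "pa_stack A (fst P) (fst Q) (snd Q) (coset A (fst P) (fst Q) 0) = coset A (fst P) (fst Q) 0"
    by (rule rho_inj[OF pa_closed(1)[OF q z] z]) (simp add: rho_mm[OF q z] mm_def fun_eq_iff)
  moreover have "pa_stack A (fst P) (fst Q) (coset A (fst P) (fst Q) 0) (snd P) = coset A (fst P) (fst Q) 0"
    by (rule rho_inj[OF pa_closed(1)[OF z p] z]) (simp add: rho_mm[OF z p] mm_def fun_eq_iff)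
  ultimately show "zeroA B P Q \<in> Hom B P Q" using o z by (simp add: Hom_proj) (simp add: proj_simps(4))
  show "pPhi (zeroA B P Q) = (\<lambda>y x. 0)" by (intro ext) (simp add: pPhi_def proj_simps(4))
next
  fix f P Q g P' Q' assume fg: "f \<in> Hom B P Q" "g \<in> Hom B P' Q'"
  show "f \<star>\<^bsub>B\<^esub> g \<in> Hom B (P \<boxtimes>\<^bsub>B\<^esub> P') (Q \<boxtimes>\<^bsub>B\<^esub> Q')" by (rule tenA_proj(1)[OF fg])
  show "pPhi (f \<star>\<^bsub>B\<^esub> g) (y @ y') (x @ x') = pt Q Q' y y' * (pPhi f y x * pPhi g y' x') / pt P P' x x'"
    if "x \<in> pI P" "x' \<in> pI P'" "y \<in> pI Q" "y' \<in> pI Q'" for x x' y y'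
    using tenA_proj(2)[OF fg] that by (simp add: pI_def)
next
  fix P Q R assume o: "P \<in> Obj B" "Q \<in> Obj B" "R \<in> Obj B"
  note i = id_proj[OF o(1)] id_proj[OF o(2)] id_proj[OF o(3)]
  have QR: "Arrow Q Q (snd Q) \<star>\<^bsub>B\<^esub> Arrow R R (snd R) = Arrow (Q \<boxtimes>\<^bsub>B\<^esub> R) (Q \<boxtimes>\<^bsub>B\<^esub> R) (snd (Q \<boxtimes>\<^bsub>B\<^esub> R))"
    by (simp add: proj_simps(7,8))
  have e: "assocA B P Q R = Arrow P P (snd P) \<star>\<^bsub>B\<^esub> (Arrow Q Q (snd Q) \<star>\<^bsub>B\<^esub> Arrow R R (snd R))"
    by (simp add: proj_simps(7,8,10))
  note QR' = tenA_proj(1)[OF i(2,3)]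
  show "assocA B P Q R \<in> Hom B ((P \<boxtimes>\<^bsub>B\<^esub> Q) \<boxtimes>\<^bsub>B\<^esub> R) (P \<boxtimes>\<^bsub>B\<^esub> (Q \<boxtimes>\<^bsub>B\<^esub> R))"
    unfolding e using tenA_proj(1)[OF i(1) QR'] by (simp add: tensor_proj_assoc[OF o])
  fix x y z x' y' z' assume l: "x \<in> pI P" "y \<in> pI Q" "z \<in> pI R" "x' \<in> pI P" "y' \<in> pI Q" "z' \<in> pI R"
  have om: "omega (pdg P x) (pdg Q y) (pdg R z) / (pt P Q x y * pt (P \<boxtimes>\<^bsub>B\<^esub> Q) R (x @ y) z) =
    1 / (pt P (Q \<boxtimes>\<^bsub>B\<^esub> R) x (y @ z) * pt Q R y z)"
  proof -
    have c: "(ht y mod int m + ht z mod int m) div int m + ht y div int m + ht z div int m = (ht y + ht z) div int m"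
      using div_add1_eq[of "ht y" "ht z" "int m"] by linarith
    have "omega (pdg P x) (pdg Q y) (pdg R z) = lam powi (- (ht x * ((ht y mod int m + ht z mod int m) div int m)))"
      by (simp add: omega_def pdg_def lam_powi_mod)
    also have "- (ht x * ((ht y mod int m + ht z mod int m) div int m)) =
      (ht x * (ht y div int m) + (ht x + ht y) * (ht z div int m)) + - (ht x * ((ht y + ht z) div int m) + ht y * (ht z div int m))"
      unfolding c[symmetric] by (simp add: algebra_simps)
    finally have eq: "omega (pdg P x) (pdg Q y) (pdg R z) = pt P Q x y * pt (P \<boxtimes>\<^bsub>B\<^esub> Q) R (x @ y) z *
      inverse (pt P (Q \<boxtimes>\<^bsub>B\<^esub> R) x (y @ z) * pt Q R y z)"
      by (simp only: pt_def lam_powi_add ht_append power_int_minus)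
    have nz: "pt P Q x y * pt (P \<boxtimes>\<^bsub>B\<^esub> Q) R (x @ y) z \<noteq> 0" by (simp add: pt_def)
    show ?thesis unfolding eq nonzero_mult_div_cancel_left[OF nz] by (simp only: inverse_eq_divide)
  qed
  have "pPhi (assocA B P Q R) (x' @ (y' @ z')) (x @ (y @ z)) =
    pt P (Q \<boxtimes>\<^bsub>B\<^esub> R) x' (y' @ z') * (pPhi (idA B P) x' x *
      (pt Q R y' z' * (pPhi (idA B Q) y' y * pPhi (idA B R) z' z) / pt Q R y z)) / pt P (Q \<boxtimes>\<^bsub>B\<^esub> R) x (y @ z)"
    unfolding e proj_simps(2)
    using tenA_proj(2)[OF i(1) QR', of x "y @ z" x' "y' @ z'"] tenA_proj(2)[OF i(2,3), of y z y' z'] l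
    by (simp add: pI_def proj_simps(7))
  also have "\<dots> = pt Q R y' z' * pt P (Q \<boxtimes>\<^bsub>B\<^esub> R) x' (y' @ z') *
      (pPhi (idA B P) x' x * (pPhi (idA B Q) y' y * pPhi (idA B R) z' z)) *
      (1 / (pt P (Q \<boxtimes>\<^bsub>B\<^esub> R) x (y @ z) * pt Q R y z))"
    by (simp add: mult_ac)
  also have "\<dots> = pt Q R y' z' * pt P (Q \<boxtimes>\<^bsub>B\<^esub> R) x' (y' @ z') *
      (omega (pdg P x) (pdg Q y) (pdg R z) * (pPhi (idA B P) x' x * (pPhi (idA B Q) y' y * pPhi (idA B R) z' z))) /
      (pt P Q x y * pt (P \<boxtimes>\<^bsub>B\<^esub> Q) R (x @ y) z)"
    unfolding om[symmetric] by (simp add: mult_ac)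
  finally show "pPhi (assocA B P Q R) (x' @ y' @ z') ((x @ y) @ z) =
      pt Q R y' z' * pt P (Q \<boxtimes>\<^bsub>B\<^esub> R) x' (y' @ z') *
      (omega (pdg P x) (pdg Q y) (pdg R z) * (pPhi (idA B P) x' x * (pPhi (idA B Q) y' y * pPhi (idA B R) z' z))) /
      (pt P Q x y * pt (P \<boxtimes>\<^bsub>B\<^esub> Q) R (x @ y) z)"
    by (simp only: append_assoc)
qed

text \<open>
  The unit matrix at the word of \<open>k\<close> upward strands; it is the projection given by
  \<open>k\<close> copies of \<open>P1\<close>.
\<close>

lemma point_exists:
  "\<exists>S \<in> pa_space A k k. (k, S) \<in> Obj B \<and>
    (\<forall>y x. rho S y x = (if y = replicate k True \<and> x = replicate k True then 1 else 0))"
proof -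
  let ?w = "replicate k True" and ?M = "\<lambda>y x. if y = replicate k True \<and> x = replicate k True then 1 else 0 :: complex"
  have "\<exists>S \<in> pa_space A k k. rho S = ?M" by (rule rho_surj) (auto split: if_splits)
  then obtain S where S: "S \<in> pa_space A k k" "rho S = ?M" by blast
  have "(\<Sum>z \<in> words k. ?M y z * ?M z x) = ?M y x" for y x
  proof -
    have "(\<Sum>z \<in> words k. ?M y z * ?M z x) = (\<Sum>z \<in> words k. if z = ?w then ?M y x else 0)"
      by (intro sum.cong refl) auto
    then show ?thesis by simp
  qed
  then have "mm (words k) ?M ?M = ?M" by (simp add: mm_def)
  then have "pa_stack A k k S S = S" using S by (intro rho_inj[where b = k and t = k]) (simp_all add: rho_mm)
  moreover have "pa_adjoint A k k S = S"
    using S by (intro rho_inj[where b = k and t = k] ext) (auto simp: rho_adjoint)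
  ultimately have "(k, S) \<in> Obj B" using S(1) by (intro projI)
  then show ?thesis using S by (intro bexI[of _ S]) simp_all
qed

theorem planar_equivalent_graded:
  "monoidally_equivalent (planar_category m lam) (graded_vec (integer_mod_group m) omega)"
proof -
  obtain S where S: "\<And>k. (k, S k) \<in> Obj B"
    "\<And>k y x. rho (S k) y x = (if y = replicate k True \<and> x = replicate k True then 1 else 0)"
    using point_exists by metis
  have "monoidally_equivalent (additive_envelope B) (graded_vec (integer_mod_group m) omega)"
  proof (rule zero_matrix_mcat.monoidally_equivalent_vec[OF projection_matrix_mcat,
      where P = "\<lambda>g. (nat g, S (nat g))" and p = "\<lambda>g. replicate (nat g) True"])
    fix g assume "g \<in> carrier (integer_mod_group m)"
    then have g: "0 \<le> g" "g < int m" using m_ge_2 by (auto simp: carrier_integer_mod_group split: if_splits)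
    show "(nat g, S (nat g)) \<in> Obj B" by (rule S)
    show "replicate (nat g) True \<in> pI (nat g, S (nat g))" by (simp add: pI_def)
    show "pdg (nat g, S (nat g)) (replicate (nat g) True) = g" using g by (simp add: pdg_def ht_replicate)
    show "pPhi (idA B (nat g, S (nat g))) y x =
      (if y = replicate (nat g) True \<and> x = replicate (nat g) True then 1 else 0)" for y x
      by (simp add: pPhi_def proj_simps(2) S)
  qed
  then show ?thesis by (simp add: planar_category_def A_def)
qed

end

theorem mainTheorem13:
  fixes m :: nat and zeta_bar :: complex
  assumes "m \<ge> 2" and "zeta_bar ^ m = 1"
  shows "\<exists>\<omega>. three_cocycle (integer_mod_group m) \<omega> \<and>
    monoidally_equivalent (planar_category m zeta_bar) (graded_vec (integer_mod_group m) \<omega>)"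
proof -
  interpret cyclic m zeta_bar by unfold_locales (fact assms)+
  show ?thesis using omega_cocycle planar_equivalent_graded by blast
qed

end
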